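(* Let $K$ be a field of characteristic zero, let $G$ be the orthogonal group $\mathrm{O}(N)$ or the symplectic group $\mathrm{Sp}(N)$ ($N$ even) over $K$, let $[1,N]=I_1\sqcup\ldots\sqcup I_\ell$ be a symmetric partition into consecutive segments, and let $U$ be the unipotent radical of the associated parabolic subgroup $P$ of $G$. Let $\mathcal F=K(G)$ be the field of rational functions on $G$ and $\mathcal F^U$ the field of invariants for the action of $U$ on $G$ by conjugation. Then the system of polynomials $\{\mathcal J^\circ_{ij}:\ (i,j)\in\mathbb S^\circ\}$ freely generates $\mathcal F^U$ over the subfield $\mathcal F_0$; that is, these elements lie in $\mathcal F^U$, are algebraically independent over $\mathcal F_0$, and generate $\mathcal F^U$ as a field extension of $\mathcal F_0$.
   Context: Write $[a,b]$ for the integer segment $\{a,\ldots,b\}$. For $i\in[1,N]$ put $i'=N+1-i$, and $T'=\{i':i\in T\}$ for $T\subseteq[1,N]$. Let $\mathbb I_m$ be the $m\times m$ matrix with ones on the anti-diagonal and zeros elsewhere, and $\mathbb J_{2m}=\begin{pmatrix}0&-\mathbb I_m\\ \mathbb I_m&0\end{pmatrix}$. Then $\mathrm{O}(N)=\{g\in\mathrm{GL}(N): g^t\mathbb I_Ng=\mathbb I_N\}$ and, for $N=2n$, $\mathrm{Sp}(N)=\{g\in\mathrm{GL}(N): g^t\mathbb J_{N}g=\mathbb J_{N}\}$. The partition $[1,N]=I_1\sqcup\ldots\sqcup I_\ell$ into consecutive segments is symmetric: $I_k'=I_{\ell-k+1}$. Put $n_k=|I_k|$, $\ell_0=[\ell/2]$,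 $N_0=n_1+\ldots+n_{\ell_0}$. If $\ell=2\ell_0+1$ is odd, put $I_0=I_{\ell_0+1}$ and $n_0=n_{\ell_0+1}$. The parabolic subgroup $P=LU$ is the group of matrices in $G$ that are block upper triangular with respect to the partition; $L$ consists of its block diagonal matrices, and the unipotent radical $U$ consists of its elements with identity diagonal blocks. $U$ acts on functions on $G$ by $(\rho(g)f)(x)=f(g^{-1}xg)$. Let $x_{ij}$ be the standard coordinate functions on $N\times N$ matrices, $\mathbb X=(x_{ij})$, and $\mathbb X^*$ the adjugate matrix of $\mathbb X$ ($\mathbb X\mathbb X^*=\det(\mathbb X)E$). $\mathbb S^\circ$ is the set of pairs $(i,j)\in[1,N]^2$ such that: 1) $i>N_0$ if $\ell=2\ell_0$, or $i>N_0+n_0$ if $\ell=2\ell_0+1$; 2) if $i\in I_k$ and $j\in I'_m$, then $k\ge m$; 3) $i>j$ in the orthogonal case, or $i\ge j$ in the symplectic case. For $(i,j)\in\mathbb S^\circ$ define the polynomial $\mathcal J_{ij}$ as follows. If $i+j\le N+1$, $\mathcal J_{ij}$ is the minor of $\mathbb X$ with columns $[1,j]$ and rows $\{i\}\cup[j'+1,N]$. If $i+j>N+1$, $\mathcal J_{ij}$ is the determinant of the $j\times j$ matrix whose first $i'$ rows form the submatrix of $\mathbb X$ with columns $[1,j]$ and the last $i'$ rows of $\mathbb X$, and whose remaining $j-i'$ rows form the submatrix of $\mathbb X^*$ with columns $[1,j]$ and the last $j-i'$ rows of $\mathbb X^*$. Let $\mathcal J^\circ_{ij}$ be the restriction of $\mathcal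 J_{ij}$ to $G$. Let $\mathbb G_0=I_0\times I_0$ for odd $\ell$, and $\mathbb G_0=\emptyset$ for even $\ell$. For $(i,j)\in\mathbb G_0$ define the rational function on $G$ by $P_{ij}=M_{ij}/M_0$, where $M_0$ is the minor of order $N_0$ of $\mathbb X$ with rows $I_{\ell_0+2}\sqcup\ldots\sqcup I_\ell$ and columns $I_1\sqcup\ldots\sqcup I_{\ell_0}$, and $M_{ij}$ is the minor obtained from $M_0$ by adding the $i$th row and the $j$th column. The $P_{ij}$ are $U$-invariant, and $\mathcal F_0\subseteq\mathcal F^U$ is the subfield generated over $K$ by $\{P_{ij}:(i,j)\in\mathbb G_0\}$ (so $\mathcal F_0=K$ for even $\ell$).
   Formalization: O(N) has two components det = ±1, so K(O(N)) is not a field; the result is stated for K of one component: either one if N is odd or ℓ = 1, and only det = (-1)^(N/2) if N is even and ℓ ≥ 2, as the claim fails on the other (e.g. J_21 = 0 on SO(2)). *)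

theory Defs
  imports
    "HOL-Algebra.Generated_Fields"
    "HOL-Algebra.Indexed_Polynomials"
    "HOL-Library.FuncSet"
    "Jordan_Normal_Form.Determinant"
    "Jordan_Normal_Form.DL_Submatrix"
begin

section \<open>Field of fractions of a domain\<close>

definition frac_rel :: "('r, 'm) ring_scheme \<Rightarrow> (('r \<times> 'r) \<times> ('r \<times> 'r)) set" where
  "frac_rel R = {((a, b), (c, d)). a \<in> carrier R \<and> c \<in> carrier R \<and>
     b \<in> carrier R - {\<zero>\<^bsub>R\<^esub>} \<and> d \<in> carrier R - {\<zero>\<^bsub>R\<^esub>} \<and> a \<otimes>\<^bsub>R\<^esub> d = c \<otimes>\<^bsub>R\<^esub> b}"

definition frac_of :: "('r, 'm) ring_scheme \<Rightarrow> 'r \<Rightarrow> 'r \<Rightarrow> ('r \<times> 'r) set" where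
  "frac_of R a b = frac_rel R `` {(a, b)}"

definition fraction_field :: "('r, 'm) ring_scheme \<Rightarrow> ('r \<times> 'r) set ring" where
  "fraction_field R = \<lparr>
     carrier = (carrier R \<times> (carrier R - {\<zero>\<^bsub>R\<^esub>})) // frac_rel R,
     monoid.mult = (\<lambda>p q. \<Union>(a, b)\<in>p. \<Union>(c, d)\<in>q. frac_of R (a \<otimes>\<^bsub>R\<^esub> c) (b \<otimes>\<^bsub>R\<^esub> d)),
     one = frac_of R \<one>\<^bsub>R\<^esub> \<one>\<^bsub>R\<^esub>,
     zero = frac_of R \<zero>\<^bsub>R\<^esub> \<one>\<^bsub>R\<^esub>,
     add = (\<lambda>p q. \<Union>(a, b)\<in>p. \<Union>(c, d)\<in>q.
              frac_of R (a \<otimes>\<^bsub>R\<^esub> d \<oplus>\<^bsub>R\<^esub> c \<otimes>\<^bsub>R\<^esub> b) (b \<otimes>\<^bsub>R\<^esub> d))\<rparr>"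

lemma UN_pairs_const:
  assumes "(a, b) \<in> p" "(c, d) \<in> q"
    and "\<And>x y z w. (x, y) \<in> p \<Longrightarrow> (z, w) \<in> q \<Longrightarrow> f x y z w = T"
  shows "(\<Union>(x, y)\<in>p. \<Union>(z, w)\<in>q. f x y z w) = T"
proof -
  have "(\<Union>(x, y)\<in>p. \<Union>(z, w)\<in>q. f x y z w) = (\<Union>_\<in>p. \<Union>_\<in>q. T)"
    using assms(3) by (intro SUP_cong refl) (auto split: prod.split)
  also have "\<dots> = T" using assms(1,2) by auto
  finally show ?thesis .
qed

context "domain"
begin

lemma frac_rel_iff:
  "((a, b), (c, d)) \<in> frac_rel R \<longleftrightarrow> a \<in> carrier R \<and> c \<in> carrier R \<and>
     b \<in> carrier R - {\<zero>} \<and> d \<in> carrier R - {\<zero>} \<and> a \<otimes> d = c \<otimes> b"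
  by (simp add: frac_rel_def)

lemma equiv_frac_rel: "equiv (carrier R \<times> (carrier R - {\<zero>})) (frac_rel R)"
proof (rule equivI)
  show "frac_rel R \<subseteq> (carrier R \<times> (carrier R - {\<zero>})) \<times> (carrier R \<times> (carrier R - {\<zero>}))"
    by (auto simp: frac_rel_def)
  show "refl_on (carrier R \<times> (carrier R - {\<zero>})) (frac_rel R)"
    by (auto simp: refl_on_def frac_rel_def)
  show "sym (frac_rel R)"
    by (auto simp: sym_def frac_rel_def)
  show "trans (frac_rel R)"
  proof (rule transI, clarify)
    fix a b c d e f
    assume "((a, b), (c, d)) \<in> frac_rel R" "((c, d), (e, f)) \<in> frac_rel R"
    then have
      cl: "a \<in> carrier R" "c \<in> carrier R" "e \<in> carrier R" "b \<in> carrier R" "d \<in> carrier R" "f \<in> carrier R"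
      and nz: "b \<noteq> \<zero>" "d \<noteq> \<zero>" "f \<noteq> \<zero>" and 1: "a \<otimes> d = c \<otimes> b" and 2: "c \<otimes> f = e \<otimes> d"
      unfolding frac_rel_iff by blast+
    have "d \<otimes> (a \<otimes> f) = (a \<otimes> d) \<otimes> f" using cl by algebra
    also have "\<dots> = (c \<otimes> f) \<otimes> b" unfolding 1 using cl by algebra
    also have "\<dots> = d \<otimes> (e \<otimes> b)" unfolding 2 using cl by algebra
    finally have "a \<otimes> f = e \<otimes> b" using cl nz by (simp add: m_lcancel)
    then show "((a, b), (e, f)) \<in> frac_rel R" using cl nz by (simp add: frac_rel_iff)
  qed
qed

lemma frac_eq_iff:
  assumes "a \<in> carrier R" "c \<in> carrier R" "b \<in> carrier R - {\<zero>}" "d \<in> carrier R - {\<zero>}"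
  shows "frac_of R a b = frac_of R c d \<longleftrightarrow> a \<otimes> d = c \<otimes> b"
  unfolding frac_of_def using eq_equiv_class_iff[OF equiv_frac_rel, of "(a, b)" "(c, d)"] assms
  by (auto simp: frac_rel_iff)

lemma mem_frac_of_iff:
  "(x, y) \<in> frac_of R a b \<longleftrightarrow> a \<in> carrier R \<and> x \<in> carrier R \<and>
     b \<in> carrier R - {\<zero>} \<and> y \<in> carrier R - {\<zero>} \<and> a \<otimes> y = x \<otimes> b"
  by (simp add: frac_of_def frac_rel_def)

lemma carrier_fraction_field:
  "carrier (fraction_field R) = {frac_of R a b | a b. a \<in> carrier R \<and> b \<in> carrier R - {\<zero>}}"
  by (auto simp: fraction_field_def quotient_def frac_of_def)

lemma frac_in_carrier:
  "a \<in> carrier R \<Longrightarrow> b \<in> carrier R - {\<zero>} \<Longrightarrow> frac_of R a b \<in> carrier (fraction_field R)"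
  unfolding carrier_fraction_field by blast

lemma mult_frac:
  assumes "a \<in> carrier R" "c \<in> carrier R" "b \<in> carrier R - {\<zero>}" "d \<in> carrier R - {\<zero>}"
  shows "frac_of R a b \<otimes>\<^bsub>fraction_field R\<^esub> frac_of R c d = frac_of R (a \<otimes> c) (b \<otimes> d)"
proof -
  have same: "frac_of R (x \<otimes> z) (y \<otimes> w) = frac_of R (a \<otimes> c) (b \<otimes> d)"
    if "(x, y) \<in> frac_of R a b" "(z, w) \<in> frac_of R c d" for x y z w
  proof -
    have cl: "x \<in> carrier R" "y \<in> carrier R" "z \<in> carrier R" "w \<in> carrier R"
       "a \<in> carrier R" "c \<in> carrier R" "b \<in> carrier R" "d \<in> carrier R"
      and nz: "y \<noteq> \<zero>" "w \<noteq> \<zero>"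
      and e: "a \<otimes> y = x \<otimes> b" "c \<otimes> w = z \<otimes> d"
      using that assms unfolding mem_frac_of_iff by blast+
    have "(x \<otimes> z) \<otimes> (b \<otimes> d) = (x \<otimes> b) \<otimes> (z \<otimes> d)" using cl by algebra
    also have "\<dots> = (a \<otimes> y) \<otimes> (c \<otimes> w)" using e by simp
    also have "\<dots> = (a \<otimes> c) \<otimes> (y \<otimes> w)" using cl by algebra
    finally show ?thesis using cl nz assms(3,4) by (simp add: frac_eq_iff integral_iff)
  qed
  have self: "(a, b) \<in> frac_of R a b" "(c, d) \<in> frac_of R c d"
    using assms unfolding mem_frac_of_iff by blast+
  show ?thesis
    unfolding fraction_field_def monoid.select_convs ring.select_convs
    by (rule UN_pairs_const[OF self same])
qed

lemma add_frac:
  assumes "a \<in> carrier R" "c \<in> carrier R" "b \<in> carrier R - {\<zero>}" "d \<in> carrier R - {\<zero>}"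
  shows "frac_of R a b \<oplus>\<^bsub>fraction_field R\<^esub> frac_of R c d = frac_of R (a \<otimes> d \<oplus> c \<otimes> b) (b \<otimes> d)"
proof -
  have same: "frac_of R (x \<otimes> w \<oplus> z \<otimes> y) (y \<otimes> w) = frac_of R (a \<otimes> d \<oplus> c \<otimes> b) (b \<otimes> d)"
    if "(x, y) \<in> frac_of R a b" "(z, w) \<in> frac_of R c d" for x y z w
  proof -
    have cl: "x \<in> carrier R" "y \<in> carrier R" "z \<in> carrier R" "w \<in> carrier R"
       "a \<in> carrier R" "c \<in> carrier R" "b \<in> carrier R" "d \<in> carrier R"
      and nz: "y \<noteq> \<zero>" "w \<noteq> \<zero>"
      and e: "a \<otimes> y = x \<otimes> b" "c \<otimes> w = z \<otimes> d"
      using that assms unfolding mem_frac_of_iff by blast+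
    have "(x \<otimes> w \<oplus> z \<otimes> y) \<otimes> (b \<otimes> d) = (x \<otimes> b) \<otimes> (w \<otimes> d) \<oplus> (z \<otimes> d) \<otimes> (y \<otimes> b)"
      using cl by algebra
    also have "\<dots> = (a \<otimes> y) \<otimes> (w \<otimes> d) \<oplus> (c \<otimes> w) \<otimes> (y \<otimes> b)" using e by simp
    also have "\<dots> = (a \<otimes> d \<oplus> c \<otimes> b) \<otimes> (y \<otimes> w)" using cl by algebra
    finally show ?thesis using cl nz assms(3,4) by (simp add: frac_eq_iff integral_iff)
  qed
  have self: "(a, b) \<in> frac_of R a b" "(c, d) \<in> frac_of R c d"
    using assms unfolding mem_frac_of_iff by blast+
  show ?thesis
    unfolding fraction_field_def monoid.select_convs ring.select_convs
    by (rule UN_pairs_const[OF self same])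
qed

lemma one_fraction_field: "\<one>\<^bsub>fraction_field R\<^esub> = frac_of R \<one> \<one>"
  and zero_fraction_field: "\<zero>\<^bsub>fraction_field R\<^esub> = frac_of R \<zero> \<one>"
  by (simp_all add: fraction_field_def)

theorem field_fraction_field: "field (fraction_field R)"
proof -
  let ?F = "fraction_field R"
  note rules = one_fraction_field zero_fraction_field mult_frac add_frac frac_in_carrier integral_iff
  have frac_cases: thesis
    if "p \<in> carrier ?F"
      "\<And>a b. \<lbrakk>p = frac_of R a b; a \<in> carrier R; b \<in> carrier R; b \<noteq> \<zero>\<rbrakk> \<Longrightarrow> thesis"
    for p thesis
    using that unfolding carrier_fraction_field by blast
  have "cring ?F"
  proof (rule cringI)
    show "abelian_group ?F"
    proof (rule abelian_groupI)
      fix p q assume p: "p \<in> carrier ?F" and q: "q \<in> carrier ?F"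
      obtain a b where pe: "p = frac_of R a b" "a \<in> carrier R" "b \<in> carrier R" "b \<noteq> \<zero>"
        using frac_cases[OF p] .
      obtain c d where qe: "q = frac_of R c d" "c \<in> carrier R" "d \<in> carrier R" "d \<noteq> \<zero>"
        using frac_cases[OF q] .
      show "p \<oplus>\<^bsub>?F\<^esub> q \<in> carrier ?F" using pe qe by (simp add: rules)
      have 1: "a \<otimes> d \<oplus> c \<otimes> b = c \<otimes> b \<oplus> a \<otimes> d" "b \<otimes> d = d \<otimes> b"
        using pe qe by (simp_all add: a_comm m_comm)
      have "p \<oplus>\<^bsub>?F\<^esub> q = frac_of R (a \<otimes> d \<oplus> c \<otimes> b) (b \<otimes> d)" using pe qe by (simp add: rules)
      also have "\<dots> = q \<oplus>\<^bsub>?F\<^esub> p" unfolding 1 using pe qe by (simp add: rules)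
      finally show "p \<oplus>\<^bsub>?F\<^esub> q = q \<oplus>\<^bsub>?F\<^esub> p" .
      fix r assume r: "r \<in> carrier ?F"
      obtain e f where re: "r = frac_of R e f" "e \<in> carrier R" "f \<in> carrier R" "f \<noteq> \<zero>"
        using frac_cases[OF r] .
      have "(a \<otimes> d \<oplus> c \<otimes> b) \<otimes> f \<oplus> e \<otimes> (b \<otimes> d) = a \<otimes> (d \<otimes> f) \<oplus> (c \<otimes> f \<oplus> e \<otimes> d) \<otimes> b"
        using pe(2,3) qe(2,3) re(2,3) by algebra
      then show "(p \<oplus>\<^bsub>?F\<^esub> q) \<oplus>\<^bsub>?F\<^esub> r = p \<oplus>\<^bsub>?F\<^esub> (q \<oplus>\<^bsub>?F\<^esub> r)"
        using pe qe re by (simp add: rules m_assoc[of b d f])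
    next
      show "\<zero>\<^bsub>?F\<^esub> \<in> carrier ?F" by (simp add: rules)
    next
      fix p assume p: "p \<in> carrier ?F"
      obtain a b where pe: "p = frac_of R a b" "a \<in> carrier R" "b \<in> carrier R" "b \<noteq> \<zero>"
        using frac_cases[OF p] .
      show "\<zero>\<^bsub>?F\<^esub> \<oplus>\<^bsub>?F\<^esub> p = p" using pe by (simp add: rules)
      have "\<ominus> a \<otimes> b \<oplus> a \<otimes> b = \<zero>" using pe(2,3) by algebra
      then have "frac_of R (\<ominus> a) b \<oplus>\<^bsub>?F\<^esub> p = \<zero>\<^bsub>?F\<^esub>" using pe by (simp add: rules frac_eq_iff)
      then show "\<exists>q\<in>carrier ?F. q \<oplus>\<^bsub>?F\<^esub> p = \<zero>\<^bsub>?F\<^esub>"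
        using pe by (intro bexI[of _ "frac_of R (\<ominus> a) b"]) (simp_all add: rules)
    qed
    show "Group.comm_monoid ?F"
    proof (rule comm_monoidI)
      fix p q assume p: "p \<in> carrier ?F" and q: "q \<in> carrier ?F"
      obtain a b where pe: "p = frac_of R a b" "a \<in> carrier R" "b \<in> carrier R" "b \<noteq> \<zero>"
        using frac_cases[OF p] .
      obtain c d where qe: "q = frac_of R c d" "c \<in> carrier R" "d \<in> carrier R" "d \<noteq> \<zero>"
        using frac_cases[OF q] .
      show "p \<otimes>\<^bsub>?F\<^esub> q \<in> carrier ?F" using pe qe by (simp add: rules)
      show "p \<otimes>\<^bsub>?F\<^esub> q = q \<otimes>\<^bsub>?F\<^esub> p" 
        using pe qe by (simp add: rules m_comm[of c a] m_comm[of d b])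
      fix r assume r: "r \<in> carrier ?F"
      obtain e f where re: "r = frac_of R e f" "e \<in> carrier R" "f \<in> carrier R" "f \<noteq> \<zero>"
        using frac_cases[OF r] .
      show "(p \<otimes>\<^bsub>?F\<^esub> q) \<otimes>\<^bsub>?F\<^esub> r = p \<otimes>\<^bsub>?F\<^esub> (q \<otimes>\<^bsub>?F\<^esub> r)"
        using pe qe re by (simp add: rules m_assoc)
    next
      show "\<one>\<^bsub>?F\<^esub> \<in> carrier ?F" by (simp add: rules)
    next
      fix p assume p: "p \<in> carrier ?F"
      obtain a b where pe: "p = frac_of R a b" "a \<in> carrier R" "b \<in> carrier R" "b \<noteq> \<zero>"
        using frac_cases[OF p] .
      show "\<one>\<^bsub>?F\<^esub> \<otimes>\<^bsub>?F\<^esub> p = p" using pe by (simp add: rules)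
    qed
    fix p q r assume p: "p \<in> carrier ?F" and q: "q \<in> carrier ?F" and r: "r \<in> carrier ?F"
    obtain a b where pe: "p = frac_of R a b" "a \<in> carrier R" "b \<in> carrier R" "b \<noteq> \<zero>"
      using frac_cases[OF p] .
    obtain c d where qe: "q = frac_of R c d" "c \<in> carrier R" "d \<in> carrier R" "d \<noteq> \<zero>"
      using frac_cases[OF q] .
    obtain e f where re: "r = frac_of R e f" "e \<in> carrier R" "f \<in> carrier R" "f \<noteq> \<zero>"
      using frac_cases[OF r] .
    have "((a \<otimes> d \<oplus> c \<otimes> b) \<otimes> e) \<otimes> ((b \<otimes> f) \<otimes> (d \<otimes> f)) =
        ((a \<otimes> e) \<otimes> (d \<otimes> f) \<oplus> (c \<otimes> e) \<otimes> (b \<otimes> f)) \<otimes> ((b \<otimes> d) \<otimes> f)"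
      using pe(2,3) qe(2,3) re(2,3) by algebra
    then show "(p \<oplus>\<^bsub>?F\<^esub> q) \<otimes>\<^bsub>?F\<^esub> r = p \<otimes>\<^bsub>?F\<^esub> r \<oplus>\<^bsub>?F\<^esub> q \<otimes>\<^bsub>?F\<^esub> r"
      using pe qe re by (simp add: rules frac_eq_iff)
  qed
  then show ?thesis
  proof (rule cring.cring_fieldI2)
    show "\<zero>\<^bsub>?F\<^esub> \<noteq> \<one>\<^bsub>?F\<^esub>" by (simp add: rules frac_eq_iff)
    fix p assume p: "p \<in> carrier ?F" and p0: "p \<noteq> \<zero>\<^bsub>?F\<^esub>"
    obtain a b where pe: "p = frac_of R a b" "a \<in> carrier R" "b \<in> carrier R" "b \<noteq> \<zero>"
      using frac_cases[OF p] .
    have a0: "a \<noteq> \<zero>" using p0 pe by (auto simp: rules frac_eq_iff)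
    have "p \<otimes>\<^bsub>?F\<^esub> frac_of R b a = \<one>\<^bsub>?F\<^esub>"
      using pe a0 by (simp add: rules frac_eq_iff m_comm[of b a])
    then show "\<exists>q\<in>carrier ?F. p \<otimes>\<^bsub>?F\<^esub> q = \<one>\<^bsub>?F\<^esub>"
      using pe a0 by (intro bexI[of _ "frac_of R b a"]) (simp_all add: rules)
  qed
qed

end


section \<open>Algebraic independence\<close>

text \<open>A polynomial is a finitely supported map from monomials (multisets of indices) to
  coefficients, as in \<^theory>\<open>HOL-Algebra.Indexed_Polynomials\<close>.\<close>

definition indexed_value ::
  "('r, 'm) ring_scheme \<Rightarrow> ('c \<Rightarrow> 'r) \<Rightarrow> ('c multiset \<Rightarrow> 'r) \<Rightarrow> 'r" where
  "indexed_value R a P = (\<Oplus>\<^bsub>R\<^esub>m\<in>{m. P m \<noteq> \<zero>\<^bsub>R\<^esub>}.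
     P m \<otimes>\<^bsub>R\<^esub> (\<Otimes>\<^bsub>R\<^esub>s\<in>set_mset m. a s [^]\<^bsub>R\<^esub> count m s))"

definition algebraically_independent ::
  "('r, 'm) ring_scheme \<Rightarrow> 'r set \<Rightarrow> 'c set \<Rightarrow> ('c \<Rightarrow> 'r) \<Rightarrow> bool" where
  "algebraically_independent R k S a \<longleftrightarrow> (\<forall>P\<in>ring.indexed_pset R S k.
     indexed_value R a P = \<zero>\<^bsub>R\<^esub> \<longrightarrow> (\<forall>m. P m = \<zero>\<^bsub>R\<^esub>))"


section \<open>The groups\<close>

text \<open>All indices \<open>i, j, k, m\<close> below run from 1 as usual, whereas matrices are indexed from 0 in the
  library; \<open>submat\<close> and \<open>entry\<close> translate.\<close>

definition entry :: "'a mat \<Rightarrow> nat \<Rightarrow> nat \<Rightarrow> 'a" where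
  "entry A i j = A $$ (i - 1, j - 1)"

definition submat :: "'a mat \<Rightarrow> nat set \<Rightarrow> nat set \<Rightarrow> 'a mat" where
  "submat A rs cs = submatrix A ((\<lambda>i. i - 1) ` rs) ((\<lambda>j. j - 1) ` cs)"

definition minor :: "'a::comm_ring_1 mat \<Rightarrow> nat set \<Rightarrow> nat set \<Rightarrow> 'a" where
  "minor A rs cs = det (submat A rs cs)"

definition opp :: "nat \<Rightarrow> nat \<Rightarrow> nat" where
  "opp N i = N + 1 - i"

datatype group_type = Orthogonal | Symplectic

definition antidiag :: "nat \<Rightarrow> 'a::comm_ring_1 mat" where
  "antidiag m = mat m m (\<lambda>(i, j). if i + j + 1 = m then 1 else 0)"

fun form_mat :: "group_type \<Rightarrow> nat \<Rightarrow> 'a::comm_ring_1 mat" where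
  "form_mat Orthogonal N = antidiag N"
| "form_mat Symplectic N = (let m = N div 2 in
     four_block_mat (0\<^sub>m m m) (- antidiag m) (antidiag m) (0\<^sub>m m m))"

definition classical_group :: "group_type \<Rightarrow> nat \<Rightarrow> 'a::field mat set" where
  "classical_group t N = {g \<in> carrier_mat N N. invertible_mat g \<and>
     g\<^sup>T * form_mat t N * g = form_mat t N}"

text \<open>\<open>O(N)\<close> is reducible: its irreducible components are the two cosets \<open>det = \<epsilon>\<close>,
  \<open>\<epsilon> = \<plusminus>1\<close>, of \<open>SO(N)\<close>, so a field of rational functions exists only for each of these
  components. \<open>Sp(N)\<close> is irreducible, and \<open>\<epsilon>\<close> plays no role. For \<open>O(2n)\<close> and a partition into at least
  two segments the relevant component is the one of \<open>antidiag (2n)\<close>, i.e. \<open>det = (-1)^n\<close>: matrices in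
  the other component have a singular lower left \<open>n \<times> n\<close> block, and the functions \<open>J_circ\<close> are
  dependent there over the subfield \<open>F0\<close>. (Already for \<open>N = 2\<close> and two segments: on \<open>SO(2)\<close> the
  only generator, the entry at position (2, 1), is zero.)\<close>

definition irr_component :: "group_type \<Rightarrow> nat \<Rightarrow> 'a::field \<Rightarrow> 'a mat set" where
  "irr_component t N \<epsilon> = (case t of
     Orthogonal \<Rightarrow> {g \<in> classical_group Orthogonal N. det g = \<epsilon>}
   | Symplectic \<Rightarrow> classical_group Symplectic N)"

definition symmetric_partition :: "nat \<Rightarrow> nat \<Rightarrow> (nat \<Rightarrow> nat set) \<Rightarrow> bool" where
  "symmetric_partition N l I \<longleftrightarrow>
     (\<forall>k\<in>{1..l}. \<exists>a b. a \<le> b \<and> I k = {a..b}) \<and>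
     (\<Union>k\<in>{1..l}. I k) = {1..N} \<and>
     (\<forall>k\<in>{1..l}. \<forall>m\<in>{1..l}. k < m \<longrightarrow> (\<forall>i\<in>I k. \<forall>j\<in>I m. i < j)) \<and>
     (\<forall>k\<in>{1..l}. opp N ` I k = I (l - k + 1))"

definition parabolic :: "group_type \<Rightarrow> nat \<Rightarrow> nat \<Rightarrow> (nat \<Rightarrow> nat set) \<Rightarrow> 'a::field mat set" where
  "parabolic t N l I = {g \<in> classical_group t N.
     \<forall>k\<in>{1..l}. \<forall>m\<in>{1..l}. m < k \<longrightarrow> (\<forall>i\<in>I k. \<forall>j\<in>I m. entry g i j = 0)}"

definition unipotent_radical ::
  "group_type \<Rightarrow> nat \<Rightarrow> nat \<Rightarrow> (nat \<Rightarrow> nat set) \<Rightarrow> 'a::field mat set" where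
  "unipotent_radical t N l I = {g \<in> parabolic t N l I.
     \<forall>k\<in>{1..l}. \<forall>i\<in>I k. \<forall>j\<in>I k. entry g i j = (if i = j then 1 else 0)}"


section \<open>Rational functions and invariants\<close>

inductive_set poly_funs :: "nat \<Rightarrow> ('a::comm_ring_1 mat \<Rightarrow> 'a) set" for N where
  const: "(\<lambda>_. c) \<in> poly_funs N"
| coord: "i \<in> {1..N} \<Longrightarrow> j \<in> {1..N} \<Longrightarrow> (\<lambda>A. entry A i j) \<in> poly_funs N"
| add: "f \<in> poly_funs N \<Longrightarrow> g \<in> poly_funs N \<Longrightarrow> (\<lambda>A. f A + g A) \<in> poly_funs N"
| mult: "f \<in> poly_funs N \<Longrightarrow> g \<in> poly_funs N \<Longrightarrow> (\<lambda>A. f A * g A) \<in> poly_funs N"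

text \<open>The ring \<open>K[C]\<close> of regular functions on a closed set \<open>C\<close> of matrices. On the groups
  considered here \<open>1/det = det\<close>, so no denominators are needed. The \<open>K\<close>-points of these (split)
  groups are Zariski dense since \<open>K\<close> is infinite, so regular functions are determined by their
  values on \<open>K\<close>-points.\<close>

definition coordinate_ring :: "nat \<Rightarrow> 'a::comm_ring_1 mat set \<Rightarrow> ('a mat \<Rightarrow> 'a) ring" where
  "coordinate_ring N C = \<lparr>
     carrier = (\<lambda>f. restrict f C) ` poly_funs N,
     monoid.mult = (\<lambda>f g. \<lambda>x\<in>C. f x * g x),
     one = (\<lambda>x\<in>C. 1),
     zero = (\<lambda>x\<in>C. 0),
     add = (\<lambda>f g. \<lambda>x\<in>C. f x + g x)\<rparr>"

type_synonym 'a ratfun = "(('a mat \<Rightarrow> 'a) \<times> ('a mat \<Rightarrow> 'a)) set"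

definition rational_functions :: "nat \<Rightarrow> 'a::field mat set \<Rightarrow> 'a ratfun ring" where
  "rational_functions N C = fraction_field (coordinate_ring N C)"

text \<open>The restriction to \<open>C\<close> of a polynomial function, as an element of \<open>K(C)\<close>.\<close>

definition ratfun_of :: "nat \<Rightarrow> 'a::field mat set \<Rightarrow> ('a mat \<Rightarrow> 'a) \<Rightarrow> 'a ratfun" where
  "ratfun_of N C f = frac_of (coordinate_ring N C) (restrict f C) (\<lambda>x\<in>C. 1)"

definition conj_fun ::
  "nat \<Rightarrow> 'a::field mat set \<Rightarrow> 'a mat \<Rightarrow> ('a mat \<Rightarrow> 'a) \<Rightarrow> ('a mat \<Rightarrow> 'a)" where
  "conj_fun N C g f = (\<lambda>x\<in>C. f (inv\<^bsub>ring_mat TYPE('a) N ()\<^esub> g * x * g))"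

text \<open>\<open>\<rho>(g)\<close> is an automorphism of \<open>K[C]\<close>, so it maps the class of \<open>a/b\<close> elementwise onto the class of
  \<open>\<rho>(g)a / \<rho>(g)b\<close>.\<close>

definition conj_ratfun ::
  "nat \<Rightarrow> 'a::field mat set \<Rightarrow> 'a mat \<Rightarrow> 'a ratfun \<Rightarrow> 'a ratfun" where
  "conj_ratfun N C g q = map_prod (conj_fun N C g) (conj_fun N C g) ` q"

definition invariants :: "nat \<Rightarrow> 'a::field mat set \<Rightarrow> 'a mat set \<Rightarrow> 'a ratfun set" where
  "invariants N C U = {q \<in> carrier (rational_functions N C). \<forall>g\<in>U. conj_ratfun N C g q = q}"


section \<open>The systems of generators\<close>

definition size0 :: "nat \<Rightarrow> (nat \<Rightarrow> nat set) \<Rightarrow> nat" where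
  "size0 l I = (\<Sum>k = 1..l div 2. card (I k))"

definition S_circ :: "group_type \<Rightarrow> nat \<Rightarrow> nat \<Rightarrow> (nat \<Rightarrow> nat set) \<Rightarrow> (nat \<times> nat) set" where
  "S_circ t N l I = {(i, j). i \<in> {1..N} \<and> j \<in> {1..N} \<and>
     (if even l then i > size0 l I else i > size0 l I + card (I (l div 2 + 1))) \<and>
     (\<forall>k\<in>{1..l}. \<forall>m\<in>{1..l}. i \<in> I k \<and> j \<in> opp N ` I m \<longrightarrow> k \<ge> m) \<and>
     (case t of Orthogonal \<Rightarrow> i > j | Symplectic \<Rightarrow> i \<ge> j)}"

definition J_poly :: "nat \<Rightarrow> nat \<times> nat \<Rightarrow> 'a::comm_ring_1 mat \<Rightarrow> 'a" where
  "J_poly N = (\<lambda>(i, j) A.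
     if i + j \<le> N + 1 then minor A ({i} \<union> {opp N j + 1..N}) {1..j}
     else det (submat A {N - opp N i + 1..N} {1..j} @\<^sub>r
               submat (adj_mat A) {N - (j - opp N i) + 1..N} {1..j}))"

definition J_circ :: "nat \<Rightarrow> 'a::field mat set \<Rightarrow> nat \<times> nat \<Rightarrow> 'a ratfun" where
  "J_circ N C s = ratfun_of N C (J_poly N s)"

definition G0 :: "nat \<Rightarrow> (nat \<Rightarrow> nat set) \<Rightarrow> (nat \<times> nat) set" where
  "G0 l I = (if odd l then I (l div 2 + 1) \<times> I (l div 2 + 1) else {})"

text \<open>The row and column sets of \<open>M\<^sub>0\<close>, for odd \<open>l\<close>.\<close>

definition M_rows :: "nat \<Rightarrow> (nat \<Rightarrow> nat set) \<Rightarrow> nat set" where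
  "M_rows l I = (\<Union>k\<in>{l div 2 + 2..l}. I k)"

definition M_cols :: "nat \<Rightarrow> (nat \<Rightarrow> nat set) \<Rightarrow> nat set" where
  "M_cols l I = (\<Union>k\<in>{1..l div 2}. I k)"

definition P_fun ::
  "nat \<Rightarrow> 'a::field mat set \<Rightarrow> nat \<Rightarrow> (nat \<Rightarrow> nat set) \<Rightarrow> nat \<times> nat \<Rightarrow> 'a ratfun" where
  "P_fun N C l I = (\<lambda>(i, j). let F = rational_functions N C in
     ratfun_of N C (\<lambda>A. minor A (insert i (M_rows l I)) (insert j (M_cols l I))) \<otimes>\<^bsub>F\<^esub>
     inv\<^bsub>F\<^esub> (ratfun_of N C (\<lambda>A. minor A (M_rows l I) (M_cols l I))))"

definition F0 :: "nat \<Rightarrow> 'a::field mat set \<Rightarrow> nat \<Rightarrow> (nat \<Rightarrow> nat set) \<Rightarrow> 'a ratfun set" where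
  "F0 N C l I = generate_field (rational_functions N C)
     (range (\<lambda>c. ratfun_of N C (\<lambda>_. c)) \<union> P_fun N C l I ` G0 l I)"

end

theory Submission
  imports Defs
begin

text \<open>
  Write \<open>i' = N + 1 - i\<close>, let \<open>C\<close> be the component in question and \<open>m = N\<^sub>0\<close> the number of indices in the first
  half of the blocks; an index is called middle if \<open>m < i \<le> N - m\<close>. Everything rests on a normal form. A point
  \<open>x\<close> of \<open>C\<close> at which certain corner minors do not vanish can be written as \<open>x = v y v\<^sup>-\<^sup>1\<close>, where \<open>v \<in> G\<close> is upper
  unitriangular with trivial middle block and \<open>y \<in> G\<close> satisfies \<open>y\<^sub>i\<^sub>c = 0\<close> for \<open>i + c < N + 1\<close>, except in the middle
  block (\<open>generic_decomposition\<close>). The generators are almost coordinates of \<open>v\<close> and \<open>y\<close>: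

  \<^item> A determinant stacked from the last rows of \<open>x\<close> and of its adjugate does not change under conjugation by upper
    unitriangular elements of \<open>G\<close>. So for \<open>i + j \<ge> N + 1\<close> the value of \<open>J\<^sub>i\<^sub>j\<close> at \<open>x\<close> is its value at \<open>y\<close>, and this is
    affine in the entry \<open>y\<^sub>i\<^sub>j\<close>; the other entries that occur stand in earlier columns or lower in column \<open>j\<close>.
  \<^item> For \<open>i + j < N + 1\<close> the value of \<open>J\<^sub>i\<^sub>j\<close> is the entry of \<open>v\<close> at position \<open>(i, j')\<close>, which lies in a diagonal block,
    times a corner minor of size \<open>j\<close>.
  \<^item> The function \<open>P\<^sub>a\<^sub>b\<close> is the entry \<open>y\<^sub>a\<^sub>b\<close> of the middle block, up to sign.
  \<^item> The remaining entries of \<open>y\<close> follow from the equations of the group, column by column.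

  Generation. Let \<open>A\<close> be the block diagonal part of \<open>v\<close>. By the above, the entries of \<open>y\<close> and of \<open>A\<close> are values of
  elements of the field generated by the proposed generators. The element \<open>u = v A\<^sup>-\<^sup>1\<close> lies in the unipotent radical, and
  \<open>u\<^sup>-\<^sup>1 x u = A y A\<^sup>-\<^sup>1\<close>. Hence an invariant \<open>f\<close> satisfies \<open>f(x) = f(A y A\<^sup>-\<^sup>1)\<close>, and the right hand side is a
  rational expression in the generators (\<open>gen_field_eq_invariants\<close>, with \<open>yy_gen_funs\<close> and \<open>vv_gen_funs\<close> for the entries).

  Independence. Order the pairs \<open>(i, j)\<close> so that each function involves only its own coordinate and earlier ones.
  Multiplying \<open>y\<close> or \<open>v\<close> by suitable one-parameter families of Siegel transformations moves the function with a
  given index linearly, while the functions with smaller index and all \<open>P\<^sub>a\<^sub>b\<close> stay constant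
  (\<open>lower_move\<close>, \<open>upper_move\<close>). A polynomial relation then loses its variables one by one, the last one first
  (\<open>triangular_independence\<close>). The moves need the coefficients of the \<open>y\<^sub>i\<^sub>j\<close> not to vanish identically on \<open>C\<close>; this
  follows inductively, starting at a multiple of the matrix of the form, which is antidiagonal (\<open>Kl_nonzero\<close>).

  Both arguments compare rational functions by their values at generic points, which requires \<open>C\<close> to be irreducible
  (\<open>component_irreducible\<close>). That is proved with rational curves: \<open>G\<close> is generated by reflections or
  transvections, and a transvection, or a product of two reflections, is joined to the identity by a rational curve.
\<close>

section \<open>Algebras of functions and minors\<close>

text \<open>Regular functions on matrices, rational functions of a curve parameter and the functions that are values of
  elements of the generated field are all closed under the ring operations, and agreement on the domain \<open>D\<close> is all that
  matters for them. Closure under determinants and adjugates is therefore derived once.\<close>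

locale function_algebra =
  fixes \<A> :: "('b \<Rightarrow> 'a::comm_ring_1) set" and D :: "'b set"
  assumes const: "(\<lambda>_. c) \<in> \<A>"
    and add: "f \<in> \<A> \<Longrightarrow> g \<in> \<A> \<Longrightarrow> (\<lambda>x. f x + g x) \<in> \<A>"
    and mult: "f \<in> \<A> \<Longrightarrow> g \<in> \<A> \<Longrightarrow> (\<lambda>x. f x * g x) \<in> \<A>"
    and cong: "f \<in> \<A> \<Longrightarrow> (\<And>x. x \<in> D \<Longrightarrow> f x = g x) \<Longrightarrow> g \<in> \<A>"
begin

lemma uminus: "f \<in> \<A> \<Longrightarrow> (\<lambda>x. - f x) \<in> \<A>"
  using mult[OF const[of "-1"], of f] by simp

lemma diff: "f \<in> \<A> \<Longrightarrow> g \<in> \<A> \<Longrightarrow> (\<lambda>x. f x - g x) \<in> \<A>"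
  using add[OF _ uminus, of f g] by simp

lemma sum: "(\<And>i. i \<in> S \<Longrightarrow> f i \<in> \<A>) \<Longrightarrow> (\<lambda>x. \<Sum>i\<in>S. f i x) \<in> \<A>"
  by (induction S rule: infinite_finite_induct) (auto intro: const add)

lemma prod: "(\<And>i. i \<in> S \<Longrightarrow> f i \<in> \<A>) \<Longrightarrow> (\<lambda>x. \<Prod>i\<in>S. f i x) \<in> \<A>"
  by (induction S rule: infinite_finite_induct) (auto intro: const mult)

lemma det:
  assumes car: "\<And>x. x \<in> D \<Longrightarrow> M x \<in> carrier_mat n n"
    and ent: "\<And>i j. i < n \<Longrightarrow> j < n \<Longrightarrow> (\<lambda>x. M x $$ (i, j)) \<in> \<A>"
  shows "(\<lambda>x. det (M x)) \<in> \<A>"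
proof (rule cong)
  show "(\<lambda>x. \<Sum>p\<in>{p. p permutes {0..<n}}. signof p * (\<Prod>i = 0..<n. M x $$ (i, p i))) \<in> \<A>"
    by (intro sum mult const prod ent) (auto simp: permutes_in_image)
qed (simp add: det_def'[OF car])

lemma adj_mat_entry:
  assumes car: "\<And>x. x \<in> D \<Longrightarrow> M x \<in> carrier_mat n n"
    and ent: "\<And>i j. i < n \<Longrightarrow> j < n \<Longrightarrow> (\<lambda>x. M x $$ (i, j)) \<in> \<A>"
    and ij: "i < n" "j < n"
  shows "(\<lambda>x. adj_mat (M x) $$ (i, j)) \<in> \<A>"
proof (rule cong)
  let ?d = "\<lambda>x. mat (n - 1) (n - 1) (\<lambda>(i', j').
    M x $$ (if i' < j then i' else Suc i', if j' < i then j' else Suc j'))"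
  show "(\<lambda>x. (-1) ^ (j + i) * det (?d x)) \<in> \<A>"
    by (intro mult const det[where n = "n - 1"]) (auto intro!: ent)
  show "(-1) ^ (j + i) * det (?d x) = adj_mat (M x) $$ (i, j)" if "x \<in> D" for x
    using car[OF that] ij unfolding adj_mat_def cofactor_def mat_delete_def by auto
qed

lemma poly_comp:
  assumes "f \<in> poly_funs N"
    and "\<And>i j. i \<in> {1..N} \<Longrightarrow> j \<in> {1..N} \<Longrightarrow> (\<lambda>x. entry (M x) i j) \<in> \<A>"
  shows "(\<lambda>x. f (M x)) \<in> \<A>"
  using assms(1) by induction (auto intro: const add mult assms(2))

end

text \<open>Polynomial functions up to their behaviour on matrices of the wrong format, where determinants
  and adjugates need not be polynomial.\<close>

definition regular_funs :: "nat \<Rightarrow> ('a::comm_ring_1 mat \<Rightarrow> 'a) set" where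
  "regular_funs N = {f. \<exists>f'\<in>poly_funs N. \<forall>A\<in>carrier_mat N N. f A = f' A}"

lemma poly_in_regular: "f \<in> poly_funs N \<Longrightarrow> f \<in> regular_funs N"
  unfolding regular_funs_def by blast

interpretation regular: function_algebra "regular_funs N" "carrier_mat N N"
proof
  show "(\<lambda>_. c) \<in> regular_funs N" for c by (intro poly_in_regular poly_funs.const)
  fix f g :: "'a mat \<Rightarrow> 'a"
  assume f: "f \<in> regular_funs N"
  then obtain f' where f': "f' \<in> poly_funs N" "\<forall>A\<in>carrier_mat N N. f A = f' A"
    unfolding regular_funs_def by blast
  show "g \<in> regular_funs N" if "\<And>x. x \<in> carrier_mat N N \<Longrightarrow> f x = g x"
    using f that unfolding regular_funs_def by auto
  assume "g \<in> regular_funs N"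
  then obtain g' where g': "g' \<in> poly_funs N" "\<forall>A\<in>carrier_mat N N. g A = g' A"
    unfolding regular_funs_def by blast
  show "(\<lambda>x. f x + g x) \<in> regular_funs N" "(\<lambda>x. f x * g x) \<in> regular_funs N"
    using poly_funs.add[OF f'(1) g'(1)] poly_funs.mult[OF f'(1) g'(1)] f'(2) g'(2)
    unfolding regular_funs_def by (auto intro: bexI)
qed

lemma (in function_algebra) regular_comp:
  assumes "f \<in> regular_funs N" and "\<And>x. x \<in> D \<Longrightarrow> M x \<in> carrier_mat N N"
    and "\<And>i j. i \<in> {1..N} \<Longrightarrow> j \<in> {1..N} \<Longrightarrow> (\<lambda>x. entry (M x) i j) \<in> \<A>"
  shows "(\<lambda>x. f (M x)) \<in> \<A>"
proof -
  obtain f' where f': "f' \<in> poly_funs N" "\<forall>A\<in>carrier_mat N N. f A = f' A"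
    using assms(1) unfolding regular_funs_def by blast
  show ?thesis by (rule cong[OF poly_comp[OF f'(1) assms(3)]]) (use f' assms in auto)
qed

lemma regular_entry: "i \<in> {1..N} \<Longrightarrow> j \<in> {1..N} \<Longrightarrow> (\<lambda>A. entry A i j) \<in> regular_funs N"
  by (intro poly_in_regular poly_funs.coord)

lemma regular_index: "i < N \<Longrightarrow> j < N \<Longrightarrow> (\<lambda>A. A $$ (i, j)) \<in> regular_funs N"
  using regular_entry[of "Suc i" N "Suc j"] by (simp add: entry_def)

text \<open>Rational functions of one parameter without poles in \<open>T\<close>. At a pole outside \<open>T\<close> the value is arbitrary, so
  that curves may be defined with total division.\<close>

definition rat_on :: "'a::field_char_0 set \<Rightarrow> ('a \<Rightarrow> 'a) set" where
  "rat_on T = {h. \<exists>p d. (\<forall>t\<in>T. poly d t \<noteq> 0) \<and> (\<forall>t. poly d t \<noteq> 0 \<longrightarrow> h t = poly p t / poly d t)}"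

interpretation rat: function_algebra "rat_on T" UNIV
proof
  have "\<exists>p d. (\<forall>t\<in>T. poly d t \<noteq> 0) \<and> (\<forall>t. poly d t \<noteq> 0 \<longrightarrow> c = poly p t / poly d t)" for c :: 'a
    by (rule exI[of _ "[:c:]"], rule exI[of _ 1]) simp
  then show "(\<lambda>_. c) \<in> rat_on T" for c by (simp add: rat_on_def)
  fix f g :: "'a \<Rightarrow> 'a"
  assume f: "f \<in> rat_on T"
  then obtain p d where f': "\<forall>t\<in>T. poly d t \<noteq> 0" "\<forall>t. poly d t \<noteq> 0 \<longrightarrow> f t = poly p t / poly d t"
    unfolding rat_on_def by blast
  show "g \<in> rat_on T" if "\<And>x. x \<in> UNIV \<Longrightarrow> f x = g x"
  proof -
    have "f = g" using that by auto
    then show ?thesis using f by simp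
  qed
  assume "g \<in> rat_on T"
  then obtain q e where g': "\<forall>t\<in>T. poly e t \<noteq> 0" "\<forall>t. poly e t \<noteq> 0 \<longrightarrow> g t = poly q t / poly e t"
    unfolding rat_on_def by blast
  have "(\<forall>t\<in>T. poly (d * e) t \<noteq> 0) \<and>
      (\<forall>t. poly (d * e) t \<noteq> 0 \<longrightarrow> f t + g t = poly (p * e + q * d) t / poly (d * e) t)"
    using f' g' by (auto simp: add_frac_eq)
  then show "(\<lambda>x. f x + g x) \<in> rat_on T" unfolding rat_on_def by blast
  have "(\<forall>t\<in>T. poly (d * e) t \<noteq> 0) \<and>
      (\<forall>t. poly (d * e) t \<noteq> 0 \<longrightarrow> f t * g t = poly (p * q) t / poly (d * e) t)"
    using f' g' by auto
  then show "(\<lambda>x. f x * g x) \<in> rat_on T" unfolding rat_on_def by blast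
qed

lemma rat_ident: "(\<lambda>t. t) \<in> rat_on T"
proof -
  have "(\<forall>t\<in>T. poly 1 t \<noteq> 0) \<and> (\<forall>t::'a. poly 1 t \<noteq> 0 \<longrightarrow> t = poly [:0, 1:] t / poly 1 t)" by simp
  then show ?thesis unfolding rat_on_def by blast
qed

lemma rat_inverse:
  assumes "f \<in> rat_on T" "\<And>t. t \<in> T \<Longrightarrow> f t \<noteq> 0"
  shows "(\<lambda>t. inverse (f t)) \<in> rat_on T"
proof -
  obtain p d where f': "\<forall>t\<in>T. poly d t \<noteq> 0" "\<forall>t. poly d t \<noteq> 0 \<longrightarrow> f t = poly p t / poly d t"
    using assms unfolding rat_on_def by blast
  have "poly (p * d) t \<noteq> 0" if "t \<in> T" for t
  proof -
    have "poly d t \<noteq> 0" "f t = poly p t / poly d t" using f' that by blast+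
    then show ?thesis using assms(2)[OF that] by simp
  qed
  moreover have "inverse (f t) = poly (d * d) t / poly (p * d) t" if "poly (p * d) t \<noteq> 0" for t
  proof -
    have "poly d t \<noteq> 0" using that by simp
    moreover from this have "f t = poly p t / poly d t" using f'(2) by blast
    ultimately show ?thesis by simp
  qed
  ultimately have "(\<forall>t\<in>T. poly (p * d) t \<noteq> 0) \<and>
      (\<forall>t. poly (p * d) t \<noteq> 0 \<longrightarrow> inverse (f t) = poly (d * d) t / poly (p * d) t)" by blast
  then show ?thesis unfolding rat_on_def by blast
qed

lemma rat_divide:
  assumes "g \<in> rat_on T" "f \<in> rat_on T" "\<And>t. t \<in> T \<Longrightarrow> f t \<noteq> 0"
  shows "(\<lambda>t. g t / f t) \<in> rat_on T"
  using rat.mult[OF assms(1) rat_inverse[OF assms(2,3)]] by (simp add: divide_inverse)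

lemma rat_finite_zeros:
  assumes "f \<in> rat_on T" "t0 \<in> T" "f t0 \<noteq> 0"
  shows "finite {t. f t = 0}"
proof -
  obtain p d where f': "\<forall>t\<in>T. poly d t \<noteq> 0" "\<forall>t. poly d t \<noteq> 0 \<longrightarrow> f t = poly p t / poly d t"
    using assms unfolding rat_on_def by blast
  have "{t. f t = 0} \<subseteq> {t. poly d t = 0} \<union> {t. poly p t = 0}" using f' by force
  moreover have "d \<noteq> 0" "p \<noteq> 0" using f' assms by auto
  ultimately show ?thesis using poly_roots_finite by (metis finite_Un finite_subset)
qed

text \<open>Matrices with indices from 1, to match \<open>entry\<close>.\<close>

definition mat1 :: "nat \<Rightarrow> (nat \<Rightarrow> nat \<Rightarrow> 'a) \<Rightarrow> 'a mat" where
  "mat1 N f = mat N N (\<lambda>(p, q). f (Suc p) (Suc q))"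

lemma mat1_carrier[simp]: "mat1 N f \<in> carrier_mat N N" by (simp add: mat1_def)

lemma entry_mat1[simp]: "i \<in> {1..N} \<Longrightarrow> j \<in> {1..N} \<Longrightarrow> entry (mat1 N f) i j = f i j"
  by (auto simp: entry_def mat1_def)

lemma entry_mult:
  assumes "A \<in> carrier_mat N N" "B \<in> carrier_mat N N" "i \<in> {1..N}" "j \<in> {1..N}"
  shows "entry (A * B) i j = (\<Sum>k = 1..N. entry A i k * entry B k j)"
proof -
  have "entry (A * B) i j = (\<Sum>k<N. A $$ (i - 1, k) * B $$ (k, j - 1))"
    using assms by (auto simp: entry_def scalar_prod_def atLeast0LessThan)
  also have "\<dots> = (\<Sum>k = 1..N. entry A i k * entry B k j)"
    by (rule sum.reindex_bij_witness[of _ "\<lambda>k. k - 1" Suc]) (auto simp: entry_def)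
  finally show ?thesis .
qed

lemma entry_one: "i \<in> {1..N} \<Longrightarrow> j \<in> {1..N} \<Longrightarrow> entry (1\<^sub>m N) i j = (if i = j then 1 else 0)"
  by (auto simp: entry_def)

lemma entry_index: "i < N \<Longrightarrow> j < N \<Longrightarrow> A $$ (i, j) = entry A (Suc i) (Suc j)"
  by (simp add: entry_def)

lemma mat_eqI:
  assumes "A \<in> carrier_mat N N" "B \<in> carrier_mat N N"
    and "\<And>i j. i \<in> {1..N} \<Longrightarrow> j \<in> {1..N} \<Longrightarrow> entry A i j = entry B i j"
  shows "A = B"
  by (rule eq_matI) (use assms in \<open>auto simp: entry_index\<close>)

definition sel :: "'a mat \<Rightarrow> (nat \<Rightarrow> nat) \<Rightarrow> (nat \<Rightarrow> nat) \<Rightarrow> nat \<Rightarrow> 'a mat" where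
  "sel A f g k = mat k k (\<lambda>(p, q). entry A (f p) (g q))"

lemma sel_carrier[simp]: "sel A f g k \<in> carrier_mat k k" by (simp add: sel_def)

lemma pick_enum:
  assumes "strict_mono_on {..<n} f" "f ` {..<n} = S" "r < n"
  shows "pick S r = f r"
  using assms(3)
proof (induction r)
  case 0
  have "f 0 \<le> a" if aS: "a \<in> S" for a
  proof -
    obtain p where p: "p < n" "a = f p" using aS assms(2) by auto
    show ?thesis using p 0 assms(1) by (cases "p = 0") (auto simp: strict_mono_on_def intro: less_imp_le)
  qed
  then show ?case using 0 assms(2) by (auto intro!: Least_equality)
next
  case (Suc r)
  have 1: "f r < f (Suc r)" using Suc.prems assms(1) by (auto simp: strict_mono_on_def)
  have 2: "f (Suc r) \<le> a" if aS: "a \<in> S" "f r < a" for a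
  proof -
    obtain p where p: "p < n" "a = f p" using aS assms(2) by auto
    have "r < p"
    proof (rule ccontr)
      assume "\<not> r < p"
      then have "p = r \<or> p < r" by auto
      then have "f p \<le> f r" using assms(1) p Suc.prems by (auto simp: strict_mono_on_def intro: less_imp_le)
      then show False using aS p by simp
    qed
    then have "p = Suc r \<or> Suc r < p" by auto
    then show ?thesis using p assms(1) Suc.prems by (auto simp: strict_mono_on_def intro: less_imp_le)
  qed
  show ?case using Suc 1 2 assms(2) by (auto intro!: Least_equality)
qed

lemma submat_enum:
  assumes A: "A \<in> carrier_mat N N"
    and f: "strict_mono_on {..<n} f" "f ` {..<n} = rs" "rs \<subseteq> {1..N}"
    and g: "strict_mono_on {..<k} g" "g ` {..<k} = cs" "cs \<subseteq> {1..N}"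
  shows "submat A rs cs = mat n k (\<lambda>(p, q). entry A (f p) (g q))"
proof -
  have aux: "card {i. i < N \<and> i \<in> (\<lambda>i. i - 1) ` S} = l \<and> (\<forall>p<l. pick ((\<lambda>i. i - 1) ` S) p = h p - 1)"
    if h: "strict_mono_on {..<l} h" "h ` {..<l} = S" "S \<subseteq> {1..N}" for S h and l :: nat
  proof -
    have 1: "strict_mono_on {..<l} (\<lambda>p. h p - 1)"
      unfolding strict_mono_on_def
    proof (intro allI impI)
      fix r s assume rs: "r \<in> {..<l} \<and> s \<in> {..<l} \<and> r < s"
      then have "h r < h s" "1 \<le> h r" using h unfolding strict_mono_on_def by auto
      then show "h r - 1 < h s - 1" by linarith
    qed
    have 2: "(\<lambda>p. h p - 1) ` {..<l} = (\<lambda>i. i - 1) ` S" using h(2) by auto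
    have "{i. i < N \<and> i \<in> (\<lambda>i. i - 1) ` S} = (\<lambda>i. i - 1) ` S" using h(3) by fastforce
    then have "card {i. i < N \<and> i \<in> (\<lambda>i. i - 1) ` S} = l"
      using card_image[OF strict_mono_on_imp_inj_on[OF 1]] 2 by simp
    then show ?thesis using pick_enum[OF 1 2] by auto
  qed
  show ?thesis
    unfolding submat_def submatrix_def using A aux[OF f] aux[OF g]
    by (intro eq_matI) (auto simp: entry_def)
qed

text \<open>Increasing enumerations of the row and column sets turn a minor into a determinant of explicitly given
  entries, which all computations below use.\<close>

lemma minor_sel:
  assumes A: "A \<in> carrier_mat N N"
    and f: "strict_mono_on {..<n} f" "f ` {..<n} = rs" "rs \<subseteq> {1..N}"
    and g: "strict_mono_on {..<n} g" "g ` {..<n} = cs" "cs \<subseteq> {1..N}"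
  shows "minor A rs cs = det (sel A f g n)"
  unfolding minor_def sel_def submat_enum[OF assms] ..

text \<open>The one term of the Cauchy-Binet formula that survives when the matrices are triangular enough.\<close>

lemma sel_mult_left:
  assumes v: "v \<in> carrier_mat N N" and y: "y \<in> carrier_mat N N"
    and f: "\<And>p. p < k \<Longrightarrow> f p \<in> {1..N}" and g: "\<And>p. p < k \<Longrightarrow> g p \<in> {1..N}"
    and h: "\<And>p. p < k \<Longrightarrow> h p \<in> {1..N}" "inj_on h {..<k}"
    and z: "\<And>p q r. p < k \<Longrightarrow> q < k \<Longrightarrow> r \<in> {1..N} \<Longrightarrow> r \<notin> h ` {..<k} \<Longrightarrow>
      entry v (f p) r * entry y r (g q) = 0"
  shows "sel (v * y) f g k = sel v f h k * sel y h g k"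
proof (rule eq_matI)
  fix p q assume "p < dim_row (sel v f h k * sel y h g k)" "q < dim_col (sel v f h k * sel y h g k)"
  then have pq: "p < k" "q < k" by (auto simp: sel_def)
  have "sel (v * y) f g k $$ (p, q) = (\<Sum>r = 1..N. entry v (f p) r * entry y r (g q))"
    using pq f g by (simp add: sel_def entry_mult[OF v y])
  also have "\<dots> = (\<Sum>r\<in>h ` {..<k}. entry v (f p) r * entry y r (g q))"
    by (rule sum.mono_neutral_right) (use h z[OF pq] in auto)
  also have "\<dots> = (\<Sum>r<k. entry v (f p) (h r) * entry y (h r) (g q))"
    by (simp add: sum.reindex[OF h(2)])
  also have "\<dots> = (sel v f h k * sel y h g k) $$ (p, q)"
    using pq by (simp add: sel_def scalar_prod_def atLeast0LessThan)
  finally show "sel (v * y) f g k $$ (p, q) = (sel v f h k * sel y h g k) $$ (p, q)" .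
qed (auto simp: sel_def)

lemma det_upper_unit:
  assumes "A \<in> carrier_mat k k" "\<And>p q. q < p \<Longrightarrow> p < k \<Longrightarrow> A $$ (p, q) = 0"
    "\<And>p. 0 < p \<Longrightarrow> p < k \<Longrightarrow> A $$ (p, p) = 1" "k > 0"
  shows "det A = (A $$ (0, 0) :: 'a::comm_ring_1)"
proof -
  have "det A = prod_list (diag_mat A)"
    by (rule det_upper_triangular[OF _ assms(1)]) (use assms in auto)
  also have "\<dots> = (\<Prod>i = 0..<k. A $$ (i, i))"
    using assms(1) by (auto simp: diag_mat_def prod.list_conv_set_nth)
  also have "\<dots> = A $$ (0, 0) * (\<Prod>i = 1..<k. A $$ (i, i))"
    using assms(4) by (simp add: prod.atLeast_Suc_lessThan)
  also have "(\<Prod>i = 1..<k. A $$ (i, i)) = 1" using assms by (intro prod.neutral) auto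
  finally show ?thesis by simp
qed

lemma det_sel_unit:
  assumes v: "\<And>i j. i \<in> {1..N} \<Longrightarrow> j \<in> {1..N} \<Longrightarrow> j \<le> i \<Longrightarrow> entry v i j = (if i = j then 1 else 0)"
    and f: "strict_mono_on {..<k} f" "\<And>p. p < k \<Longrightarrow> f p \<in> {1..N}"
  shows "det (sel v f f k) = (1::'a::comm_ring_1)"
proof (cases "k = 0")
  case True then show ?thesis using det_dim_zero[of "sel v f f k"] by auto
next
  case False
  have m: "f q < f p" if "q < p" "p < k" for p q using that f(1) by (auto simp: strict_mono_on_def)
  have "det (sel v f f k) = sel v f f k $$ (0, 0)"
  proof (rule det_upper_unit)
    show "sel v f f k $$ (p, q) = 0" if "q < p" "p < k" for p q
      using v[OF f(2) f(2), of p q] m[OF that] that by (simp add: sel_def)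
    show "sel v f f k $$ (p, p) = 1" if "0 < p" "p < k" for p
      using v[OF f(2) f(2), of p p] that by (simp add: sel_def)
  qed (use False in auto)
  then show ?thesis using v[OF f(2) f(2), of 0 0] False by (auto simp: sel_def)
qed

text \<open>Expansion of a determinant along the last entry of its first row.\<close>

text \<open>A determinant is affine in its upper right entry. This isolates the coordinate \<open>y\<^sub>i\<^sub>j\<close> in \<open>J\<^sub>i\<^sub>j\<close>.\<close>

lemma det_corner:
  fixes A B :: "'a::comm_ring_1 mat"
  assumes A: "A \<in> carrier_mat (Suc k) (Suc k)" and B: "B \<in> carrier_mat (Suc k) (Suc k)"
    and eq: "\<And>p q. p \<le> k \<Longrightarrow> q \<le> k \<Longrightarrow> (p, q) \<noteq> (0, k) \<Longrightarrow> A $$ (p, q) = B $$ (p, q)"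
  shows "det A = det B + (-1) ^ k * (A $$ (0, k) - B $$ (0, k)) * det (mat_delete A 0 k)"
proof -
  have del: "mat_delete A 0 q = mat_delete B 0 q" for q
    unfolding mat_delete_def using A B eq by (intro eq_matI) auto
  have 1: "det M = (\<Sum>q<k. M $$ (0, q) * cofactor M 0 q) + (-1) ^ k * M $$ (0, k) * det (mat_delete M 0 k)"
    if "M \<in> carrier_mat (Suc k) (Suc k)" for M :: "'a mat"
    using laplace_expansion_row[OF that, of 0] by (simp add: cofactor_def mult_ac)
  have 2: "(\<Sum>q<k. A $$ (0, q) * cofactor A 0 q) = (\<Sum>q<k. B $$ (0, q) * cofactor B 0 q)"
    by (intro sum.cong refl) (simp add: cofactor_def del eq)
  show ?thesis unfolding 1[OF A] 1[OF B] 2 del by (simp add: algebra_simps)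
qed

section \<open>The isometry group of an antidiagonal form\<close>

text \<open>Both types of groups at once: the form has the sign \<open>s i\<close> at position \<open>(i, i')\<close>, and it is symmetric for
  \<open>sg = 1\<close> and alternating for \<open>sg = -1\<close>.\<close>

locale antidiagonal_form =
  fixes N :: nat and s :: "nat \<Rightarrow> 'a::field_char_0" and sg :: 'a
  assumes N_pos: "N \<ge> 1"
    and s_sq: "i \<in> {1..N} \<Longrightarrow> s i * s i = 1"
    and s_opp: "i \<in> {1..N} \<Longrightarrow> s (Suc N - i) = sg * s i"
    and sg_cases: "sg = 1 \<or> sg = -1"
begin

lemma opp_mem: "p \<in> {1..N} \<Longrightarrow> Suc N - p \<in> {1..N}" by auto

lemma opp_bounds [simp]: "Suc 0 \<le> Suc N - p \<longleftrightarrow> p \<le> N" "Suc 0 \<le> p \<Longrightarrow> Suc N - p \<le> N"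
  by auto

lemma opp_opp: "p \<in> {1..N} \<Longrightarrow> Suc N - (Suc N - p) = p" by auto

lemma sg_sq: "sg * sg = 1" using sg_cases by auto

lemma s_nz: "i \<in> {1..N} \<Longrightarrow> s i \<noteq> 0" using s_sq by fastforce

definition bf :: "(nat \<Rightarrow> 'a) \<Rightarrow> (nat \<Rightarrow> 'a) \<Rightarrow> 'a" where
  "bf x y = (\<Sum>p = 1..N. s p * x p * y (Suc N - p))"

definition unit :: "nat \<Rightarrow> nat \<Rightarrow> 'a" where "unit i p = (if p = i then 1 else 0)"

lemma bf_cong:
  "(\<And>p. p \<in> {1..N} \<Longrightarrow> x p = x' p) \<Longrightarrow> (\<And>p. p \<in> {1..N} \<Longrightarrow> y p = y' p) \<Longrightarrow> bf x y = bf x' y'"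
  unfolding bf_def by (intro sum.cong refl arg_cong2[of _ _ _ _ "(*)"]) (use opp_mem in blast)+

lemma bf_add_left: "bf (\<lambda>p. x p + y p) z = bf x z + bf y z"
  and bf_diff_left: "bf (\<lambda>p. x p - y p) z = bf x z - bf y z"
  and bf_add_right: "bf z (\<lambda>p. x p + y p) = bf z x + bf z y"
  and bf_diff_right: "bf z (\<lambda>p. x p - y p) = bf z x - bf z y"
  by (simp_all add: bf_def sum.distrib sum_subtractf algebra_simps)

lemma bf_scale_left: "bf (\<lambda>p. c * x p) z = c * bf x z"
  and bf_scale_right: "bf z (\<lambda>p. c * x p) = c * bf z x"
  by (simp_all add: bf_def sum_distrib_left mult_ac)

lemma bf_uminus_left: "bf (\<lambda>p. - x p) z = - bf x z"
  and bf_uminus_right: "bf z (\<lambda>p. - x p) = - bf z x"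
  by (simp_all add: bf_def sum_negf)

lemma bf_sum_left: "bf (\<lambda>p. \<Sum>r\<in>S. f r p) z = (\<Sum>r\<in>S. bf (f r) z)"
  unfolding bf_def sum_distrib_left sum_distrib_right by (rule sum.swap)

lemma bf_sum_right: "bf z (\<lambda>p. \<Sum>r\<in>S. f r p) = (\<Sum>r\<in>S. bf z (f r))"
  unfolding bf_def sum_distrib_left sum_distrib_right by (rule sum.swap)

lemmas bf_linear = bf_add_left bf_diff_left bf_add_right bf_diff_right bf_scale_left bf_scale_right
  bf_uminus_left bf_uminus_right

lemma bf_commute: "bf y x = sg * bf x y"
proof -
  have "bf y x = (\<Sum>p = 1..N. s (Suc N - p) * y (Suc N - p) * x p)"
    unfolding bf_def
    by (rule sum.reindex_bij_witness[of _ "\<lambda>p. Suc N - p" "\<lambda>p. Suc N - p"]) auto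
  also have "\<dots> = sg * bf x y"
    unfolding bf_def sum_distrib_left by (intro sum.cong refl) (simp add: s_opp mult_ac)
  finally show ?thesis .
qed

lemma bf_self_alt: "sg = -1 \<Longrightarrow> bf x x = 0"
  using bf_commute[of x x] by simp

lemma bf_unit_left: "i \<in> {1..N} \<Longrightarrow> bf (unit i) y = s i * y (Suc N - i)"
  by (simp add: bf_def unit_def if_distrib if_distribR sum.delta cong: if_cong)

lemma bf_unit_right:
  assumes "i \<in> {1..N}" shows "bf x (unit i) = s (Suc N - i) * x (Suc N - i)"
proof -
  have "bf x (unit i) = (\<Sum>p = 1..N. if p = Suc N - i then s p * x p else 0)"
    unfolding bf_def unit_def by (intro sum.cong refl) (use assms in auto)
  then show ?thesis using opp_mem[OF assms] by simp
qed

lemma bf_expand_left: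
  "bf x y = (\<Sum>p = 1..N. x p * bf (unit p) y)"
  unfolding bf_def[of x] by (intro sum.cong refl) (simp add: bf_unit_left)

definition vmul :: "(nat \<Rightarrow> 'a) \<Rightarrow> 'a mat \<Rightarrow> nat \<Rightarrow> 'a" where
  "vmul x h q = (\<Sum>p = 1..N. x p * entry h p q)"

text \<open>The isometry group, described by the inner products of the rows. The usual description by \<open>g\<^sup>T J g = J\<close> concerns
  the columns; one says that \<open>ginv g\<close> is a right inverse of \<open>g\<close>, the other that it is a left inverse (\<open>G_iff\<close>).\<close>

definition G :: "'a mat set" where
  "G = {g \<in> carrier_mat N N. \<forall>i\<in>{1..N}. \<forall>k\<in>{1..N}.
     bf (entry g i) (entry g k) = (if k = Suc N - i then s i else 0)}"

lemma G_carrier: "g \<in> G \<Longrightarrow> g \<in> carrier_mat N N" by (simp add: G_def)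

lemma G_rows:
  "g \<in> G \<Longrightarrow> i \<in> {1..N} \<Longrightarrow> k \<in> {1..N} \<Longrightarrow>
     bf (entry g i) (entry g k) = (if k = Suc N - i then s i else 0)"
  by (simp add: G_def)

lemma unit_rows:
  "i \<in> {1..N} \<Longrightarrow> k \<in> {1..N} \<Longrightarrow> bf (unit i) (unit k) = (if k = Suc N - i then s i else 0)"
  by (auto simp: bf_unit_left unit_def)

lemma bf_vmul:
  assumes "h \<in> G" shows "bf (vmul x h) (vmul y h) = bf x y"
proof -
  have "bf (vmul x h) (vmul y h) = (\<Sum>p=1..N. \<Sum>r=1..N. x p * (y r * bf (entry h p) (entry h r)))"
    unfolding vmul_def bf_sum_left bf_sum_right bf_scale_left bf_scale_right sum_distrib_left ..
  also have "\<dots> = (\<Sum>p=1..N. \<Sum>r=1..N. if r = Suc N - p then x p * (y r * s p) else 0)"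
    by (intro sum.cong refl) (simp add: G_rows[OF assms])
  also have "\<dots> = bf x y" unfolding bf_def by (intro sum.cong refl) (auto simp: mult_ac)
  finally show ?thesis .
qed

lemma entry_mult_vmul:
  assumes "A \<in> carrier_mat N N" "B \<in> carrier_mat N N" "i \<in> {1..N}" "q \<in> {1..N}"
  shows "entry (A * B) i q = vmul (entry A i) B q"
  using assms by (simp add: entry_mult vmul_def)

lemma G_mult: "g \<in> G \<Longrightarrow> h \<in> G \<Longrightarrow> g * h \<in> G"
proof -
  assume g: "g \<in> G" and h: "h \<in> G"
  have "bf (entry (g * h) i) (entry (g * h) k) = (if k = Suc N - i then s i else 0)"
    if ik: "i \<in> {1..N}" "k \<in> {1..N}" for i k
  proof -
    have "bf (entry (g * h) i) (entry (g * h) k) = bf (vmul (entry g i) h) (vmul (entry g k) h)"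
      by (rule bf_cong) (use ik in \<open>simp_all add: entry_mult_vmul[OF G_carrier[OF g] G_carrier[OF h]]\<close>)
    then show ?thesis using bf_vmul[OF h] G_rows[OF g ik] by simp
  qed
  moreover have "g * h \<in> carrier_mat N N" using G_carrier[OF g] G_carrier[OF h] by simp
  ultimately show ?thesis by (simp add: G_def)
qed

lemma G_one: "1\<^sub>m N \<in> G"
proof -
  have "bf (entry (1\<^sub>m N) i) (entry (1\<^sub>m N) k) = bf (unit i) (unit k)"
    if "i \<in> {1..N}" "k \<in> {1..N}" for i k
    by (rule bf_cong) (use that in \<open>auto simp: entry_one unit_def\<close>)
  then show ?thesis by (simp add: G_def unit_rows)
qed

definition ginv :: "'a mat \<Rightarrow> 'a mat" where
  "ginv g = mat1 N (\<lambda>a b. s (Suc N - a) * s (Suc N - b) * entry g (Suc N - b) (Suc N - a))"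

lemma ginv_carrier[simp]: "ginv g \<in> carrier_mat N N" by (simp add: ginv_def)

lemma entry_ginv:
  "a \<in> {1..N} \<Longrightarrow> b \<in> {1..N} \<Longrightarrow>
    entry (ginv g) a b = s (Suc N - a) * s (Suc N - b) * entry g (Suc N - b) (Suc N - a)"
  by (simp add: ginv_def)

lemma ginv_right: assumes g: "g \<in> G" shows "g * ginv g = 1\<^sub>m N"
proof (rule mat_eqI)
  fix i k assume ik: "i \<in> {1..N}" "k \<in> {1..N}"
  have "entry (g * ginv g) i k =
    (\<Sum>p=1..N. entry g i p * (s (Suc N - p) * s (Suc N - k) * entry g (Suc N - k) (Suc N - p)))"
    using ik by (simp add: entry_mult[OF G_carrier[OF g] ginv_carrier] entry_ginv)
  also have "\<dots> = sg * s (Suc N - k) * bf (entry g i) (entry g (Suc N - k))"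
    unfolding bf_def sum_distrib_left by (intro sum.cong refl) (simp add: s_opp mult_ac)
  also have "\<dots> = (if i = k then 1 else 0)"
  proof -
    have 1: "bf (entry g i) (entry g (Suc N - k)) = (if k = i then s i else 0)"
      using G_rows[OF g ik(1) opp_mem[OF ik(2)]] ik by auto
    have "sg * s (Suc N - k) * s k = (sg * sg) * (s k * s k)" using s_opp[OF ik(2)] by simp
    then show ?thesis using s_sq[OF ik(2)] unfolding 1 sg_sq by auto
  qed
  finally show "entry (g * ginv g) i k = entry (1\<^sub>m N) i k" using ik by (simp add: entry_one)
qed (use G_carrier[OF g] in auto)

lemma ginv_left: "g \<in> G \<Longrightarrow> ginv g * g = 1\<^sub>m N"
  using mat_mult_left_right_inverse[OF _ _ ginv_right] G_carrier by auto

lemma vmul_mult: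
  assumes "A \<in> carrier_mat N N" "B \<in> carrier_mat N N" "q \<in> {1..N}"
  shows "vmul x (A * B) q = vmul (vmul x A) B q"
proof -
  have "vmul x (A * B) q = (\<Sum>p = 1..N. \<Sum>k = 1..N. x p * (entry A p k * entry B k q))"
    using assms by (simp add: vmul_def entry_mult sum_distrib_left)
  also have "\<dots> = (\<Sum>k = 1..N. \<Sum>p = 1..N. x p * (entry A p k * entry B k q))" by (rule sum.swap)
  also have "\<dots> = vmul (vmul x A) B q" by (simp add: vmul_def sum_distrib_right mult.assoc)
  finally show ?thesis .
qed

lemma vmul_cong: "(\<And>p. p \<in> {1..N} \<Longrightarrow> x p = y p) \<Longrightarrow> vmul x A q = vmul y A q"
  by (simp add: vmul_def)

lemma vmul_unit: "i \<in> {1..N} \<Longrightarrow> vmul (unit i) A q = entry A i q"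
  by (simp add: vmul_def unit_def if_distrib if_distribR cong: if_cong)

lemma G_ginv: assumes g: "g \<in> G" shows "ginv g \<in> G"
proof -
  let ?h = "ginv g"
  have e: "vmul (entry ?h i) g p = unit i p" if "i \<in> {1..N}" "p \<in> {1..N}" for i p
  proof -
    have "vmul (entry ?h i) g p = entry (1\<^sub>m N) i p"
      using entry_mult_vmul[OF ginv_carrier G_carrier[OF g] that, of g] unfolding ginv_left[OF g] ..
    also have "\<dots> = unit i p" unfolding entry_one[OF that] unit_def by auto
    finally show ?thesis .
  qed
  have "bf (entry ?h i) (entry ?h k) = bf (unit i) (unit k)" if ik: "i \<in> {1..N}" "k \<in> {1..N}" for i k
  proof -
    have "bf (entry ?h i) (entry ?h k) = bf (vmul (entry ?h i) g) (vmul (entry ?h k) g)"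
      by (simp add: bf_vmul[OF g])
    also have "\<dots> = bf (unit i) (unit k)" by (rule bf_cong) (use ik e in auto)
    finally show ?thesis .
  qed
  then show ?thesis by (simp add: G_def unit_rows)
qed

definition form :: "'a mat" where
  "form = mat1 N (\<lambda>a b. if b = Suc N - a then s a else 0)"

lemma form_carrier[simp]: "form \<in> carrier_mat N N" by (simp add: form_def)

lemma form_G: "form \<in> G"
proof -
  have "bf (entry form i) (entry form k) = bf (\<lambda>p. s i * unit (Suc N - i) p) (\<lambda>p. s k * unit (Suc N - k) p)"
    if "i \<in> {1..N}" "k \<in> {1..N}" for i k
    by (rule bf_cong) (use that in \<open>auto simp: unit_def form_def\<close>)
  moreover have "s i * (s (Suc N - i) * s (Suc N - i)) = s i" if "i \<in> {1..N}" for i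
    using s_sq[OF opp_mem[OF that]] by simp
  ultimately show ?thesis
    unfolding G_def bf_linear
    by (simp add: unit_rows[OF opp_mem opp_mem]) (auto simp: mult_ac)
qed

text \<open>For every \<open>g\<close>, isometry or not, \<open>ginv g\<close> is the transpose of \<open>g\<close> conjugated by the form. Both \<open>det_sq\<close> and
  \<open>G_iff\<close> rest on this.\<close>

lemma form_ginv: assumes g: "g \<in> carrier_mat N N" shows "form * ginv g = g\<^sup>T * form"
proof -
  have t: "g\<^sup>T \<in> carrier_mat N N" using g by simp
  have et: "entry (g\<^sup>T) a b = entry g b a" if "a \<in> {1..N}" "b \<in> {1..N}" for a b
    using g that by (auto simp: entry_def)
  show ?thesis
  proof (rule mat_eqI)
    fix i k assume ik: "i \<in> {1..N}" "k \<in> {1..N}"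
    have "entry (form * ginv g) i k = (\<Sum>p = 1..N. if p = Suc N - i then s i * entry (ginv g) p k else 0)"
      unfolding entry_mult[OF form_carrier ginv_carrier ik]
      by (intro sum.cong refl) (use ik in \<open>auto simp: form_def\<close>)
    also have "\<dots> = s i * entry (ginv g) (Suc N - i) k" using opp_mem[OF ik(1)] by simp
    also have "\<dots> = s (Suc N - k) * entry g (Suc N - k) i"
    proof -
      have "s i * entry (ginv g) (Suc N - i) k = (s i * s i) * (s (Suc N - k) * entry g (Suc N - k) i)"
        by (simp add: entry_ginv[OF opp_mem[OF ik(1)] ik(2)] opp_opp[OF ik(1)] mult.assoc)
      then show ?thesis using s_sq[OF ik(1)] by simp
    qed
    also have "\<dots> = (\<Sum>p = 1..N. if p = Suc N - k then s (Suc N - k) * entry g (Suc N - k) i else 0)"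
      using opp_mem[OF ik(2)] by simp
    also have "\<dots> = (\<Sum>p = 1..N. entry g\<^sup>T i p * entry form p k)"
      by (intro sum.cong refl) (use ik et in \<open>auto simp: form_def\<close>)
    also have "\<dots> = entry (g\<^sup>T * form) i k"
      using ik by (simp add: entry_mult[OF t form_carrier])
    finally show "entry (form * ginv g) i k = entry (g\<^sup>T * form) i k" .
  qed (rule mult_carrier_mat[OF form_carrier ginv_carrier], rule mult_carrier_mat[OF t form_carrier])
qed

lemma det_form: "det form \<noteq> 0"
  using det_mult[OF form_carrier ginv_carrier, of form] ginv_right[OF form_G] by auto

lemma det_sq: assumes g: "g \<in> G" shows "det g * det g = 1"
proof -
  have t: "g\<^sup>T \<in> carrier_mat N N" using G_carrier[OF g] by simp
  have "det form * det (ginv g) = det g * det form"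
    using arg_cong[OF form_ginv[OF G_carrier[OF g]], of det] det_mult[OF form_carrier ginv_carrier] det_mult[OF t form_carrier]
      det_transpose[OF G_carrier[OF g]] by simp
  then have "det (ginv g) = det g" using det_form by simp
  then show ?thesis
    using det_mult[OF G_carrier[OF g] ginv_carrier, of g] ginv_right[OF g] by simp
qed

lemma G_iff: "g \<in> G \<longleftrightarrow> g \<in> carrier_mat N N \<and> g\<^sup>T * form * g = form"
proof
  assume g: "g \<in> G"
  note c = G_carrier[OF g]
  have "g\<^sup>T * form * g = form * (ginv g * g)"
    unfolding form_ginv[OF c, symmetric] by (rule assoc_mult_mat[OF form_carrier ginv_carrier c])
  then show "g \<in> carrier_mat N N \<and> g\<^sup>T * form * g = form"
    using c by (simp add: ginv_left[OF g] right_mult_one_mat[OF form_carrier])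
next
  assume g: "g \<in> carrier_mat N N \<and> g\<^sup>T * form * g = form"
  then have c: "g \<in> carrier_mat N N" by simp
  note fc = form_carrier ginv_carrier[of form]
  have m: "ginv g * g \<in> carrier_mat N N" by (rule mult_carrier_mat[OF ginv_carrier c])
  have "form * (ginv g * g) = form"
    unfolding assoc_mult_mat[OF form_carrier ginv_carrier c, symmetric] form_ginv[OF c] using g by simp
  then have "ginv form * (form * (ginv g * g)) = ginv form * form" by simp
  then have "ginv g * g = 1\<^sub>m N"
    unfolding assoc_mult_mat[OF fc(2,1) m, symmetric] ginv_left[OF form_G] left_mult_one_mat[OF m] .
  then have r: "g * ginv g = 1\<^sub>m N" using mat_mult_left_right_inverse[OF ginv_carrier c] by simp
  have "bf (entry g i) (entry g k) = (if k = Suc N - i then s i else 0)" if ik: "i \<in> {1..N}" "k \<in> {1..N}" for i k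
  proof -
    have "entry (g * ginv g) i (Suc N - k) = (\<Sum>p=1..N. entry g i p * (s (Suc N - p) * s k * entry g k (Suc N - p)))"
      unfolding entry_mult[OF c ginv_carrier ik(1) opp_mem[OF ik(2)]]
      by (intro sum.cong refl) (simp only: entry_ginv opp_mem[OF ik(2)] opp_opp[OF ik(2)])
    also have "\<dots> = sg * s k * bf (entry g i) (entry g k)"
      unfolding bf_def sum_distrib_left by (intro sum.cong refl) (simp add: s_opp mult_ac)
    finally have "sg * s k * bf (entry g i) (entry g k) = (if i = Suc N - k then 1 else 0)"
      unfolding r entry_one[OF ik(1) opp_mem[OF ik(2)]] by simp
    then have "(sg * s k) * (sg * s k * bf (entry g i) (entry g k)) = (if k = Suc N - i then sg * s k else 0)"
      using ik by auto
    moreover have "(sg * s k) * (sg * s k * bf (entry g i) (entry g k)) = (sg * sg) * (s k * s k) * bf (entry g i) (entry g k)"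
      by (simp add: mult_ac)
    moreover have "k = Suc N - i \<Longrightarrow> sg * s k = s i"
      using s_opp[OF ik(1)] sg_sq by (simp add: mult.assoc[symmetric])
    ultimately show ?thesis using s_sq[OF ik(2)] sg_sq by (auto split: if_splits)
  qed
  then show "g \<in> G" using c by (simp add: G_def)
qed

text \<open>Only a symmetric form has isometries of determinant \<open>-1\<close>, so the determinant is prescribed for \<open>sg = 1\<close>
  only.\<close>

definition component :: "'a \<Rightarrow> 'a mat set" where
  "component \<epsilon> = {g \<in> G. sg = 1 \<longrightarrow> det g = \<epsilon>}"

text \<open>Matrices act on row vectors from the right: \<open>lmat L\<close> is the matrix of the linear map \<open>L\<close>, and \<open>row_map L g\<close> is
  the product of \<open>g\<close> with it. Preservation of the form has to be checked for \<open>L\<close> only.\<close>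

definition lmat :: "((nat \<Rightarrow> 'a) \<Rightarrow> nat \<Rightarrow> 'a) \<Rightarrow> 'a mat" where
  "lmat L = mat1 N (\<lambda>i. L (unit i))"

definition row_map :: "((nat \<Rightarrow> 'a) \<Rightarrow> nat \<Rightarrow> 'a) \<Rightarrow> 'a mat \<Rightarrow> 'a mat" where
  "row_map L g = mat1 N (\<lambda>i. L (entry g i))"

lemma row_map_G:
  assumes "\<And>x y. bf (L x) (L y) = bf x y" "g \<in> G"
  shows "row_map L g \<in> G"
proof -
  have "bf (entry (row_map L g) i) (entry (row_map L g) k) = bf (L (entry g i)) (L (entry g k))"
    if "i \<in> {1..N}" "k \<in> {1..N}" for i k
    by (rule bf_cong) (use that in \<open>auto simp: row_map_def\<close>)
  then show ?thesis using assms G_rows[OF assms(2)] by (simp add: G_def row_map_def)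
qed

lemma lmat_G:
  assumes "\<And>x y. bf (L x) (L y) = bf x y" shows "lmat L \<in> G"
proof -
  have "bf (entry (lmat L) i) (entry (lmat L) k) = bf (L (unit i)) (L (unit k))"
    if "i \<in> {1..N}" "k \<in> {1..N}" for i k
    by (rule bf_cong) (use that in \<open>auto simp: lmat_def\<close>)
  then show ?thesis using assms by (simp add: G_def lmat_def unit_rows)
qed

text \<open>For \<open>\<tau> * bf w w = 1 + sg\<close> this is an orthogonal reflection in the symmetric case and a symplectic transvection
  in the alternating case.\<close>

definition refl :: "'a \<Rightarrow> (nat \<Rightarrow> 'a) \<Rightarrow> (nat \<Rightarrow> 'a) \<Rightarrow> nat \<Rightarrow> 'a" where
  "refl \<tau> w x q = x q - \<tau> * bf x w * w q"

lemma refl_isometry: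
  assumes "\<tau> * bf w w = 1 + sg \<or> \<tau> = 0"
  shows "bf (refl \<tau> w x) (refl \<tau> w y) = bf x y"
proof -
  have "bf (refl \<tau> w x) (refl \<tau> w y) = bf x y - \<tau> * bf x w * bf w y - \<tau> * bf y w * bf x w
      + \<tau> * (\<tau> * bf w w) * bf x w * bf y w"
    unfolding refl_def bf_linear by (simp add: algebra_simps)
  also have "\<tau> * (\<tau> * bf w w) = \<tau> * (1 + sg)" using assms by auto
  also have "bf x y - \<tau> * bf x w * bf w y - \<tau> * bf y w * bf x w + \<tau> * (1 + sg) * bf x w * bf y w = bf x y"
    unfolding bf_commute[of w y] by (simp add: algebra_simps)
  finally show ?thesis .
qed

lemma vmul_lmat_refl:
  assumes "q \<in> {1..N}" shows "vmul x (lmat (refl \<tau> w)) q = refl \<tau> w x q"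
proof -
  have "vmul x (lmat (refl \<tau> w)) q = (\<Sum>p=1..N. x p * unit p q - \<tau> * (x p * bf (unit p) w) * w q)"
    unfolding vmul_def lmat_def refl_def
    by (intro sum.cong refl) (use assms in \<open>simp add: algebra_simps\<close>)
  also have "\<dots> = (\<Sum>p=1..N. x p * unit p q) - \<tau> * bf x w * w q"
    unfolding bf_expand_left[of x w] sum_subtractf by (simp add: sum_distrib_left sum_distrib_right)
  also have "(\<Sum>p=1..N. x p * unit p q) = x q"
    using assms by (simp add: unit_def if_distrib cong: if_cong)
  finally show ?thesis unfolding refl_def .
qed

text \<open>For isotropic \<open>a\<close> this is an isometry even if \<open>v\<close> is not orthogonal to \<open>a\<close>; the usual Siegel (Eichler)
  transformation is the case \<open>bf v a = 0\<close>, in which the denominators are \<open>1\<close> and \<open>2\<close>.\<close>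

definition siegel :: "'a \<Rightarrow> (nat \<Rightarrow> 'a) \<Rightarrow> (nat \<Rightarrow> 'a) \<Rightarrow> (nat \<Rightarrow> 'a) \<Rightarrow> nat \<Rightarrow> 'a" where
  "siegel t a v x q = x q + t * bf x a * v q - sg * t / (1 + t * bf v a) * bf x v * a q
     - t ^ 2 * bf v v / (2 * (1 + t * bf v a)) * bf x a * a q"

text \<open>The coefficients of the two terms along \<open>a\<close> are chosen to cancel the mixed terms and the square of the term along
  \<open>v\<close>, respectively.\<close>

lemma siegel_isometry:
  assumes a: "bf a a = 0" and t: "1 + t * bf v a \<noteq> 0"
  shows "bf (siegel t a v x) (siegel t a v y) = bf x y"
proof -
  define d where "d = 1 + t * bf v a"
  define m where "m = sg * t / d"
  define k where "k = t ^ 2 * bf v v / (2 * d)"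
  have d0: "d \<noteq> 0" using t by (simp add: d_def)
  have md: "m * d = sg * t" using d0 by (simp add: m_def)
  have kd: "k * d * (1 + sg) = t ^ 2 * bf v v"
    using d0 sg_cases bf_self_alt by (auto simp: k_def field_simps)
  have tc: "t * bf v a = d - 1" by (simp add: d_def)
  have L: "siegel t a v x = (\<lambda>q. x q + (t * bf x a) * v q - (m * bf x v) * a q - (k * bf x a) * a q)" for x
    by (rule ext) (simp add: siegel_def m_def k_def d_def)
  have c: "bf a v = sg * bf v a" "bf a y = sg * bf y a" "bf v y = sg * bf y v"
    by (rule bf_commute)+
  have "bf (siegel t a v x) (siegel t a v y) = bf x y + t * bf y a * bf x v - m * bf y v * bf x a
     - k * bf y a * bf x a + t * bf x a * (sg * bf y v) + t ^ 2 * bf v v * bf x a * bf y a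
     - m * bf x a * bf y v * (t * bf v a) - k * bf x a * bf y a * (t * bf v a)
     - (m * bf x v + k * bf x a) * (sg * bf y a + sg * bf y a * (t * bf v a))"
    unfolding L bf_linear by (simp add: c a algebra_simps power2_eq_square)
  also have "\<dots> = bf x y + bf y a * bf x v * (t - (m * d) * sg) + bf y v * bf x a * (t * sg - m * d)
     + bf x a * bf y a * (t ^ 2 * bf v v - k * d * (1 + sg))"
    unfolding tc by (simp add: algebra_simps)
  also have "\<dots> = bf x y" unfolding md kd using sg_sq by (simp add: algebra_simps)
  finally show ?thesis .
qed

lemma vmul_lmat_siegel:
  assumes "q \<in> {1..N}" shows "vmul x (lmat (siegel t a v)) q = siegel t a v x q"
proof -
  define m where "m = sg * t / (1 + t * bf v a)"
  define k where "k = t ^ 2 * bf v v / (2 * (1 + t * bf v a))"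
  have "vmul x (lmat (siegel t a v)) q = (\<Sum>p=1..N. x p * unit p q + t * (x p * bf (unit p) a) * v q
      - m * (x p * bf (unit p) v) * a q - k * (x p * bf (unit p) a) * a q)"
    unfolding vmul_def lmat_def siegel_def m_def[symmetric] k_def[symmetric]
    by (intro sum.cong refl) (use assms in \<open>simp add: algebra_simps\<close>)
  also have "\<dots> = (\<Sum>p=1..N. x p * unit p q) + t * bf x a * v q - m * bf x v * a q - k * bf x a * a q"
    unfolding bf_expand_left[of x a] bf_expand_left[of x v] sum_subtractf sum.distrib
    by (simp add: sum_distrib_left sum_distrib_right)
  also have "(\<Sum>p=1..N. x p * unit p q) = x q"
    using assms by (simp add: unit_def if_distrib cong: if_cong)
  finally show ?thesis unfolding siegel_def m_def k_def .
qed

end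

section \<open>Generation of the group by reflections\<close>

context antidiagonal_form
begin

definition fixes_vec :: "'a mat \<Rightarrow> (nat \<Rightarrow> 'a) \<Rightarrow> bool" where
  "fixes_vec z b \<longleftrightarrow> (\<forall>q\<in>{1..N}. vmul b z q = b q)"

lemma refl_refl:
  assumes "\<tau> * bf w w = 1 + sg" shows "refl (sg * \<tau>) w (refl \<tau> w x) q = x q"
proof -
  have "refl (sg * \<tau>) w (refl \<tau> w x) q
      = x q - bf x w * w q * (\<tau> + sg * \<tau> - sg * \<tau> * (\<tau> * bf w w))"
    unfolding refl_def bf_linear by (simp add: algebra_simps)
  also have "\<tau> + sg * \<tau> - sg * \<tau> * (\<tau> * bf w w) = 0"
    unfolding assms using sg_cases by auto
  finally show ?thesis by simp
qed

lemma lmat_carrier[simp]: "lmat L \<in> carrier_mat N N" by (simp add: lmat_def)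

lemma lmat_refl_inverse:
  assumes "\<tau> * bf w w = 1 + sg" shows "lmat (refl \<tau> w) * lmat (refl (sg * \<tau>) w) = 1\<^sub>m N"
proof (rule mat_eqI)
  fix i j assume ij: "i \<in> {1..N}" "j \<in> {1..N}"
  have "entry (lmat (refl \<tau> w) * lmat (refl (sg * \<tau>) w)) i j =
      vmul (vmul (unit i) (lmat (refl \<tau> w))) (lmat (refl (sg * \<tau>) w)) j"
    using ij by (simp add: entry_mult_vmul vmul_unit cong: vmul_cong)
  also have "\<dots> = vmul (refl \<tau> w (unit i)) (lmat (refl (sg * \<tau>) w)) j"
    by (rule vmul_cong) (simp add: vmul_lmat_refl)
  also have "\<dots> = unit i j" using ij by (simp add: vmul_lmat_refl refl_refl[OF assms])
  finally show "entry (lmat (refl \<tau> w) * lmat (refl (sg * \<tau>) w)) i j = entry (1\<^sub>m N) i j"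
    using ij by (simp add: entry_one unit_def)
qed (use mult_carrier_mat[OF lmat_carrier lmat_carrier] in auto)

lemma lmat_refl_G: "\<tau> * bf w w = 1 + sg \<or> \<tau> = 0 \<Longrightarrow> lmat (refl \<tau> w) \<in> G"
  by (rule lmat_G) (rule refl_isometry)

text \<open>The reflection in the difference of \<open>u z\<close> and \<open>p\<close> sends \<open>u z\<close> to \<open>p\<close>, and it fixes every vector that has the same
  product with \<open>u z\<close> as with \<open>p\<close>.\<close>

lemma move_by_refl:
  assumes z: "z \<in> G" and p: "bf p p = bf u u" and nz: "bf (vmul u z) (\<lambda>q. vmul u z q - p q) \<noteq> 0"
  obtains \<tau> w where "\<tau> * bf w w = 1 + sg"
    "\<And>q. q \<in> {1..N} \<Longrightarrow> vmul u (z * lmat (refl \<tau> w)) q = p q"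
    "\<And>b. fixes_vec z b \<Longrightarrow> bf b p = bf b u \<Longrightarrow> fixes_vec (z * lmat (refl \<tau> w)) b"
proof -
  define u' where "u' = vmul u z"
  define w where "w = (\<lambda>q. u' q - p q)"
  define \<kappa> where "\<kappa> = bf u' w"
  have k0: "\<kappa> \<noteq> 0" using nz by (simp add: \<kappa>_def w_def u'_def)
  have uu: "bf u' u' = bf u u" unfolding u'_def by (rule bf_vmul[OF z])
  have "bf w w = (1 + sg) * \<kappa>"
  proof (cases "sg = -1")
    case True then show ?thesis using bf_self_alt by simp
  next
    case False
    then have "sg = 1" using sg_cases by auto
    moreover have "\<kappa> = bf u u - bf u' p" by (simp add: \<kappa>_def w_def bf_linear uu)
    moreover have "bf w w = bf u u - bf u' p - (bf p u' - bf u u)"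
      unfolding w_def by (simp add: bf_linear uu p)
    ultimately show ?thesis using bf_commute[of p u'] by simp
  qed
  then have 1: "(1 / \<kappa>) * bf w w = 1 + sg" using k0 by simp
  have R: "vmul x (z * lmat (refl (1 / \<kappa>) w)) q = refl (1 / \<kappa>) w (vmul x z) q"
    if "q \<in> {1..N}" for x q
    using that by (simp add: vmul_mult[OF G_carrier[OF z]] vmul_lmat_refl)
  have 2: "vmul u (z * lmat (refl (1 / \<kappa>) w)) q = p q" if "q \<in> {1..N}" for q
    using k0 unfolding R[OF that] refl_def u'_def[symmetric] \<kappa>_def[symmetric] by (simp add: w_def)
  have 3: "fixes_vec (z * lmat (refl (1 / \<kappa>) w)) b" if b: "fixes_vec z b" "bf b p = bf b u" for b
  proof -
    have "bf b u' = bf (vmul b z) u'" by (rule bf_cong) (use b in \<open>auto simp: fixes_vec_def\<close>)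
    also have "\<dots> = bf b u" unfolding u'_def by (rule bf_vmul[OF z])
    finally have "bf b w = 0" using b by (simp add: w_def bf_linear)
    moreover have "bf (vmul b z) w = bf b w"
      by (rule bf_cong) (use b in \<open>auto simp: fixes_vec_def\<close>)
    ultimately show ?thesis using b(1) by (simp add: fixes_vec_def R refl_def)
  qed
  show ?thesis by (rule that[OF 1 2 3])
qed

context
  fixes X1 :: "'a mat set"
  assumes X_refl: "\<And>z \<tau> w. z \<in> X1 \<Longrightarrow> \<tau> * bf w w = 1 + sg \<Longrightarrow> z * lmat (refl \<tau> w) \<in> X1"
begin

text \<open>The pointwise stabilizer of \<open>B\<close> is contained in \<open>X1\<close>, a set that is closed under right multiplication by
  reflections.\<close>

definition stab_in :: "(nat \<Rightarrow> 'a) set \<Rightarrow> bool" where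
  "stab_in B \<longleftrightarrow> (\<forall>z\<in>G. (\<forall>b\<in>B. fixes_vec z b) \<longrightarrow> z \<in> X1)"

lemma in_X_by_refl:
  assumes "\<And>z. z \<in> G \<Longrightarrow> (\<forall>b\<in>B. fixes_vec z b) \<Longrightarrow> (\<forall>q\<in>{1..N}. vmul u z q = p q) \<Longrightarrow> z \<in> X1"
    and z: "z \<in> G" "\<forall>b\<in>B. fixes_vec z b" and p: "bf p p = bf u u" "\<forall>b\<in>B. bf b p = bf b u"
    and nz: "bf (vmul u z) (\<lambda>q. vmul u z q - p q) \<noteq> 0"
  shows "z \<in> X1"
proof -
  obtain \<tau> w where r: "\<tau> * bf w w = 1 + sg"
    "\<And>q. q \<in> {1..N} \<Longrightarrow> vmul u (z * lmat (refl \<tau> w)) q = p q"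
    "\<And>b. fixes_vec z b \<Longrightarrow> bf b p = bf b u \<Longrightarrow> fixes_vec (z * lmat (refl \<tau> w)) b"
    using move_by_refl[OF z(1) p(1) nz] by blast
  have "z * lmat (refl \<tau> w) \<in> G" using r(1) by (intro G_mult z lmat_refl_G) simp
  then have "z * lmat (refl \<tau> w) \<in> X1" using assms(1) r z(2) p(2) by blast
  moreover have "sg * \<tau> * bf w w = 1 + sg" using r(1) sg_cases by auto
  ultimately have "z * lmat (refl \<tau> w) * lmat (refl (sg * \<tau>) w) \<in> X1" by (rule X_refl)
  also have "z * lmat (refl \<tau> w) * lmat (refl (sg * \<tau>) w) = z"
    using assoc_mult_mat[OF G_carrier[OF z(1)] lmat_carrier lmat_carrier]
      lmat_refl_inverse[OF r(1)] G_carrier[OF z(1)] by simp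
  finally show ?thesis .
qed

text \<open>An anisotropic vector \<open>u\<close> can be sent back by one reflection unless \<open>u z - u\<close> is isotropic; in that case \<open>u z + u\<close> is
  anisotropic, and the detour over \<open>-u\<close> works.\<close>

lemma stab_in_symmetric:
  assumes "sg = 1" "stab_in (insert u B)" "bf u u \<noteq> 0" "\<forall>b\<in>B. bf b u = 0"
  shows "stab_in B"
  unfolding stab_in_def
proof (intro ballI impI)
  have 0: "z \<in> X1" if "z \<in> G" "\<forall>b\<in>B. fixes_vec z b" "\<forall>q\<in>{1..N}. vmul u z q = u q" for z
    using assms(2) that unfolding stab_in_def by (auto simp: fixes_vec_def)
  fix z assume z: "z \<in> G" "\<forall>b\<in>B. fixes_vec z b"
  show "z \<in> X1"
  proof (cases "bf (vmul u z) (\<lambda>q. vmul u z q - u q) = 0")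
    case False then show ?thesis using in_X_by_refl[OF 0 z] by simp
  next
    case True
    then have e: "bf (vmul u z) u = bf u u" by (simp add: bf_linear bf_vmul[OF z(1)])
    have 1: "y \<in> X1" if y: "y \<in> G" "\<forall>b\<in>B. fixes_vec y b" "\<forall>q\<in>{1..N}. vmul u y q = - u q" for y
    proof (rule in_X_by_refl[OF 0 y(1,2)])
      have "bf (vmul u y) (\<lambda>q. vmul u y q - u q) = bf (\<lambda>q. - u q) (\<lambda>q. - u q - u q)"
        by (rule bf_cong) (use y in auto)
      then show "bf (vmul u y) (\<lambda>q. vmul u y q - u q) \<noteq> 0"
        using assms(3) by (simp add: bf_linear)
    qed auto
    show ?thesis
      by (rule in_X_by_refl[where p = "\<lambda>q. - u q" and u = u and B = B])
        (use 1 z assms(3,4) e in \<open>auto simp: bf_linear bf_vmul[OF z(1)]\<close>)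
  qed
qed

text \<open>If \<open>u\<close> and \<open>u z\<close> are orthogonal, one transvection does not suffice, and the vector \<open>u + q\<close> serves as an
  intermediate stop.\<close>

lemma stab_in_alternating:
  assumes "sg = -1" "stab_in (insert u B)"
    and q: "\<And>z. z \<in> G \<Longrightarrow> \<forall>b\<in>B. fixes_vec z b \<Longrightarrow>
      \<exists>q. (\<forall>b\<in>B. bf b q = 0) \<and> bf u q \<noteq> 0 \<and> bf (vmul u z) q \<noteq> 0"
  shows "stab_in B"
  unfolding stab_in_def
proof (intro ballI impI)
  have 0: "z \<in> X1" if "z \<in> G" "\<forall>b\<in>B. fixes_vec z b" "\<forall>q\<in>{1..N}. vmul u z q = u q" for z
    using assms(2) that unfolding stab_in_def by (auto simp: fixes_vec_def)
  fix z assume z: "z \<in> G" "\<forall>b\<in>B. fixes_vec z b"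
  show "z \<in> X1"
  proof (cases "bf (vmul u z) (\<lambda>q. vmul u z q - u q) = 0")
    case False then show ?thesis using in_X_by_refl[OF 0 z] by simp
  next
    case True
    obtain q where q': "\<forall>b\<in>B. bf b q = 0" "bf u q \<noteq> 0" "bf (vmul u z) q \<noteq> 0" using q[OF z] by blast
    define p where "p = (\<lambda>i. u i + q i)"
    have 1: "y \<in> X1" if y: "y \<in> G" "\<forall>b\<in>B. fixes_vec y b" "\<forall>i\<in>{1..N}. vmul u y i = p i" for y
    proof (rule in_X_by_refl[OF 0 y(1,2)])
      have "bf (vmul u y) (\<lambda>i. vmul u y i - u i) = bf p q"
        by (rule bf_cong) (use y in \<open>auto simp: p_def\<close>)
      then show "bf (vmul u y) (\<lambda>i. vmul u y i - u i) \<noteq> 0"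
        using q'(2) assms(1) by (simp add: p_def bf_linear bf_self_alt)
    qed auto
    show ?thesis
    proof (rule in_X_by_refl[OF 1 z])
      have "bf (vmul u z) u = 0" using True assms(1) by (simp add: bf_linear bf_self_alt)
      then show "bf (vmul u z) (\<lambda>i. vmul u z i - p i) \<noteq> 0"
        using q'(3) assms(1) by (simp add: p_def bf_linear bf_self_alt algebra_simps)
    qed (use assms(1) q' bf_commute[of q u] in \<open>auto simp: p_def bf_linear bf_self_alt\<close>)
  qed
qed

lemma fixes_vec_comb:
  assumes "fixes_vec z x" "fixes_vec z y"
  shows "fixes_vec z (\<lambda>p. c * x p + d * y p)"
proof -
  have "vmul (\<lambda>p. c * x p + d * y p) z q = c * vmul x z q + d * vmul y z q" for q
    by (simp add: vmul_def sum_distrib_left sum.distrib algebra_simps)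
  then show ?thesis using assms by (simp add: fixes_vec_def)
qed

text \<open>Pairs of dual basis vectors, from the ends inwards.\<close>

definition outer :: "nat \<Rightarrow> (nat \<Rightarrow> 'a) set" where
  "outer k = unit ` ({1..k} \<union> {Suc N - k..N})"

lemma stab_in_outer_step:
  assumes "stab_in (outer (Suc k))" "Suc k \<le> Suc N div 2"
  shows "stab_in (outer k)"
proof -
  define a where "a = Suc k"
  define b where "b = Suc N - a"
  have ab: "a \<le> b" "a \<in> {1..N}" "b \<in> {1..N}" "Suc N - b = a" using assms(2) by (auto simp: a_def b_def)
  have "{1..Suc k} \<union> {Suc N - Suc k..N} = insert a (insert b ({1..k} \<union> {Suc N - k..N}))"
    using assms(2) by (auto simp: a_def b_def)
  then have outer: "outer (Suc k) = insert (unit a) (insert (unit b) (outer k))"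
    unfolding outer_def by simp
  have orth: "bf x (unit a) = 0" "bf x (unit b) = 0" if "x \<in> outer k" for x
  proof -
    obtain i where i: "x = unit i" "i \<in> {1..k} \<union> {Suc N - k..N}" using \<open>x \<in> outer k\<close> by (auto simp: outer_def)
    have "i \<noteq> a" "i \<noteq> b" using i(2) assms(2) by (auto simp: a_def b_def)
    moreover have "Suc N - a = b" by (simp add: b_def)
    ultimately show "bf x (unit a) = 0" "bf x (unit b) = 0"
      using ab(4) i(1) unfolding bf_unit_right[OF ab(2)] bf_unit_right[OF ab(3)] by (auto simp: unit_def)
  qed
  have u: "bf (unit a) (unit b) = s a" "bf (unit b) (unit a) = s b" "s b = sg * s a"
    using ab by (auto simp: unit_rows b_def s_opp)
  show ?thesis
  proof (cases "sg = 1")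
    case True
    show ?thesis
    proof (cases "a = b")
      case eq: True
      have "stab_in (insert (unit a) (outer k))" using assms(1) unfolding outer eq by simp
      then show ?thesis
        by (rule stab_in_symmetric[OF True]) (use u(1) orth eq s_nz[OF ab(2)] in auto)
    next
      case False
      \<comment> \<open>The hyperbolic plane spanned by \<open>e\<^sub>a\<close> and \<open>e\<^sub>b\<close> has an orthogonal basis of anisotropic vectors.\<close>
      define x where "x = (\<lambda>p. unit a p + unit b p)"
      define y where "y = (\<lambda>p. unit a p - unit b p)"
      have aa: "bf (unit a) (unit a) = 0" "bf (unit b) (unit b) = 0"
        using ab False by (auto simp: unit_rows b_def)
      have "stab_in (insert y (insert x (outer k)))"
        unfolding stab_in_def
      proof (intro ballI impI)
        fix z assume z: "z \<in> G" "\<forall>c\<in>insert y (insert x (outer k)). fixes_vec z c"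
        have "unit a = (\<lambda>p. (1/2) * x p + (1/2) * y p)" "unit b = (\<lambda>p. (1/2) * x p + (-1/2) * y p)"
          by (auto simp: x_def y_def field_simps)
        then have "fixes_vec z (unit a)" "fixes_vec z (unit b)"
          using fixes_vec_comb[of z x y "1/2" "1/2"] fixes_vec_comb[of z x y "1/2" "-1/2"] z by auto
        then show "z \<in> X1" using z assms(1) unfolding stab_in_def outer by auto
      qed
      then have "stab_in (insert x (outer k))"
        by (rule stab_in_symmetric[OF True])
          (use u aa orth s_nz[OF ab(2)] True in \<open>auto simp: x_def y_def bf_linear\<close>)
      then show ?thesis
        by (rule stab_in_symmetric[OF True])
          (use u aa orth s_nz[OF ab(2)] True in \<open>auto simp: x_def bf_linear\<close>)
    qed
  next
    case False
    then have sg: "sg = -1" using sg_cases by auto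
    have "stab_in (insert (unit b) (insert (unit a) (outer k)))"
      using assms(1) unfolding outer by (simp add: insert_commute)
    then have "stab_in (insert (unit a) (outer k))"
    proof (rule stab_in_alternating[OF sg])
      fix z assume z: "z \<in> G" "\<forall>c\<in>insert (unit a) (outer k). fixes_vec z c"
      have "bf (vmul (unit b) z) (unit a) = bf (vmul (unit b) z) (vmul (unit a) z)"
        by (rule bf_cong) (use z in \<open>auto simp: fixes_vec_def\<close>)
      also have "\<dots> = s b" using u by (simp add: bf_vmul[OF z(1)])
      finally show "\<exists>q. (\<forall>c\<in>insert (unit a) (outer k). bf c q = 0) \<and> bf (unit b) q \<noteq> 0 \<and>
          bf (vmul (unit b) z) q \<noteq> 0"
        using u orth s_nz[OF ab(3)] by (intro exI[of _ "unit a"]) (auto simp: bf_self_alt[OF sg])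
    qed
    then show ?thesis
    proof (rule stab_in_alternating[OF sg])
      fix z assume z: "z \<in> G" "\<forall>c\<in>outer k. fixes_vec z c"
      \<comment> \<open>One of \<open>q1\<close>, \<open>q2\<close> and \<open>q1 + q2\<close> is orthogonal neither to \<open>e\<^sub>a\<close> nor to its image.\<close>
      define q1 where "q1 = unit b"
      define q2 where "q2 = vmul (unit b) z"
      have o1: "bf c q1 = 0" if "c \<in> outer k" for c using orth that by (simp add: q1_def)
      have o2: "bf c q2 = 0" if "c \<in> outer k" for c
      proof -
        have "bf c q2 = bf (vmul c z) q2"
          by (rule bf_cong) (use z that in \<open>auto simp: fixes_vec_def\<close>)
        then show ?thesis using orth that by (simp add: q2_def bf_vmul[OF z(1)])
      qed
      have n1: "bf (unit a) q1 \<noteq> 0" using u s_nz ab by (simp add: q1_def)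
      have n2: "bf (vmul (unit a) z) q2 \<noteq> 0" using u s_nz ab by (simp add: q2_def bf_vmul[OF z(1)])
      consider "bf (vmul (unit a) z) q1 \<noteq> 0" | "bf (unit a) q2 \<noteq> 0"
        | "bf (vmul (unit a) z) q1 = 0" "bf (unit a) q2 = 0" by blast
      then show "\<exists>q. (\<forall>c\<in>outer k. bf c q = 0) \<and> bf (unit a) q \<noteq> 0 \<and> bf (vmul (unit a) z) q \<noteq> 0"
      proof cases
        case 1 then show ?thesis using o1 n1 by (intro exI[of _ q1]) auto
      next
        case 2 then show ?thesis using o2 n2 by (intro exI[of _ q2]) auto
      next
        case 3
        then show ?thesis using o1 o2 n1 n2
          by (intro exI[of _ "\<lambda>i. q1 i + q2 i"]) (auto simp: bf_linear)
      qed
    qed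
  qed
qed

text \<open>A weak form of the theorem of Cartan and Dieudonne: the reflections or transvections \<open>refl \<tau> w\<close> generate the
  group. Going down from the pointwise stabilizer of the whole standard basis, which is trivial, the pairs of dual
  basis vectors are released one after the other, the innermost pair first.\<close>

lemma G_subset_if_closed_under_refl:
  assumes "1\<^sub>m N \<in> X1" shows "G \<subseteq> X1"
proof -
  have "stab_in (outer (Suc N div 2 - k))" if "k \<le> Suc N div 2" for k
    using that
  proof (induction k)
    case 0
    show ?case unfolding stab_in_def
    proof (intro ballI impI)
      fix z assume z: "z \<in> G" "\<forall>b\<in>outer (Suc N div 2 - 0). fixes_vec z b"
      have "{1..N} \<subseteq> {1..Suc N div 2} \<union> {Suc N - Suc N div 2..N}" by auto
      then have "fixes_vec z (unit i)" if "i \<in> {1..N}" for i using z that by (auto simp: outer_def)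
      then have "z = 1\<^sub>m N"
        by (intro mat_eqI) (auto simp: entry_one fixes_vec_def vmul_unit unit_def G_carrier[OF z(1)])
      then show "z \<in> X1" using assms by simp
    qed
  next
    case (Suc k)
    then show ?case using stab_in_outer_step[of "Suc N div 2 - Suc k"]
      by (simp add: Suc_diff_Suc)
  qed
  from this[of "Suc N div 2"] have "stab_in {}" by (simp add: outer_def)
  then show ?thesis unfolding stab_in_def by auto
qed

end

section \<open>Rational curves in the group\<close>

definition rcurve :: "'a set \<Rightarrow> ('a \<Rightarrow> 'a mat) \<Rightarrow> bool" where
  "rcurve T \<gamma> \<longleftrightarrow> (\<forall>t. \<gamma> t \<in> carrier_mat N N) \<and>
     (\<forall>i\<in>{1..N}. \<forall>j\<in>{1..N}. (\<lambda>t. entry (\<gamma> t) i j) \<in> rat_on T)"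

lemma rcurve_const: "g \<in> carrier_mat N N \<Longrightarrow> rcurve T (\<lambda>_. g)"
  by (simp add: rcurve_def rat.const)

lemma rcurve_mult: "rcurve T \<gamma> \<Longrightarrow> rcurve T \<delta> \<Longrightarrow> rcurve T (\<lambda>t. \<gamma> t * \<delta> t)"
proof -
  assume \<gamma>: "rcurve T \<gamma>" and \<delta>: "rcurve T \<delta>"
  have c: "\<gamma> t \<in> carrier_mat N N" "\<delta> t \<in> carrier_mat N N" for t using \<gamma> \<delta> by (auto simp: rcurve_def)
  have "(\<lambda>t. entry (\<gamma> t * \<delta> t) i j) \<in> rat_on T" if "i \<in> {1..N}" "j \<in> {1..N}" for i j
  proof -
    have "(\<lambda>t. \<Sum>k = 1..N. entry (\<gamma> t) i k * entry (\<delta> t) k j) \<in> rat_on T"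
      using \<gamma> \<delta> that unfolding rcurve_def by (intro rat.sum rat.mult) auto
    then show ?thesis by (simp add: entry_mult[OF c that])
  qed
  moreover have "\<gamma> t * \<delta> t \<in> carrier_mat N N" for t by (rule mult_carrier_mat[OF c])
  ultimately show ?thesis by (simp add: rcurve_def)
qed

lemma rcurve_regular: "rcurve T \<gamma> \<Longrightarrow> f \<in> regular_funs N \<Longrightarrow> (\<lambda>t. f (\<gamma> t)) \<in> rat_on T"
  by (rule rat.regular_comp) (auto simp: rcurve_def)

lemma det_regular: "det \<in> regular_funs N"
  using regular.det[of N "\<lambda>A. A" N] by (simp add: regular_index)

text \<open>Wherever the curve is in \<open>G\<close>, the determinant is \<open>\<plusminus>1\<close>; a rational function that is \<open>\<epsilon>\<close> at one point takes the
  value \<open>-\<epsilon>\<close> only finitely often.\<close>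

lemma rcurve_stays_in_component:
  assumes \<gamma>: "rcurve T \<gamma>" "finite {t. \<gamma> t \<notin> G}" and t0: "t0 \<in> T" "\<gamma> t0 \<in> component \<epsilon>"
    and \<epsilon>: "sg = 1 \<Longrightarrow> \<epsilon> = 1 \<or> \<epsilon> = -1"
  shows "finite {t. \<gamma> t \<notin> component \<epsilon>}"
proof (cases "sg = 1")
  case True
  have "(\<lambda>t. det (\<gamma> t) + \<epsilon>) \<in> rat_on T" by (intro rat.add rcurve_regular[OF \<gamma>(1)] det_regular rat.const)
  moreover have "det (\<gamma> t0) = \<epsilon>" using t0(2) True unfolding component_def by blast
  then have "det (\<gamma> t0) + \<epsilon> \<noteq> 0" using \<epsilon>[OF True] by auto
  ultimately have "finite {t. det (\<gamma> t) + \<epsilon> = 0}" using rat_finite_zeros[OF _ t0(1)] by simp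
  then have "finite ({t. \<gamma> t \<notin> G} \<union> {t. det (\<gamma> t) + \<epsilon> = 0})" using \<gamma>(2) by simp
  moreover have "{t. \<gamma> t \<notin> component \<epsilon>} \<subseteq> {t. \<gamma> t \<notin> G} \<union> {t. det (\<gamma> t) + \<epsilon> = 0}"
  proof
    fix t assume "t \<in> {t. \<gamma> t \<notin> component \<epsilon>}"
    moreover have "det (\<gamma> t) = 1 \<or> det (\<gamma> t) = -1" if "\<gamma> t \<in> G"
      using det_sq[OF that] by (simp add: square_eq_1_iff)
    ultimately show "t \<in> {t. \<gamma> t \<notin> G} \<union> {t. det (\<gamma> t) + \<epsilon> = 0}"
      using \<epsilon>[OF True] True unfolding component_def by auto
  qed
  ultimately show ?thesis by (rule finite_subset[rotated])
next
  case False then show ?thesis using \<gamma>(2) by (simp add: component_def)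
qed

text \<open>The curve may leave \<open>G\<close> at finitely many parameters, where a denominator vanishes.\<close>

definition connected :: "'a mat \<Rightarrow> bool" where
  "connected z \<longleftrightarrow> (\<exists>\<gamma>. rcurve {0, 1} \<gamma> \<and> finite {t. \<gamma> t \<notin> G} \<and> \<gamma> 0 = 1\<^sub>m N \<and> \<gamma> 1 = z)"

lemma connected_one: "connected (1\<^sub>m N)"
  unfolding connected_def by (rule exI[of _ "\<lambda>_. 1\<^sub>m N"]) (auto intro!: rcurve_const simp: G_one)

lemma connected_mult:
  assumes "connected x" "connected y" shows "connected (x * y)"
proof -
  obtain \<gamma> \<delta> where g: "rcurve {0, 1} \<gamma>" "finite {t. \<gamma> t \<notin> G}" "\<gamma> 0 = 1\<^sub>m N" "\<gamma> 1 = x"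
    and d: "rcurve {0, 1} \<delta>" "finite {t. \<delta> t \<notin> G}" "\<delta> 0 = 1\<^sub>m N" "\<delta> 1 = y"
    using assms unfolding connected_def by blast
  have "{t. \<gamma> t * \<delta> t \<notin> G} \<subseteq> {t. \<gamma> t \<notin> G} \<union> {t. \<delta> t \<notin> G}" using G_mult by auto
  then have "finite {t. \<gamma> t * \<delta> t \<notin> G}" using g(2) d(2) by (simp add: finite_subset)
  then show ?thesis unfolding connected_def
    using g d rcurve_mult[OF g(1) d(1)] by (intro exI[of _ "\<lambda>t. \<gamma> t * \<delta> t"]) auto
qed

lemma connected_det:
  assumes "connected x" "sg = 1 \<or> sg = -1" shows "det x = 1"
proof -
  obtain \<gamma> where g: "rcurve {0, 1} \<gamma>" "finite {t. \<gamma> t \<notin> G}" "\<gamma> 0 = 1\<^sub>m N" "\<gamma> 1 = x"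
    using assms unfolding connected_def by blast
  have d: "(\<lambda>t. det (\<gamma> t)) \<in> rat_on {0, 1}" by (rule rcurve_regular[OF g(1) det_regular])
  have "finite {t. det (\<gamma> t) + 1 = 0}"
    by (rule rat_finite_zeros[of _ "{0,1}" 0]) (auto intro!: rat.add rat.const d simp: g)
  then have fin: "finite ({t. \<gamma> t \<notin> G} \<union> {t. det (\<gamma> t) + 1 = 0})" using g(2) by simp
  have sub: "{t. det (\<gamma> t) - 1 \<noteq> 0} \<subseteq> {t. \<gamma> t \<notin> G} \<union> {t. det (\<gamma> t) + 1 = 0}"
  proof
    fix t assume "t \<in> {t. det (\<gamma> t) - 1 \<noteq> 0}"
    moreover have "det (\<gamma> t) = 1 \<or> det (\<gamma> t) = -1" if "\<gamma> t \<in> G"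
      using det_sq[OF that] by (simp add: square_eq_1_iff)
    ultimately show "t \<in> {t. \<gamma> t \<notin> G} \<union> {t. det (\<gamma> t) + 1 = 0}" by auto
  qed
  show ?thesis
  proof (rule ccontr)
    assume "det x \<noteq> 1"
    then have "finite {t. det (\<gamma> t) - 1 = 0}"
      by (intro rat_finite_zeros[of _ "{0,1}" 1]) (auto intro!: rat.diff rat.const d simp: g)
    moreover have "UNIV = {t. det (\<gamma> t) - 1 = 0} \<union> {t. det (\<gamma> t) - 1 \<noteq> 0}" by auto
    ultimately have "finite (UNIV :: 'a set)" using finite_subset[OF sub fin] by (metis finite_Un)
    then show False by (simp add: infinite_UNIV_char_0)
  qed
qed

lemma rcurve_refl:
  assumes "\<tau> \<in> rat_on T" "\<And>q. q \<in> {1..N} \<Longrightarrow> (\<lambda>t. w t q) \<in> rat_on T"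
  shows "rcurve T (\<lambda>t. lmat (refl (\<tau> t) (w t)))"
proof -
  have "(\<lambda>t. refl (\<tau> t) (w t) (unit i) j) \<in> rat_on T" if "i \<in> {1..N}" "j \<in> {1..N}" for i j
    unfolding refl_def bf_def
    by (intro rat.diff rat.mult rat.sum rat.const assms that) auto
  then show ?thesis by (simp add: rcurve_def lmat_def)
qed

lemma rat_bf:
  assumes "\<And>q. q \<in> {1..N} \<Longrightarrow> (\<lambda>t. x t q) \<in> rat_on T" "\<And>q. q \<in> {1..N} \<Longrightarrow> (\<lambda>t. y t q) \<in> rat_on T"
  shows "(\<lambda>t. bf (x t) (y t)) \<in> rat_on T"
  unfolding bf_def by (intro rat.sum rat.mult rat.const assms) auto

lemma connected_transvection: assumes "sg = -1" shows "connected (lmat (refl \<tau> w))"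
proof -
  have "lmat (refl (0 * \<tau>) w) = 1\<^sub>m N"
    by (rule mat_eqI) (auto simp: lmat_def refl_def unit_def entry_one)
  moreover have "lmat (refl (t * \<tau>) w) \<in> G" for t
    using assms by (intro lmat_refl_G) (simp add: bf_self_alt)
  ultimately show ?thesis unfolding connected_def
    by (intro exI[of _ "\<lambda>t. lmat (refl (t * \<tau>) w)"] conjI rcurve_refl rat.mult rat_ident rat.const) auto
qed

text \<open>Move the vector of the first reflection along a line to the vector of the second one. Along this line the
  reflection is undefined where the vector becomes isotropic, which happens finitely often.\<close>

lemma connected_refl_refl:
  assumes sg: "sg = 1" and \<tau>: "\<tau> * bf w w = 2" and \<tau>': "\<tau>' * bf w' w' = 2"
  shows "connected (lmat (refl \<tau> w) * lmat (refl \<tau>' w'))"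
proof -
  define u where "u t = (\<lambda>q. (1 - t) * w' q + t * w q)" for t
  define \<sigma> where "\<sigma> t = 2 / bf (u t) (u t)" for t
  have u: "u 0 = w'" "u 1 = w" by (auto simp: u_def)
  have ru: "(\<lambda>t. u t q) \<in> rat_on T" for q T
    unfolding u_def by (intro rat.add rat.mult rat.diff rat.const rat_ident)
  have ends: "bf w w \<noteq> 0" "bf w' w' \<noteq> 0" using \<tau> \<tau>' by auto
  have rb: "(\<lambda>t. bf (u t) (u t)) \<in> rat_on T" for T by (intro rat_bf ru)
  have r\<sigma>: "\<sigma> \<in> rat_on {0, 1}"
    unfolding \<sigma>_def using ends by (intro rat_divide rat.const rb) (auto simp: u)
  have \<sigma>: "\<sigma> 0 = \<tau>'" "\<sigma> 1 = \<tau>" using ends \<tau> \<tau>' by (auto simp: \<sigma>_def u field_simps)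
  have G': "lmat (refl \<tau>' w') \<in> G" using \<tau>' sg by (intro lmat_refl_G) auto
  let ?\<gamma> = "\<lambda>t. lmat (refl (\<sigma> t) (u t)) * lmat (refl \<tau>' w')"
  have "finite {t. bf (u t) (u t) = 0}" using rat_finite_zeros[OF rb, of 0 "{0,1}"] ends u by auto
  moreover have "{t. ?\<gamma> t \<notin> G} \<subseteq> {t. bf (u t) (u t) = 0}"
    using G' sg by (auto intro!: G_mult lmat_refl_G simp: \<sigma>_def)
  ultimately have "finite {t. ?\<gamma> t \<notin> G}" by (rule finite_subset[rotated])
  moreover have "?\<gamma> 0 = 1\<^sub>m N"
    using lmat_refl_inverse[of \<tau>' w'] \<tau>' sg by (simp add: u \<sigma>)
  moreover have "rcurve {0,1} ?\<gamma>" by (intro rcurve_mult rcurve_refl rcurve_const r\<sigma> ru) auto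
  ultimately show ?thesis unfolding connected_def by (intro exI[of _ ?\<gamma>]) (auto simp: u \<sigma>)
qed

lemma reflection_with_det_minus_one:
  assumes sg: "sg = 1" obtains \<tau> w where "\<tau> * bf w w = 2" "det (lmat (refl \<tau> w)) = -1"
proof (cases "N = 1")
  case True
  have ss: "s (Suc 0) * s (Suc 0) = 1" using s_sq[of 1] True by simp
  have bu: "bf (unit 1) (unit 1) = s 1"
  proof -
    have "bf (unit 1) (unit 1) = s 1 * unit 1 (Suc N - 1)" using N_pos by (intro bf_unit_left) auto
    also have "unit 1 (Suc N - 1) = 1" using True by (simp add: unit_def)
    finally show ?thesis by simp
  qed
  have 1: "(2 * s 1) * bf (unit 1) (unit 1) = 2"
    using ss unfolding bu by simp
  have "lmat (refl (2 * s 1) (unit 1)) \<in> carrier_mat 1 1" using lmat_carrier True by simp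
  then have "det (lmat (refl (2 * s 1) (unit 1))) = entry (lmat (refl (2 * s 1) (unit 1))) 1 1"
    using det_single[of "lmat (refl (2 * s 1) (unit 1))"] by (simp add: entry_def)
  also have "\<dots> = 1 - 2 * (s 1 * s 1)"
  proof -
    have "entry (lmat (refl (2 * s 1) (unit 1))) 1 1 = refl (2 * s 1) (unit 1) (unit 1) 1"
      using N_pos by (simp add: lmat_def)
    then show ?thesis unfolding refl_def bu by (simp add: unit_def)
  qed
  finally have "det (lmat (refl (2 * s 1) (unit 1))) = -1" using ss by simp
  then show ?thesis using that[OF 1] by simp
next
  case False
  then have N: "N \<ge> 2" using N_pos by simp
  define w where "w = (\<lambda>q. unit 1 q - unit N q)"
  have s1: "s N = s 1" "s 1 * s 1 = 1" using s_opp[of 1] s_sq[of 1] sg N by auto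
  \<comment> \<open>The reflection in \<open>e\<^sub>1 - e\<^sub>N\<close> interchanges the first and the last basis vector.\<close>
  have 1: "(- s 1) * bf w w = 2"
    using s1 N by (simp add: w_def bf_linear unit_rows algebra_simps)
  have e: "refl (- s 1) w (unit i) j = unit i j + (unit i N - unit i 1) * w j" if "i \<in> {1..N}" for i j
  proof -
    have "bf (unit i) w = s 1 * (unit i N - unit i 1)"
      using s1 N by (simp add: w_def bf_linear bf_unit_right algebra_simps)
    then have "refl (- s 1) w (unit i) j = unit i j + (s 1 * s 1) * ((unit i N - unit i 1) * w j)"
      unfolding refl_def by (simp add: mult_ac)
    then show ?thesis using s1 by simp
  qed
  have "lmat (refl (- s 1) w) = swaprows_mat N 0 (N - 1)"
  proof (rule mat_eqI)
    fix i j assume ij: "i \<in> {1..N}" "j \<in> {1..N}"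
    have "entry (lmat (refl (- s 1) w)) i j = unit i j + (unit i N - unit i 1) * w j"
      using ij e by (simp add: lmat_def)
    also have "\<dots> = entry (swaprows_mat N 0 (N - 1)) i j"
      using ij N by (auto simp: entry_def unit_def w_def)
    finally show "entry (lmat (refl (- s 1) w)) i j = entry (swaprows_mat N 0 (N - 1)) i j" .
  qed auto
  then have "det (lmat (refl (- s 1) w)) = -1" using det_swaprows_mat[of 0 N "N - 1"] N by simp
  then show ?thesis using that[OF 1] by simp
qed

text \<open>In the symmetric case a fixed reflection \<open>R\<close> records the parity: multiplying by one more reflection interchanges
  the isometries joined to \<open>1\<close> with those whose product with \<open>R\<close> is.\<close>

lemma connected_if_det_one:
  assumes z: "z \<in> G" "sg = 1 \<Longrightarrow> det z = 1" shows "connected z"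
proof (cases "sg = 1")
  case False
  then have sg: "sg = -1" using sg_cases by auto
  have "G \<subseteq> Collect connected"
    by (rule G_subset_if_closed_under_refl)
      (auto intro: connected_mult connected_transvection[OF sg] connected_one)
  then show ?thesis using z by auto
next
  case True
  obtain \<tau> w where \<tau>: "\<tau> * bf w w = 2" and d: "det (lmat (refl \<tau> w)) = -1"
    using reflection_with_det_minus_one[OF True] .
  define R where "R = lmat (refl \<tau> w)"
  have R: "R \<in> carrier_mat N N" by (simp add: R_def)
  have RR: "R * R = 1\<^sub>m N" using lmat_refl_inverse[of \<tau> w] \<tau> True by (simp add: R_def)
  have "G \<subseteq> {z \<in> carrier_mat N N. connected z \<or> connected (z * R)}"
  proof (rule G_subset_if_closed_under_refl)
    fix z \<tau>' w' assume z: "z \<in> {z \<in> carrier_mat N N. connected z \<or> connected (z * R)}"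
      and \<tau>': "\<tau>' * bf w' w' = 1 + sg"
    let ?R' = "lmat (refl \<tau>' w')"
    have z': "z \<in> carrier_mat N N" using z by simp
    have c: "connected (?R' * R)" "connected (R * ?R')"
      unfolding R_def using connected_refl_refl[OF True] \<tau> \<tau>' True by auto
    show "z * ?R' \<in> {z \<in> carrier_mat N N. connected z \<or> connected (z * R)}"
    proof (cases "connected z")
      case True
      then have "connected (z * (?R' * R))" using c(1) by (rule connected_mult)
      then show ?thesis using z' R by (simp add: assoc_mult_mat[OF z' lmat_carrier R])
    next
      case False
      then have "connected (z * R * (R * ?R'))" using z c(2) connected_mult by auto
      also have "z * R * (R * ?R') = z * (R * R) * ?R'"
        using z' R by (simp add: assoc_mult_mat[of _ N N _ N _ N])
      also have "\<dots> = z * ?R'" using z' by (simp add: RR)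
      finally show ?thesis using z' by simp
    qed
  qed (use connected_one in auto)
  then consider "connected z" | "connected (z * R)" using z by auto
  then show ?thesis
  proof cases
    case 2
    then have "det (z * R) = 1" using connected_det sg_cases by blast
    then show ?thesis using z(2)[OF True] d det_mult[OF G_carrier[OF z(1)] R] by (simp add: R_def)
  qed
qed

lemma det_alternating: "sg = -1 \<Longrightarrow> z \<in> G \<Longrightarrow> det z = 1"
  using connected_det connected_if_det_one by fastforce

text \<open>On a rational curve through \<open>x\<close> and \<open>y\<close> each of the two functions vanishes at finitely many parameters only.\<close>

lemma component_irreducible:
  assumes f: "f \<in> regular_funs N" and g: "g \<in> regular_funs N"
    and \<epsilon>: "sg = 1 \<Longrightarrow> \<epsilon> = 1 \<or> \<epsilon> = -1"
    and x: "x \<in> component \<epsilon>" "f x \<noteq> 0" and y: "y \<in> component \<epsilon>" "g y \<noteq> 0"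
  shows "\<exists>z\<in>component \<epsilon>. f z \<noteq> 0 \<and> g z \<noteq> 0"
proof -
  have G: "x \<in> G" "y \<in> G" using x y by (auto simp: component_def)
  note C = G_carrier[OF G(1)] G_carrier[OF G(2)]
  have "det (ginv x * y) = 1" if "sg = 1"
  proof -
    have "det x * det (ginv x) = 1"
      using det_mult[OF C(1) ginv_carrier, of x] ginv_right[OF G(1)] by simp
    moreover have "det x = \<epsilon>" "det y = \<epsilon>" using x(1) y(1) that unfolding component_def by blast+
    ultimately show ?thesis using det_mult[OF ginv_carrier C(2), of x] by (simp add: mult.commute)
  qed
  then have "connected (ginv x * y)" using G by (intro connected_if_det_one G_mult G_ginv)
  then obtain \<gamma> where c: "rcurve {0, 1} \<gamma>" "finite {t. \<gamma> t \<notin> G}" "\<gamma> 0 = 1\<^sub>m N" "\<gamma> 1 = ginv x * y"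
    unfolding connected_def by blast
  define \<delta> where "\<delta> t = x * \<gamma> t" for t
  have d0: "\<delta> 0 = x" using C by (simp add: \<delta>_def c)
  have "\<delta> 1 = (x * ginv x) * y" unfolding \<delta>_def c using C by (simp add: assoc_mult_mat[of _ N N _ N _ N])
  then have d1: "\<delta> 1 = y" using C ginv_right[OF G(1)] by simp
  have d: "rcurve {0, 1} \<delta>" unfolding \<delta>_def by (intro rcurve_mult rcurve_const C c)
  have "{t. \<delta> t \<notin> G} \<subseteq> {t. \<gamma> t \<notin> G}" using G_mult[OF G(1)] by (auto simp: \<delta>_def)
  then have "finite {t. \<delta> t \<notin> G}" using c(2) by (rule finite_subset)
  then have 1: "finite {t. \<delta> t \<notin> component \<epsilon>}"
    by (rule rcurve_stays_in_component[OF d, where ?t0.0 = 0]) (use x d0 \<epsilon> in auto)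
  have 2: "finite {t. f (\<delta> t) = 0}"
    by (rule rat_finite_zeros[OF rcurve_regular[OF d f], of 0]) (use d0 x in auto)
  have 3: "finite {t. g (\<delta> t) = 0}"
    by (rule rat_finite_zeros[OF rcurve_regular[OF d g], of 1]) (use d1 y in auto)
  have "\<exists>t. t \<notin> {t. \<delta> t \<notin> component \<epsilon>} \<union> {t. f (\<delta> t) = 0} \<union> {t. g (\<delta> t) = 0}"
    using 1 2 3 infinite_UNIV_char_0 by (intro ex_new_if_finite) auto
  then show ?thesis by auto
qed

end

section \<open>Stacked minors and the generic decomposition\<close>

context antidiagonal_form
begin

lemma ginv_unique:
  assumes g: "g \<in> G" and h: "h \<in> carrier_mat N N" "h * g = 1\<^sub>m N" shows "h = ginv g"
proof -
  have "h = h * (g * ginv g)" using ginv_right[OF g] h by simp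
  also have "\<dots> = (h * g) * ginv g" by (rule assoc_mult_mat[OF h(1) G_carrier[OF g] ginv_carrier, symmetric])
  also have "\<dots> = ginv g" unfolding h(2) by (rule left_mult_one_mat[OF ginv_carrier])
  finally show ?thesis .
qed

lemma ginv_ginv: "g \<in> G \<Longrightarrow> ginv (ginv g) = g"
  using ginv_unique[OF G_ginv G_carrier ginv_right] by simp

text \<open>On \<open>G\<close> the adjugate is, up to the constant \<open>det x\<close>, a rearrangement of the entries of \<open>x\<close> itself. Therefore the
  last rows of the adjugate involve only the first columns of \<open>x\<close>.\<close>

lemma adj_G: assumes x: "x \<in> G" shows "adj_mat x = det x \<cdot>\<^sub>m ginv x"
proof -
  note c = G_carrier[OF x] adj_mat(1)[OF G_carrier[OF x]]
  have "adj_mat x = adj_mat x * (x * ginv x)" using ginv_right[OF x] c by simp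
  also have "\<dots> = (adj_mat x * x) * ginv x" using c by (simp add: assoc_mult_mat[of _ N N _ N _ N])
  also have "\<dots> = det x \<cdot>\<^sub>m ginv x"
    unfolding adj_mat(3)[OF c(1)] mult_smult_assoc_mat[OF one_carrier_mat ginv_carrier]
      left_mult_one_mat[OF ginv_carrier] ..
  finally show ?thesis .
qed

lemma entry_adj:
  assumes "x \<in> G" "a \<in> {1..N}" "b \<in> {1..N}"
  shows "entry (adj_mat x) a b = det x * (s (Suc N - a) * s (Suc N - b) * entry x (Suc N - b) (Suc N - a))"
proof -
  have "entry (adj_mat x) a b = det x * entry (ginv x) a b"
    using assms(2,3) carrier_matD[OF ginv_carrier[of x]] unfolding adj_G[OF assms(1)] entry_def by auto
  then show ?thesis using assms by (simp add: entry_ginv)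
qed

definition utri :: "'a mat \<Rightarrow> bool" where
  "utri v \<longleftrightarrow> v \<in> carrier_mat N N \<and>
     (\<forall>i\<in>{1..N}. \<forall>r\<in>{1..N}. r \<le> i \<longrightarrow> entry v i r = (if i = r then 1 else 0))"

lemma utriD: "utri v \<Longrightarrow> i \<in> {1..N} \<Longrightarrow> r \<in> {1..N} \<Longrightarrow> r \<le> i \<Longrightarrow> entry v i r = (if i = r then 1 else 0)"
  and utri_carrier: "utri v \<Longrightarrow> v \<in> carrier_mat N N"
  by (auto simp: utri_def)

lemma utri_ginv: assumes "utri v" shows "utri (ginv v)"
  unfolding utri_def
proof (intro conjI ballI impI)
  fix i r assume ir: "i \<in> {1..N}" "r \<in> {1..N}" "r \<le> i"
  have "entry (ginv v) i r = s (Suc N - i) * s (Suc N - r) * (if Suc N - r = Suc N - i then 1 else 0)"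
  proof -
    have "entry v (Suc N - r) (Suc N - i) = (if Suc N - r = Suc N - i then 1 else 0)"
      by (rule utriD[OF assms opp_mem[OF ir(2)] opp_mem[OF ir(1)]]) (use ir in auto)
    then show ?thesis using entry_ginv[OF ir(1,2)] by simp
  qed
  moreover have "Suc N - r = Suc N - i \<longleftrightarrow> i = r" using ir by auto
  ultimately show "entry (ginv v) i r = (if i = r then 1 else 0)"
    using s_sq[OF opp_mem[OF ir(1)]] by (cases "i = r") auto
qed auto

text \<open>The last \<open>e\<close> rows of \<open>A\<close> above the last \<open>d\<close> rows of \<open>B\<close>, restricted to the first \<open>e + d\<close> columns.\<close>

definition stack :: "nat \<Rightarrow> nat \<Rightarrow> 'a mat \<Rightarrow> 'a mat \<Rightarrow> 'a mat" where
  "stack e d A B = mat (e + d) (e + d) (\<lambda>(p, q). if p < e then entry A (N - e + 1 + p) (q + 1)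
     else entry B (N - d + 1 + (p - e)) (q + 1))"

lemma stack_carrier[simp]: "stack e d A B \<in> carrier_mat (e + d) (e + d)"
  by (simp add: stack_def)

text \<open>For \<open>d = 0\<close> a lower left corner minor, and in general the shape of \<open>J\<^sub>i\<^sub>j\<close> for \<open>i + j \<ge> N + 1\<close>, with
  \<open>e = i'\<close> and \<open>d = j - i'\<close> (\<open>J_poly_lower\<close>).\<close>

definition mixed_minor :: "nat \<Rightarrow> nat \<Rightarrow> 'a mat \<Rightarrow> 'a" where
  "mixed_minor e d A = det (stack e d A (adj_mat A))"

lemma sum_lessThan_add: "(\<Sum>p<e + (d::nat). f p :: 'a) = (\<Sum>p<e. f p) + (\<Sum>p<d. f (e + p))"
  by (induction d) (auto simp: add.assoc)

lemma utri_row_sum: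
  assumes v: "utri v" and i: "i \<in> {1..N}" "i > N - e" and e: "e \<le> N"
  shows "(\<Sum>r = 1..N. entry v i r * a r) = (\<Sum>p<e. entry v i (N - e + 1 + p) * a (N - e + 1 + p))"
proof -
  have "(\<Sum>r = 1..N. entry v i r * a r) = (\<Sum>r\<in>{N - e + 1..N}. entry v i r * a r)"
    by (rule sum.mono_neutral_right) (use i utriD[OF v i(1)] in auto)
  also have "\<dots> = (\<Sum>p<e. entry v i (N - e + 1 + p) * a (N - e + 1 + p))"
    by (rule sum.reindex_bij_witness[of _ "\<lambda>p. N - e + 1 + p" "\<lambda>r. r - (N - e + 1)"]) (use e in auto)
  finally show ?thesis .
qed

text \<open>The last rows of \<open>v A\<close> are unitriangular combinations of the last rows of \<open>A\<close>, separately in both halves of the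
  stack.\<close>

lemma stack_left:
  assumes v: "utri v" and A: "A \<in> carrier_mat N N" and B: "B \<in> carrier_mat N N" and ed: "e + d \<le> N"
  obtains T where "T \<in> carrier_mat (e + d) (e + d)" "det T = 1"
    "stack e d (v * A) (v * B) = T * stack e d A B"
proof -
  define T where "T = mat (e + d) (e + d) (\<lambda>(p, p').
     if p < e then (if p' < e then entry v (N - e + 1 + p) (N - e + 1 + p') else 0)
     else (if p' < e then 0 else entry v (N - d + 1 + (p - e)) (N - d + 1 + (p' - e))))"
  have T: "T \<in> carrier_mat (e + d) (e + d)" by (simp add: T_def)
  have "det T = 1"
  proof (cases "e + d = 0")
    case True then show ?thesis using T det_dim_zero by simp
  next
    case False
    have "det T = T $$ (0, 0)"
      by (rule det_upper_unit[OF T]) (use False ed utriD[OF v] in \<open>auto simp: T_def\<close>)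
    also have "\<dots> = 1" using False ed utriD[OF v] by (auto simp: T_def)
    finally show ?thesis .
  qed
  moreover have "stack e d (v * A) (v * B) = T * stack e d A B"
  proof (rule eq_matI)
    fix p q assume "p < dim_row (T * stack e d A B)" "q < dim_col (T * stack e d A B)"
    then have pq: "p < e + d" "q < e + d" by (auto simp: T_def stack_def)
    have "(T * stack e d A B) $$ (p, q) = (\<Sum>r<e + d. T $$ (p, r) * stack e d A B $$ (r, q))"
      using pq T by (simp add: scalar_prod_def atLeast0LessThan stack_def)
    also have "\<dots> = (\<Sum>r<e. T $$ (p, r) * stack e d A B $$ (r, q)) +
        (\<Sum>r<d. T $$ (p, e + r) * stack e d A B $$ (e + r, q))" by (rule sum_lessThan_add)
    also have "\<dots> = stack e d (v * A) (v * B) $$ (p, q)"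
    proof (cases "p < e")
      case True
      have "stack e d (v * A) (v * B) $$ (p, q) = (\<Sum>r = 1..N. entry v (N - e + 1 + p) r * entry A r (q + 1))"
        using True pq ed by (simp add: stack_def entry_mult[OF utri_carrier[OF v] A])
      also have "\<dots> = (\<Sum>r<e. entry v (N - e + 1 + p) (N - e + 1 + r) * entry A (N - e + 1 + r) (q + 1))"
        by (rule utri_row_sum[OF v]) (use True ed in auto)
      finally show ?thesis using True pq by (simp add: T_def stack_def)
    next
      case False
      have "stack e d (v * A) (v * B) $$ (p, q) =
          (\<Sum>r = 1..N. entry v (N - d + 1 + (p - e)) r * entry B r (q + 1))"
        using False pq ed by (simp add: stack_def entry_mult[OF utri_carrier[OF v] B])
      also have "\<dots> = (\<Sum>r<d. entry v (N - d + 1 + (p - e)) (N - d + 1 + r) * entry B (N - d + 1 + r) (q + 1))"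
        by (rule utri_row_sum[OF v]) (use False pq ed in auto)
      finally show ?thesis using False pq by (simp add: T_def stack_def)
    qed
    finally show "stack e d (v * A) (v * B) $$ (p, q) = (T * stack e d A B) $$ (p, q)" by simp
  qed (auto simp: T_def stack_def)
  ultimately show ?thesis using that T by blast
qed

lemma stack_right:
  assumes v: "utri v" and A: "A \<in> carrier_mat N N" and B: "B \<in> carrier_mat N N" and ed: "e + d \<le> N"
  shows "stack e d (A * v) (B * v) = stack e d A B * sel v Suc Suc (e + d)"
proof (rule eq_matI)
  fix p q assume "p < dim_row (stack e d A B * sel v Suc Suc (e + d))"
    "q < dim_col (stack e d A B * sel v Suc Suc (e + d))"
  then have pq: "p < e + d" "q < e + d" by (auto simp: sel_def stack_def)
  have s: "entry (M * v) i (Suc q) = (\<Sum>r<e + d. entry M i (Suc r) * entry v (Suc r) (Suc q))"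
    if "M \<in> carrier_mat N N" "i \<in> {1..N}" for M i
  proof -
    have "entry (M * v) i (Suc q) = (\<Sum>r = 1..N. entry M i r * entry v r (Suc q))"
      using that pq ed by (simp add: entry_mult[OF _ utri_carrier[OF v]])
    also have "\<dots> = (\<Sum>r\<in>{1..e + d}. entry M i r * entry v r (Suc q))"
      by (rule sum.mono_neutral_right) (use pq ed utriD[OF v] in auto)
    also have "\<dots> = (\<Sum>r<e + d. entry M i (Suc r) * entry v (Suc r) (Suc q))"
      by (rule sum.reindex_bij_witness[of _ Suc "\<lambda>r. r - 1"]) auto
    finally show ?thesis .
  qed
  have "stack e d (A * v) (B * v) $$ (p, q) = (\<Sum>r<e + d. stack e d A B $$ (p, r) * entry v (Suc r) (Suc q))"
    using pq ed by (simp add: stack_def s A B)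
  then show "stack e d (A * v) (B * v) $$ (p, q) = (stack e d A B * sel v Suc Suc (e + d)) $$ (p, q)"
    using pq by (simp add: scalar_prod_def atLeast0LessThan stack_def sel_def)
qed (auto simp: sel_def stack_def)

lemma det_stack_invariant:
  assumes v: "utri v" "utri w" and A: "A \<in> carrier_mat N N" and B: "B \<in> carrier_mat N N" and ed: "e + d \<le> N"
  shows "det (stack e d (v * A * w) (v * B * w)) = det (stack e d A B)"
proof -
  obtain T where T: "T \<in> carrier_mat (e + d) (e + d)" "det T = 1"
    "stack e d (v * A) (v * B) = T * stack e d A B" using stack_left[OF v(1) A B ed] .
  have c: "v * A \<in> carrier_mat N N" "v * B \<in> carrier_mat N N"
    using A B utri_carrier[OF v(1)] by auto
  have "det (sel w Suc Suc (e + d)) = 1"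
    by (rule det_sel_unit[of N]) (use utriD[OF v(2)] ed in \<open>auto simp: strict_mono_on_def\<close>)
  moreover have "stack e d (v * A * w) (v * B * w) = (T * stack e d A B) * sel w Suc Suc (e + d)"
    unfolding stack_right[OF v(2) c ed] T(3) ..
  ultimately show ?thesis
    using T(1,2) det_mult[OF mult_carrier_mat[OF T(1) stack_carrier] sel_carrier, of A B w Suc Suc]
      det_mult[OF T(1) stack_carrier, of A B] by simp
qed

lemma adj_conj:
  assumes v: "v \<in> G" and y: "y \<in> G"
  shows "adj_mat (v * y * ginv v) = v * adj_mat y * ginv v"
proof -
  define x where "x = v * y * ginv v"
  have x: "x \<in> G" unfolding x_def by (intro G_mult G_ginv v y)
  note c = G_carrier[OF v] G_carrier[OF y] G_carrier[OF x] ginv_carrier[of v] ginv_carrier[of x]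
    adj_mat(1)[OF G_carrier[OF y]] adj_mat(1)[OF G_carrier[OF x]]
  note as = assoc_mult_mat[of _ N N _ N _ N]
  have dv: "det v * det (ginv v) = 1"
    using det_mult[OF c(1,4)] ginv_right[OF v] by simp
  have dx: "det x = det y"
  proof -
    have "det x = det v * det y * det (ginv v)"
      unfolding x_def using det_mult[OF mult_carrier_mat[OF c(1,2)] c(4)] det_mult[OF c(1,2)] by simp
    then show ?thesis using dv by (simp add: mult_ac)
  qed
  have "(v * adj_mat y * ginv v) * x = v * (adj_mat y * ((ginv v * v) * (y * ginv v)))"
    unfolding x_def using c by (simp add: as)
  also have "\<dots> = v * ((adj_mat y * y) * ginv v)" using c by (simp add: ginv_left[OF v] as)
  also have "\<dots> = det y \<cdot>\<^sub>m 1\<^sub>m N"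
    unfolding adj_mat(3)[OF c(2)] mult_smult_assoc_mat[OF one_carrier_mat c(4)] left_mult_one_mat[OF c(4)]
      mult_smult_distrib[OF c(1) c(4)] ginv_right[OF v] ..
  finally have "(v * adj_mat y * ginv v) * x = adj_mat x * x" unfolding adj_mat(3)[OF c(3)] dx .
  moreover have w: "v * adj_mat y * ginv v \<in> carrier_mat N N"
    by (rule mult_carrier_mat[OF mult_carrier_mat[OF c(1,6)] c(4)])
  ultimately have "(v * adj_mat y * ginv v) * (x * ginv x) = adj_mat x * (x * ginv x)"
    unfolding assoc_mult_mat[OF w c(3,5), symmetric] assoc_mult_mat[OF c(7,3,5), symmetric] by simp
  then show ?thesis
    unfolding ginv_right[OF x] right_mult_one_mat[OF w] right_mult_one_mat[OF c(7)] by (simp add: x_def)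
qed

text \<open>This is the invariance of \<open>J\<^sub>i\<^sub>j\<close> for \<open>i + j \<ge> N + 1\<close>; taking adjugates commutes with conjugation.\<close>

lemma mixed_minor_conj:
  assumes v: "v \<in> G" "utri v" and y: "y \<in> G" and ed: "e + d \<le> N"
  shows "mixed_minor e d (v * y * ginv v) = mixed_minor e d y"
  unfolding mixed_minor_def adj_conj[OF v(1) y]
  by (rule det_stack_invariant[OF v(2) utri_ginv[OF v(2)] G_carrier[OF y] adj_mat(1)[OF G_carrier[OF y]] ed])

text \<open>Deleting the first row and the last column leaves a stack again. So the coefficient of \<open>y\<^sub>i\<^sub>j\<close> in \<open>J\<^sub>i\<^sub>j\<close> is a
  mixed minor, too.\<close>

lemma stack_delete:
  assumes "Suc e \<le> N" shows "mat_delete (stack (Suc e) d A B) 0 (e + d) = stack e d A B"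
  unfolding mat_delete_def stack_def using assms
  by (intro eq_matI) (auto simp: Suc_diff_Suc)

lemma mixed_minor_regular: assumes "e + d \<le> N" shows "mixed_minor e d \<in> regular_funs N"
proof -
  have a: "(\<lambda>x. entry (adj_mat x) i j) \<in> regular_funs N" if "i \<in> {1..N}" "j \<in> {1..N}" for i j
    unfolding entry_def by (rule regular.adj_mat_entry[where n = N]) (use that in \<open>auto simp: regular_index\<close>)
  have "(\<lambda>x. stack e d x (adj_mat x) $$ (p, q)) \<in> regular_funs N" if "p < e + d" "q < e + d" for p q
    using that assms by (cases "p < e") (auto simp: stack_def intro!: regular_entry a)
  then show ?thesis unfolding mixed_minor_def by (intro regular.det[where n = "e + d"]) auto
qed

lemma image_shift: assumes "k \<le> N" shows "(\<lambda>p. N - k + 1 + p) ` {..<k} = {N - k + 1..N}"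
proof
  show "{N - k + 1..N} \<subseteq> (\<lambda>p. N - k + 1 + p) ` {..<k}"
  proof
    fix r assume "r \<in> {N - k + 1..N}"
    then show "r \<in> (\<lambda>p. N - k + 1 + p) ` {..<k}"
      using assms by (intro image_eqI[of _ _ "r - (N - k + 1)"]) auto
  qed
qed (use assms in auto)

lemma J_poly_lower:
  assumes A: "A \<in> carrier_mat N N" and ij: "i \<in> {1..N}" "j \<in> {1..N}" "i + j \<ge> Suc N"
  shows "J_poly N (i, j) A = mixed_minor (Suc N - i) (j - (Suc N - i)) A"
proof (cases "i + j = Suc N")
  case True
  then have j: "j = Suc N - i" "opp N j = i" using ij by (auto simp: opp_def)
  have rows: "{i} \<union> {opp N j + 1..N} = {i..N}" using j ij by auto
  have "minor A {i..N} {1..j} = det (sel A (\<lambda>p. i + p) Suc j)"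
  proof (rule minor_sel[OF A])
    show "(\<lambda>p. i + p) ` {..<j} = {i..N}"
      using image_shift[of j] j ij by simp
    show "Suc ` {..<j} = {1..j}" by (simp add: image_Suc_lessThan)
  qed (use ij in \<open>auto simp: strict_mono_on_def\<close>)
  also have "sel A (\<lambda>p. i + p) Suc j = stack j 0 A (adj_mat A)"
    unfolding sel_def stack_def using ij j(1) by (intro eq_matI) auto
  finally show ?thesis using rows True j by (simp add: J_poly_def mixed_minor_def)
next
  case False
  define e where "e = Suc N - i"
  define d where "d = j - e"
  have e: "opp N i = e" "e + d = j" "e \<le> N" "d \<le> N" using ij by (auto simp: opp_def e_def d_def)
  have s: "submat M {N - k + 1..N} {1..j} = mat k j (\<lambda>(p, q). entry M (N - k + 1 + p) (q + 1))"
    if M: "M \<in> carrier_mat N N" "k \<le> N" for M :: "'a mat" and k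
    by (subst submat_enum[OF M(1) _ image_shift[OF M(2)], where k = j and g = Suc])
      (use ij in \<open>auto simp: strict_mono_on_def image_Suc_lessThan\<close>)
  have "submat A {N - e + 1..N} {1..j} @\<^sub>r submat (adj_mat A) {N - d + 1..N} {1..j} = stack e d A (adj_mat A)"
    unfolding s[OF A e(3)] s[OF adj_mat(1)[OF A] e(4)] append_rows_def stack_def using e
    by (intro eq_matI) (auto simp: add.commute)
  then show ?thesis using False ij e unfolding J_poly_def mixed_minor_def
    by (simp add: e_def[symmetric] d_def[symmetric])
qed

lemma J_poly_upper:
  assumes A: "A \<in> carrier_mat N N" and ij: "i \<in> {1..N}" "j \<in> {1..N}" "i + j < Suc N"
  shows "J_poly N (i, j) A = det (sel A (\<lambda>p. if p = 0 then i else Suc N - j + p) Suc j)"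
proof -
  let ?f = "\<lambda>p. if p = 0 then i else Suc N - j + p"
  have "minor A ({i} \<union> {opp N j + 1..N}) {1..j} = det (sel A ?f Suc j)"
  proof (rule minor_sel[OF A])
    show "?f ` {..<j} = {i} \<union> {opp N j + 1..N}"
    proof
      show "{i} \<union> {opp N j + 1..N} \<subseteq> ?f ` {..<j}"
      proof
        fix r assume r: "r \<in> {i} \<union> {opp N j + 1..N}"
        show "r \<in> ?f ` {..<j}"
        proof (cases "r = i")
          case True then show ?thesis using ij by (intro image_eqI[of _ _ 0]) auto
        next
          case False
          then show ?thesis using r ij
            by (intro image_eqI[of _ _ "r - (Suc N - j)"]) (auto simp: opp_def)
        qed
      qed
    qed (use ij in \<open>auto simp: opp_def\<close>)
    show "Suc ` {..<j} = {1..j}" by (simp add: image_Suc_lessThan)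
  qed (use ij in \<open>auto simp: strict_mono_on_def opp_def\<close>)
  then show ?thesis using ij by (simp add: J_poly_def)
qed

end

text \<open>The number \<open>m\<close> is the total size of the blocks before the middle.\<close>

locale split_form = antidiagonal_form +
  fixes m :: nat and \<epsilon> :: 'a
  assumes m_le: "2 * m \<le> N"
    and \<epsilon>_cases: "sg = 1 \<Longrightarrow> \<epsilon> = 1 \<or> \<epsilon> = -1"
begin

abbreviation C where "C \<equiv> component \<epsilon>"

lemma C_G: "x \<in> C \<Longrightarrow> x \<in> G" by (simp add: component_def)

lemma C_carrier: "x \<in> C \<Longrightarrow> x \<in> carrier_mat N N" using C_G G_carrier by blast

definition mid :: "nat \<Rightarrow> bool" where "mid i \<longleftrightarrow> m < i \<and> i \<le> N - m"

text \<open>The pattern of the unipotent radical for the partition in which all blocks but the middle one are singletons.\<close>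

definition upat :: "'a mat \<Rightarrow> bool" where
  "upat v \<longleftrightarrow> (\<forall>i\<in>{1..N}. \<forall>r\<in>{1..N}. r \<le> i \<or> (mid i \<and> mid r) \<longrightarrow> entry v i r = (if i = r then 1 else 0))"

text \<open>The pattern of the second factor of the normal form.\<close>

definition zpat :: "'a mat \<Rightarrow> bool" where
  "zpat z \<longleftrightarrow> (\<forall>i\<in>{1..N}. \<forall>c\<in>{1..N}. i + c < Suc N \<and> \<not> (mid i \<and> mid c) \<longrightarrow> entry z i c = 0)"

lemma upatD: "upat v \<Longrightarrow> i \<in> {1..N} \<Longrightarrow> r \<in> {1..N} \<Longrightarrow> r \<le> i \<or> (mid i \<and> mid r) \<Longrightarrow>
    entry v i r = (if i = r then 1 else 0)"
  by (auto simp: upat_def)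

lemma zpatD: "zpat v \<Longrightarrow> i \<in> {1..N} \<Longrightarrow> r \<in> {1..N} \<Longrightarrow> i + r < Suc N \<Longrightarrow> \<not> (mid i \<and> mid r) \<Longrightarrow>
    entry v i r = 0"
  by (auto simp: zpat_def)

definition U1 :: "'a mat set" where "U1 = {v \<in> G. upat v}"

lemma U1_utri: "v \<in> U1 \<Longrightarrow> utri v" by (auto simp: U1_def utri_def upat_def G_carrier)

lemma mid_opp: "i \<in> {1..N} \<Longrightarrow> mid (Suc N - i) \<longleftrightarrow> mid i" by (auto simp: mid_def)

lemma U1_ginv: assumes v: "v \<in> U1" shows "ginv v \<in> U1"
proof -
  have "upat (ginv v)" unfolding upat_def
  proof (intro ballI impI)
    fix i r assume ir: "i \<in> {1..N}" "r \<in> {1..N}" "r \<le> i \<or> (mid i \<and> mid r)"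
    have "upat v" using v by (simp add: U1_def)
    then have "entry (ginv v) i r = s (Suc N - i) * s (Suc N - r) * (if Suc N - r = Suc N - i then 1 else 0)"
    proof -
      have "entry v (Suc N - r) (Suc N - i) = (if Suc N - r = Suc N - i then 1 else 0)"
        by (rule upatD[OF \<open>upat v\<close> opp_mem[OF ir(2)] opp_mem[OF ir(1)]])
          (use ir mid_opp[OF ir(1)] mid_opp[OF ir(2)] in auto)
      then show ?thesis using entry_ginv[OF ir(1,2)] by simp
    qed
    moreover have "Suc N - r = Suc N - i \<longleftrightarrow> i = r" using ir by auto
    ultimately show "entry (ginv v) i r = (if i = r then 1 else 0)"
      using s_sq[OF opp_mem[OF ir(1)]] by (cases "i = r") auto
  qed
  then show ?thesis using v by (auto simp: U1_def intro: G_ginv)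
qed

text \<open>For these pairs of rows the supports meet in at most one position, so part of the equations of \<open>G\<close> holds for every
  matrix with the pattern. The complementary pairs are covered by \<open>zpat_rows_form\<close>.\<close>

lemma upat_rows_form:
  assumes n: "upat n" and ik: "i \<in> {1..N}" "k \<in> {1..N}" "i + k \<ge> Suc N \<or> (mid i \<and> mid k)"
  shows "bf (entry n i) (entry n k) = (if k = Suc N - i then s i else 0)"
proof -
  have "bf (entry n i) (entry n k) = (\<Sum>p = 1..N. if p = i then (if k = Suc N - i then s i else 0) else 0)"
    unfolding bf_def
  proof (intro sum.cong refl)
    fix p assume p: "p \<in> {1..N}"
    show "s p * entry n i p * entry n k (Suc N - p) = (if p = i then if k = Suc N - i then s i else 0 else 0)"
    proof (cases "p = i")
      case True
      have "entry n k (Suc N - i) = (if k = Suc N - i then 1 else 0)"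
      proof -
        have "Suc N - i \<le> k \<or> (mid k \<and> mid (Suc N - i))" using ik mid_opp[OF ik(1)] by auto
        from upatD[OF n ik(2) opp_mem[OF ik(1)] this] show ?thesis .
      qed
      moreover have "entry n i i = 1" using upatD[OF n ik(1,1)] by simp
      ultimately show ?thesis using True by auto
    next
      case False
      have "entry n i p = 0 \<or> entry n k (Suc N - p) = 0"
      proof (rule ccontr)
        assume a: "\<not> (entry n i p = 0 \<or> entry n k (Suc N - p) = 0)"
        have "\<not> (p \<le> i \<or> (mid i \<and> mid p))"
        proof
          assume "p \<le> i \<or> (mid i \<and> mid p)"
          from upatD[OF n ik(1) p this] show False using a False by simp
        qed
        then have 1: "i < p" "\<not> (mid i \<and> mid p)" by auto
        have "Suc N - p = k \<or> (k < Suc N - p \<and> \<not> (mid k \<and> mid (Suc N - p)))"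
          using a upatD[OF n ik(2) opp_mem[OF p]] by (metis linorder_not_le)
        then show False using 1 ik p mid_opp[OF p] by (auto simp: mid_def)
      qed
      then show ?thesis using False by auto
    qed
  qed
  then show ?thesis using ik by simp
qed

lemma zpat_rows_form:
  assumes z: "zpat z" and ik: "i \<in> {1..N}" "k \<in> {1..N}" "i + k < Suc N" "\<not> (mid i \<and> mid k)"
  shows "bf (entry z i) (entry z k) = 0"
  unfolding bf_def
proof (intro sum.neutral ballI)
  fix p assume p: "p \<in> {1..N}"
  have "entry z i p = 0 \<or> entry z k (Suc N - p) = 0"
  proof (rule ccontr)
    assume a: "\<not> (entry z i p = 0 \<or> entry z k (Suc N - p) = 0)"
    have 1: "i + p \<ge> Suc N \<or> (mid i \<and> mid p)" using a zpatD[OF z ik(1) p] by fastforce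
    have 2: "k + (Suc N - p) \<ge> Suc N \<or> (mid k \<and> mid (Suc N - p))"
      using a zpatD[OF z ik(2) opp_mem[OF p]] by fastforce
    show False using 1 2 ik p m_le by (auto simp: mid_def)
  qed
  then show "s p * entry z i p * entry z k (Suc N - p) = 0" by auto
qed

text \<open>Cramer's rule for a row vector.\<close>

lemma solve_rows:
  assumes A: "A \<in> carrier_mat k k" "det A \<noteq> (0 :: 'a)"
  obtains c where "\<And>q. q < k \<Longrightarrow> (\<Sum>p<k. c p * A $$ (p, q)) = b q"
proof -
  define c where "c p = (\<Sum>r<k. b r * adj_mat A $$ (r, p)) / det A" for p
  have "(\<Sum>p<k. c p * A $$ (p, q)) = b q" if q: "q < k" for q
  proof -
    have 1: "(\<Sum>p<k. adj_mat A $$ (r, p) * A $$ (p, q)) = (if r = q then det A else 0)" if "r < k" for r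
    proof -
      have "(adj_mat A * A) $$ (r, q) = (\<Sum>p<k. adj_mat A $$ (r, p) * A $$ (p, q))"
        using A(1) adj_mat(1)[OF A(1)] q that by (auto simp: scalar_prod_def atLeast0LessThan)
      moreover have "(adj_mat A * A) $$ (r, q) = (if r = q then det A else 0)"
        unfolding adj_mat(3)[OF A(1)] using q that by simp
      ultimately show ?thesis by simp
    qed
    have "(\<Sum>p<k. c p * A $$ (p, q)) = (\<Sum>p<k. \<Sum>r<k. b r * (adj_mat A $$ (r, p) * A $$ (p, q))) / det A"
    proof -
      have "c p * A $$ (p, q) = (\<Sum>r<k. b r * (adj_mat A $$ (r, p) * A $$ (p, q))) / det A" for p
        by (simp add: c_def sum_distrib_right mult.assoc)
      then show ?thesis by (simp add: sum_divide_distrib)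
    qed
    also have "(\<Sum>p<k. \<Sum>r<k. b r * (adj_mat A $$ (r, p) * A $$ (p, q)))
        = (\<Sum>r<k. b r * (\<Sum>p<k. adj_mat A $$ (r, p) * A $$ (p, q)))"
      by (subst sum.swap) (simp add: sum_distrib_left)
    also have "\<dots> = (\<Sum>r<k. if r = q then b r * det A else 0)"
      by (intro sum.cong refl) (simp add: 1)
    also have "\<dots> = b q * det A" using q by simp
    finally show ?thesis using A(2) by simp
  qed
  then show ?thesis using that by blast
qed

text \<open>The corner minors that have to be invertible in the elimination. Rows in the middle only have to be cleared in the
  first \<open>m\<close> columns, therefore sizes strictly between \<open>m\<close> and \<open>N - m\<close> do not occur.\<close>

definition corner_sizes :: "nat set" where "corner_sizes = {1..m} \<union> {N - m..<N}"

text \<open>Row elimination from below: every row of \<open>x\<close> is corrected by lower rows so that \<open>z = n x\<close> has the required zeros; the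
  equations are solvable because the corner minors do not vanish. It remains to see that \<open>n\<close> is an isometry. A product of
  two rows of \<open>n\<close> is right by \<open>upat_rows_form\<close>, or else it equals the product of the same rows of \<open>z\<close>, since \<open>x\<close> is an
  isometry, and this is zero by \<open>zpat_rows_form\<close>.\<close>

lemma generic_decomposition:
  assumes x: "x \<in> G" and D: "\<And>r. r \<in> corner_sizes \<Longrightarrow> mixed_minor r 0 x \<noteq> 0"
  obtains v y where "v \<in> U1" "y \<in> G" "zpat y" "x = v * y * ginv v"
proof -
  \<comment> \<open>Row \<open>i\<close> is to vanish in its first \<open>M i\<close> columns, and the last \<open>M i\<close> rows serve to correct it.\<close>
  define M where "M i = (if mid i then m else N - i)" for i
  have M: "M i \<le> N - i" "M i \<le> N" if "i \<in> {1..N}" for i using that by (auto simp: M_def mid_def)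
  have det: "det (stack (M i) 0 x x) \<noteq> 0" if i: "i \<in> {1..N}" for i
  proof -
    have "stack (M i) 0 x x = stack (M i) 0 x (adj_mat x)" by (auto simp: stack_def)
    moreover have "mixed_minor (M i) 0 x \<noteq> 0"
    proof (cases "M i = 0")
      case True then show ?thesis using det_dim_zero[of "stack 0 0 x (adj_mat x)"] by (simp add: mixed_minor_def stack_def)
    next
      case False
      then have "M i \<in> corner_sizes" using i by (auto simp: M_def mid_def corner_sizes_def split: if_splits)
      then show ?thesis by (rule D)
    qed
    ultimately show ?thesis by (simp add: mixed_minor_def)
  qed
  have "\<exists>c. \<forall>q<M i. (\<Sum>p<M i. c p * stack (M i) 0 x x $$ (p, q)) = - entry x i (Suc q)"
    if i: "i \<in> {1..N}" for i
  proof -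
    obtain c where "\<And>q. q < M i \<Longrightarrow> (\<Sum>p<M i. c p * stack (M i) 0 x x $$ (p, q)) = - entry x i (Suc q)"
      using solve_rows[of "stack (M i) 0 x x" "M i" "\<lambda>q. - entry x i (Suc q)"] det[OF i] stack_carrier[of "M i" 0 x x]
      by auto
    then show ?thesis by blast
  qed
  then obtain c where c: "\<And>i q. i \<in> {1..N} \<Longrightarrow> q < M i \<Longrightarrow>
      (\<Sum>p<M i. c i p * stack (M i) 0 x x $$ (p, q)) = - entry x i (Suc q)" by metis
  define n where "n = mat1 N (\<lambda>i r. if r = i then 1 else if r > N - M i then c i (r - (N - M i + 1)) else 0)"
  have nc: "n \<in> carrier_mat N N" by (simp add: n_def)
  have n: "upat n" unfolding upat_def
  proof (intro ballI impI)
    fix i r assume ir: "i \<in> {1..N}" "r \<in> {1..N}" "r \<le> i \<or> mid i \<and> mid r"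
    have "\<not> r > N - M i" if "i \<noteq> r" using ir that m_le by (auto simp: M_def mid_def)
    then show "entry n i r = (if i = r then 1 else 0)" using ir by (auto simp: n_def)
  qed
  define z where "z = n * x"
  have z: "zpat z" unfolding zpat_def
  proof (intro ballI impI)
    fix i k assume ik: "i \<in> {1..N}" "k \<in> {1..N}" "i + k < Suc N \<and> \<not> (mid i \<and> mid k)"
    have k: "k - 1 < M i" using ik by (auto simp: M_def mid_def)
    have "entry z i k = (\<Sum>r = 1..N. entry n i r * entry x r k)"
      unfolding z_def by (rule entry_mult[OF nc G_carrier[OF x] ik(1,2)])
    also have "\<dots> = (\<Sum>r = 1..N. (if r = i then entry x i k else 0) +
        (if r > N - M i then c i (r - (N - M i + 1)) * entry x r k else 0))"
      by (intro sum.cong refl) (use ik M[OF ik(1)] in \<open>auto simp: n_def\<close>)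
    also have "\<dots> = entry x i k + (\<Sum>r = 1..N. if r > N - M i then c i (r - (N - M i + 1)) * entry x r k else 0)"
      unfolding sum.distrib using ik by simp
    also have "(\<Sum>r = 1..N. if r > N - M i then c i (r - (N - M i + 1)) * entry x r k else 0)
        = (\<Sum>r\<in>{N - M i + 1..N}. c i (r - (N - M i + 1)) * entry x r k)"
      by (rule sum.mono_neutral_cong_right) auto
    also have "\<dots> = (\<Sum>p<M i. c i p * entry x (N - M i + 1 + p) k)"
      by (rule sum.reindex_bij_witness[of _ "\<lambda>p. N - M i + 1 + p" "\<lambda>r. r - (N - M i + 1)"])
         (use M[OF ik(1)] in auto)
    also have "\<dots> = (\<Sum>p<M i. c i p * stack (M i) 0 x x $$ (p, k - 1))"
      by (intro sum.cong refl) (use k ik in \<open>auto simp: stack_def\<close>)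
    also have "\<dots> = - entry x i k" using c[OF ik(1) k] ik by simp
    finally show "entry z i k = 0" by simp
  qed
  have nG: "n \<in> G"
  proof -
    have "bf (entry n i) (entry n k) = (if k = Suc N - i then s i else 0)" if ik: "i \<in> {1..N}" "k \<in> {1..N}" for i k
    proof (cases "i + k \<ge> Suc N \<or> (mid i \<and> mid k)")
      case True then show ?thesis by (rule upat_rows_form[OF n ik])
    next
      case False
      have "bf (entry n i) (entry n k) = bf (vmul (entry n i) x) (vmul (entry n k) x)"
        by (simp add: bf_vmul[OF x])
      also have "\<dots> = bf (entry z i) (entry z k)"
        by (rule bf_cong) (use ik in \<open>simp_all add: z_def entry_mult_vmul[OF nc G_carrier[OF x]]\<close>)
      also have "\<dots> = 0" using zpat_rows_form[OF z ik] False by simp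
      finally show ?thesis using False ik by auto
    qed
    then show ?thesis using nc by (simp add: G_def)
  qed
  have nU: "n \<in> U1" using n nG by (simp add: U1_def)
  define y where "y = z * ginv n"
  have yG: "y \<in> G" unfolding y_def z_def by (intro G_mult G_ginv nG x)
  have y: "zpat y" unfolding zpat_def
  proof (intro ballI impI)
    fix i k assume ik: "i \<in> {1..N}" "k \<in> {1..N}" "i + k < Suc N \<and> \<not> (mid i \<and> mid k)"
    have zc: "z \<in> carrier_mat N N" using nc G_carrier[OF x] by (simp add: z_def)
    have "entry y i k = (\<Sum>p = 1..N. entry z i p * entry (ginv n) p k)"
      unfolding y_def by (rule entry_mult[OF zc ginv_carrier ik(1,2)])
    also have "\<dots> = 0"
    proof (intro sum.neutral ballI)
      fix p assume p: "p \<in> {1..N}"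
      have up: "upat (ginv n)" using U1_ginv[OF nU] by (simp add: U1_def)
      show "entry z i p * entry (ginv n) p k = 0"
      proof (rule ccontr)
        assume a: "entry z i p * entry (ginv n) p k \<noteq> 0"
        have 1: "i + p \<ge> Suc N \<or> (mid i \<and> mid p)" using a zpatD[OF z ik(1) p] by fastforce
        have 2: "p = k \<or> (p < k \<and> \<not> (mid p \<and> mid k))"
          using a upatD[OF up p ik(2)] by (metis linorder_not_le mult_zero_right)
        show False using 1 2 ik p m_le by (auto simp: mid_def)
      qed
    qed
    finally show "entry y i k = 0" .
  qed
  have "x = ginv n * y * ginv (ginv n)"
  proof -
    note c = nc G_carrier[OF x] ginv_carrier[of n]
    have "ginv n * y * ginv (ginv n) = ginv n * (n * x * ginv n) * n"
      by (simp add: ginv_ginv[OF nG] y_def z_def)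
    also have "\<dots> = (ginv n * n) * x * (ginv n * n)"
      using c mult_carrier_mat[OF c(1,2)] mult_carrier_mat[OF c(3,1)] mult_carrier_mat[OF c(2,3)]
        mult_carrier_mat[OF mult_carrier_mat[OF c(1,2)] c(3)]
      by (simp add: assoc_mult_mat[of _ N N _ N _ N])
    also have "\<dots> = x" using c by (simp add: ginv_left[OF nG])
    finally show ?thesis by simp
  qed
  then show ?thesis using that[OF U1_ginv[OF nU] yG y] by blast
qed

end

section \<open>Curves that move one coordinate\<close>

text \<open>Reversing the columns makes the matrix diagonal.\<close>

lemma det_antidiagonal_nonzero:
  assumes A: "(A :: 'a::field mat) \<in> carrier_mat k k"
    and z: "\<And>p q. p < k \<Longrightarrow> q < k \<Longrightarrow> A $$ (p, q) \<noteq> 0 \<longleftrightarrow> p + q = k - 1"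
  shows "det A \<noteq> 0"
proof -
  define T where "T = (mat k k (\<lambda>(p, q). if p + q = k - 1 then 1 else 0) :: 'a mat)"
  have T: "T \<in> carrier_mat k k" by (simp add: T_def)
  have AT: "(A * T) $$ (p, q) = A $$ (p, k - 1 - q)" if "p < k" "q < k" for p q
  proof -
    have "(A * T) $$ (p, q) = (\<Sum>r<k. A $$ (p, r) * T $$ (r, q))"
      using that A T by (auto simp: scalar_prod_def atLeast0LessThan)
    also have "\<dots> = (\<Sum>r<k. if r = k - 1 - q then A $$ (p, r) else 0)"
      by (intro sum.cong refl) (use that in \<open>auto simp: T_def\<close>)
    finally show ?thesis using that by simp
  qed
  have ATc: "A * T \<in> carrier_mat k k" using A T by simp
  have "det (A * T) = prod_list (diag_mat (A * T))"
  proof (rule det_upper_triangular[OF _ ATc])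
    show "upper_triangular (A * T)"
    proof (rule upper_triangularI)
      fix i j assume ij: "j < i" "i < dim_row (A * T)"
      then have "i < k" "j < k" using A by auto
      moreover have "k - 1 - j < k" "i + (k - 1 - j) \<noteq> k - 1" using \<open>i < k\<close> ij by auto
      ultimately show "(A * T) $$ (i, j) = 0" using AT z[of i "k - 1 - j"] by simp
    qed
  qed
  also have "\<dots> = (\<Prod>i = 0..<k. (A * T) $$ (i, i))"
    using carrier_matD[OF ATc] by (auto simp: diag_mat_def prod.list_conv_set_nth)
  also have "\<dots> = (\<Prod>i = 0..<k. A $$ (i, k - 1 - i))"
    by (intro prod.cong refl AT) auto
  also have "\<dots> \<noteq> 0"
  proof -
    have "A $$ (i, k - 1 - i) \<noteq> 0" if "i < k" for i using z[of i "k - 1 - i"] that by simp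
    then show ?thesis by simp
  qed
  finally show ?thesis using det_mult[OF A T] by auto
qed

context split_form
begin

text \<open>The product of the rows \<open>i\<close> and \<open>i'\<close> of \<open>y\<close> has a single term.\<close>

lemma zpat_antidiagonal:
  assumes y: "y \<in> G" "zpat y" and i: "i \<in> {1..N}" "\<not> mid i"
  shows "entry y i (Suc N - i) \<noteq> 0"
proof -
  note i' = opp_mem[OF i(1)]
  have "s i = bf (entry y i) (entry y (Suc N - i))" by (simp only: G_rows[OF y(1) i(1) i'] if_True refl)
  also have "\<dots> = (\<Sum>p = 1..N. if p = Suc N - i then s p * entry y i p * entry y (Suc N - i) (Suc N - p) else 0)"
    unfolding bf_def
  proof (intro sum.cong refl)
    fix p assume p: "p \<in> {1..N}"
    have "entry y i p * entry y (Suc N - i) (Suc N - p) = 0" if "p \<noteq> Suc N - i"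
    proof (cases "p < Suc N - i")
      case True then show ?thesis using zpatD[OF y(2) i(1) p] i by auto
    next
      case False
      then have "Suc N - i + (Suc N - p) < Suc N" using i(1) p that by auto
      then show ?thesis using zpatD[OF y(2) i' opp_mem[OF p]] i mid_opp[OF i(1)] by auto
    qed
    then show "s p * entry y i p * entry y (Suc N - i) (Suc N - p) =
      (if p = Suc N - i then s p * entry y i p * entry y (Suc N - i) (Suc N - p) else 0)" by auto
  qed
  also have "\<dots> = s (Suc N - i) * entry y i (Suc N - i) * entry y (Suc N - i) (Suc N - (Suc N - i))"
    using i' by simp
  finally show ?thesis using s_nz[OF i(1)] by auto
qed

text \<open>Conjugation changes the chosen columns unitriangularly. On the rows, the first factor replaces row \<open>i\<close>
  by row \<open>j'\<close> of \<open>y\<close> with the entry \<open>(i, j')\<close> of \<open>v\<close> as coefficient, because the rows of \<open>y\<close> above row \<open>j'\<close> vanish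
  in the first \<open>j\<close> columns.\<close>

lemma J_upper_value:
  assumes v: "v \<in> U1" and y: "y \<in> G" "zpat y"
    and ij: "N - m < i" "i \<in> {1..N}" "j \<in> {1..N}" "i + j < Suc N"
  shows "J_poly N (i, j) (v * y * ginv v) = entry v i (Suc N - j) * mixed_minor j 0 y"
proof -
  define f where "f p = (if p = 0 then i else Suc N - j + p)" for p
  define h where "h p = Suc N - j + p" for p
  have vG: "v \<in> G" and ut: "utri v" and un: "utri (ginv v)"
    using v U1_utri U1_ginv by (auto simp: U1_def)
  note c = G_carrier[OF vG] G_carrier[OF y(1)] ginv_carrier[of v]
  have vy: "v * y \<in> carrier_mat N N" using c by simp
  have j: "j \<le> m" "j \<ge> 1" using ij by auto
  have x: "v * y * ginv v \<in> carrier_mat N N" by (rule mult_carrier_mat[OF vy c(3)])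
  have f: "f p \<in> {1..N}" "h p \<in> {1..N}" "Suc p \<in> {1..N}" if "p < j" for p
    using that ij by (auto simp: f_def h_def)
  have 1: "sel (v * y * ginv v) f Suc j = sel (v * y) f Suc j * sel (ginv v) Suc Suc j"
  proof (rule sel_mult_left[OF vy c(3)])
    fix p q r assume "p < j" "q < j" "r \<in> {1..N}" "r \<notin> Suc ` {..<j}"
    then have "Suc q < r" by (auto simp: image_Suc_lessThan)
    then show "entry (v * y) (f p) r * entry (ginv v) r (Suc q) = 0"
      using utriD[OF un \<open>r \<in> {1..N}\<close>, of "Suc q"] \<open>r \<in> {1..N}\<close> by simp
  qed (use f in auto)
  have 2: "sel (v * y) f Suc j = sel v f h j * sel y h Suc j"
  proof (rule sel_mult_left[OF c(1,2)])
    fix p q r assume pq: "p < j" "q < j" "r \<in> {1..N}" "r \<notin> h ` {..<j}"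
    have "h = (\<lambda>p. N - j + 1 + p)" using ij j by (auto simp: h_def)
    then have "h ` {..<j} = {N - j + 1..N}" using image_shift[of j] ij by simp
    also have "\<dots> = {Suc N - j..N}" using ij by (simp add: Suc_diff_le)
    finally have "h ` {..<j} = {Suc N - j..N}" .
    then have r: "r < Suc N - j" using pq by auto
    show "entry v (f p) r * entry y r (Suc q) = 0"
    proof (cases "p = 0")
      case True
      then show ?thesis using zpatD[OF y(2) pq(3), of "Suc q"] pq r j m_le by (auto simp: mid_def)
    next
      case False
      then have "r < f p" using r by (simp add: f_def)
      then show ?thesis using utriD[OF ut f(1)[OF pq(1)] pq(3)] by simp
    qed
  qed (use f in \<open>auto simp: inj_on_def h_def\<close>)
  have "det (sel v f h j) = sel v f h j $$ (0, 0)"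
  proof (rule det_upper_unit)
    show "sel v f h j $$ (p, q) = 0" if "q < p" "p < j" for p q
      using utriD[OF ut f(1) f(2), of p q] that by (simp add: sel_def) (simp add: f_def h_def)
    show "sel v f h j $$ (p, p) = 1" if "0 < p" "p < j" for p
      using utriD[OF ut f(1) f(2), of p p] that by (simp add: sel_def) (simp add: f_def h_def)
  qed (use j in auto)
  also have "\<dots> = entry v i (Suc N - j)" using j by (simp add: sel_def f_def h_def)
  finally have 3: "det (sel v f h j) = entry v i (Suc N - j)" .
  have 4: "det (sel (ginv v) Suc Suc j) = 1"
    by (rule det_sel_unit[of N]) (use utriD[OF un] f in \<open>auto simp: strict_mono_on_def\<close>)
  have 5: "sel y h Suc j = stack j 0 y (adj_mat y)"
    using ij by (intro eq_matI) (auto simp: sel_def stack_def h_def Suc_diff_le)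
  have "J_poly N (i, j) (v * y * ginv v) = det (sel (v * y * ginv v) f Suc j)"
    using J_poly_upper[OF x ij(2-4)] unfolding f_def[symmetric] .
  also have "\<dots> = entry v i (Suc N - j) * mixed_minor j 0 y"
    unfolding 1 2 using det_mult[OF mult_carrier_mat[OF sel_carrier sel_carrier] sel_carrier, of v f h j y h Suc "ginv v" Suc Suc]
      det_mult[OF sel_carrier sel_carrier, of v f h j y h Suc] 3 4 5 by (simp add: mixed_minor_def)
  finally show ?thesis .
qed

text \<open>The minor \<open>M\<^sub>a\<^sub>b\<close>, the numerator of \<open>P\<^sub>a\<^sub>b\<close>: the lower left corner of size \<open>m\<close> bordered by row \<open>a\<close> and
  column \<open>b\<close>, for middle indices \<open>a\<close> and \<open>b\<close>.\<close>

definition bordered_minor :: "nat \<Rightarrow> nat \<Rightarrow> 'a mat \<Rightarrow> 'a" where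
  "bordered_minor a b x = det (sel x (\<lambda>p. if p = 0 then a else N - m + p) (\<lambda>q. if q < m then Suc q else b) (Suc m))"

lemma bordered_minor_conj:
  assumes v: "v \<in> U1" and y: "y \<in> carrier_mat N N" and ab: "mid a" "mid b"
  shows "bordered_minor a b (v * y * ginv v) = bordered_minor a b y"
proof -
  define f where "f p = (if p = 0 then a else N - m + p)" for p
  define g where "g q = (if q < m then Suc q else b)" for q
  have vG: "v \<in> G" and nU: "ginv v \<in> U1"
    using v U1_ginv by (auto simp: U1_def)
  have up: "upat v" "upat (ginv v)" using v nU by (auto simp: U1_def)
  note c = G_carrier[OF vG] y ginv_carrier[of v]
  have vy: "v * y \<in> carrier_mat N N" using c by simp
  have fg: "f p \<in> {1..N}" "g p \<in> {1..N}" if "p < Suc m" for p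
    using that ab m_le by (auto simp: f_def g_def mid_def)
  have mono: "strict_mono_on {..<Suc m} f" "strict_mono_on {..<Suc m} g"
    using ab by (auto simp: strict_mono_on_def f_def g_def mid_def)
  have fim: "f ` {..<Suc m} = insert a {N - m + 1..N}"
  proof
    show "insert a {N - m + 1..N} \<subseteq> f ` {..<Suc m}"
    proof
      fix r assume "r \<in> insert a {N - m + 1..N}"
      then show "r \<in> f ` {..<Suc m}"
      proof (cases "r = a")
        case True then show ?thesis by (intro image_eqI[of _ _ 0]) (auto simp: f_def)
      next
        case False
        then show ?thesis using \<open>r \<in> insert a {N - m + 1..N}\<close> m_le
          by (intro image_eqI[of _ _ "r - (N - m)"]) (auto simp: f_def)
      qed
    qed
  qed (use ab m_le in \<open>auto simp: f_def mid_def\<close>)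
  have gim: "g ` {..<Suc m} = insert b {1..m}"
  proof
    show "insert b {1..m} \<subseteq> g ` {..<Suc m}"
    proof
      fix r assume "r \<in> insert b {1..m}"
      then show "r \<in> g ` {..<Suc m}"
      proof (cases "r = b")
        case True then show ?thesis by (intro image_eqI[of _ _ m]) (auto simp: g_def)
      next
        case False
        then show ?thesis using \<open>r \<in> insert b {1..m}\<close>
          by (intro image_eqI[of _ _ "r - 1"]) (auto simp: g_def)
      qed
    qed
  qed (auto simp: g_def)
  have 1: "sel (v * y) f g (Suc m) = sel v f f (Suc m) * sel y f g (Suc m)"
  proof (rule sel_mult_left[OF c(1,2)])
    fix p q r assume pq: "p < Suc m" "q < Suc m" "r \<in> {1..N}" "r \<notin> f ` {..<Suc m}"
    have r: "r \<noteq> a" "r \<le> N - m" using pq(3,4) unfolding fim by auto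
    have "r \<le> f p \<or> (mid (f p) \<and> mid r)" "f p \<noteq> r" using r ab by (auto simp: f_def mid_def)
    then show "entry v (f p) r * entry y r (g q) = 0"
      using upatD[OF up(1) fg(1)[OF pq(1)] pq(3)] by simp
  qed (use fg strict_mono_on_imp_inj_on[OF mono(1)] in auto)
  have 2: "sel (v * y * ginv v) f g (Suc m) = sel (v * y) f g (Suc m) * sel (ginv v) g g (Suc m)"
  proof (rule sel_mult_left[OF vy c(3)])
    fix p q r assume pq: "p < Suc m" "q < Suc m" "r \<in> {1..N}" "r \<notin> g ` {..<Suc m}"
    have r: "r \<noteq> b" "r > m" using pq(3,4) unfolding gim by auto
    have "g q \<le> r \<or> (mid r \<and> mid (g q))" "g q \<noteq> r" using r ab by (auto simp: g_def mid_def)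
    then show "entry (v * y) (f p) r * entry (ginv v) r (g q) = 0"
      using upatD[OF up(2) pq(3) fg(2)[OF pq(2)]] by simp
  qed (use fg strict_mono_on_imp_inj_on[OF mono(2)] in auto)
  have 3: "det (sel v f f (Suc m)) = 1" "det (sel (ginv v) g g (Suc m)) = 1"
    using fg mono utriD[OF U1_utri[OF v]] utriD[OF U1_utri[OF nU]]
    by (auto intro!: det_sel_unit[of N])
  show ?thesis
    unfolding bordered_minor_def f_def[symmetric] g_def[symmetric] 1 2
    using det_mult[OF mult_carrier_mat[OF sel_carrier sel_carrier] sel_carrier, of v f f "Suc m" y f g "ginv v" g g]
      det_mult[OF sel_carrier sel_carrier, of v f f "Suc m" y f g] 3 by simp
qed

lemma bordered_minor_value:
  assumes ab: "mid a" "mid b" and z: "\<And>q. q \<in> {1..m} \<Longrightarrow> entry y a q = 0"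
  shows "bordered_minor a b y = (-1) ^ m * entry y a b * mixed_minor m 0 y"
proof -
  let ?A = "sel y (\<lambda>p. if p = 0 then a else N - m + p) (\<lambda>q. if q < m then Suc q else b) (Suc m)"
  have "det ?A = (\<Sum>q<Suc m. ?A $$ (0, q) * cofactor ?A 0 q)"
    by (rule laplace_expansion_row) auto
  also have "\<dots> = entry y a b * cofactor ?A 0 m"
    using z by (simp add: sel_def)
  also have "mat_delete ?A 0 m = stack m 0 y (adj_mat y)"
    unfolding mat_delete_def by (intro eq_matI) (auto simp: sel_def stack_def)
  then have "cofactor ?A 0 m = (-1) ^ m * mixed_minor m 0 y" by (simp add: cofactor_def mixed_minor_def)
  finally show ?thesis by (simp add: bordered_minor_def mult_ac)
qed

text \<open>The pairs of \<open>S_circ\<close> on or below the antidiagonal.\<close>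

definition lower_pairs :: "(nat \<times> nat) set" where
  "lower_pairs = {(i, j). i \<in> {1..N} \<and> j \<in> {1..N} \<and> N - m < i \<and> i + j \<ge> Suc N \<and> (j < i \<or> (j = i \<and> sg = -1))}"

definition Jl :: "nat \<Rightarrow> nat \<Rightarrow> 'a mat \<Rightarrow> 'a" where
  "Jl i j = mixed_minor (Suc N - i) (j - (Suc N - i))"

text \<open>Up to sign the coefficient of \<open>x\<^sub>i\<^sub>j\<close> in the expansion of \<open>Jl i j\<close> along its first row.\<close>

definition Kl :: "nat \<Rightarrow> nat \<Rightarrow> 'a mat \<Rightarrow> 'a" where
  "Kl i j = mixed_minor (N - i) (j - (Suc N - i))"

text \<open>By \<open>adj_G\<close> the rows taken from the adjugate depend on columns before \<open>j\<close> only. So if \<open>y\<close> and \<open>y'\<close> agree there and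
  in column \<open>j\<close> below row \<open>i\<close>, the two determinants differ in one entry.\<close>

lemma Jl_change:
  assumes y: "y \<in> G" "y' \<in> G" "det y' = det y"
    and ij: "i \<in> {1..N}" "j \<in> {1..N}" "i + j \<ge> Suc N"
    and col: "\<And>r c. r \<in> {1..N} \<Longrightarrow> c \<in> {1..N} \<Longrightarrow> c < j \<Longrightarrow> entry y' r c = entry y r c"
    and row: "\<And>r. r \<in> {1..N} \<Longrightarrow> i < r \<Longrightarrow> entry y' r j = entry y r j"
  shows "Jl i j y' = Jl i j y + (-1) ^ (j - 1) * (entry y' i j - entry y i j) * Kl i j y"
proof -
  define e where "e = N - i"
  define d where "d = j - (Suc N - i)"
  have ed: "Suc N - i = Suc e" "e + d = j - 1" "Suc e + d = Suc (e + d)" "Suc e \<le> N" "e + d < N" "N - e = i" "N - Suc e + 1 = i"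
    using ij by (auto simp: e_def d_def)
  let ?A = "stack (Suc e) d y (adj_mat y)" and ?B = "stack (Suc e) d y' (adj_mat y')"
  have eq: "?A $$ (p, q) = ?B $$ (p, q)" if pq: "p \<le> e + d" "q \<le> e + d" "(p, q) \<noteq> (0, e + d)" for p q
  proof (cases "p < Suc e")
    case True
    have "entry y' (i + p) (q + 1) = entry y (i + p) (q + 1)"
    proof (cases "q + 1 = j")
      case True
      then have "0 < p" using pq ed by auto
      then show ?thesis using row[of "i + p"] True \<open>p < Suc e\<close> ij by (auto simp: e_def)
    next
      case False
      moreover have "q + 1 \<le> j" using pq(2) ed(2) ij(2) by auto
      moreover have "i + p \<in> {1..N}" using True ij(1) by (auto simp: e_def)
      ultimately show ?thesis using ij(2) by (intro col) auto
    qed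
    then show ?thesis using True pq ed by (simp add: stack_def)
  next
    case False
    define a where "a = N - d + 1 + (p - Suc e)"
    define r where "r = p - Suc e"
    have "r < d" "a = N - d + 1 + r" "d \<le> N" "d < j"
      using False pq(1) ed(2,5) ij(2) by (auto simp: a_def r_def)
    then have a: "a \<in> {1..N}" "Suc N - a < j" by auto
    have q: "q + 1 \<in> {1..N}" using pq(2) ed(5) by auto
    have "entry (adj_mat y') a (q + 1) = entry (adj_mat y) a (q + 1)"
      unfolding entry_adj[OF y(1) a(1) q] entry_adj[OF y(2) a(1) q] y(3)
      using col[OF opp_mem[OF q] opp_mem[OF a(1)] a(2)] by simp
    then show ?thesis using False pq by (simp add: stack_def a_def)
  qed
  have 1: "det ?A = det ?B + (-1) ^ (e + d) * (?A $$ (0, e + d) - ?B $$ (0, e + d)) * det (mat_delete ?A 0 (e + d))"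
    by (rule det_corner) (use eq stack_carrier[of "Suc e" d] in auto)
  have 2: "?A $$ (0, e + d) = entry y i j" "?B $$ (0, e + d) = entry y' i j"
    using ed ij by (auto simp: stack_def)
  have "Jl i j y = det ?A" "Jl i j y' = det ?B" "Kl i j y = det (stack e d y (adj_mat y))"
    by (simp_all add: Jl_def Kl_def mixed_minor_def ed(1) d_def e_def[symmetric])
  then show ?thesis using 1 unfolding 2 stack_delete[OF ed(4)] unfolding ed(2) by (simp add: algebra_simps)
qed

lemma det_C: "x \<in> C \<Longrightarrow> y \<in> C \<Longrightarrow> det x = det y"
proof (cases "sg = 1")
  case True then show "x \<in> C \<Longrightarrow> y \<in> C \<Longrightarrow> det x = det y" unfolding component_def by simp
next
  case False
  then have "sg = -1" using sg_cases by auto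
  then show "x \<in> C \<Longrightarrow> y \<in> C \<Longrightarrow> det x = det y" using det_alternating C_G by metis
qed

lemma det_conj: assumes "v \<in> G" "y \<in> carrier_mat N N" shows "det (v * y * ginv v) = det y"
proof -
  note c = G_carrier[OF assms(1)] assms(2) ginv_carrier[of v]
  have "det v * det (ginv v) = 1" using det_mult[OF c(1,3)] ginv_right[OF assms(1)] by simp
  moreover have "det (v * y * ginv v) = det v * det y * det (ginv v)"
    using det_mult[OF mult_carrier_mat[OF c(1,2)] c(3)] det_mult[OF c(1,2)] by simp
  ultimately show ?thesis by (simp add: mult_ac)
qed

lemma conj_C: "v \<in> G \<Longrightarrow> y \<in> C \<Longrightarrow> v * y * ginv v \<in> C"
  using det_conj[of v y] C_carrier[of y] by (auto simp: component_def intro!: G_mult G_ginv)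

lemma conj_C_iff: assumes "v \<in> G" "y \<in> G" shows "v * y * ginv v \<in> C \<longleftrightarrow> y \<in> C"
  using det_conj[OF assms(1) G_carrier[OF assms(2)]] assms G_mult G_ginv by (auto simp: component_def)

lemma rcurve_row_map_siegel:
  assumes y: "y \<in> carrier_mat N N"
  shows "rcurve {0} (\<lambda>t. row_map (siegel t a v) y)"
proof -
  have "(\<lambda>t. siegel t a v x q) \<in> rat_on {0}" for x q
    unfolding siegel_def power2_eq_square
    by (intro rat.diff rat.add rat.mult rat.const rat_ident rat_divide) auto
  then show ?thesis by (simp add: rcurve_def row_map_def)
qed

lemma finite_linear_zero: "finite {t :: 'a. 1 + t * c = 0}"
proof (cases "c = 0")
  case False
  have "{t. 1 + t * c = 0} \<subseteq> {- 1 / c}"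
    using False by (auto simp: field_simps eq_neg_iff_add_eq_0 add.commute)
  then show ?thesis by (rule finite_subset) simp
qed simp

text \<open>The curve is \<open>v y\<^sub>t v\<^sup>-\<^sup>1\<close>, where \<open>y\<^sub>t\<close> is the image of \<open>y\<close> under a Siegel transformation whose isotropic vector
  is row \<open>i'\<close> of \<open>y\<close>. This row starts at column \<open>i\<close> and is orthogonal to all rows but row \<open>i\<close>. Hence in the columns before
  \<open>i\<close> and in column \<open>j\<close> only the entry \<open>(i, j)\<close> changes. In particular the middle block of \<open>y\<close> stays the same, and
  with it the quotients \<open>bordered_minor a b / mixed_minor m 0\<close>.\<close>

lemma lower_move:
  assumes x: "x \<in> C" "x = v * y * ginv v" and v: "v \<in> U1" and y: "y \<in> G" "zpat y" and ij: "(i, j) \<in> lower_pairs"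
  obtains \<gamma> \<kappa> where "rcurve {0} \<gamma>" "\<gamma> 0 = x" "finite {t. \<gamma> t \<notin> C}" "\<kappa> \<noteq> 0"
    "\<And>t. \<gamma> t \<in> C \<Longrightarrow> Jl i j (\<gamma> t) = Jl i j x + t * \<kappa> * Kl i j x"
    "\<And>t p q. \<gamma> t \<in> C \<Longrightarrow> (p, q) \<in> lower_pairs \<Longrightarrow> q < j \<or> (q = j \<and> i < p) \<Longrightarrow> Jl p q (\<gamma> t) = Jl p q x"
    "\<And>t a b. mid a \<Longrightarrow> mid b \<Longrightarrow> \<gamma> t \<in> C \<Longrightarrow> bordered_minor a b (\<gamma> t) * mixed_minor m 0 x = bordered_minor a b x * mixed_minor m 0 (\<gamma> t)"
proof -
  have vG: "v \<in> G" and ut: "utri v" using v U1_utri by (auto simp: U1_def)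
  have ijN: "i \<in> {1..N}" "j \<in> {1..N}" "N - m < i" "i + j \<ge> Suc N" "j \<le> i" "j = i \<Longrightarrow> sg = -1"
    using ij by (auto simp: lower_pairs_def)
  have i': "Suc N - i \<in> {1..N}" "\<not> mid (Suc N - i)" "Suc N - i < i"
    using ijN m_le by (auto simp: mid_def)
  define a where "a = entry y (Suc N - i)"
  \<comment> \<open>For \<open>j = i\<close>, in the alternating case, the transvection along \<open>a\<close> takes the place of a proper Siegel transformation.\<close>
  define w where "w = (if j = i then a else unit j)"
  define c where "c = bf w a"
  define yt where "yt t = row_map (siegel t a w) y" for t
  define \<gamma> where "\<gamma> t = v * yt t * ginv v" for t
  define k0 where "k0 = (if j = i then 2 * s i * a i else s i)"
  have a_low: "a q = 0" if "q \<in> {1..N}" "q < i" for q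
    unfolding a_def using zpatD[OF y(2) i'(1) that(1)] that i' ijN by auto
  have ai: "a i \<noteq> 0" unfolding a_def using zpat_antidiagonal[OF y i'(1,2)] ijN by simp
  have k0: "k0 \<noteq> 0" using ai s_nz[OF ijN(1)] by (simp add: k0_def)
  have ra: "bf (entry y r) a = (if r = i then s i else 0)" if "r \<in> {1..N}" for r
    unfolding a_def G_rows[OF y(1) that i'(1)] using that ijN(1) by auto
  have aa: "bf a a = 0" unfolding a_def G_rows[OF y(1) i'(1) i'(1)] using i' ijN by auto
  have yt_entry: "entry (yt t) r q = entry y r q + (if r = i \<and> q = j then t * k0 else 0)"
    if rq: "r \<in> {1..N}" "q \<in> {1..N}" "q < i \<or> q \<le> j" for t r q
  proof (cases "j = i")
    case False
    then have "q < i" using rq ijN by auto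
    have "entry (yt t) r q = siegel t a w (entry y r) q" using rq by (simp add: yt_def row_map_def)
    also have "\<dots> = entry y r q + t * (if r = i then s i else 0) * unit j q"
      unfolding siegel_def ra[OF rq(1)] a_low[OF rq(2) \<open>q < i\<close>] using False by (simp add: w_def)
    finally show ?thesis using False by (auto simp: k0_def unit_def)
  next
    case True
    then have sg: "sg = -1" using ijN by simp
    have "entry (yt t) r q = siegel t a a (entry y r) q" using rq True by (simp add: yt_def row_map_def w_def)
    also have "\<dots> = entry y r q + 2 * t * (if r = i then s i else 0) * a q"
      unfolding siegel_def ra[OF rq(1)] aa by (simp add: sg algebra_simps)
    finally show ?thesis using True a_low[OF rq(2)] rq by (cases "q = i") (auto simp: k0_def)
  qed
  have ytG: "yt t \<in> G" if "1 + t * c \<noteq> 0" for t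
    unfolding yt_def by (rule row_map_G[OF siegel_isometry[OF aa] y(1)]) (use that in \<open>simp add: c_def\<close>)
  have ytc: "yt t \<in> carrier_mat N N" for t by (simp add: yt_def row_map_def)
  have ytG': "yt t \<in> G" if t: "\<gamma> t \<in> C" for t
  proof -
    note cc = G_carrier[OF vG] ytc[of t] ginv_carrier[of v]
    have "ginv v * \<gamma> t * v = (ginv v * v) * yt t * (ginv v * v)"
      unfolding \<gamma>_def using cc mult_carrier_mat[OF cc(1,2)] mult_carrier_mat[OF cc(3,1)] mult_carrier_mat[OF cc(2,3)]
        mult_carrier_mat[OF mult_carrier_mat[OF cc(1,2)] cc(3)]
      by (simp add: assoc_mult_mat[of _ N N _ N _ N])
    also have "\<dots> = yt t" using cc by (simp add: ginv_left[OF vG])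
    finally show ?thesis using G_mult[OF G_mult[OF G_ginv[OF vG] C_G[OF t]] vG] by simp
  qed
  have yC: "y \<in> C" using conj_C_iff[OF vG y(1)] x by simp
  have det: "det (yt t) = det y" if t: "\<gamma> t \<in> C" for t
    using det_C[OF _ yC] conj_C_iff[OF vG ytG'[OF t]] t by (simp add: \<gamma>_def)
  have y0: "yt 0 = y"
    by (rule mat_eqI[where N = N]) (auto simp: G_carrier[OF y(1)] yt_def row_map_def siegel_def)
  have rc: "rcurve {0} \<gamma>"
    unfolding \<gamma>_def yt_def using vG y(1) by (intro rcurve_mult rcurve_const rcurve_row_map_siegel G_carrier ginv_carrier)
  have "{t. \<gamma> t \<notin> G} \<subseteq> {t. 1 + t * c = 0}"
    using ytG vG by (auto simp: \<gamma>_def intro!: G_mult G_ginv)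
  then have "finite {t. \<gamma> t \<notin> G}" using finite_linear_zero by (rule finite_subset)
  then have fin: "finite {t. \<gamma> t \<notin> C}"
    by (rule rcurve_stays_in_component[OF rc _, where ?t0.0 = 0]) (use x y0 \<epsilon>_cases in \<open>auto simp: \<gamma>_def\<close>)
  have J: "Jl p q (\<gamma> t) = Jl p q (yt t)" "Jl p q x = Jl p q y" if "\<gamma> t \<in> C" "(p, q) \<in> lower_pairs" for t p q
  proof -
    have "(Suc N - p) + (q - (Suc N - p)) \<le> N" using that(2) by (auto simp: lower_pairs_def)
    then show "Jl p q (\<gamma> t) = Jl p q (yt t)" "Jl p q x = Jl p q y"
      unfolding Jl_def \<gamma>_def x(2) using mixed_minor_conj[OF vG ut] ytG'[OF that(1)] y(1) by auto
  qed
  have K: "Kl i j x = Kl i j y"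
    unfolding Kl_def x(2) by (rule mixed_minor_conj[OF vG ut y(1)]) (use ijN in auto)
  have 1: "Jl i j (\<gamma> t) = Jl i j x + t * ((-1) ^ (j - 1) * k0) * Kl i j x" if t: "\<gamma> t \<in> C" for t
  proof -
    have "Jl i j (yt t) = Jl i j y + (-1) ^ (j - 1) * (entry (yt t) i j - entry y i j) * Kl i j y"
      by (rule Jl_change[OF y(1) ytG'[OF t] det[OF t] ijN(1,2,4)]) (use yt_entry ijN in auto)
    then show ?thesis using J[OF t ij] K yt_entry[of i j t] ijN by (simp add: mult_ac)
  qed
  have 2: "Jl p q (\<gamma> t) = Jl p q x" if t: "\<gamma> t \<in> C" and pq: "(p, q) \<in> lower_pairs" "q < j \<or> (q = j \<and> i < p)" for t p q
  proof -
    have pqN: "p \<in> {1..N}" "q \<in> {1..N}" "p + q \<ge> Suc N" using pq by (auto simp: lower_pairs_def)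
    have "Jl p q (yt t) = Jl p q y + (-1) ^ (q - 1) * (entry (yt t) p q - entry y p q) * Kl p q y"
      by (rule Jl_change[OF y(1) ytG'[OF t] det[OF t] pqN]) (use yt_entry pq pqN in auto)
    then show ?thesis using J[OF t pq(1)] yt_entry[of p q t] pq pqN by auto
  qed
  have 3: "bordered_minor a b (\<gamma> t) * mixed_minor m 0 x = bordered_minor a b x * mixed_minor m 0 (\<gamma> t)" if ab: "mid a" "mid b" and t: "\<gamma> t \<in> C" for a b t
  proof -
    have abN: "a \<in> {1..N}" "b \<in> {1..N}" "a \<noteq> i" "b < i" using ab ijN by (auto simp: mid_def)
    have D: "mixed_minor m 0 (\<gamma> t) = mixed_minor m 0 (yt t)" "mixed_minor m 0 x = mixed_minor m 0 y"
      unfolding \<gamma>_def x(2) using mixed_minor_conj[OF vG ut _, of _ m 0] ytG'[OF t] y(1) m_le by auto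
    have z: "entry y a q = 0" if "q \<in> {1..m}" for q
      using zpatD[OF y(2) abN(1), of q] that ab m_le by (auto simp: mid_def)
    have zt: "entry (yt t) a q = 0" if "q \<in> {1..m}" for q
      using yt_entry[OF abN(1), of q t] z[OF that] that abN ijN m_le by auto
    have "bordered_minor a b (yt t) = (-1) ^ m * entry (yt t) a b * mixed_minor m 0 (yt t)" by (rule bordered_minor_value[OF ab zt])
    then have "bordered_minor a b (\<gamma> t) = (-1) ^ m * entry y a b * mixed_minor m 0 (yt t)"
      unfolding \<gamma>_def bordered_minor_conj[OF v ytc ab] using yt_entry[OF abN(1,2), of t] abN by simp
    moreover have "bordered_minor a b x = (-1) ^ m * entry y a b * mixed_minor m 0 y"
      unfolding x(2) bordered_minor_conj[OF v G_carrier[OF y(1)] ab] by (rule bordered_minor_value[OF ab z])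
    ultimately show ?thesis unfolding D by simp
  qed
  show ?thesis
    by (rule that[OF rc _ fin _ 1 2 3]) (use y0 x k0 in \<open>auto simp: \<gamma>_def\<close>)
qed

text \<open>Here \<open>v\<close> is multiplied by the root element of \<open>G\<close> that adds column \<open>i\<close> to column \<open>j'\<close> and, dually, column
  \<open>j\<close> to column \<open>i'\<close>. Since \<open>y\<close> stays the same, mixed minors and middle quotients do not change.\<close>

lemma upper_move:
  assumes x: "x \<in> C" "x = v * y * ginv v" and v: "v \<in> U1" and y: "y \<in> G" "zpat y"
    and ij: "N - m < i" "i \<in> {1..N}" "j \<in> {1..N}" "i + j < Suc N"
  obtains \<gamma> \<kappa> where "rcurve {0} \<gamma>" "\<gamma> 0 = x" "\<And>t. \<gamma> t \<in> C" "\<kappa> \<noteq> 0"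
    "\<And>t. J_poly N (i, j) (\<gamma> t) = J_poly N (i, j) x + t * \<kappa> * mixed_minor j 0 x"
    "\<And>t p q. N - m < p \<Longrightarrow> p \<in> {1..N} \<Longrightarrow> q \<in> {1..N} \<Longrightarrow> p + q < Suc N \<Longrightarrow>
      q < j \<or> (q = j \<and> i < p) \<Longrightarrow> J_poly N (p, q) (\<gamma> t) = J_poly N (p, q) x"
    "\<And>t p q. (p, q) \<in> lower_pairs \<Longrightarrow> Jl p q (\<gamma> t) = Jl p q x"
    "\<And>t a b. mid a \<Longrightarrow> mid b \<Longrightarrow> bordered_minor a b (\<gamma> t) * mixed_minor m 0 x = bordered_minor a b x * mixed_minor m 0 (\<gamma> t)"
proof -
  define i' where "i' = Suc N - i"
  define j' where "j' = Suc N - j"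
  have N: "i' \<in> {1..N}" "j' \<in> {1..N}" "Suc N - i' = i" "Suc N - j' = j" "i < j'" "j < i'" "i' \<le> m" "j' > N - m"
    "i' \<noteq> i" "j' \<noteq> j" "i' < j'"
    using ij m_le by (auto simp: i'_def j'_def)
  define h where "h t = lmat (siegel t (unit i') (unit j'))" for t
  have z: "bf (unit i') (unit i') = 0" "bf (unit j') (unit i') = 0" "bf (unit j') (unit j') = 0"
    using N by (auto simp: unit_rows)
  have hG: "h t \<in> G" for t unfolding h_def by (rule lmat_G[OF siegel_isometry]) (use z in auto)
  have sg: "siegel t (unit i') (unit j') x q = x q + t * (s i * x i) * unit j' q - sg * t * (s j * x j) * unit i' q" for t x q
    unfolding siegel_def z unfolding bf_unit_right[OF N(1)] bf_unit_right[OF N(2)] N(3,4) by simp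
  have h_entry: "entry (h t) r q = unit r q + t * (s i * unit r i) * unit j' q - sg * t * (s j * unit r j) * unit i' q"
    if "r \<in> {1..N}" "q \<in> {1..N}" for t r q
    using that by (simp add: h_def lmat_def sg)
  have hU: "h t \<in> U1" for t
    using hG N m_le by (auto simp: U1_def upat_def h_entry unit_def mid_def)
  define V where "V t = v * h t" for t
  have vG: "v \<in> G" using v by (simp add: U1_def)
  note c = G_carrier[OF vG] G_carrier[OF hG]
  have V_entry: "entry (V t) r q = entry v r q + t * (s i * entry v r i) * unit j' q - sg * t * (s j * entry v r j) * unit i' q"
    if "r \<in> {1..N}" "q \<in> {1..N}" for t r q
    unfolding V_def entry_mult_vmul[OF c that] unfolding h_def vmul_lmat_siegel[OF that(2)] by (rule sg)
  have VG: "V t \<in> G" for t unfolding V_def by (intro G_mult vG hG)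
  have VU: "V t \<in> U1" for t
  proof -
    have "upat (V t)" unfolding upat_def
    proof (intro ballI impI)
      fix r q assume rq: "r \<in> {1..N}" "q \<in> {1..N}" "q \<le> r \<or> mid r \<and> mid q"
      have up: "upat v" using v by (simp add: U1_def)
      have "q = j' \<Longrightarrow> entry v r i = 0" "q = i' \<Longrightarrow> entry v r j = 0"
        using rq N ij upatD[OF up rq(1), of i] upatD[OF up rq(1), of j] by (auto simp: mid_def)
      then have "entry (V t) r q = entry v r q" unfolding V_entry[OF rq(1,2)] by (auto simp: unit_def)
      then show "entry (V t) r q = (if r = q then 1 else 0)" using upatD[OF up rq] by simp
    qed
    then show ?thesis using VG by (simp add: U1_def)
  qed
  define \<gamma> where "\<gamma> t = V t * y * ginv (V t)" for t
  have V0: "V 0 = v"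
    by (rule mat_eqI[where N = N]) (auto simp: V_entry G_carrier VG vG)
  have g0: "\<gamma> 0 = x" using x V0 by (simp add: \<gamma>_def)
  have yC: "y \<in> C" using conj_C_iff[OF vG y(1)] x by simp
  have gC: "\<gamma> t \<in> C" for t unfolding \<gamma>_def by (rule conj_C[OF VG yC])
  have rV: "(\<lambda>t. entry (V t) r q) \<in> rat_on {0}" if "r \<in> {1..N}" "q \<in> {1..N}" for r q
    unfolding V_entry[OF that] by (intro rat.diff rat.add rat.mult rat.const rat_ident)
  have "rcurve {0} V" using rV G_carrier[OF VG] by (simp add: rcurve_def)
  moreover have "rcurve {0} (\<lambda>t. ginv (V t))"
    unfolding rcurve_def by (auto simp: entry_ginv intro!: rat.mult rat.const rV)
  ultimately have rc: "rcurve {0} \<gamma>"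
    unfolding \<gamma>_def using y by (intro rcurve_mult rcurve_const G_carrier)
  have J: "J_poly N (p, q) (\<gamma> t) = entry (V t) p (Suc N - q) * mixed_minor q 0 y"
     "J_poly N (p, q) x = entry v p (Suc N - q) * mixed_minor q 0 y"
    if "N - m < p" "p \<in> {1..N}" "q \<in> {1..N}" "p + q < Suc N" for p q t
    unfolding \<gamma>_def x(2) using J_upper_value[OF VU y that] J_upper_value[OF v y that] by auto
  have Dx: "mixed_minor j 0 x = mixed_minor j 0 y" unfolding x(2) using mixed_minor_conj[OF vG U1_utri[OF v] y(1)] ij by simp
  have vip: "entry v p i = (if p = i then 1 else 0)" "entry v p j = 0" if "p \<in> {1..N}" "i \<le> p" for p
    using utriD[OF U1_utri[OF v] that(1)] that ij N by auto
  have 1: "J_poly N (i, j) (\<gamma> t) = J_poly N (i, j) x + t * s i * mixed_minor j 0 x" for t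
    unfolding J[OF ij] V_entry[OF ij(2) opp_mem[OF ij(3)]] Dx
    using vip[OF ij(2)] N by (simp add: unit_def j'_def algebra_simps)
  have 2: "J_poly N (p, q) (\<gamma> t) = J_poly N (p, q) x"
    if pq: "N - m < p" "p \<in> {1..N}" "q \<in> {1..N}" "p + q < Suc N" "q < j \<or> (q = j \<and> i < p)" for t p q
  proof -
    have "Suc N - q = j' \<longleftrightarrow> q = j" using pq ij by (auto simp: j'_def)
    moreover have "entry v p j = 0" using utriD[OF U1_utri[OF v] pq(2) ij(3)] pq ij m_le by auto
    moreover have "q = j \<Longrightarrow> entry v p i = 0" using vip(1)[OF pq(2)] pq(5) by auto
    ultimately show ?thesis
      unfolding J[OF pq(1-4)] V_entry[OF pq(2) opp_mem[OF pq(3)]] by (auto simp: unit_def)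
  qed
  have D: "mixed_minor e d (\<gamma> t) = mixed_minor e d x" if "e + d \<le> N" for e d t
    unfolding \<gamma>_def x(2) using mixed_minor_conj[OF VG U1_utri[OF VU] y(1) that] mixed_minor_conj[OF vG U1_utri[OF v] y(1) that] by simp
  have 3: "Jl p q (\<gamma> t) = Jl p q x" if "(p, q) \<in> lower_pairs" for t p q
    unfolding Jl_def by (rule D) (use that in \<open>auto simp: lower_pairs_def\<close>)
  have 4: "bordered_minor a b (\<gamma> t) * mixed_minor m 0 x = bordered_minor a b x * mixed_minor m 0 (\<gamma> t)" if ab: "mid a" "mid b" for a b t
  proof -
    have "bordered_minor a b (\<gamma> t) = bordered_minor a b x"
      unfolding \<gamma>_def x(2) bordered_minor_conj[OF VU G_carrier[OF y(1)] ab] bordered_minor_conj[OF v G_carrier[OF y(1)] ab] ..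
    then show ?thesis using D[of m 0] m_le by simp
  qed
  show ?thesis by (rule that[OF rc g0 gC s_nz[OF ij(2)] 1 2 3 4])
qed

end

section \<open>Generic points\<close>

text \<open>A multiple of the matrix of the form lies in the chosen component. For the even orthogonal groups this is what
  determines the component.\<close>

locale generic_form = split_form +
  assumes C_nonempty: "C \<noteq> {}"
    and antidiagonal_element: "m \<ge> 1 \<Longrightarrow> \<exists>w\<in>C. \<exists>c. c \<noteq> 0 \<and>
      (\<forall>i\<in>{1..N}. \<forall>k\<in>{1..N}. entry w i k = (if k = Suc N - i then c * s i else 0))"
begin

lemma common_nonzero:
  assumes "finite F" "\<And>f. f \<in> F \<Longrightarrow> f \<in> regular_funs N" "\<And>f. f \<in> F \<Longrightarrow> \<exists>x\<in>C. f x \<noteq> 0"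
  shows "\<exists>x\<in>C. \<forall>f\<in>F. f x \<noteq> 0"
proof -
  have "\<exists>x\<in>C. (\<Prod>f\<in>F. f x) \<noteq> 0"
    using assms
  proof (induction F rule: finite_induct)
    case empty then show ?case using C_nonempty by auto
  next
    case (insert f F)
    obtain x y where x: "x \<in> C" "f x \<noteq> 0" and y: "y \<in> C" "(\<Prod>f\<in>F. f y) \<noteq> 0"
      using insert.IH insert.prems by blast
    have "(\<lambda>x. \<Prod>f\<in>F. f x) \<in> regular_funs N" using insert.prems by (intro regular.prod) auto
    then obtain z where "z \<in> C" "f z \<noteq> 0" "(\<Prod>f\<in>F. f z) \<noteq> 0"
      using component_irreducible[where f = f and g = "\<lambda>x. \<Prod>f\<in>F. f x" and x = x and y = y, OF _ _ \<epsilon>_cases x y]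
        insert.prems(1) by auto
    then show ?case using insert.hyps by auto
  qed
  then show ?thesis using assms(1) by auto
qed

lemma mixed_minor_antidiagonal:
  assumes w: "w \<in> C" "c \<noteq> 0"
    "\<And>i k. i \<in> {1..N} \<Longrightarrow> k \<in> {1..N} \<Longrightarrow> entry w i k = (if k = Suc N - i then c * s i else 0)"
    and r: "r \<le> N"
  shows "mixed_minor r 0 w \<noteq> 0" "mixed_minor 0 r w \<noteq> 0"
proof -
  have dw: "det w \<noteq> 0" using det_sq[OF C_G[OF w(1)]] by auto
  show "mixed_minor r 0 w \<noteq> 0"
    unfolding mixed_minor_def
  proof (rule det_antidiagonal_nonzero)
    show "stack r 0 w (adj_mat w) \<in> carrier_mat r r" using stack_carrier[of r 0] by simp
    fix p q assume pq: "p < r" "q < r"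
    then have i: "N - r + 1 + p \<in> {1..N}" "q + 1 \<in> {1..N}" using r by auto
    show "(stack r 0 w (adj_mat w) $$ (p, q) \<noteq> 0) = (p + q = r - 1)"
      using pq r w(2) s_nz[OF i(1)] w(3)[OF i] by (auto simp: stack_def)
  qed
  show "mixed_minor 0 r w \<noteq> 0"
    unfolding mixed_minor_def
  proof (rule det_antidiagonal_nonzero)
    show "stack 0 r w (adj_mat w) \<in> carrier_mat r r" using stack_carrier[of 0 r] by simp
    fix p q assume pq: "p < r" "q < r"
    then have i: "N - r + 1 + p \<in> {1..N}" "q + 1 \<in> {1..N}" using r by auto
    have "entry (adj_mat w) (N - r + 1 + p) (q + 1) \<noteq> 0 \<longleftrightarrow> Suc N - (N - r + 1 + p) = Suc N - (Suc N - (q + 1))"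
      unfolding entry_adj[OF C_G[OF w(1)] i] w(3)[OF opp_mem[OF i(2)] opp_mem[OF i(1)]]
      using dw w(2) s_nz[OF opp_mem[OF i(1)]] s_nz[OF opp_mem[OF i(2)]] by simp
    then show "(stack 0 r w (adj_mat w) $$ (p, q) \<noteq> 0) = (p + q = r - 1)"
      using pq r by (auto simp: stack_def)
  qed
qed

lemma corner_sizes_pos: "r \<in> corner_sizes \<Longrightarrow> m \<ge> 1" "r \<in> corner_sizes \<Longrightarrow> r \<le> N"
  using m_le by (auto simp: corner_sizes_def)

lemma mixed_minor_corner_nonzero:
  assumes "r \<in> corner_sizes" shows "\<exists>x\<in>C. mixed_minor r 0 x \<noteq> 0"
  using antidiagonal_element[OF corner_sizes_pos(1)[OF assms]] mixed_minor_antidiagonal(1) corner_sizes_pos(2)[OF assms]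
  by meson

lemma lower_pairsD: assumes "(i, j) \<in> lower_pairs"
  shows "i \<in> {1..N}" "j \<in> {1..N}" "N - m < i" "i + j \<ge> Suc N" "j \<le> i" "m \<ge> 1"
    "(N - i) + (j - (Suc N - i)) \<le> N"
  using assms by (auto simp: lower_pairs_def)

lemma finite_lower_pairs: "finite lower_pairs"
  by (rule finite_subset[of _ "{1..N} \<times> {1..N}"]) (auto simp: lower_pairs_def)

lemma Kl_regular: "(i, j) \<in> lower_pairs \<Longrightarrow> Kl i j \<in> regular_funs N"
  unfolding Kl_def using lower_pairsD(7) by (rule mixed_minor_regular)

text \<open>Induction on the number \<open>N - i\<close> of rows taken from \<open>x\<close>. Without such rows the antidiagonal point is a witness. For the
  step, \<open>Kl i j\<close> equals \<open>Jl (i + 1) (j - 1)\<close>, which a move makes nonzero because its slope \<open>Kl (i + 1) (j - 1)\<close> is nonzero at a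
  generic point by induction.\<close>

lemma Kl_nonzero: "(i, j) \<in> lower_pairs \<Longrightarrow> \<exists>x\<in>C. Kl i j x \<noteq> 0"
proof (induction "N - i" arbitrary: i j)
  case 0
  obtain w c where w: "w \<in> C" "c \<noteq> 0"
    "\<forall>i\<in>{1..N}. \<forall>k\<in>{1..N}. entry w i k = (if k = Suc N - i then c * s i else 0)"
    using antidiagonal_element[OF lower_pairsD(6)[OF 0(2)]] by blast
  have "Kl i j = mixed_minor 0 (j - (Suc N - i))" using 0 by (simp add: Kl_def)
  then show ?case using mixed_minor_antidiagonal(2)[OF w(1,2), of "j - (Suc N - i)"] w lower_pairsD(7)[OF 0(2)] by auto
next
  case (Suc e)
  note ij = lower_pairsD[OF Suc(3)]
  have i: "i < N" using Suc(2) by simp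
  have s2: "(Suc i, j - 1) \<in> lower_pairs" using Suc(3) i by (auto simp: lower_pairs_def)
  have KJ: "Kl i j = Jl (Suc i) (j - 1)" using i ij by (simp add: Kl_def Jl_def Suc_diff_Suc)
  have "e = N - Suc i" using Suc(2) by simp
  then have IH: "\<exists>x\<in>C. Kl (Suc i) (j - 1) x \<noteq> 0" using Suc(1) s2 by blast
  define F where "F = insert (Kl (Suc i) (j - 1)) ((\<lambda>r. mixed_minor r 0) ` corner_sizes)"
  have "\<exists>x\<in>C. \<forall>f\<in>F. f x \<noteq> 0"
  proof (rule common_nonzero)
    show "finite F" by (simp add: F_def corner_sizes_def)
    show "f \<in> regular_funs N" if "f \<in> F" for f
      using that Kl_regular[OF s2] corner_sizes_pos(2) by (auto simp: F_def intro!: mixed_minor_regular)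
    show "\<exists>x\<in>C. f x \<noteq> 0" if "f \<in> F" for f using that IH mixed_minor_corner_nonzero by (auto simp: F_def)
  qed
  then obtain x where x: "x \<in> C" "Kl (Suc i) (j - 1) x \<noteq> 0" "\<And>r. r \<in> corner_sizes \<Longrightarrow> mixed_minor r 0 x \<noteq> 0"
    by (auto simp: F_def)
  obtain v y where vy: "v \<in> U1" "y \<in> G" "zpat y" "x = v * y * ginv v"
    using generic_decomposition[OF C_G[OF x(1)] x(3)] .
  show ?case
  proof (rule lower_move[OF x(1) vy(4,1,2,3) s2])
    fix \<gamma> \<kappa> assume \<gamma>: "finite {t. \<gamma> t \<notin> C}" "\<kappa> \<noteq> 0"
      "\<And>t. \<gamma> t \<in> C \<Longrightarrow> Jl (Suc i) (j - 1) (\<gamma> t) = Jl (Suc i) (j - 1) x + t * \<kappa> * Kl (Suc i) (j - 1) x"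
  have "\<exists>t. t \<notin> {t. \<gamma> t \<notin> C} \<union> {- Jl (Suc i) (j - 1) x / (\<kappa> * Kl (Suc i) (j - 1) x)}"
    using \<gamma>(1) infinite_UNIV_char_0 by (intro ex_new_if_finite) auto
  then obtain t where t: "\<gamma> t \<in> C" "t \<noteq> - Jl (Suc i) (j - 1) x / (\<kappa> * Kl (Suc i) (j - 1) x)" by auto
  have "Jl (Suc i) (j - 1) (\<gamma> t) \<noteq> 0"
  proof
    assume "Jl (Suc i) (j - 1) (\<gamma> t) = 0"
    then have "t * (\<kappa> * Kl (Suc i) (j - 1) x) = - Jl (Suc i) (j - 1) x"
      using \<gamma>(3)[OF t(1)] by (simp add: eq_neg_iff_add_eq_0 add.commute mult.assoc)
    then show False using t(2) \<gamma>(2) x(2) by (simp add: field_simps)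
  qed
  then show ?thesis using t(1) KJ by auto
  qed
qed

text \<open>Its nonvanishing guarantees both the normal form and nonzero slopes for all moves.\<close>

definition Gen :: "'a mat \<Rightarrow> 'a" where
  "Gen x = (\<Prod>r\<in>corner_sizes. mixed_minor r 0 x) * (\<Prod>(i, j)\<in>lower_pairs. Kl i j x)"

lemma Gen_regular: "Gen \<in> regular_funs N"
  unfolding Gen_def[abs_def]
proof (intro regular.mult regular.prod)
  show "mixed_minor r 0 \<in> regular_funs N" if "r \<in> corner_sizes" for r
    using corner_sizes_pos(2)[OF that] by (intro mixed_minor_regular) simp
  show "(\<lambda>x. case a of (i, j) \<Rightarrow> Kl i j x) \<in> regular_funs N" if "a \<in> lower_pairs" for a
    using that Kl_regular by (cases a) auto
qed

lemma Gen_nonzero: "\<exists>x\<in>C. Gen x \<noteq> 0"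
proof -
  define F where "F = (\<lambda>r. mixed_minor r 0) ` corner_sizes \<union> (\<lambda>(i, j). Kl i j) ` lower_pairs"
  have "\<exists>x\<in>C. \<forall>f\<in>F. f x \<noteq> 0"
  proof (rule common_nonzero)
    show "finite F" by (simp add: F_def corner_sizes_def finite_lower_pairs)
    show "f \<in> regular_funs N" if "f \<in> F" for f
      using that Kl_regular corner_sizes_pos(2) by (auto simp: F_def intro!: mixed_minor_regular)
    show "\<exists>x\<in>C. f x \<noteq> 0" if "f \<in> F" for f
      using that Kl_nonzero mixed_minor_corner_nonzero by (auto simp: F_def)
  qed
  then obtain x where x: "x \<in> C" "\<forall>f\<in>F. f x \<noteq> 0" by blast
  have "finite corner_sizes" by (simp add: corner_sizes_def)
  then have "Gen x \<noteq> 0" using x(2) finite_lower_pairs by (auto simp: Gen_def F_def)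
  then show ?thesis using x(1) by blast
qed

lemma GenD:
  assumes "Gen x \<noteq> 0"
  shows "r \<in> corner_sizes \<Longrightarrow> mixed_minor r 0 x \<noteq> 0" "(i, j) \<in> lower_pairs \<Longrightarrow> Kl i j x \<noteq> 0"
proof -
  have "finite corner_sizes" by (simp add: corner_sizes_def)
  then show "r \<in> corner_sizes \<Longrightarrow> mixed_minor r 0 x \<noteq> 0" "(i, j) \<in> lower_pairs \<Longrightarrow> Kl i j x \<noteq> 0"
    using assms finite_lower_pairs by (auto simp: Gen_def)
qed

end

section \<open>A criterion for algebraic independence\<close>

text \<open>Remove the largest variable first. For a fixed point \<open>z\<close> the relation is a polynomial in \<open>J s\<close> whose coefficients
  involve smaller variables only. It vanishes at the infinitely many values that \<open>J s\<close> takes while the smaller variables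
  keep their values at \<open>z\<close>, so each coefficient gives a relation for \<open>S - {s}\<close>. Monomials are abstracted to an index \<open>m\<close> with
  exponents \<open>ex m\<close>, and the coefficients of a relation enter through their constant values on \<open>Z\<close>.\<close>

lemma triangular_independence:
  fixes J :: "'s \<Rightarrow> 'z \<Rightarrow> 'a::{field_char_0}" and key :: "'s \<Rightarrow> nat" and ex :: "'m \<Rightarrow> 's \<Rightarrow> nat"
  assumes "finite S" "inj_on key S" "Z \<noteq> {}" "finite Ms"
    and "\<And>z s. z \<in> Z \<Longrightarrow> s \<in> S \<Longrightarrow>
      infinite {J s z' | z'. z' \<in> Z \<and> (\<forall>r\<in>S. key r < key s \<longrightarrow> J r z' = J r z)}"
    and "\<And>m m'. m \<in> Ms \<Longrightarrow> m' \<in> Ms \<Longrightarrow> (\<forall>s\<in>S. ex m s = ex m' s) \<Longrightarrow> m = m'"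
    and "\<And>z. z \<in> Z \<Longrightarrow> (\<Sum>m\<in>Ms. c m * (\<Prod>s\<in>S. J s z ^ ex m s)) = 0"
    and "m \<in> Ms"
  shows "c m = 0"
  using assms
proof (induction "card S" arbitrary: S Ms m)
  case 0
  then have S: "S = {}" by simp
  have "m' = m" if "m' \<in> Ms" for m' using 0(7)[OF that 0(9)] S by simp
  then have Ms: "Ms = {m}" using 0(9) by blast
  obtain z where "z \<in> Z" using 0(4) by blast
  from 0(8)[OF this] show ?case unfolding S Ms by simp
next
  case (Suc n)
  have S0: "finite S" "S \<noteq> {}" using Suc(2,3) by auto
  obtain s where s: "s \<in> S" "\<And>r. r \<in> S \<Longrightarrow> key r \<le> key s"
    using obtains_MAX[OF S0, of key] S0 by (metis Max_ge finite_imageI imageI)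
  define S' where "S' = S - {s}"
  have S': "finite S'" "card S' = n" "S = insert s S'" "s \<notin> S'" "S' \<subseteq> S" using Suc(2,3) s(1) by (auto simp: S'_def)
  have lt: "key r < key s" if "r \<in> S'" for r
    using that s Suc(4) by (metis S'(5) S'(4) inj_on_def le_neq_implies_less subsetD)
  \<comment> \<open>The coefficient of the power of \<open>J s\<close> that occurs in the monomial \<open>m\<close>.\<close>
  define Ms' where "Ms' = {m' \<in> Ms. ex m' s = ex m s}"
  show ?case
  proof (rule Suc(1)[of S' Ms' m])
    show "infinite {J r z' | z'. z' \<in> Z \<and> (\<forall>q\<in>S'. key q < key r \<longrightarrow> J q z' = J q z)}" if "z \<in> Z" "r \<in> S'" for z r
    proof (rule infinite_super)
      show "infinite {J r z' | z'. z' \<in> Z \<and> (\<forall>q\<in>S. key q < key r \<longrightarrow> J q z' = J q z)}"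
        using that S'(5) by (intro Suc(7)) auto
    qed (use S'(5) in auto)
    show "m1 = m2" if "m1 \<in> Ms'" "m2 \<in> Ms'" "\<forall>s\<in>S'. ex m1 s = ex m2 s" for m1 m2
      using that unfolding Ms'_def by (intro Suc(8)) (auto simp: S'(3))
    show "(\<Sum>m\<in>Ms'. c m * (\<Prod>s\<in>S'. J s z ^ ex m s)) = 0" if z: "z \<in> Z" for z
    proof -
      define p where "p = (\<Sum>m\<in>Ms. monom (c m * (\<Prod>r\<in>S'. J r z ^ ex m r)) (ex m s))"
      have "poly p T = 0" if T: "T \<in> {J s z' | z'. z' \<in> Z \<and> (\<forall>r\<in>S. key r < key s \<longrightarrow> J r z' = J r z)}" for T
      proof -
        obtain z' where z': "T = J s z'" "z' \<in> Z" "\<forall>r\<in>S. key r < key s \<longrightarrow> J r z' = J r z"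
          using T by blast
        have "poly p T = (\<Sum>m\<in>Ms. c m * (\<Prod>r\<in>S. J r z' ^ ex m r))"
          unfolding p_def poly_sum
        proof (intro sum.cong refl)
          fix k assume "k \<in> Ms"
          have "(\<Prod>r\<in>S'. J r z ^ ex k r) = (\<Prod>r\<in>S'. J r z' ^ ex k r)"
            using z'(3) lt S'(5) by (intro prod.cong refl) auto
          then show "poly (monom (c k * (\<Prod>r\<in>S'. J r z ^ ex k r)) (ex k s)) T = c k * (\<Prod>r\<in>S. J r z' ^ ex k r)"
            using S' z'(1) by (simp add: poly_monom mult_ac)
        qed
        also have "\<dots> = 0" using Suc(9)[OF z'(2)] .
        finally show ?thesis .
      qed
      then have "{J s z' | z'. z' \<in> Z \<and> (\<forall>r\<in>S. key r < key s \<longrightarrow> J r z' = J r z)} \<subseteq> {T. poly p T = 0}" by blast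
      then have "infinite {T. poly p T = 0}" using Suc(7)[OF z s(1)] by (rule infinite_super)
      then have "p = 0" using poly_roots_finite by blast
      then have "0 = coeff p (ex m s)" by simp
      also have "\<dots> = (\<Sum>k\<in>Ms. if ex k s = ex m s then c k * (\<Prod>r\<in>S'. J r z ^ ex k r) else 0)"
        unfolding p_def coeff_sum by (intro sum.cong refl) simp
      also have "\<dots> = (\<Sum>m\<in>Ms'. c m * (\<Prod>s\<in>S'. J s z ^ ex m s))"
        unfolding Ms'_def using Suc(6) by (simp add: sum.inter_filter)
      finally show ?thesis by simp
    qed
    show "n = card S'" "finite S'" using S' by auto
    show "inj_on key S'" using Suc(4) S'(5) by (rule inj_on_subset)
    show "finite Ms'" "m \<in> Ms'" using Suc(6,10) by (auto simp: Ms'_def)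
    show "Z \<noteq> {}" by (rule Suc(5))
  qed
qed

section \<open>Values of rational functions\<close>

text \<open>Irreducibility is phrased for \<open>K\<close>-points: two regular functions that do not vanish identically have a common point at
  which neither vanishes. This makes the coordinate ring a domain.\<close>

locale irreducible_set =
  fixes N :: nat and C :: "'a::field_char_0 mat set"
  assumes C_carrier_mat: "C \<subseteq> carrier_mat N N"
    and C_not_empty: "C \<noteq> {}"
    and irreducible: "\<And>f g. f \<in> regular_funs N \<Longrightarrow> g \<in> regular_funs N \<Longrightarrow> \<exists>x\<in>C. f x \<noteq> 0 \<Longrightarrow>
      \<exists>x\<in>C. g x \<noteq> 0 \<Longrightarrow> \<exists>x\<in>C. f x \<noteq> 0 \<and> g x \<noteq> 0"
begin

abbreviation CR where "CR \<equiv> coordinate_ring N C"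
abbreviation F where "F \<equiv> rational_functions N C"

lemma carrier_CR: "f \<in> carrier CR \<longleftrightarrow> (\<exists>f'\<in>regular_funs N. f = restrict f' C)"
proof
  assume "f \<in> carrier CR"
  then show "\<exists>f'\<in>regular_funs N. f = restrict f' C"
    using poly_in_regular by (auto simp: coordinate_ring_def)
next
  assume "\<exists>f'\<in>regular_funs N. f = restrict f' C"
  then obtain f' p where "f = restrict f' C" "p \<in> poly_funs N" "\<forall>A\<in>carrier_mat N N. f' A = p A"
    by (auto simp: regular_funs_def)
  then have "f = restrict p C" using C_carrier_mat by (auto simp: restrict_def fun_eq_iff)
  then show "f \<in> carrier CR" using \<open>p \<in> poly_funs N\<close> by (auto simp: coordinate_ring_def)
qed

lemma CR_simps:
  "f \<otimes>\<^bsub>CR\<^esub> g = (\<lambda>x\<in>C. f x * g x)" "f \<oplus>\<^bsub>CR\<^esub> g = (\<lambda>x\<in>C. f x + g x)"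
  "\<one>\<^bsub>CR\<^esub> = (\<lambda>x\<in>C. 1)" "\<zero>\<^bsub>CR\<^esub> = (\<lambda>x\<in>C. 0)"
  by (simp_all add: coordinate_ring_def)

lemma CR_ext: "f \<in> carrier CR \<Longrightarrow> restrict f C = f"
  by (auto simp: carrier_CR)

lemma CR_eqI: "f \<in> carrier CR \<Longrightarrow> g \<in> carrier CR \<Longrightarrow> (\<And>x. x \<in> C \<Longrightarrow> f x = g x) \<Longrightarrow> f = g"
  by (metis CR_ext restrict_ext)

lemma CR_regular: "f \<in> carrier CR \<Longrightarrow> \<exists>f'\<in>regular_funs N. \<forall>x\<in>C. f x = f' x"
  by (auto simp: carrier_CR)

lemma CR_irreducible:
  assumes "f \<in> carrier CR" "g \<in> carrier CR" "\<exists>x\<in>C. f x \<noteq> 0" "\<exists>x\<in>C. g x \<noteq> 0"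
  shows "\<exists>x\<in>C. f x \<noteq> 0 \<and> g x \<noteq> 0"
proof -
  obtain f' g' where f': "f' \<in> regular_funs N" "\<forall>x\<in>C. f x = f' x" and g': "g' \<in> regular_funs N" "\<forall>x\<in>C. g x = g' x"
    using CR_regular assms(1,2) by blast
  then have "\<exists>x\<in>C. f' x \<noteq> 0 \<and> g' x \<noteq> 0" using assms(3,4) by (intro irreducible) auto
  then show ?thesis using f' g' by auto
qed

lemma CR_closed:
  "f \<in> carrier CR \<Longrightarrow> g \<in> carrier CR \<Longrightarrow> (\<lambda>x\<in>C. f x * g x) \<in> carrier CR"
  "f \<in> carrier CR \<Longrightarrow> g \<in> carrier CR \<Longrightarrow> (\<lambda>x\<in>C. f x + g x) \<in> carrier CR"
  "(\<lambda>x\<in>C. c) \<in> carrier CR"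
proof -
  show "(\<lambda>x\<in>C. c) \<in> carrier CR" unfolding carrier_CR by (intro bexI[of _ "\<lambda>_. c"] refl regular.const)
  assume "f \<in> carrier CR" "g \<in> carrier CR"
  then obtain f' g' where "f' \<in> regular_funs N" "f = restrict f' C" "g' \<in> regular_funs N" "g = restrict g' C"
    by (auto simp: carrier_CR)
  then have "(\<lambda>x. f' x * g' x) \<in> regular_funs N" "(\<lambda>x. f' x + g' x) \<in> regular_funs N"
    "(\<lambda>x\<in>C. f x * g x) = restrict (\<lambda>x. f' x * g' x) C" "(\<lambda>x\<in>C. f x + g x) = restrict (\<lambda>x. f' x + g' x) C"
    by (auto intro: regular.mult regular.add)
  then show "(\<lambda>x\<in>C. f x * g x) \<in> carrier CR" "(\<lambda>x\<in>C. f x + g x) \<in> carrier CR"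
    unfolding carrier_CR by blast+
qed

lemma domain_CR: "domain CR"
proof -
  note cl = CR_closed
  have "cring CR"
  proof (rule cringI)
    show "abelian_group CR"
    proof (rule abelian_groupI)
      fix f assume f: "f \<in> carrier CR"
      have "(\<lambda>x\<in>C. (\<lambda>x\<in>C. -1) x * f x) \<in> carrier CR" by (rule cl(1)[OF cl(3) f])
      then show "\<exists>g\<in>carrier CR. g \<oplus>\<^bsub>CR\<^esub> f = \<zero>\<^bsub>CR\<^esub>"
        by (rule bexI[rotated]) (auto simp: CR_simps restrict_def fun_eq_iff)
      show "\<zero>\<^bsub>CR\<^esub> \<oplus>\<^bsub>CR\<^esub> f = f"
        unfolding CR_simps by (rule CR_eqI[OF cl(2)[OF cl(3) f] f]) auto
    qed (auto simp: CR_simps cl cl[unfolded restrict_def] restrict_def fun_eq_iff)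
    show "Group.comm_monoid CR"
    proof (rule comm_monoidI)
      fix f assume f: "f \<in> carrier CR"
      show "\<one>\<^bsub>CR\<^esub> \<otimes>\<^bsub>CR\<^esub> f = f"
        unfolding CR_simps by (rule CR_eqI[OF cl(1)[OF cl(3) f] f]) auto
    qed (auto simp: CR_simps cl cl[unfolded restrict_def] restrict_def fun_eq_iff)
  qed (auto simp: CR_simps restrict_def fun_eq_iff algebra_simps)
  then show ?thesis
  proof (rule domain.intro)
    show "domain_axioms CR"
    proof
      obtain x where "x \<in> C" using C_not_empty by auto
      then have "\<one>\<^bsub>CR\<^esub> x \<noteq> \<zero>\<^bsub>CR\<^esub> x" by (simp add: CR_simps)
      then show "\<one>\<^bsub>CR\<^esub> \<noteq> \<zero>\<^bsub>CR\<^esub>" by metis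
    next
      fix f g assume fg: "f \<otimes>\<^bsub>CR\<^esub> g = \<zero>\<^bsub>CR\<^esub>" "f \<in> carrier CR" "g \<in> carrier CR"
      have "f x * g x = 0" if "x \<in> C" for x using fun_cong[OF fg(1), of x] that by (simp add: CR_simps)
      then have "(\<forall>x\<in>C. f x = 0) \<or> (\<forall>x\<in>C. g x = 0)" using CR_irreducible[OF fg(2,3)] by auto
      then show "f = \<zero>\<^bsub>CR\<^esub> \<or> g = \<zero>\<^bsub>CR\<^esub>"
        using fg(2,3) by (auto simp: CR_simps intro!: CR_eqI cl(3))
    qed
  qed
qed

sublocale CR: domain CR by (rule domain_CR)

lemma field_F: "field F" unfolding rational_functions_def by (rule CR.field_fraction_field)

sublocale F: field F by (rule field_F)

lemma CR_nonzero: "r \<in> carrier CR \<Longrightarrow> x \<in> C \<Longrightarrow> r x \<noteq> 0 \<Longrightarrow> r \<in> carrier CR - {\<zero>\<^bsub>CR\<^esub>}"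
  by (auto simp: CR_simps)

lemma CR_nonzeroD: "r \<in> carrier CR - {\<zero>\<^bsub>CR\<^esub>} \<Longrightarrow> \<exists>x\<in>C. r x \<noteq> 0"
  using CR_eqI[OF _ CR_closed(3)[of 0]] by (auto simp: CR_simps)

text \<open>The rational function \<open>q\<close> is regular at \<open>x\<close> with value \<open>v\<close>. A relation is used because \<open>q\<close> may fail to have a
  value; \<open>ev_eqI\<close> recovers \<open>q\<close> from its values at generic points.\<close>

definition ev :: "'a mat \<Rightarrow> 'a ratfun \<Rightarrow> 'a \<Rightarrow> bool" where
  "ev x q v \<longleftrightarrow> x \<in> C \<and> (\<exists>p\<in>carrier CR. \<exists>r\<in>carrier CR. q = frac_of CR p r \<and> r x \<noteq> 0 \<and> v = p x / r x)"

lemma evE: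
  assumes "ev x q v"
  obtains p r where "x \<in> C" "p \<in> carrier CR" "r \<in> carrier CR - {\<zero>\<^bsub>CR\<^esub>}" "q = frac_of CR p r" "r x \<noteq> 0" "v = p x / r x"
  using assms CR_nonzero unfolding ev_def by blast

lemma evI:
  "x \<in> C \<Longrightarrow> p \<in> carrier CR \<Longrightarrow> r \<in> carrier CR - {\<zero>\<^bsub>CR\<^esub>} \<Longrightarrow> q = frac_of CR p r \<Longrightarrow> r x \<noteq> 0 \<Longrightarrow> v = p x / r x \<Longrightarrow> ev x q v"
  unfolding ev_def by blast

lemma ev_carrier: "ev x q v \<Longrightarrow> q \<in> carrier F"
  by (elim evE) (simp add: rational_functions_def CR.frac_in_carrier)

lemma F_cases:
  assumes "q \<in> carrier F"
  obtains p r where "p \<in> carrier CR" "r \<in> carrier CR - {\<zero>\<^bsub>CR\<^esub>}" "q = frac_of CR p r"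
  using assms unfolding rational_functions_def CR.carrier_fraction_field by blast

lemma frac_eqD:
  assumes "p \<in> carrier CR" "p' \<in> carrier CR" "r \<in> carrier CR - {\<zero>\<^bsub>CR\<^esub>}" "r' \<in> carrier CR - {\<zero>\<^bsub>CR\<^esub>}"
    and "frac_of CR p r = frac_of CR p' r'" "x \<in> C"
  shows "p x * r' x = p' x * r x"
proof -
  have "p \<otimes>\<^bsub>CR\<^esub> r' = p' \<otimes>\<^bsub>CR\<^esub> r" using CR.frac_eq_iff[OF assms(1-4)] assms(5) by simp
  from fun_cong[OF this, of x] show ?thesis using assms(6) by (simp add: CR_simps)
qed

lemma ev_unique: assumes "ev x q v" "ev x q w" shows "v = w"
proof -
  obtain p r where 1: "x \<in> C" "p \<in> carrier CR" "r \<in> carrier CR - {\<zero>\<^bsub>CR\<^esub>}" "q = frac_of CR p r" "r x \<noteq> 0" "v = p x / r x"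
    using evE[OF assms(1)] .
  obtain p' r' where 2: "p' \<in> carrier CR" "r' \<in> carrier CR - {\<zero>\<^bsub>CR\<^esub>}" "q = frac_of CR p' r'" "r' x \<noteq> 0" "w = p' x / r' x"
    using evE[OF assms(2)] .
  show ?thesis using frac_eqD[OF 1(2) 2(1) 1(3) 2(2)] 1 2 by (simp add: frac_eq_eq)
qed

lemma ev_mult: assumes "ev x q v" "ev x q' w" shows "ev x (q \<otimes>\<^bsub>F\<^esub> q') (v * w)"
proof -
  obtain p r where 1: "x \<in> C" "p \<in> carrier CR" "r \<in> carrier CR - {\<zero>\<^bsub>CR\<^esub>}" "q = frac_of CR p r" "r x \<noteq> 0" "v = p x / r x"
    using evE[OF assms(1)] .
  obtain p' r' where 2: "p' \<in> carrier CR" "r' \<in> carrier CR - {\<zero>\<^bsub>CR\<^esub>}" "q' = frac_of CR p' r'" "r' x \<noteq> 0" "w = p' x / r' x"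
    using evE[OF assms(2)] .
  have c: "p \<otimes>\<^bsub>CR\<^esub> p' \<in> carrier CR" "r \<otimes>\<^bsub>CR\<^esub> r' \<in> carrier CR" using 1 2 by auto
  show ?thesis
  proof (rule evI[OF 1(1) c(1) CR_nonzero[OF c(2) 1(1)]])
    show "q \<otimes>\<^bsub>F\<^esub> q' = frac_of CR (p \<otimes>\<^bsub>CR\<^esub> p') (r \<otimes>\<^bsub>CR\<^esub> r')"
      unfolding 1(4) 2(3) rational_functions_def by (rule CR.mult_frac[OF 1(2) 2(1) 1(3) 2(2)])
  qed (use 1 2 in \<open>auto simp: CR_simps\<close>)
qed

lemma ev_add: assumes "ev x q v" "ev x q' w" shows "ev x (q \<oplus>\<^bsub>F\<^esub> q') (v + w)"
proof -
  obtain p r where 1: "x \<in> C" "p \<in> carrier CR" "r \<in> carrier CR - {\<zero>\<^bsub>CR\<^esub>}" "q = frac_of CR p r" "r x \<noteq> 0" "v = p x / r x"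
    using evE[OF assms(1)] .
  obtain p' r' where 2: "p' \<in> carrier CR" "r' \<in> carrier CR - {\<zero>\<^bsub>CR\<^esub>}" "q' = frac_of CR p' r'" "r' x \<noteq> 0" "w = p' x / r' x"
    using evE[OF assms(2)] .
  have c: "p \<otimes>\<^bsub>CR\<^esub> r' \<oplus>\<^bsub>CR\<^esub> p' \<otimes>\<^bsub>CR\<^esub> r \<in> carrier CR" "r \<otimes>\<^bsub>CR\<^esub> r' \<in> carrier CR" using 1 2 by auto
  show ?thesis
  proof (rule evI[OF 1(1) c(1) CR_nonzero[OF c(2) 1(1)]])
    show "q \<oplus>\<^bsub>F\<^esub> q' = frac_of CR (p \<otimes>\<^bsub>CR\<^esub> r' \<oplus>\<^bsub>CR\<^esub> p' \<otimes>\<^bsub>CR\<^esub> r) (r \<otimes>\<^bsub>CR\<^esub> r')"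
      unfolding 1(4) 2(3) rational_functions_def by (rule CR.add_frac[OF 1(2) 2(1) 1(3) 2(2)])
  qed (use 1 2 in \<open>auto simp: CR_simps add_frac_eq\<close>)
qed

lemma ev_frac: "x \<in> C \<Longrightarrow> p \<in> carrier CR \<Longrightarrow> r \<in> carrier CR \<Longrightarrow> r x \<noteq> 0 \<Longrightarrow> ev x (frac_of CR p r) (p x / r x)"
  using evI[OF _ _ CR_nonzero refl] by blast

lemma restrict_CR: "f \<in> regular_funs N \<Longrightarrow> restrict f C \<in> carrier CR"
  by (auto simp: carrier_CR)

lemma ev_ratfun: "x \<in> C \<Longrightarrow> f \<in> regular_funs N \<Longrightarrow> ev x (ratfun_of N C f) (f x)"
  using ev_frac[of x "restrict f C" "\<lambda>x\<in>C. 1"] restrict_CR CR_closed(3)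
  by (simp add: ratfun_of_def)

lemma ratfun_carrier: "f \<in> regular_funs N \<Longrightarrow> ratfun_of N C f \<in> carrier F"
  using ev_carrier[OF ev_ratfun] C_not_empty by blast

lemma ev_one: "x \<in> C \<Longrightarrow> ev x \<one>\<^bsub>F\<^esub> 1"
  using ev_frac[of x "\<one>\<^bsub>CR\<^esub>" "\<one>\<^bsub>CR\<^esub>"]
  by (simp add: rational_functions_def CR.one_fraction_field) (simp add: CR_simps)

lemma ev_zero: "x \<in> C \<Longrightarrow> ev x \<zero>\<^bsub>F\<^esub> 0"
  using ev_frac[of x "\<zero>\<^bsub>CR\<^esub>" "\<one>\<^bsub>CR\<^esub>"]
  by (simp add: rational_functions_def CR.zero_fraction_field) (simp add: CR_simps)

lemma ev_const: "x \<in> C \<Longrightarrow> ev x (ratfun_of N C (\<lambda>_. c)) c"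
  using ev_ratfun[OF _ regular.const] by auto

lemma ev_nonzero: "ev x q v \<Longrightarrow> v \<noteq> 0 \<Longrightarrow> q \<noteq> \<zero>\<^bsub>F\<^esub>"
  using ev_unique ev_zero by (metis evE)

lemma ev_eqI:
  assumes q: "q \<in> carrier F" "q' \<in> carrier F" and g: "g \<in> regular_funs N" "\<exists>x\<in>C. g x \<noteq> 0"
    and e: "\<And>x. x \<in> C \<Longrightarrow> g x \<noteq> 0 \<Longrightarrow> \<exists>v. ev x q v \<and> ev x q' v"
  shows "q = q'"
proof -
  obtain p r where 1: "p \<in> carrier CR" "r \<in> carrier CR - {\<zero>\<^bsub>CR\<^esub>}" "q = frac_of CR p r" using F_cases[OF q(1)] .
  obtain p' r' where 2: "p' \<in> carrier CR" "r' \<in> carrier CR - {\<zero>\<^bsub>CR\<^esub>}" "q' = frac_of CR p' r'" using F_cases[OF q(2)] .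
  have rr: "(\<lambda>x\<in>C. r x * r' x) \<in> carrier CR" using 1 2 by (intro CR_closed) auto
  have gC: "restrict g C \<in> carrier CR" by (rule restrict_CR[OF g(1)])
  have "p \<otimes>\<^bsub>CR\<^esub> r' = p' \<otimes>\<^bsub>CR\<^esub> r"
  proof (rule ccontr)
    assume ne: "p \<otimes>\<^bsub>CR\<^esub> r' \<noteq> p' \<otimes>\<^bsub>CR\<^esub> r"
    \<comment> \<open>The difference is written with the operations under which the coordinate ring is known to be closed.\<close>
    define d where "d = (\<lambda>x\<in>C. p x * r' x + (\<lambda>x\<in>C. (\<lambda>x\<in>C. -1) x * (\<lambda>x\<in>C. p' x * r x) x) x)"
    have d: "d x = p x * r' x - p' x * r x" if "x \<in> C" for x using that by (simp add: d_def)
    have "d = (\<lambda>x\<in>C. (\<lambda>x\<in>C. p x * r' x) x + (\<lambda>x\<in>C. (\<lambda>x\<in>C. -1) x * (\<lambda>x\<in>C. p' x * r x) x) x)"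
      by (auto simp: d_def restrict_def fun_eq_iff)
    moreover have "\<dots> \<in> carrier CR" using 1 2 by (intro CR_closed) auto
    ultimately have dC: "d \<in> carrier CR" by simp
    have "\<exists>x\<in>C. d x \<noteq> 0"
    proof (rule ccontr)
      assume "\<not> (\<exists>x\<in>C. d x \<noteq> 0)"
      then have "p \<otimes>\<^bsub>CR\<^esub> r' = p' \<otimes>\<^bsub>CR\<^esub> r" using d by (auto simp: CR_simps restrict_def fun_eq_iff)
      then show False using ne by simp
    qed
    then have "\<exists>x\<in>C. d x \<noteq> 0 \<and> restrict g C x \<noteq> 0"
      using g(2) by (intro CR_irreducible[OF dC gC]) auto
    then have "\<exists>x\<in>C. (\<lambda>x\<in>C. d x * restrict g C x) x \<noteq> 0" by auto
    moreover have "\<exists>x\<in>C. (\<lambda>x\<in>C. r x * r' x) x \<noteq> 0"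
      using CR_irreducible[of r r'] CR_nonzeroD[OF 1(2)] CR_nonzeroD[OF 2(2)] 1 2 by auto
    ultimately obtain x where x: "x \<in> C" "d x \<noteq> 0" "g x \<noteq> 0" "r x \<noteq> 0" "r' x \<noteq> 0"
      using CR_irreducible[OF CR_closed(1)[OF dC gC] rr] by auto
    obtain v where v: "ev x q v" "ev x q' v" using e[OF x(1,3)] by blast
    have "v = p x / r x" using ev_unique[OF v(1)] ev_frac[of x p r] 1 x by auto
    moreover have "v = p' x / r' x" using ev_unique[OF v(2)] ev_frac[of x p' r'] 2 x by auto
    ultimately show False using x d by (simp add: frac_eq_eq)
  qed
  then show ?thesis unfolding 1(3) 2(3) using CR.frac_eq_iff 1 2 by blast
qed

lemma ev_uminus: assumes "ev x q v" shows "ev x (\<ominus>\<^bsub>F\<^esub> q) (- v)"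
proof -
  have x: "x \<in> C" using assms evE by blast
  have q: "q \<in> carrier F" by (rule ev_carrier[OF assms])
  define c where "c = ratfun_of N C (\<lambda>_. -1 :: 'a)"
  have c: "c \<in> carrier F" unfolding c_def by (intro ratfun_carrier regular.const)
  have "c \<oplus>\<^bsub>F\<^esub> \<one>\<^bsub>F\<^esub> = \<zero>\<^bsub>F\<^esub>"
  proof (rule ev_eqI)
    show "\<exists>v. ev y (c \<oplus>\<^bsub>F\<^esub> \<one>\<^bsub>F\<^esub>) v \<and> ev y \<zero>\<^bsub>F\<^esub> v" if "y \<in> C" for y
      using ev_add[OF ev_const[OF that, of "-1"] ev_one[OF that]] ev_zero[OF that] by (auto simp: c_def)
  qed (use c C_not_empty in \<open>auto intro!: regular.const[of 1]\<close>)
  then have "c = \<ominus>\<^bsub>F\<^esub> \<one>\<^bsub>F\<^esub>" using c F.minus_equality by auto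
  then have "\<ominus>\<^bsub>F\<^esub> q = c \<otimes>\<^bsub>F\<^esub> q" using q by (simp add: F.l_minus)
  then show ?thesis using ev_mult[OF ev_const[OF x, of "-1"] assms] by (simp add: c_def)
qed

lemma ev_inverse: assumes "ev x q v" "v \<noteq> 0" shows "ev x (inv\<^bsub>F\<^esub> q) (inverse v)"
proof -
  obtain p r where 1: "x \<in> C" "p \<in> carrier CR" "r \<in> carrier CR - {\<zero>\<^bsub>CR\<^esub>}" "q = frac_of CR p r" "r x \<noteq> 0" "v = p x / r x"
    using evE[OF assms(1)] .
  have px: "p x \<noteq> 0" using 1 assms(2) by auto
  have p: "p \<in> carrier CR - {\<zero>\<^bsub>CR\<^esub>}" by (rule CR_nonzero[OF 1(2,1) px])
  have "q \<otimes>\<^bsub>F\<^esub> frac_of CR r p = frac_of CR (p \<otimes>\<^bsub>CR\<^esub> r) (r \<otimes>\<^bsub>CR\<^esub> p)"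
    unfolding 1(4) rational_functions_def using 1 p by (intro CR.mult_frac) auto
  also have "\<dots> = \<one>\<^bsub>F\<^esub>"
    unfolding rational_functions_def CR.one_fraction_field using 1 p
    by (subst CR.frac_eq_iff) (auto simp: CR.m_comm CR.integral_iff)
  finally have e: "q \<otimes>\<^bsub>F\<^esub> frac_of CR r p = \<one>\<^bsub>F\<^esub>" .
  have ef: "ev x (frac_of CR r p) (inverse v)"
    using ev_frac[OF 1(1) _ 1(2) px, of r] 1 by simp
  have "inv\<^bsub>F\<^esub> q = frac_of CR r p"
    using F.comm_inv_char[OF ev_carrier[OF assms(1)] ev_carrier[OF ef] e] by simp
  then show ?thesis using ef by simp
qed

lemma ev_divide: "ev x q v \<Longrightarrow> ev x q' w \<Longrightarrow> w \<noteq> 0 \<Longrightarrow> ev x (q \<otimes>\<^bsub>F\<^esub> inv\<^bsub>F\<^esub> q') (v / w)"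
  using ev_mult[OF _ ev_inverse, of x q v q' w] by (simp add: divide_inverse)

lemma ev_finsum:
  assumes "x \<in> C" "\<And>a. a \<in> A \<Longrightarrow> ev x (f a) (h a)" "finite A"
  shows "ev x (\<Oplus>\<^bsub>F\<^esub>a\<in>A. f a) (\<Sum>a\<in>A. h a)"
  using assms(3,2)
proof (induction A rule: finite_induct)
  case empty then show ?case using ev_zero[OF assms(1)] by simp
next
  case (insert a A)
  then have "f \<in> insert a A \<rightarrow> carrier F" using ev_carrier by blast
  then show ?case using insert by (simp add: F.finsum_insert ev_add)
qed

lemma ev_finprod:
  assumes "x \<in> C" "\<And>a. a \<in> A \<Longrightarrow> ev x (f a) (h a)" "finite A"
  shows "ev x (\<Otimes>\<^bsub>F\<^esub>a\<in>A. f a) (\<Prod>a\<in>A. h a)"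
  using assms(3,2)
proof (induction A rule: finite_induct)
  case empty then show ?case using ev_one[OF assms(1)] by simp
next
  case (insert a A)
  then have "f \<in> insert a A \<rightarrow> carrier F" using ev_carrier by blast
  then show ?case using insert by (simp add: F.finprod_insert ev_mult)
qed

lemma ev_pow: assumes "ev x q v" shows "ev x (q [^]\<^bsub>F\<^esub> (n::nat)) (v ^ n)"
proof (induction n)
  case 0 then show ?case using ev_one evE[OF assms] by (simp add: F.nat_pow_0) metis
next
  case (Suc n) then show ?case using ev_mult[OF Suc assms] by (simp add: mult.commute)
qed

lemma ev_indexed_value:
  assumes "x \<in> C" "finite {m. P m \<noteq> \<zero>\<^bsub>F\<^esub>}" "\<And>m. P m \<noteq> \<zero>\<^bsub>F\<^esub> \<Longrightarrow> ev x (P m) (c m)"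
    and "\<And>m s. P m \<noteq> \<zero>\<^bsub>F\<^esub> \<Longrightarrow> s \<in># m \<Longrightarrow> ev x (a s) (j s)"
  shows "ev x (indexed_value F a P) (\<Sum>m\<in>{m. P m \<noteq> \<zero>\<^bsub>F\<^esub>}. c m * (\<Prod>s\<in>set_mset m. j s ^ count m s))"
  unfolding indexed_value_def
  using assms by (intro ev_finsum ev_mult ev_finprod ev_pow) auto

end

section \<open>Invariants of a conjugation action\<close>

text \<open>What is needed of \<open>U\<close> in order that the invariants form a subfield: conjugation acts on the points by regular
  bijections.\<close>

locale conj_action = irreducible_set +
  fixes U :: "'a mat set"
  assumes conj_stable: "g \<in> U \<Longrightarrow> x \<in> C \<Longrightarrow> inv\<^bsub>ring_mat TYPE('a) N ()\<^esub> g * x * g \<in> C"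
    and conj_inverse: "g \<in> U \<Longrightarrow> \<exists>h\<in>U. \<forall>x\<in>C.
      inv\<^bsub>ring_mat TYPE('a) N ()\<^esub> g * (inv\<^bsub>ring_mat TYPE('a) N ()\<^esub> h * x * h) * g = x \<and>
      inv\<^bsub>ring_mat TYPE('a) N ()\<^esub> h * (inv\<^bsub>ring_mat TYPE('a) N ()\<^esub> g * x * g) * h = x"
    and conj_regular: "g \<in> U \<Longrightarrow> f \<in> regular_funs N \<Longrightarrow>
      (\<lambda>x. f (inv\<^bsub>ring_mat TYPE('a) N ()\<^esub> g * x * g)) \<in> regular_funs N"
begin

definition cj :: "'a mat \<Rightarrow> 'a mat \<Rightarrow> 'a mat" where
  "cj g x = inv\<^bsub>ring_mat TYPE('a) N ()\<^esub> g * x * g"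

lemma cj_stable: "g \<in> U \<Longrightarrow> x \<in> C \<Longrightarrow> cj g x \<in> C"
  unfolding cj_def by (rule conj_stable)

lemma cj_inverse: assumes "g \<in> U"
  obtains h where "h \<in> U" "\<And>x. x \<in> C \<Longrightarrow> cj g (cj h x) = x" "\<And>x. x \<in> C \<Longrightarrow> cj h (cj g x) = x"
  using conj_inverse[OF assms] unfolding cj_def by blast

lemma conj_fun_cj: "conj_fun N C g f = (\<lambda>x\<in>C. f (cj g x))"
  by (simp add: conj_fun_def cj_def)

lemma conj_fun_closed: assumes "g \<in> U" "f \<in> carrier CR" shows "conj_fun N C g f \<in> carrier CR"
proof -
  obtain f' where f': "f' \<in> regular_funs N" "f = restrict f' C" using assms(2) by (auto simp: carrier_CR)
  have "conj_fun N C g f = restrict (\<lambda>x. f' (cj g x)) C"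
    unfolding conj_fun_cj f'(2) using cj_stable[OF assms(1)] by (auto simp: restrict_def fun_eq_iff)
  then show ?thesis using conj_regular[OF assms(1) f'(1)] unfolding carrier_CR cj_def by blast
qed

text \<open>Invariance of the fraction \<open>p / r\<close> with denominators cleared.\<close>

definition inv_frac :: "('a mat \<Rightarrow> 'a) \<Rightarrow> ('a mat \<Rightarrow> 'a) \<Rightarrow> bool" where
  "inv_frac p r \<longleftrightarrow> (\<forall>g\<in>U. \<forall>x\<in>C. p x * r (cj g x) = p (cj g x) * r x)"

text \<open>Invariance is defined by the image of the whole equivalence class of a fraction; cross-multiplied equations move
  from one representative \<open>(p, r)\<close> to all others.\<close>

lemma conj_frac_subset:
  assumes p: "p \<in> carrier CR" and r: "r \<in> carrier CR - {\<zero>\<^bsub>CR\<^esub>}" and i: "inv_frac p r" and g: "g \<in> U"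
  shows "map_prod (conj_fun N C g) (conj_fun N C g) ` frac_of CR p r \<subseteq> frac_of CR p r"
proof
  fix z assume "z \<in> map_prod (conj_fun N C g) (conj_fun N C g) ` frac_of CR p r"
  then obtain a b where ab: "(a, b) \<in> frac_of CR p r" "z = (conj_fun N C g a, conj_fun N C g b)"
    by force
  have 1: "a \<in> carrier CR" "b \<in> carrier CR - {\<zero>\<^bsub>CR\<^esub>}" "p \<otimes>\<^bsub>CR\<^esub> b = a \<otimes>\<^bsub>CR\<^esub> r"
    using ab(1) CR.mem_frac_of_iff by auto
  have pb: "p x * b x = a x * r x" if "x \<in> C" for x
    using fun_cong[OF 1(3), of x] that by (simp add: CR_simps)
  obtain h where h: "h \<in> U" "\<And>x. x \<in> C \<Longrightarrow> cj g (cj h x) = x" using cj_inverse[OF g] by metis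
  have cl: "conj_fun N C g a \<in> carrier CR" "conj_fun N C g b \<in> carrier CR" "conj_fun N C g r \<in> carrier CR"
    using conj_fun_closed[OF g] 1 r by auto
  have nz: "\<exists>x\<in>C. conj_fun N C g f x \<noteq> 0" if f: "f \<in> carrier CR - {\<zero>\<^bsub>CR\<^esub>}" for f
  proof -
    obtain x where "x \<in> C" "f x \<noteq> 0" using CR_nonzeroD[OF f] by blast
    then show ?thesis using h cj_stable[OF h(1)] by (intro bexI[of _ "cj h x"]) (auto simp: conj_fun_cj)
  qed
  have b0: "conj_fun N C g b \<in> carrier CR - {\<zero>\<^bsub>CR\<^esub>}"
    using nz[OF 1(2)] CR_nonzero[OF cl(2)] by blast
  have r0: "conj_fun N C g r \<in> carrier CR - {\<zero>\<^bsub>CR\<^esub>}" using nz[OF r] CR_nonzero[OF cl(3)] by blast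
  have "(p \<otimes>\<^bsub>CR\<^esub> conj_fun N C g b) \<otimes>\<^bsub>CR\<^esub> conj_fun N C g r = (conj_fun N C g a \<otimes>\<^bsub>CR\<^esub> r) \<otimes>\<^bsub>CR\<^esub> conj_fun N C g r"
  proof (rule CR_eqI)
    fix x assume x: "x \<in> C"
    have "p x * b (cj g x) * r (cj g x) = (p x * r (cj g x)) * b (cj g x)" by simp
    also have "p x * r (cj g x) = p (cj g x) * r x" using i g x by (simp add: inv_frac_def)
    also have "p (cj g x) * r x * b (cj g x) = a (cj g x) * r x * r (cj g x)"
      using pb[OF cj_stable[OF g x]] by (simp add: mult_ac)
    finally show "((p \<otimes>\<^bsub>CR\<^esub> conj_fun N C g b) \<otimes>\<^bsub>CR\<^esub> conj_fun N C g r) x = ((conj_fun N C g a \<otimes>\<^bsub>CR\<^esub> r) \<otimes>\<^bsub>CR\<^esub> conj_fun N C g r) x"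
      using x by (simp add: CR_simps conj_fun_cj)
  qed (use p r cl in auto)
  then have "p \<otimes>\<^bsub>CR\<^esub> conj_fun N C g b = conj_fun N C g a \<otimes>\<^bsub>CR\<^esub> r"
    using CR.m_rcancel[OF _ cl(3)] r0 p r cl by auto
  then show "z \<in> frac_of CR p r"
    unfolding ab(2) CR.mem_frac_of_iff using p r b0 cl by auto
qed

lemma invariants_iff:
  assumes p: "p \<in> carrier CR" and r: "r \<in> carrier CR - {\<zero>\<^bsub>CR\<^esub>}"
  shows "frac_of CR p r \<in> invariants N C U \<longleftrightarrow> inv_frac p r"
proof
  assume i: "frac_of CR p r \<in> invariants N C U"
  show "inv_frac p r" unfolding inv_frac_def
  proof (intro ballI)
    fix g x assume g: "g \<in> U" and x: "x \<in> C"
    have "(p, r) \<in> frac_of CR p r" unfolding CR.mem_frac_of_iff using p r by auto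
    then have "(conj_fun N C g p, conj_fun N C g r) \<in> conj_ratfun N C g (frac_of CR p r)"
      unfolding conj_ratfun_def by force
    also have "conj_ratfun N C g (frac_of CR p r) = frac_of CR p r" using i g by (simp add: invariants_def)
    finally have "p \<otimes>\<^bsub>CR\<^esub> conj_fun N C g r = conj_fun N C g p \<otimes>\<^bsub>CR\<^esub> r"
      unfolding CR.mem_frac_of_iff by blast
    from fun_cong[OF this, of x] show "p x * r (cj g x) = p (cj g x) * r x"
      using x by (simp add: CR_simps conj_fun_cj)
  qed
next
  assume i: "inv_frac p r"
  have "conj_ratfun N C g (frac_of CR p r) = frac_of CR p r" if g: "g \<in> U" for g
    unfolding conj_ratfun_def
  proof
    show "frac_of CR p r \<subseteq> map_prod (conj_fun N C g) (conj_fun N C g) ` frac_of CR p r"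
    proof
      fix z assume z: "z \<in> frac_of CR p r"
      obtain a b where zab: "z = (a, b)" by (cases z)
      have ab: "a \<in> carrier CR" "b \<in> carrier CR" using z unfolding zab CR.mem_frac_of_iff by auto
      obtain h where h: "h \<in> U" "\<And>x. x \<in> C \<Longrightarrow> cj h (cj g x) = x" using cj_inverse[OF g] by metis
      have rt: "conj_fun N C g (conj_fun N C h f) = f" if "f \<in> carrier CR" for f
        by (rule CR_eqI[OF conj_fun_closed[OF g conj_fun_closed[OF h(1) that]] that])
          (use h cj_stable[OF g] in \<open>auto simp: conj_fun_cj\<close>)
      have "map_prod (conj_fun N C h) (conj_fun N C h) z \<in> frac_of CR p r"
        using conj_frac_subset[OF p r i h(1)] z by blast
      moreover have "z = map_prod (conj_fun N C g) (conj_fun N C g) (map_prod (conj_fun N C h) (conj_fun N C h) z)"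
        unfolding zab using rt ab by simp
      ultimately show "z \<in> map_prod (conj_fun N C g) (conj_fun N C g) ` frac_of CR p r" by (rule rev_image_eqI)
    qed
  qed (rule conj_frac_subset[OF p r i g])
  moreover have "frac_of CR p r \<in> carrier F"
    unfolding rational_functions_def using p r by (rule CR.frac_in_carrier)
  ultimately show "frac_of CR p r \<in> invariants N C U" by (simp add: invariants_def)
qed

lemma invariants_carrier: "q \<in> invariants N C U \<Longrightarrow> q \<in> carrier F"
  by (simp add: invariants_def)

lemma invariantsE:
  assumes "q \<in> invariants N C U"
  obtains p r where "p \<in> carrier CR" "r \<in> carrier CR - {\<zero>\<^bsub>CR\<^esub>}" "q = frac_of CR p r" "inv_frac p r"
proof -
  obtain p r where "p \<in> carrier CR" "r \<in> carrier CR - {\<zero>\<^bsub>CR\<^esub>}" "q = frac_of CR p r"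
    using F_cases[OF invariants_carrier[OF assms]] .
  then show ?thesis using that invariants_iff assms by blast
qed

lemma inv_ratfun:
  assumes "f \<in> regular_funs N" "\<And>g x. g \<in> U \<Longrightarrow> x \<in> C \<Longrightarrow> f (cj g x) = f x"
  shows "ratfun_of N C f \<in> invariants N C U"
  unfolding ratfun_of_def
proof (subst invariants_iff)
  show "restrict f C \<in> carrier CR" by (rule restrict_CR[OF assms(1)])
  show "(\<lambda>x\<in>C. 1) \<in> carrier CR - {\<zero>\<^bsub>CR\<^esub>}" using CR.one_not_zero CR.one_closed by (simp add: CR_simps)
  show "inv_frac (restrict f C) (\<lambda>x\<in>C. 1)"
    unfolding inv_frac_def using assms(2) cj_stable by simp
qed

lemma inv_mult:
  assumes "q \<in> invariants N C U" "q' \<in> invariants N C U" shows "q \<otimes>\<^bsub>F\<^esub> q' \<in> invariants N C U"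
proof -
  obtain p r where 1: "p \<in> carrier CR" "r \<in> carrier CR - {\<zero>\<^bsub>CR\<^esub>}" "q = frac_of CR p r" "inv_frac p r"
    using invariantsE[OF assms(1)] .
  obtain p' r' where 2: "p' \<in> carrier CR" "r' \<in> carrier CR - {\<zero>\<^bsub>CR\<^esub>}" "q' = frac_of CR p' r'" "inv_frac p' r'"
    using invariantsE[OF assms(2)] .
  have e: "q \<otimes>\<^bsub>F\<^esub> q' = frac_of CR (p \<otimes>\<^bsub>CR\<^esub> p') (r \<otimes>\<^bsub>CR\<^esub> r')"
    unfolding 1(3) 2(3) rational_functions_def by (rule CR.mult_frac[OF 1(1) 2(1) 1(2) 2(2)])
  have "inv_frac (p \<otimes>\<^bsub>CR\<^esub> p') (r \<otimes>\<^bsub>CR\<^esub> r')" unfolding inv_frac_def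
  proof (intro ballI)
    fix g x assume g: "g \<in> U" and x: "x \<in> C"
    have "(p x * r (cj g x)) * (p' x * r' (cj g x)) = (p (cj g x) * r x) * (p' (cj g x) * r' x)"
      using 1(4) 2(4) g x by (simp add: inv_frac_def)
    then show "(p \<otimes>\<^bsub>CR\<^esub> p') x * (r \<otimes>\<^bsub>CR\<^esub> r') (cj g x) = (p \<otimes>\<^bsub>CR\<^esub> p') (cj g x) * (r \<otimes>\<^bsub>CR\<^esub> r') x"
      using x cj_stable[OF g x] by (simp add: CR_simps mult_ac)
  qed
  then show ?thesis unfolding e using 1 2 by (subst invariants_iff) (auto simp: CR.integral_iff)
qed

lemma inv_add:
  assumes "q \<in> invariants N C U" "q' \<in> invariants N C U" shows "q \<oplus>\<^bsub>F\<^esub> q' \<in> invariants N C U"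
proof -
  obtain p r where 1: "p \<in> carrier CR" "r \<in> carrier CR - {\<zero>\<^bsub>CR\<^esub>}" "q = frac_of CR p r" "inv_frac p r"
    using invariantsE[OF assms(1)] .
  obtain p' r' where 2: "p' \<in> carrier CR" "r' \<in> carrier CR - {\<zero>\<^bsub>CR\<^esub>}" "q' = frac_of CR p' r'" "inv_frac p' r'"
    using invariantsE[OF assms(2)] .
  have e: "q \<oplus>\<^bsub>F\<^esub> q' = frac_of CR (p \<otimes>\<^bsub>CR\<^esub> r' \<oplus>\<^bsub>CR\<^esub> p' \<otimes>\<^bsub>CR\<^esub> r) (r \<otimes>\<^bsub>CR\<^esub> r')"
    unfolding 1(3) 2(3) rational_functions_def by (rule CR.add_frac[OF 1(1) 2(1) 1(2) 2(2)])
  have "inv_frac (p \<otimes>\<^bsub>CR\<^esub> r' \<oplus>\<^bsub>CR\<^esub> p' \<otimes>\<^bsub>CR\<^esub> r) (r \<otimes>\<^bsub>CR\<^esub> r')" unfolding inv_frac_def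
  proof (intro ballI)
    fix g x assume g: "g \<in> U" and x: "x \<in> C"
    let ?y = "cj g x"
    have a: "p x * r ?y = p ?y * r x" "p' x * r' ?y = p' ?y * r' x"
      using 1(4) 2(4) g x by (auto simp: inv_frac_def)
    have "(p x * r' x + p' x * r x) * (r ?y * r' ?y) = (p x * r ?y) * (r' x * r' ?y) + (p' x * r' ?y) * (r x * r ?y)"
      by (simp add: algebra_simps)
    also have "\<dots> = (p ?y * r' ?y + p' ?y * r ?y) * (r x * r' x)" unfolding a by (simp add: algebra_simps)
    finally show "(p \<otimes>\<^bsub>CR\<^esub> r' \<oplus>\<^bsub>CR\<^esub> p' \<otimes>\<^bsub>CR\<^esub> r) x * (r \<otimes>\<^bsub>CR\<^esub> r') ?y = (p \<otimes>\<^bsub>CR\<^esub> r' \<oplus>\<^bsub>CR\<^esub> p' \<otimes>\<^bsub>CR\<^esub> r) ?y * (r \<otimes>\<^bsub>CR\<^esub> r') x"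
      using x cj_stable[OF g x] by (simp add: CR_simps)
  qed
  then show ?thesis unfolding e using 1 2 by (subst invariants_iff) (auto simp: CR.integral_iff)
qed

lemma inv_inverse:
  assumes "q \<in> invariants N C U" "q \<noteq> \<zero>\<^bsub>F\<^esub>" shows "inv\<^bsub>F\<^esub> q \<in> invariants N C U"
proof -
  obtain p r where 1: "p \<in> carrier CR" "r \<in> carrier CR - {\<zero>\<^bsub>CR\<^esub>}" "q = frac_of CR p r" "inv_frac p r"
    using invariantsE[OF assms(1)] .
  have "p \<noteq> \<zero>\<^bsub>CR\<^esub>"
    using assms(2) 1 unfolding rational_functions_def CR.zero_fraction_field
    by (auto simp: CR.frac_eq_iff)
  then have p: "p \<in> carrier CR - {\<zero>\<^bsub>CR\<^esub>}" using 1 by auto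
  have f: "frac_of CR r p \<in> carrier F"
    unfolding rational_functions_def using 1 p by (intro CR.frac_in_carrier) auto
  have "q \<otimes>\<^bsub>F\<^esub> frac_of CR r p = frac_of CR (p \<otimes>\<^bsub>CR\<^esub> r) (r \<otimes>\<^bsub>CR\<^esub> p)"
    unfolding 1(3) rational_functions_def using 1 p by (intro CR.mult_frac) auto
  also have "\<dots> = \<one>\<^bsub>F\<^esub>"
    unfolding rational_functions_def CR.one_fraction_field using 1 p
    by (subst CR.frac_eq_iff) (auto simp: CR.m_comm CR.integral_iff)
  finally have "inv\<^bsub>F\<^esub> q = frac_of CR r p"
    using F.comm_inv_char[OF invariants_carrier[OF assms(1)] f] by simp
  moreover have "inv_frac r p" using 1(4) by (auto simp: inv_frac_def mult.commute)
  ultimately show ?thesis using invariants_iff[OF _ p, of r] 1 by auto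
qed

lemma generate_field_invariants:
  assumes "H \<subseteq> invariants N C U" shows "generate_field F H \<subseteq> invariants N C U"
proof
  have c: "ratfun_of N C (\<lambda>_. k) \<in> invariants N C U" for k by (intro inv_ratfun regular.const) auto
  have c1: "ratfun_of N C (\<lambda>_. 1) = \<one>\<^bsub>F\<^esub>"
    unfolding ratfun_of_def rational_functions_def CR.one_fraction_field by (simp add: CR_simps restrict_def)
  fix q assume "q \<in> generate_field F H"
  then show "q \<in> invariants N C U"
  proof induction
    case one then show ?case using c[of 1] c1 by simp
  next
    case (a_inv h)
    obtain p r where 1: "p \<in> carrier CR" "r \<in> carrier CR - {\<zero>\<^bsub>CR\<^esub>}" "h = frac_of CR p r"
      using F_cases[OF invariants_carrier[OF a_inv.IH]] .
    obtain r' where r': "r' \<in> regular_funs N" "\<forall>x\<in>C. r x = r' x" using CR_regular 1(2) by blast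
    have "\<ominus>\<^bsub>F\<^esub> h = ratfun_of N C (\<lambda>_. -1) \<otimes>\<^bsub>F\<^esub> h"
    proof (rule ev_eqI)
      show h: "\<ominus>\<^bsub>F\<^esub> h \<in> carrier F" "ratfun_of N C (\<lambda>_. -1) \<otimes>\<^bsub>F\<^esub> h \<in> carrier F"
        using invariants_carrier[OF a_inv.IH] ratfun_carrier[OF regular.const, of "-1"] by auto
      show "r' \<in> regular_funs N" "\<exists>x\<in>C. r' x \<noteq> 0" using r' CR_nonzeroD[OF 1(2)] by auto
      show "\<exists>v. ev x (\<ominus>\<^bsub>F\<^esub> h) v \<and> ev x (ratfun_of N C (\<lambda>_. -1) \<otimes>\<^bsub>F\<^esub> h) v" if x: "x \<in> C" "r' x \<noteq> 0" for x
      proof -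
        have "ev x h (p x / r x)" unfolding 1(3) using x r' 1 by (intro ev_frac) auto
        from ev_uminus[OF this] ev_mult[OF ev_const[OF x(1), of "-1"] this] show ?thesis by auto
      qed
    qed
    then show ?case using inv_mult[OF c a_inv.IH] by simp
  qed (use assms inv_inverse inv_add inv_mult in auto)
qed

end

section \<open>The unipotent radical and its invariants\<close>

text \<open>The partition enters only through the number \<open>B i\<close> of the block of \<open>i\<close>, the total number of blocks being \<open>L\<close>.\<close>

locale block_form = generic_form +
  fixes B :: "nat \<Rightarrow> nat" and L :: nat
  assumes B_mono: "a \<in> {1..N} \<Longrightarrow> b \<in> {1..N} \<Longrightarrow> a \<le> b \<Longrightarrow> B a \<le> B b"
    and B_opp: "a \<in> {1..N} \<Longrightarrow> B (Suc N - a) + B a = Suc L"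
    and B_mid: "mid a \<Longrightarrow> mid b \<Longrightarrow> B a = B b"
    and B_region: "a \<in> {1..N} \<Longrightarrow> b \<in> {1..N} \<Longrightarrow> B a = B b \<Longrightarrow>
      (a \<le> m \<and> b \<le> m) \<or> (mid a \<and> mid b) \<or> (N - m < a \<and> N - m < b)"
begin

sublocale irr: irreducible_set N C
proof
  show "C \<subseteq> carrier_mat N N" using C_carrier by blast
  show "C \<noteq> {}" by (rule C_nonempty)
  fix f g :: "'a mat \<Rightarrow> 'a"
  assume fg: "f \<in> regular_funs N" "g \<in> regular_funs N" "\<exists>x\<in>C. f x \<noteq> 0" "\<exists>x\<in>C. g x \<noteq> 0"
  then obtain x y where "x \<in> C" "f x \<noteq> 0" "y \<in> C" "g y \<noteq> 0" by blast
  then show "\<exists>x\<in>C. f x \<noteq> 0 \<and> g x \<noteq> 0" using component_irreducible[OF fg(1,2) \<epsilon>_cases] by blast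
qed

definition radical :: "'a mat set" where
  "radical = {g \<in> G. \<forall>a\<in>{1..N}. \<forall>b\<in>{1..N}. B b \<le> B a \<longrightarrow> entry g a b = (if a = b then 1 else 0)}"

lemma radicalD: "g \<in> radical \<Longrightarrow> a \<in> {1..N} \<Longrightarrow> b \<in> {1..N} \<Longrightarrow> B b \<le> B a \<Longrightarrow> entry g a b = (if a = b then 1 else 0)"
  and radical_G: "g \<in> radical \<Longrightarrow> g \<in> G"
  by (auto simp: radical_def)

lemma radical_U1: assumes "g \<in> radical" shows "g \<in> U1"
proof -
  have "upat g" unfolding upat_def
  proof (intro ballI impI)
    fix i r assume ir: "i \<in> {1..N}" "r \<in> {1..N}" "r \<le> i \<or> mid i \<and> mid r"
    have "B r \<le> B i" using ir(3) B_mono[OF ir(2,1)] B_mid[of i r] by auto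
    then show "entry g i r = (if i = r then 1 else 0)" by (rule radicalD[OF assms ir(1,2)])
  qed
  then show ?thesis using radical_G[OF assms] by (simp add: U1_def)
qed

lemma radical_ginv: assumes "g \<in> radical" shows "ginv g \<in> radical"
proof -
  have "entry (ginv g) a b = (if a = b then 1 else 0)" if ab: "a \<in> {1..N}" "b \<in> {1..N}" "B b \<le> B a" for a b
  proof -
    have "B (Suc N - a) \<le> B (Suc N - b)" using B_opp[OF ab(1)] B_opp[OF ab(2)] ab(3) by linarith
    from radicalD[OF assms opp_mem[OF ab(2)] opp_mem[OF ab(1)] this]
    have e: "entry g (Suc N - b) (Suc N - a) = (if a = b then 1 else 0)" using ab by auto
    show ?thesis unfolding entry_ginv[OF ab(1,2)] e using s_sq[OF opp_mem[OF ab(1)]] by auto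
  qed
  then show ?thesis using G_ginv[OF radical_G[OF assms]] by (simp add: radical_def)
qed

lemma ring_mat_inv:
  assumes "g \<in> G" shows "inv\<^bsub>ring_mat TYPE('a) N ()\<^esub> g = ginv g"
proof -
  interpret R: ring "ring_mat TYPE('a) N ()" by (rule ring_mat)
  show ?thesis
    by (rule R.inv_char) (use assms G_carrier ginv_left ginv_right in \<open>auto simp: ring_mat_simps\<close>)
qed

lemma conj_twice:
  assumes g: "g \<in> G" and h: "h \<in> carrier_mat N N" "h * g = 1\<^sub>m N" "g * h = 1\<^sub>m N" and x: "x \<in> carrier_mat N N"
  shows "h * (g * x * h) * g = x"
proof -
  note c = G_carrier[OF g] h(1) x
  have "h * (g * x * h) * g = (h * g) * x * (h * g)"
    using c mult_carrier_mat[OF c(1,3)] mult_carrier_mat[OF c(2,1)] mult_carrier_mat[OF c(3,2)]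
      mult_carrier_mat[OF mult_carrier_mat[OF c(1,3)] c(2)]
    by (simp add: assoc_mult_mat[of _ N N _ N _ N])
  then show ?thesis using c unfolding h(2) by simp
qed

sublocale irr: conj_action N C radical
proof
  fix g assume g: "g \<in> radical"
  note gG = radical_G[OF g] and gi = radical_ginv[OF g]
  show "inv\<^bsub>ring_mat TYPE('a) N ()\<^esub> g * x * g \<in> C" if "x \<in> C" for x
    using conj_C[OF radical_G[OF gi] that] unfolding ring_mat_inv[OF gG] ginv_ginv[OF gG] .
  have "\<forall>x\<in>C. ginv g * (g * x * ginv g) * g = x \<and> g * (ginv g * x * g) * ginv g = x"
    using conj_twice[OF gG ginv_carrier ginv_left[OF gG] ginv_right[OF gG] C_carrier]
      conj_twice[OF radical_G[OF gi] G_carrier[OF gG] ginv_right[OF gG] ginv_left[OF gG] C_carrier] by blast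
  then show "\<exists>h\<in>radical. \<forall>x\<in>C.
      inv\<^bsub>ring_mat TYPE('a) N ()\<^esub> g * (inv\<^bsub>ring_mat TYPE('a) N ()\<^esub> h * x * h) * g = x \<and>
      inv\<^bsub>ring_mat TYPE('a) N ()\<^esub> h * (inv\<^bsub>ring_mat TYPE('a) N ()\<^esub> g * x * g) * h = x"
    using gi unfolding ring_mat_inv[OF gG]
    by (intro bexI[of _ "ginv g"]) (simp_all add: ring_mat_inv[OF radical_G[OF gi]] ginv_ginv[OF gG])
  fix f :: "'a mat \<Rightarrow> 'a" assume f: "f \<in> regular_funs N"
  show "(\<lambda>x. f (inv\<^bsub>ring_mat TYPE('a) N ()\<^esub> g * x * g)) \<in> regular_funs N"
    unfolding ring_mat_inv[OF gG]
  proof (rule regular.regular_comp[OF f])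
    note c = G_carrier[OF gG] ginv_carrier[of g]
    show "ginv g * x * g \<in> carrier_mat N N" if "x \<in> carrier_mat N N" for x
      using mult_carrier_mat[OF mult_carrier_mat[OF c(2) that] c(1)] .
    fix i j assume ij: "i \<in> {1..N}" "j \<in> {1..N}"
    have e: "entry (ginv g * x * g) i j = (\<Sum>k=1..N. (\<Sum>l=1..N. entry (ginv g) i l * entry x l k) * entry g k j)"
      if "x \<in> carrier_mat N N" for x
      using ij by (simp add: entry_mult[OF mult_carrier_mat[OF c(2) that] c(1)] entry_mult[OF c(2) that])
    have "(\<lambda>x. \<Sum>k=1..N. (\<Sum>l=1..N. entry (ginv g) i l * entry x l k) * entry g k j) \<in> regular_funs N"
      by (intro regular.sum regular.mult regular.const regular_entry)
    then show "(\<lambda>x. entry (ginv g * x * g) i j) \<in> regular_funs N"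
      by (rule regular.cong) (simp add: e)
  qed
qed

lemma cj_ginv: "g \<in> radical \<Longrightarrow> irr.cj g x = ginv g * x * ginv (ginv g)"
  unfolding irr.cj_def ring_mat_inv[OF radical_G] ginv_ginv[OF radical_G] ..

definition gen_pairs :: "(nat \<times> nat) set" where
  "gen_pairs = {(i, j). i \<in> {1..N} \<and> j \<in> {1..N} \<and> N - m < i \<and> (j < i \<or> (j = i \<and> sg = -1)) \<and> B (Suc N - j) \<le> B i}"

text \<open>The pairs of \<open>S_circ\<close> above the antidiagonal: \<open>i\<close> and \<open>j'\<close> lie in the same block (\<open>gen_pairs_split\<close>).\<close>

definition upper_pairs :: "(nat \<times> nat) set" where
  "upper_pairs = {(i, j). i \<in> {1..N} \<and> j \<in> {1..N} \<and> N - m < i \<and> i + j < Suc N \<and> B i = B (Suc N - j)}"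

lemma gen_pairs_split: "gen_pairs = lower_pairs \<union> upper_pairs"
proof -
  have 1: "B (Suc N - j) \<le> B i" if "i \<in> {1..N}" "j \<in> {1..N}" "i + j \<ge> Suc N" for i j
    using that by (intro B_mono) auto
  have 2: "B i \<le> B (Suc N - j)" if "i \<in> {1..N}" "j \<in> {1..N}" "i + j < Suc N" for i j
    using that by (intro B_mono) auto
  show ?thesis
  proof (rule subset_antisym; rule subsetI)
    fix s assume s: "s \<in> gen_pairs"
    obtain i j where ij: "s = (i, j)" by (cases s)
    show "s \<in> lower_pairs \<union> upper_pairs" using s 2[of i j] unfolding ij by (cases "i + j < Suc N") (auto simp: gen_pairs_def upper_pairs_def lower_pairs_def)
  next
    fix s assume s: "s \<in> lower_pairs \<union> upper_pairs"
    obtain i j where ij: "s = (i, j)" by (cases s)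
    show "s \<in> gen_pairs" using s 1[of i j] m_le unfolding ij by (auto simp: gen_pairs_def upper_pairs_def lower_pairs_def)
  qed
qed

lemma finite_gen_pairs: "finite gen_pairs"
  by (rule finite_subset[of _ "{1..N} \<times> {1..N}"]) (auto simp: gen_pairs_def)

lemma J_poly_lower_pairs: "(i, j) \<in> lower_pairs \<Longrightarrow> x \<in> carrier_mat N N \<Longrightarrow> J_poly N (i, j) x = Jl i j x"
  unfolding Jl_def by (rule J_poly_lower) (auto simp: lower_pairs_def)

lemma Jl_regular: "(i, j) \<in> lower_pairs \<Longrightarrow> Jl i j \<in> regular_funs N"
  unfolding Jl_def by (rule mixed_minor_regular) (auto simp: lower_pairs_def)

lemma J_regular: assumes "a \<in> gen_pairs" shows "(J_poly N a :: 'a mat \<Rightarrow> 'a) \<in> regular_funs N"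
proof -
  obtain i j where a: "a = (i, j)" by (cases a)
  show ?thesis
  proof (cases "a \<in> lower_pairs")
    case True
    have "Jl i j \<in> regular_funs N" using True a Jl_regular by simp
    then show ?thesis unfolding a
      by (rule regular.cong) (use True a J_poly_lower_pairs in auto)
  next
    case False
    then have ij: "i \<in> {1..N}" "j \<in> {1..N}" "i + j < Suc N" using assms unfolding gen_pairs_split a upper_pairs_def by auto
    have "(\<lambda>x. det (sel x (\<lambda>p. if p = 0 then i else Suc N - j + p) Suc j)) \<in> regular_funs N"
    proof (rule regular.det)
      fix p q assume pq: "p < j" "q < j"
      have "(if p = 0 then i else Suc N - j + p) \<in> {1..N}" "Suc q \<in> {1..N}" using pq ij by auto
      from regular_entry[OF this]
      show "(\<lambda>x. sel x (\<lambda>p. if p = 0 then i else Suc N - j + p) Suc j $$ (p, q)) \<in> regular_funs N"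
        using pq by (simp add: sel_def)
    qed (rule sel_carrier)
    then show ?thesis unfolding a by (rule regular.cong) (simp add: J_poly_upper[OF _ ij])
  qed
qed

text \<open>Above the antidiagonal the rows of the minor are row \<open>i\<close> and all rows below row \<open>j'\<close>. An element of the radical adds to
  row \<open>i\<close> only rows of later blocks, and these are among them because \<open>i\<close> and \<open>j'\<close> lie in the same block.\<close>

lemma J_invariant:
  assumes a: "a \<in> gen_pairs" and h: "h \<in> radical" and x: "x \<in> C"
  shows "J_poly N a (h * x * ginv h) = J_poly N a x"
proof -
  obtain i j where ij: "a = (i, j)" by (cases a)
  have ut: "utri h" "utri (ginv h)" using U1_utri[OF radical_U1] radical_ginv[OF h] h by auto
  note c = G_carrier[OF radical_G[OF h]] C_carrier[OF x] ginv_carrier[of h]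
  have hx: "h * x \<in> carrier_mat N N" by (rule mult_carrier_mat[OF c(1,2)])
  have hxh: "h * x * ginv h \<in> carrier_mat N N" by (rule mult_carrier_mat[OF hx c(3)])
  show ?thesis
  proof (cases "a \<in> lower_pairs")
    case True
    then show ?thesis
      unfolding ij J_poly_lower_pairs[OF True[unfolded ij] hxh] J_poly_lower_pairs[OF True[unfolded ij] c(2)] Jl_def
      using mixed_minor_conj[OF radical_G[OF h] ut(1) C_G[OF x]] by (auto simp: lower_pairs_def)
  next
    case False
    then have ijN: "i \<in> {1..N}" "j \<in> {1..N}" "i + j < Suc N" "B i = B (Suc N - j)"
      using a unfolding gen_pairs_split ij upper_pairs_def by auto
    define f where "f p = (if p = 0 then i else Suc N - j + p)" for p
    have f: "f p \<in> {1..N}" "Suc p \<in> {1..N}" if "p < j" for p using that ijN by (auto simp: f_def)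
    have mono: "strict_mono_on {..<j} f" using ijN by (auto simp: strict_mono_on_def f_def)
    have fim: "r \<in> f ` {..<j}" if "Suc N - j < r" "r \<le> N" for r
      using that ijN by (intro image_eqI[of _ _ "r - (Suc N - j)"]) (auto simp: f_def)
    have i_im: "i \<in> f ` {..<j}" using ijN by (intro image_eqI[of _ _ 0]) (auto simp: f_def)
    have 1: "sel (h * x) f Suc j = sel h f f j * sel x f Suc j"
    proof (rule sel_mult_left[OF c(1,2)])
      fix p q r assume pq: "p < j" "q < j" "r \<in> {1..N}" "r \<notin> f ` {..<j}"
      have r: "r \<le> Suc N - j" "r \<noteq> i" using fim[of r] i_im pq by auto
      have "B r \<le> B (f p)"
      proof (cases "p = 0")
        case True
        then show ?thesis using B_mono[of r "Suc N - j"] r pq ijN by (auto simp: f_def)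
      next
        case False
        then show ?thesis using r by (intro B_mono pq f(1)) (auto simp: f_def)
      qed
      moreover have "f p \<noteq> r" using pq by auto
      ultimately show "entry h (f p) r * entry x r (Suc q) = 0"
        using radicalD[OF h f(1)[OF pq(1)] pq(3)] by simp
    qed (use f strict_mono_on_imp_inj_on[OF mono] in auto)
    have 2: "sel (h * x * ginv h) f Suc j = sel (h * x) f Suc j * sel (ginv h) Suc Suc j"
    proof (rule sel_mult_left[OF hx c(3)])
      fix p q r assume "p < j" "q < j" "r \<in> {1..N}" "r \<notin> Suc ` {..<j}"
      then have "Suc q < r" by (auto simp: image_Suc_lessThan)
      then show "entry (h * x) (f p) r * entry (ginv h) r (Suc q) = 0"
        using utriD[OF ut(2) \<open>r \<in> {1..N}\<close>, of "Suc q"] \<open>r \<in> {1..N}\<close> by simp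
    qed (use f in auto)
    have 3: "det (sel h f f j) = 1" by (rule det_sel_unit[of N]) (use utriD[OF ut(1)] f mono in auto)
    have 4: "det (sel (ginv h) Suc Suc j) = 1"
      by (rule det_sel_unit[of N]) (use utriD[OF ut(2)] f in \<open>auto simp: strict_mono_on_def\<close>)
    show ?thesis
      unfolding ij J_poly_upper[OF hxh ijN(1-3)] J_poly_upper[OF c(2) ijN(1-3)] f_def[symmetric] 1 2
      using det_mult[OF mult_carrier_mat[OF sel_carrier sel_carrier] sel_carrier, of h f f j x f Suc "ginv h" Suc Suc]
        det_mult[OF sel_carrier sel_carrier, of h f f j x f Suc] 3 4 by simp
  qed
qed

lemma J_circ_invariant: "a \<in> gen_pairs \<Longrightarrow> J_circ N C a \<in> invariants N C radical"
  unfolding J_circ_def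
  by (rule irr.inv_ratfun[OF J_regular]) (auto simp: cj_ginv J_invariant radical_ginv)

lemma bordered_minor_regular: assumes "mid a" "mid b" shows "bordered_minor a b \<in> regular_funs N"
proof -
  have r: "a \<in> {1..N}" "b \<in> {1..N}" using assms by (auto simp: mid_def)
  have i: "(if p = 0 then a else N - m + p) \<in> {1..N}" "(if p < m then Suc p else b) \<in> {1..N}" if "p < Suc m" for p
    using that r m_le by auto
  show ?thesis unfolding bordered_minor_def[abs_def]
  proof (rule regular.det)
    fix p q assume pq: "p < Suc m" "q < Suc m"
    show "(\<lambda>x. sel x (\<lambda>p. if p = 0 then a else N - m + p) (\<lambda>q. if q < m then Suc q else b) (Suc m) $$ (p, q)) \<in> regular_funs N"
      using pq regular_entry[OF i(1)[OF pq(1)] i(2)[OF pq(2)]] by (simp add: sel_def)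
  qed (rule sel_carrier)
qed

lemma corner_minor_m_regular: "mixed_minor m 0 \<in> regular_funs N" using m_le by (intro mixed_minor_regular) auto

definition Pf :: "nat \<times> nat \<Rightarrow> 'a ratfun" where
  "Pf = (\<lambda>(a, b). ratfun_of N C (bordered_minor a b) \<otimes>\<^bsub>irr.F\<^esub> inv\<^bsub>irr.F\<^esub> (ratfun_of N C (mixed_minor m 0)))"

definition F0B :: "'a ratfun set" where
  "F0B = generate_field irr.F (range (\<lambda>c. ratfun_of N C (\<lambda>_. c)) \<union> Pf ` {(a, b). mid a \<and> mid b})"

lemma corner_minor_m_Gen: assumes "Gen x \<noteq> 0" shows "mixed_minor m 0 x \<noteq> 0"
proof (cases "m = 0")
  case True
  then show ?thesis using det_dim_zero[of "stack 0 0 x (adj_mat x)"] by (simp add: mixed_minor_def stack_def)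
next
  case False
  then show ?thesis using GenD(1)[OF assms, of m] m_le by (auto simp: corner_sizes_def)
qed

lemma corner_minor_m_nonzero: "\<exists>x\<in>C. mixed_minor m 0 x \<noteq> 0" using Gen_nonzero corner_minor_m_Gen by blast

lemma Pf_invariant: assumes "mid a" "mid b" shows "Pf (a, b) \<in> invariants N C radical"
proof -
  have "ratfun_of N C (bordered_minor a b) \<in> invariants N C radical"
    by (rule irr.inv_ratfun[OF bordered_minor_regular[OF assms]])
      (auto simp: cj_ginv intro!: bordered_minor_conj[OF radical_U1[OF radical_ginv] C_carrier assms])
  moreover have "ratfun_of N C (mixed_minor m 0) \<in> invariants N C radical"
  proof (rule irr.inv_ratfun[OF corner_minor_m_regular])
    fix g x assume g: "g \<in> radical" and x: "x \<in> C"
    show "mixed_minor m 0 (irr.cj g x) = mixed_minor m 0 x"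
      unfolding cj_ginv[OF g]
      by (rule mixed_minor_conj[OF radical_G[OF radical_ginv[OF g]] U1_utri[OF radical_U1[OF radical_ginv[OF g]]] C_G[OF x]]) (use m_le in auto)
  qed
  moreover have "ratfun_of N C (mixed_minor m 0) \<noteq> \<zero>\<^bsub>irr.F\<^esub>"
    using corner_minor_m_nonzero irr.ev_nonzero[OF irr.ev_ratfun[OF _ corner_minor_m_regular]] by blast
  ultimately show ?thesis unfolding Pf_def by (simp add: irr.inv_mult irr.inv_inverse)
qed

lemma F0B_invariant: "F0B \<subseteq> invariants N C radical"
  unfolding F0B_def
proof (rule irr.generate_field_invariants)
  have "ratfun_of N C (\<lambda>_. c) \<in> invariants N C radical" for c by (intro irr.inv_ratfun regular.const) auto
  then show "range (\<lambda>c. ratfun_of N C (\<lambda>_. c)) \<union> Pf ` {(a, b). mid a \<and> mid b} \<subseteq> invariants N C radical"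
    using Pf_invariant by auto
qed

end

section \<open>Algebraic independence\<close>

lemma (in ring) indexed_pset_support:
  assumes "P \<in> indexed_pset I K" "\<zero> \<in> K" "\<And>a b. a \<in> K \<Longrightarrow> b \<in> K \<Longrightarrow> a \<oplus> b \<in> K"
  shows "finite {k. P k \<noteq> \<zero>} \<and> (\<forall>k. P k \<in> K) \<and> (\<forall>k. P k \<noteq> \<zero> \<longrightarrow> set_mset k \<subseteq> I)"
  using assms(1)
proof induction
  case (indexed_const c)
  have "{k. indexed_const c k \<noteq> \<zero>} \<subseteq> {{#}}" by (auto simp: indexed_const_def split: if_splits)
  then show ?case using indexed_const assms(2) finite_subset by (fastforce simp: indexed_const_def)
next
  case (indexed_padd P Q)
  have "{k. indexed_padd P Q k \<noteq> \<zero>} \<subseteq> {k. P k \<noteq> \<zero>} \<union> {k. Q k \<noteq> \<zero>}"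
    by (auto simp: indexed_padd_def)
  then have "finite {k. indexed_padd P Q k \<noteq> \<zero>}" using indexed_padd.IH finite_subset by blast
  moreover have "\<forall>k. indexed_padd P Q k \<noteq> \<zero> \<longrightarrow> P k \<noteq> \<zero> \<or> Q k \<noteq> \<zero>" by (auto simp: indexed_padd_def)
  ultimately show ?case using indexed_padd.IH assms(3) by (fastforce simp: indexed_padd_def)
next
  case (indexed_pmult P i)
  have "{k. indexed_pmult P i k \<noteq> \<zero>} \<subseteq> add_mset i ` {k. P k \<noteq> \<zero>}"
  proof
    fix k assume "k \<in> {k. indexed_pmult P i k \<noteq> \<zero>}"
    then have "i \<in># k" "P (k - {#i#}) \<noteq> \<zero>" by (auto simp: indexed_pmult_def split: if_splits)
    then show "k \<in> add_mset i ` {k. P k \<noteq> \<zero>}" by (intro image_eqI[of _ _ "k - {#i#}"]) auto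
  qed
  then have "finite {k. indexed_pmult P i k \<noteq> \<zero>}" using indexed_pmult.IH finite_subset by blast
  moreover have "set_mset k \<subseteq> I" if k: "indexed_pmult P i k \<noteq> \<zero>" for k
  proof -
    have "i \<in># k" "P (k - {#i#}) \<noteq> \<zero>" using k by (auto simp: indexed_pmult_def split: if_splits)
    then have "set_mset (k - {#i#}) \<subseteq> I" "k = add_mset i (k - {#i#})" using indexed_pmult.IH by auto
    then show ?thesis using indexed_pmult.hyps(2) by (metis insert_subset set_mset_add_mset_insert)
  qed
  ultimately show ?case using indexed_pmult.IH assms(2) by (auto simp: indexed_pmult_def)
qed

lemma (in irreducible_set) regular_mult_nonzero:
  assumes "f \<in> regular_funs N" "g \<in> regular_funs N" "\<exists>x\<in>C. f x \<noteq> 0" "\<exists>x\<in>C. g x \<noteq> 0"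
  shows "(\<lambda>x. f x * g x) \<in> regular_funs N" "\<exists>x\<in>C. f x * g x \<noteq> 0"
  using irreducible[OF assms] assms(1,2) by (auto intro: regular.mult)

lemma (in irreducible_set) regular_prod_nonzero:
  assumes "finite A" "\<And>a. a \<in> A \<Longrightarrow> f a \<in> regular_funs N \<and> (\<exists>x\<in>C. f a x \<noteq> 0)"
  shows "(\<lambda>x. \<Prod>a\<in>A. f a x) \<in> regular_funs N \<and> (\<exists>x\<in>C. (\<Prod>a\<in>A. f a x) \<noteq> 0)"
  using assms
proof (induction A rule: finite_induct)
  case empty then show ?case using C_not_empty by (auto intro: regular.const)
next
  case (insert a A)
  have "(\<lambda>x. \<Prod>a\<in>A. f a x) \<in> regular_funs N" "\<exists>x\<in>C. (\<Prod>a\<in>A. f a x) \<noteq> 0"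
    "f a \<in> regular_funs N" "\<exists>x\<in>C. f a x \<noteq> 0"
    using insert by auto
  then show ?case using regular_mult_nonzero[of "f a" "\<lambda>x. \<Prod>a\<in>A. f a x"] insert.hyps by simp
qed

lemma (in irreducible_set) frac_regular:
  assumes "q \<in> carrier F"
  obtains p r where "p \<in> regular_funs N" "r \<in> regular_funs N" "\<exists>x\<in>C. r x \<noteq> 0"
    "q = frac_of CR (restrict p C) (restrict r C)" "\<And>x. x \<in> C \<Longrightarrow> r x \<noteq> 0 \<Longrightarrow> ev x q (p x / r x)"
    "q \<noteq> \<zero>\<^bsub>F\<^esub> \<Longrightarrow> \<exists>x\<in>C. p x \<noteq> 0"
proof -
  obtain p r where 1: "p \<in> carrier CR" "r \<in> carrier CR - {\<zero>\<^bsub>CR\<^esub>}" "q = frac_of CR p r" using F_cases[OF assms] .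
  obtain p' r' where 2: "p' \<in> regular_funs N" "p = restrict p' C" "r' \<in> regular_funs N" "r = restrict r' C"
    using 1(1,2) by (auto simp: carrier_CR)
  have 3: "\<exists>x\<in>C. r' x \<noteq> 0" using CR_nonzeroD[OF 1(2)] 2 by auto
  have 4: "ev x q (p' x / r' x)" if "x \<in> C" "r' x \<noteq> 0" for x
    using ev_frac[of x p r] 1 2 that by auto
  have 5: "\<exists>x\<in>C. p' x \<noteq> 0" if "q \<noteq> \<zero>\<^bsub>F\<^esub>"
  proof (rule ccontr)
    assume "\<not> (\<exists>x\<in>C. p' x \<noteq> 0)"
    then have "p = \<zero>\<^bsub>CR\<^esub>" using 2 by (auto simp: CR_simps restrict_def fun_eq_iff)
    then have "q = \<zero>\<^bsub>F\<^esub>" using 1 unfolding rational_functions_def CR.zero_fraction_field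
      by (simp add: CR.frac_eq_iff)
    then show False using that by simp
  qed
  show ?thesis using that[OF 2(1,3) 3 _ 4 5] 1(3) 2 by simp
qed

context block_form
begin

text \<open>The points \<open>x\<close> and \<open>x'\<close> have the same middle quotients \<open>P\<^sub>a\<^sub>b\<close>, with denominators cleared.\<close>

definition sim :: "'a mat \<Rightarrow> 'a mat \<Rightarrow> bool" where
  "sim x x' \<longleftrightarrow> (\<forall>a b. mid a \<longrightarrow> mid b \<longrightarrow> bordered_minor a b x * mixed_minor m 0 x' = bordered_minor a b x' * mixed_minor m 0 x)"

lemma sim_trans:
  assumes "sim x y" "sim y z" "mixed_minor m 0 y \<noteq> 0" shows "sim x z"
  unfolding sim_def
proof (intro allI impI)
  fix a b assume ab: "mid a" "mid b"
  have 1: "bordered_minor a b x * mixed_minor m 0 y = bordered_minor a b y * mixed_minor m 0 x" "bordered_minor a b y * mixed_minor m 0 z = bordered_minor a b z * mixed_minor m 0 y"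
    using assms(1,2) ab by (auto simp: sim_def)
  have "mixed_minor m 0 y * (bordered_minor a b x * mixed_minor m 0 z) = (bordered_minor a b x * mixed_minor m 0 y) * mixed_minor m 0 z" by simp
  also have "\<dots> = (bordered_minor a b y * mixed_minor m 0 z) * mixed_minor m 0 x" unfolding 1(1) by simp
  also have "\<dots> = mixed_minor m 0 y * (bordered_minor a b z * mixed_minor m 0 x)" unfolding 1(2) by simp
  finally show "bordered_minor a b x * mixed_minor m 0 z = bordered_minor a b z * mixed_minor m 0 x" using assms(3) by simp
qed

lemma ev_Pf:
  assumes "mid a" "mid b" "x \<in> C" "mixed_minor m 0 x \<noteq> 0" shows "irr.ev x (Pf (a, b)) (bordered_minor a b x / mixed_minor m 0 x)"
  unfolding Pf_def
  using irr.ev_divide[OF irr.ev_ratfun[OF assms(3) bordered_minor_regular[OF assms(1,2)]] irr.ev_ratfun[OF assms(3) corner_minor_m_regular] assms(4)]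
  by simp

text \<open>Elements of \<open>F0B\<close> are rational expressions in the middle quotients, so outside the zeros of some \<open>g\<close> their values
  depend on these quotients only.\<close>

lemma F0B_values:
  assumes "q \<in> F0B"
  shows "\<exists>g\<in>regular_funs N. (\<exists>x\<in>C. g x \<noteq> 0) \<and>
    (\<forall>x\<in>C. \<forall>x'\<in>C. sim x x' \<and> g x \<noteq> 0 \<and> g x' \<noteq> 0 \<longrightarrow> (\<exists>v. irr.ev x q v \<and> irr.ev x' q v))"
  using assms unfolding F0B_def
proof induction
  case one
  show ?case using C_nonempty irr.ev_one by (intro bexI[of _ "\<lambda>_. 1"] regular.const) auto
next
  case (incl q)
  then consider c where "q = ratfun_of N C (\<lambda>_. c)" | a b where "mid a" "mid b" "q = Pf (a, b)" by auto
  then show ?case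
  proof cases
    case 1
    show ?thesis using C_nonempty irr.ev_const unfolding 1 by (intro bexI[of _ "\<lambda>_. 1"] regular.const) auto
  next
    case 2
    show ?thesis
    proof (intro bexI[OF _ corner_minor_m_regular] conjI corner_minor_m_nonzero ballI impI)
      fix x x' assume x: "x \<in> C" "x' \<in> C" "sim x x' \<and> mixed_minor m 0 x \<noteq> 0 \<and> mixed_minor m 0 x' \<noteq> 0"
      have "bordered_minor a b x / mixed_minor m 0 x = bordered_minor a b x' / mixed_minor m 0 x'"
        using x(3) 2(1,2) by (simp add: frac_eq_eq sim_def)
      then show "\<exists>v. irr.ev x q v \<and> irr.ev x' q v"
        using ev_Pf[OF 2(1,2)] x unfolding 2(3) by metis
    qed
  qed
next
  case (a_inv q)
  obtain g where g: "g \<in> regular_funs N" "\<exists>x\<in>C. g x \<noteq> 0"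
    "\<forall>x\<in>C. \<forall>x'\<in>C. sim x x' \<and> g x \<noteq> 0 \<and> g x' \<noteq> 0 \<longrightarrow> (\<exists>v. irr.ev x q v \<and> irr.ev x' q v)"
    using a_inv.IH by blast
  show ?case
  proof (intro bexI[OF _ g(1)] conjI g(2) ballI impI)
    fix x x' assume "x \<in> C" "x' \<in> C" "sim x x' \<and> g x \<noteq> 0 \<and> g x' \<noteq> 0"
    then obtain v where "irr.ev x q v" "irr.ev x' q v" using g(3) by blast
    then show "\<exists>w. irr.ev x (\<ominus>\<^bsub>irr.F\<^esub> q) w \<and> irr.ev x' (\<ominus>\<^bsub>irr.F\<^esub> q) w"
      using irr.ev_uminus by blast
  qed
next
  case (m_inv q)
  obtain g where g: "g \<in> regular_funs N" "\<exists>x\<in>C. g x \<noteq> 0"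
    "\<forall>x\<in>C. \<forall>x'\<in>C. sim x x' \<and> g x \<noteq> 0 \<and> g x' \<noteq> 0 \<longrightarrow> (\<exists>v. irr.ev x q v \<and> irr.ev x' q v)"
    using m_inv.IH by blast
  have "q \<in> carrier irr.F" using m_inv.hyps(1) F0B_invariant irr.invariants_carrier unfolding F0B_def by blast
  then obtain p r where pr: "p \<in> regular_funs N" "r \<in> regular_funs N" "\<exists>x\<in>C. r x \<noteq> 0"
    "\<And>x. x \<in> C \<Longrightarrow> r x \<noteq> 0 \<Longrightarrow> irr.ev x q (p x / r x)" "q \<noteq> \<zero>\<^bsub>irr.F\<^esub> \<Longrightarrow> \<exists>x\<in>C. p x \<noteq> 0"
    by (rule irr.frac_regular) blast
  note rp = irr.regular_mult_nonzero[OF pr(2,1,3) pr(5)[OF m_inv.hyps(2)]]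
  note grp = irr.regular_mult_nonzero[OF g(1) rp(1) g(2) rp(2)]
  show ?case
  proof (intro bexI[OF _ grp(1)] conjI grp(2) ballI impI)
    fix x x' assume x: "x \<in> C" "x' \<in> C" "sim x x' \<and> g x * (r x * p x) \<noteq> 0 \<and> g x' * (r x' * p x') \<noteq> 0"
    then obtain v where v: "irr.ev x q v" "irr.ev x' q v" using g(3) by fastforce
    have "v = p x / r x" using irr.ev_unique[OF v(1) pr(4)[OF x(1)]] x(3) by auto
    then have "v \<noteq> 0" using x(3) by auto
    then show "\<exists>w. irr.ev x (inv\<^bsub>irr.F\<^esub> q) w \<and> irr.ev x' (inv\<^bsub>irr.F\<^esub> q) w"
      using irr.ev_inverse v by blast
  qed
next
  case (eng_add q q')
  then obtain g g' where g: "g \<in> regular_funs N" "\<exists>x\<in>C. g x \<noteq> 0"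
    "\<forall>x\<in>C. \<forall>x'\<in>C. sim x x' \<and> g x \<noteq> 0 \<and> g x' \<noteq> 0 \<longrightarrow> (\<exists>v. irr.ev x q v \<and> irr.ev x' q v)"
    and g': "g' \<in> regular_funs N" "\<exists>x\<in>C. g' x \<noteq> 0"
    "\<forall>x\<in>C. \<forall>x'\<in>C. sim x x' \<and> g' x \<noteq> 0 \<and> g' x' \<noteq> 0 \<longrightarrow> (\<exists>v. irr.ev x q' v \<and> irr.ev x' q' v)"
    by blast
  note gg = irr.regular_mult_nonzero[OF g(1) g'(1) g(2) g'(2)]
  show ?case
  proof (intro bexI[OF _ gg(1)] conjI gg(2) ballI impI)
    fix x x' assume x: "x \<in> C" "x' \<in> C" "sim x x' \<and> g x * g' x \<noteq> 0 \<and> g x' * g' x' \<noteq> 0"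
    obtain v w where "irr.ev x q v" "irr.ev x' q v" "irr.ev x q' w" "irr.ev x' q' w"
      using g(3) g'(3) x by fastforce
    then show "\<exists>v. irr.ev x (q \<oplus>\<^bsub>irr.F\<^esub> q') v \<and> irr.ev x' (q \<oplus>\<^bsub>irr.F\<^esub> q') v" using irr.ev_add by blast
  qed
next
  case (eng_mult q q')
  then obtain g g' where g: "g \<in> regular_funs N" "\<exists>x\<in>C. g x \<noteq> 0"
    "\<forall>x\<in>C. \<forall>x'\<in>C. sim x x' \<and> g x \<noteq> 0 \<and> g x' \<noteq> 0 \<longrightarrow> (\<exists>v. irr.ev x q v \<and> irr.ev x' q v)"
    and g': "g' \<in> regular_funs N" "\<exists>x\<in>C. g' x \<noteq> 0"
    "\<forall>x\<in>C. \<forall>x'\<in>C. sim x x' \<and> g' x \<noteq> 0 \<and> g' x' \<noteq> 0 \<longrightarrow> (\<exists>v. irr.ev x q' v \<and> irr.ev x' q' v)"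
    by blast
  note gg = irr.regular_mult_nonzero[OF g(1) g'(1) g(2) g'(2)]
  show ?case
  proof (intro bexI[OF _ gg(1)] conjI gg(2) ballI impI)
    fix x x' assume x: "x \<in> C" "x' \<in> C" "sim x x' \<and> g x * g' x \<noteq> 0 \<and> g x' * g' x' \<noteq> 0"
    obtain v w where "irr.ev x q v" "irr.ev x' q v" "irr.ev x q' w" "irr.ev x' q' w"
      using g(3) g'(3) x by fastforce
    then show "\<exists>v. irr.ev x (q \<otimes>\<^bsub>irr.F\<^esub> q') v \<and> irr.ev x' (q \<otimes>\<^bsub>irr.F\<^esub> q') v" using irr.ev_mult by blast
  qed
qed

text \<open>A numerical code for the lexicographic order: pairs on or below the antidiagonal come first, then the column counts,
  then the row from below.\<close>

definition key :: "nat \<times> nat \<Rightarrow> nat" where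
  "key = (\<lambda>(i, j). (if Suc N \<le> i + j then 0 else Suc N * Suc N) + j * Suc N + (N - i))"

lemma lex_less:
  assumes "q * Suc N + a < j * Suc N + b" "a \<le> N" "b \<le> N" shows "q < j \<or> (q = j \<and> a < b)"
proof (cases "q \<le> j")
  case True then show ?thesis using assms(1) by (cases "q = j") auto
next
  case False
  then have "Suc j * Suc N \<le> q * Suc N" by (intro mult_le_mono1) simp
  then show ?thesis using assms by simp
qed

lemma key_less:
  assumes "key (p, q) < key (i, j)" "i \<in> {1..N}" "j \<in> {1..N}" "p \<in> {1..N}" "q \<in> {1..N}"
  shows "(Suc N \<le> p + q \<and> i + j < Suc N) \<or> ((Suc N \<le> p + q \<longleftrightarrow> Suc N \<le> i + j) \<and> (q < j \<or> (q = j \<and> i < p)))"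
proof -
  have s: "j * Suc N + (N - i) < Suc N * Suc N"
  proof -
    have "j * Suc N \<le> N * Suc N" using assms(3) by (intro mult_le_mono1) simp
    then show ?thesis by simp
  qed
  consider "Suc N \<le> p + q \<longleftrightarrow> Suc N \<le> i + j" | "Suc N \<le> p + q" "i + j < Suc N" | "p + q < Suc N" "Suc N \<le> i + j" by linarith
  then show ?thesis
  proof cases
    case 1
    then have "q * Suc N + (N - p) < j * Suc N + (N - i)" using assms(1) by (auto simp: key_def split: if_splits)
    then have "q < j \<or> (q = j \<and> N - p < N - i)" by (rule lex_less) auto
    then show ?thesis using 1 by auto
  next
    case 3
    then have "Suc N * Suc N < j * Suc N + (N - i)" using assms(1) by (simp add: key_def)
    then show ?thesis using s by simp
  qed auto
qed

lemma inj_key: "inj_on key gen_pairs"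
proof (rule inj_onI)
  fix a b assume ab: "a \<in> gen_pairs" "b \<in> gen_pairs" "key a = key b"
  obtain p q i j where e: "a = (p, q)" "b = (i, j)" by (cases a, cases b)
  have N: "p \<in> {1..N}" "q \<in> {1..N}" "i \<in> {1..N}" "j \<in> {1..N}" using ab e by (auto simp: gen_pairs_def)
  have *: "p' = i' \<and> q' = j'" if "key (p', q') = key (i', j')" "p' \<in> {1..N}" "q' \<in> {1..N}" "i' \<in> {1..N}" "j' \<in> {1..N}"
    "Suc N \<le> p' + q' \<longrightarrow> Suc N \<le> i' + j'" for p' q' i' j'
  proof -
    have s: "j' * Suc N + (N - i') < Suc N * Suc N"
    proof -
      have "j' * Suc N \<le> N * Suc N" using that by (intro mult_le_mono1) simp
      then show ?thesis by simp
    qed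
    then have "Suc N \<le> p' + q' \<longleftrightarrow> Suc N \<le> i' + j'" using that by (auto simp: key_def split: if_splits)
    then have eq: "q' * Suc N + (N - p') = j' * Suc N + (N - i')" using that(1) by (auto simp: key_def split: if_splits)
    have "q' = j'"
      using lex_less[of q' "N - p'" j' "Suc (N - i')"] lex_less[of q' "N - p'" j' "N - i'"]
    proof (cases q' j' rule: linorder_cases)
      case less
      then have "Suc q' * Suc N \<le> j' * Suc N" by (intro mult_le_mono1) simp
      then show ?thesis using eq by simp
    next
      case greater
      then have "Suc j' * Suc N \<le> q' * Suc N" by (intro mult_le_mono1) simp
      then show ?thesis using eq by simp
    qed simp
    then show ?thesis using eq that by auto
  qed
  show "a = b"
  proof (cases "Suc N \<le> p + q \<longrightarrow> Suc N \<le> i + j")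
    case True
    from *[OF ab(3)[unfolded e] N True] show ?thesis unfolding e by simp
  next
    case False
    then have "Suc N \<le> i + j \<longrightarrow> Suc N \<le> p + q" by blast
    from *[OF ab(3)[unfolded e, symmetric] N(3,4,1,2) this] show ?thesis unfolding e by simp
  qed
qed

text \<open>The two kinds of moves combined, for the order \<open>key\<close>: at a generic point the slope \<open>\<kappa>\<close> does not vanish, so
  one function takes infinitely many values while the smaller ones and the middle quotients stay fixed.\<close>

lemma coordinate_moves:
  assumes a: "a \<in> gen_pairs" and x: "x \<in> C" "Gen x \<noteq> 0"
  obtains \<gamma> \<kappa> where "rcurve {0} \<gamma>" "\<gamma> 0 = x" "finite {t. \<gamma> t \<notin> C}" "\<kappa> \<noteq> 0"
    "\<And>t. \<gamma> t \<in> C \<Longrightarrow> J_poly N a (\<gamma> t) = J_poly N a x + t * \<kappa>"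
    "\<And>t b. \<gamma> t \<in> C \<Longrightarrow> b \<in> gen_pairs \<Longrightarrow> key b < key a \<Longrightarrow> J_poly N b (\<gamma> t) = J_poly N b x"
    "\<And>t. \<gamma> t \<in> C \<Longrightarrow> sim x (\<gamma> t)"
proof -
  obtain i j where ij: "a = (i, j)" by (cases a)
  obtain v y where vy: "v \<in> U1" "y \<in> G" "zpat y" "x = v * y * ginv v"
    using generic_decomposition[OF C_G[OF x(1)] GenD(1)[OF x(2)]] .
  have aN: "i \<in> {1..N}" "j \<in> {1..N}" using a by (auto simp: ij gen_pairs_def)
  note xc = C_carrier[OF x(1)]
  show ?thesis
  proof (cases "a \<in> lower_pairs")
    case True
    note s2 = True[unfolded ij]
    show ?thesis
    proof (rule lower_move[OF x(1) vy(4,1,2,3) s2])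
      fix \<gamma> \<kappa> assume g: "rcurve {0} \<gamma>" "\<gamma> 0 = x" "finite {t. \<gamma> t \<notin> C}" "\<kappa> \<noteq> 0"
        "\<And>t. \<gamma> t \<in> C \<Longrightarrow> Jl i j (\<gamma> t) = Jl i j x + t * \<kappa> * Kl i j x"
        "\<And>t p q. \<gamma> t \<in> C \<Longrightarrow> (p, q) \<in> lower_pairs \<Longrightarrow> q < j \<or> (q = j \<and> i < p) \<Longrightarrow> Jl p q (\<gamma> t) = Jl p q x"
        "\<And>t a b. mid a \<Longrightarrow> mid b \<Longrightarrow> \<gamma> t \<in> C \<Longrightarrow> bordered_minor a b (\<gamma> t) * mixed_minor m 0 x = bordered_minor a b x * mixed_minor m 0 (\<gamma> t)"
      have 1: "J_poly N b (\<gamma> t) = J_poly N b x" if t: "\<gamma> t \<in> C" and b: "b \<in> gen_pairs" "key b < key a" for t b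
      proof -
        obtain p q where pq: "b = (p, q)" by (cases b)
        have pN: "p \<in> {1..N}" "q \<in> {1..N}" using b by (auto simp: pq gen_pairs_def)
        have "Suc N \<le> i + j" using True by (auto simp: ij lower_pairs_def)
        then have *: "Suc N \<le> p + q \<and> (q < j \<or> (q = j \<and> i < p))"
          using key_less[of p q i j] b(2) aN pN unfolding pq ij by auto
        then have "(p, q) \<in> lower_pairs" using b(1) unfolding gen_pairs_split pq by (auto simp: upper_pairs_def)
        then show ?thesis unfolding pq using J_poly_lower_pairs C_carrier[OF t] xc g(6)[OF t] * by auto
      qed
      show ?thesis
      proof (rule that[OF g(1-3) _ _ 1])
        show "\<kappa> * Kl i j x \<noteq> 0" using g(4) GenD(2)[OF x(2) s2] by simp
        show "J_poly N a (\<gamma> t) = J_poly N a x + t * (\<kappa> * Kl i j x)" if "\<gamma> t \<in> C" for t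
          using g(5)[OF that] J_poly_lower_pairs[OF s2] C_carrier[OF that] xc by (simp add: ij mult.assoc)
        show "sim x (\<gamma> t)" if "\<gamma> t \<in> C" for t unfolding sim_def using g(7)[OF _ _ that] by simp
      qed
    qed
  next
    case False
    then have ij1: "N - m < i" "i + j < Suc N" using a by (auto simp: gen_pairs_split upper_pairs_def ij)
    have j: "j \<in> corner_sizes" using ij1 aN m_le by (auto simp: corner_sizes_def)
    show ?thesis
    proof (rule upper_move[OF x(1) vy(4,1,2,3) ij1(1) aN ij1(2)])
      fix \<gamma> \<kappa> assume g: "rcurve {0} \<gamma>" "\<gamma> 0 = x" "\<And>t. \<gamma> t \<in> C" "\<kappa> \<noteq> 0"
        "\<And>t. J_poly N (i, j) (\<gamma> t) = J_poly N (i, j) x + t * \<kappa> * mixed_minor j 0 x"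
        "\<And>t p q. N - m < p \<Longrightarrow> p \<in> {1..N} \<Longrightarrow> q \<in> {1..N} \<Longrightarrow> p + q < Suc N \<Longrightarrow>
          q < j \<or> (q = j \<and> i < p) \<Longrightarrow> J_poly N (p, q) (\<gamma> t) = J_poly N (p, q) x"
        "\<And>t p q. (p, q) \<in> lower_pairs \<Longrightarrow> Jl p q (\<gamma> t) = Jl p q x"
        "\<And>t a b. mid a \<Longrightarrow> mid b \<Longrightarrow> bordered_minor a b (\<gamma> t) * mixed_minor m 0 x = bordered_minor a b x * mixed_minor m 0 (\<gamma> t)"
      have 1: "J_poly N b (\<gamma> t) = J_poly N b x" if b: "b \<in> gen_pairs" "key b < key a" for t b
      proof -
        obtain p q where pq: "b = (p, q)" by (cases b)
        show ?thesis
        proof (cases "b \<in> lower_pairs")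
          case True
          then show ?thesis unfolding pq using J_poly_lower_pairs C_carrier[OF g(3)] xc g(7) by auto
        next
          case False
          then have p: "N - m < p" "p \<in> {1..N}" "q \<in> {1..N}" "p + q < Suc N"
            using b(1) by (auto simp: gen_pairs_split upper_pairs_def pq)
          then have "q < j \<or> (q = j \<and> i < p)" using key_less[of p q i j] b(2) aN unfolding pq ij by auto
          then show ?thesis unfolding pq by (rule g(6)[OF p])
        qed
      qed
      show ?thesis
      proof (rule that[OF g(1,2) _ _ _ 1])
        show "finite {t. \<gamma> t \<notin> C}" using g(3) by simp
        show "\<kappa> * mixed_minor j 0 x \<noteq> 0" using g(4) GenD(1)[OF x(2) j] by simp
        show "J_poly N a (\<gamma> t) = J_poly N a x + t * (\<kappa> * mixed_minor j 0 x)" for t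
          using g(5) by (simp add: ij mult.assoc)
        show "sim x (\<gamma> t)" for t unfolding sim_def using g(8) by simp
      qed
    qed
  qed
qed

lemma F0B_zero_add: "\<zero>\<^bsub>irr.F\<^esub> \<in> F0B" "q \<in> F0B \<Longrightarrow> q' \<in> F0B \<Longrightarrow> q \<oplus>\<^bsub>irr.F\<^esub> q' \<in> F0B"
  unfolding F0B_def by (rule irr.F.zero_in_generate, rule generate_field.eng_add)

text \<open>In a relation \<open>P\<close> over \<open>F0B\<close> fix the middle quotients of one generic point \<open>x0\<close>. On the set \<open>Z\<close> of generic points with
  these quotients the coefficients of \<open>P\<close> take constant values, and \<open>triangular_independence\<close> forces the value of
  every coefficient to be zero. The generic set is chosen so that the value of a nonzero coefficient is not zero.\<close>

lemma J_circ_independent: "algebraically_independent irr.F F0B gen_pairs (J_circ N C)"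
  unfolding algebraically_independent_def
proof (intro ballI impI allI, rule ccontr)
  fix P k0
  assume P: "P \<in> irr.F.indexed_pset gen_pairs F0B" and v0: "indexed_value irr.F (J_circ N C) P = \<zero>\<^bsub>irr.F\<^esub>"
    and k0: "P k0 \<noteq> \<zero>\<^bsub>irr.F\<^esub>"
  define K where "K = {k. P k \<noteq> \<zero>\<^bsub>irr.F\<^esub>}"
  have K: "finite K" "\<And>k. P k \<in> F0B" "\<And>k. k \<in> K \<Longrightarrow> set_mset k \<subseteq> gen_pairs"
    using irr.F.indexed_pset_support[OF P F0B_zero_add] by (auto simp: K_def)
  obtain g where g: "\<And>k. g k \<in> regular_funs N" "\<And>k. \<exists>x\<in>C. g k x \<noteq> 0"
    "\<And>k x x'. x \<in> C \<Longrightarrow> x' \<in> C \<Longrightarrow> sim x x' \<Longrightarrow> g k x \<noteq> 0 \<Longrightarrow> g k x' \<noteq> 0 \<Longrightarrow> \<exists>v. irr.ev x (P k) v \<and> irr.ev x' (P k) v"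
  proof -
    define Q where "Q k g \<longleftrightarrow> g \<in> regular_funs N \<and> (\<exists>x\<in>C. g x \<noteq> 0) \<and> (\<forall>x\<in>C. \<forall>x'\<in>C. sim x x' \<and> g x \<noteq> 0 \<and> g x' \<noteq> 0 \<longrightarrow>
      (\<exists>v. irr.ev x (P k) v \<and> irr.ev x' (P k) v))" for k g
    have "\<exists>g. Q k g" for k using F0B_values[OF K(2)] unfolding Q_def by blast
    then have q: "Q k (SOME g. Q k g)" for k by (rule someI_ex)
    show ?thesis using that[of "\<lambda>k. SOME g. Q k g"] q unfolding Q_def by blast
  qed
  have "P k0 \<in> carrier irr.F" using K(2) F0B_invariant irr.invariants_carrier by blast
  then obtain p r where pr: "p \<in> regular_funs N" "r \<in> regular_funs N" "\<exists>x\<in>C. r x \<noteq> 0"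
    "\<And>x. x \<in> C \<Longrightarrow> r x \<noteq> 0 \<Longrightarrow> irr.ev x (P k0) (p x / r x)" "P k0 \<noteq> \<zero>\<^bsub>irr.F\<^esub> \<Longrightarrow> \<exists>x\<in>C. p x \<noteq> 0"
    by (rule irr.frac_regular) blast
  \<comment> \<open>Where \<open>W\<close> does not vanish, the moves exist, all coefficients have values, and the value of \<open>P k0\<close> is not zero.\<close>
  define W where "W x = Gen x * ((\<Prod>k\<in>K. g k x) * (p x * r x))" for x
  have gK: "(\<lambda>x. \<Prod>k\<in>K. g k x) \<in> regular_funs N" "\<exists>x\<in>C. (\<Prod>k\<in>K. g k x) \<noteq> 0"
    using irr.regular_prod_nonzero[OF K(1), of g] g(1,2) by auto
  note m1 = irr.regular_mult_nonzero[OF pr(1,2) pr(5)[OF k0] pr(3)]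
  note m2 = irr.regular_mult_nonzero[OF gK(1) m1(1) gK(2) m1(2)]
  note m3 = irr.regular_mult_nonzero[OF Gen_regular m2(1) Gen_nonzero m2(2)]
  have W: "W \<in> regular_funs N" using m3(1) unfolding W_def[abs_def] .
  obtain x0 where x0: "x0 \<in> C" "W x0 \<noteq> 0" using m3(2) unfolding W_def[abs_def] by blast
  have WD: "Gen x \<noteq> 0" "p x \<noteq> 0" "r x \<noteq> 0" "k \<in> K \<Longrightarrow> g k x \<noteq> 0" if "W x \<noteq> 0" for x k
    using that K(1) by (auto simp: W_def)
  define Z where "Z = {x \<in> C. W x \<noteq> 0 \<and> sim x0 x}"
  have x0Z: "x0 \<in> Z" using x0 by (simp add: Z_def sim_def)
  define c where "c k = (THE v. irr.ev x0 (P k) v)" for k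
  have c: "irr.ev z (P k) (c k)" if zk: "z \<in> Z" "k \<in> K" for z k
  proof -
    obtain v where v: "irr.ev x0 (P k) v" "irr.ev z (P k) v"
      using g(3)[of x0 z k] zk x0 WD(4) by (auto simp: Z_def)
    have "c k = v" unfolding c_def by (rule the_equality) (use v irr.ev_unique in auto)
    then show ?thesis using v by simp
  qed
  have k0K: "k0 \<in> K" using k0 by (simp add: K_def)
  have "c k0 = 0"
  proof (rule triangular_independence[where J = "J_poly N" and Z = Z and S = gen_pairs and key = key and Ms = K and ex = count])
    show "infinite {J_poly N s z' |z'. z' \<in> Z \<and> (\<forall>r\<in>gen_pairs. key r < key s \<longrightarrow> J_poly N r z' = J_poly N r z)}"
      if z: "z \<in> Z" and s: "s \<in> gen_pairs" for z s
    proof -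
      have zC: "z \<in> C" "W z \<noteq> 0" "sim x0 z" using z by (auto simp: Z_def)
      show ?thesis
      proof (rule coordinate_moves[OF s zC(1) WD(1)[OF zC(2)]])
        fix \<gamma> \<kappa> assume ga: "rcurve {0} \<gamma>" "\<gamma> 0 = z" "finite {t. \<gamma> t \<notin> C}" "\<kappa> \<noteq> 0"
          "\<And>t. \<gamma> t \<in> C \<Longrightarrow> J_poly N s (\<gamma> t) = J_poly N s z + t * \<kappa>"
          "\<And>t b. \<gamma> t \<in> C \<Longrightarrow> b \<in> gen_pairs \<Longrightarrow> key b < key s \<Longrightarrow> J_poly N b (\<gamma> t) = J_poly N b z"
          "\<And>t. \<gamma> t \<in> C \<Longrightarrow> sim z (\<gamma> t)"
        have "finite {t. W (\<gamma> t) = 0}"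
          by (rule rat_finite_zeros[OF rcurve_regular[OF ga(1) W], of 0]) (use ga(2) zC in auto)
        then have "finite ({t. \<gamma> t \<notin> C} \<union> {t. W (\<gamma> t) = 0})" using ga(3) by simp
        then have "infinite (UNIV - ({t. \<gamma> t \<notin> C} \<union> {t. W (\<gamma> t) = 0}))"
          using infinite_UNIV_char_0 by (rule Diff_infinite_finite)
        moreover have "inj_on (\<lambda>t. J_poly N s z + t * \<kappa>) T" for T using ga(4) by (auto simp: inj_on_def)
        ultimately have "infinite ((\<lambda>t. J_poly N s z + t * \<kappa>) ` (UNIV - ({t. \<gamma> t \<notin> C} \<union> {t. W (\<gamma> t) = 0})))"
          using finite_imageD by blast
        moreover have "(\<lambda>t. J_poly N s z + t * \<kappa>) ` (UNIV - ({t. \<gamma> t \<notin> C} \<union> {t. W (\<gamma> t) = 0})) \<subseteq>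
          {J_poly N s z' |z'. z' \<in> Z \<and> (\<forall>r\<in>gen_pairs. key r < key s \<longrightarrow> J_poly N r z' = J_poly N r z)}"
        proof
          fix T assume "T \<in> (\<lambda>t. J_poly N s z + t * \<kappa>) ` (UNIV - ({t. \<gamma> t \<notin> C} \<union> {t. W (\<gamma> t) = 0}))"
          then obtain t where t: "\<gamma> t \<in> C" "W (\<gamma> t) \<noteq> 0" "T = J_poly N s z + t * \<kappa>" by auto
          have "\<gamma> t \<in> Z" using t sim_trans[OF zC(3) ga(7)[OF t(1)]] corner_minor_m_Gen WD(1) zC(2) by (simp add: Z_def)
          then show "T \<in> {J_poly N s z' |z'. z' \<in> Z \<and> (\<forall>r\<in>gen_pairs. key r < key s \<longrightarrow> J_poly N r z' = J_poly N r z)}"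
            using t(3) ga(5)[OF t(1)] ga(6)[OF t(1)] by (intro CollectI exI[of _ "\<gamma> t"]) simp
        qed
        ultimately show ?thesis by (rule infinite_super[rotated])
      qed
    qed
    show "k = k'" if "k \<in> K" "k' \<in> K" "\<forall>s\<in>gen_pairs. count k s = count k' s" for k k'
    proof (rule multiset_eqI)
      fix s show "count k s = count k' s"
        using that K(3)[OF that(1)] K(3)[OF that(2)] by (metis count_eq_zero_iff subsetD)
    qed
    show "(\<Sum>k\<in>K. c k * (\<Prod>s\<in>gen_pairs. J_poly N s z ^ count k s)) = 0" if z: "z \<in> Z" for z
    proof -
      have zC: "z \<in> C" using z by (simp add: Z_def)
      have "irr.ev z (indexed_value irr.F (J_circ N C) P) (\<Sum>k\<in>{k. P k \<noteq> \<zero>\<^bsub>irr.F\<^esub>}. c k * (\<Prod>s\<in>set_mset k. J_poly N s z ^ count k s))"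
      proof (rule irr.ev_indexed_value[OF zC])
        show "finite {k. P k \<noteq> \<zero>\<^bsub>irr.F\<^esub>}" using K(1) by (simp add: K_def)
        show "irr.ev z (P k) (c k)" if "P k \<noteq> \<zero>\<^bsub>irr.F\<^esub>" for k using c[OF z] that by (simp add: K_def)
        show "irr.ev z (J_circ N C s) (J_poly N s z)" if "P k \<noteq> \<zero>\<^bsub>irr.F\<^esub>" "s \<in># k" for k s
          unfolding J_circ_def using K(3)[of k] that by (intro irr.ev_ratfun zC J_regular) (auto simp: K_def)
      qed
      then have "(\<Sum>k\<in>K. c k * (\<Prod>s\<in>set_mset k. J_poly N s z ^ count k s)) = 0"
        using irr.ev_unique irr.ev_zero[OF zC] unfolding v0 K_def by blast
      moreover have "(\<Prod>s\<in>set_mset k. J_poly N s z ^ count k s) = (\<Prod>s\<in>gen_pairs. J_poly N s z ^ count k s)" if "k \<in> K" for k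
        by (rule prod.mono_neutral_left[OF finite_gen_pairs K(3)[OF that]]) (auto simp: not_in_iff)
      ultimately show ?thesis by simp
    qed
  qed (use finite_gen_pairs inj_key x0Z K(1) k0K in auto)
  moreover have "c k0 = p x0 / r x0"
    using irr.ev_unique[OF c[OF x0Z k0K] pr(4)[OF x0(1)]] WD(3)[OF x0(2)] by simp
  ultimately show False using WD(2,3)[OF x0(2)] by simp
qed

end

section \<open>Generation of the field of invariants\<close>

context block_form
begin

definition gen_field :: "'a ratfun set" where
  "gen_field = generate_field irr.F (F0B \<union> J_circ N C ` gen_pairs)"

definition generic_points :: "'a mat set" where "generic_points = {x \<in> C. Gen x \<noteq> 0}"

text \<open>Membership is a matter of values, because the two factors of the normal form are chosen point by point and are not
  known to be rational in \<open>x\<close> beforehand.\<close>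

definition gen_funs :: "('a mat \<Rightarrow> 'a) set" where
  "gen_funs = {h. \<exists>q\<in>gen_field. \<forall>x\<in>generic_points. irr.ev x q (h x)}"

lemma F0B_gen_field: "q \<in> F0B \<Longrightarrow> q \<in> gen_field" unfolding gen_field_def by (intro generate_field.incl) simp

lemma const_gen_field: "ratfun_of N C (\<lambda>_. c) \<in> gen_field"
  by (rule F0B_gen_field) (auto simp: F0B_def intro: generate_field.incl)

lemma generic_points_C: "x \<in> generic_points \<Longrightarrow> x \<in> C" and generic_points_Gen: "x \<in> generic_points \<Longrightarrow> Gen x \<noteq> 0"
  by (auto simp: generic_points_def)

lemma generic_points_nonempty: "generic_points \<noteq> {}" using Gen_nonzero by (auto simp: generic_points_def)

sublocale gen_funs: function_algebra gen_funs generic_points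
proof
  show "(\<lambda>_. c) \<in> gen_funs" for c
    unfolding gen_funs_def using const_gen_field irr.ev_const generic_points_C by blast
  fix f g :: "'a mat \<Rightarrow> 'a"
  assume f: "f \<in> gen_funs"
  then obtain q where q: "q \<in> gen_field" "\<forall>x\<in>generic_points. irr.ev x q (f x)" unfolding gen_funs_def by blast
  show "g \<in> gen_funs" if "\<And>x. x \<in> generic_points \<Longrightarrow> f x = g x" unfolding gen_funs_def using q that by auto
  assume "g \<in> gen_funs"
  then obtain q' where q': "q' \<in> gen_field" "\<forall>x\<in>generic_points. irr.ev x q' (g x)" unfolding gen_funs_def by blast
  show "(\<lambda>x. f x + g x) \<in> gen_funs"
    unfolding gen_funs_def using q q' by (auto intro!: bexI[of _ "q \<oplus>\<^bsub>irr.F\<^esub> q'"] irr.ev_add simp: gen_field_def generate_field.eng_add)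
  show "(\<lambda>x. f x * g x) \<in> gen_funs"
    unfolding gen_funs_def using q q' by (auto intro!: bexI[of _ "q \<otimes>\<^bsub>irr.F\<^esub> q'"] irr.ev_mult simp: gen_field_def generate_field.eng_mult)
qed

lemma gen_funs_divide:
  assumes f: "f \<in> gen_funs" and g: "g \<in> gen_funs" "\<And>x. x \<in> generic_points \<Longrightarrow> g x \<noteq> 0" shows "(\<lambda>x. f x / g x) \<in> gen_funs"
proof -
  obtain q where q: "q \<in> gen_field" "\<forall>x\<in>generic_points. irr.ev x q (g x)" using g unfolding gen_funs_def by blast
  obtain x0 where "x0 \<in> generic_points" using generic_points_nonempty by blast
  then have "q \<noteq> \<zero>\<^bsub>irr.F\<^esub>" using irr.ev_nonzero q g(2) by blast
  then have "inv\<^bsub>irr.F\<^esub> q \<in> gen_field" using q(1) unfolding gen_field_def by (intro generate_field.m_inv)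
  moreover have "\<forall>x\<in>generic_points. irr.ev x (inv\<^bsub>irr.F\<^esub> q) (inverse (g x))" using q(2) g(2) irr.ev_inverse by blast
  ultimately have "(\<lambda>x. inverse (g x)) \<in> gen_funs" unfolding gen_funs_def by blast
  from gen_funs.mult[OF f this] show ?thesis by (simp add: divide_inverse)
qed

lemma J_gen_funs: assumes "a \<in> gen_pairs" shows "J_poly N a \<in> gen_funs"
proof -
  have "J_circ N C a \<in> gen_field" unfolding gen_field_def using assms by (intro generate_field.incl) simp
  moreover have "\<forall>x\<in>generic_points. irr.ev x (J_circ N C a) (J_poly N a x)"
    unfolding J_circ_def using irr.ev_ratfun[OF generic_points_C J_regular[OF assms]] by blast
  ultimately show ?thesis unfolding gen_funs_def by blast
qed

lemma mixed_minor_gen_funs: assumes "j \<in> {1..m}" shows "mixed_minor j 0 \<in> gen_funs" "\<And>x. x \<in> generic_points \<Longrightarrow> mixed_minor j 0 x \<noteq> 0"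
proof -
  have s: "(Suc N - j, j) \<in> lower_pairs" using assms m_le by (auto simp: lower_pairs_def)
  have e: "Jl (Suc N - j) j = mixed_minor j 0" using assms m_le by (auto simp: Jl_def)
  have "J_poly N (Suc N - j, j) \<in> gen_funs" by (rule J_gen_funs) (use s gen_pairs_split in blast)
  then show "mixed_minor j 0 \<in> gen_funs"
    by (rule gen_funs.cong) (use J_poly_lower_pairs[OF s] C_carrier generic_points_C e in auto)
  show "mixed_minor j 0 x \<noteq> 0" if "x \<in> generic_points" for x
    using GenD(1)[OF generic_points_Gen[OF that], of j] assms by (auto simp: corner_sizes_def)
qed

text \<open>The two factors of the generic decomposition as functions of the point.\<close>

definition vy :: "'a mat \<Rightarrow> 'a mat \<times> 'a mat" where
  "vy x = (SOME z. fst z \<in> U1 \<and> snd z \<in> G \<and> zpat (snd z) \<and> x = fst z * snd z * ginv (fst z))"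

definition vv where "vv x = fst (vy x)"
definition yy where "yy x = snd (vy x)"

lemma vy:
  assumes "x \<in> generic_points" shows "vv x \<in> U1" "yy x \<in> G" "zpat (yy x)" "x = vv x * yy x * ginv (vv x)"
proof -
  obtain v y where "v \<in> U1" "y \<in> G" "zpat y" "x = v * y * ginv v"
    using generic_decomposition[OF C_G[OF generic_points_C[OF assms]] GenD(1)[OF generic_points_Gen[OF assms]]] .
  then have "\<exists>z. fst z \<in> U1 \<and> snd z \<in> G \<and> zpat (snd z) \<and> x = fst z * snd z * ginv (fst z)"
    by (intro exI[of _ "(v, y)"]) simp
  from someI_ex[OF this] show "vv x \<in> U1" "yy x \<in> G" "zpat (yy x)" "x = vv x * yy x * ginv (vv x)"
    unfolding vv_def yy_def vy_def by blast+
qed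

lemma vv_G: "x \<in> generic_points \<Longrightarrow> vv x \<in> G" using vy(1) by (simp add: U1_def)

lemma mixed_minor_yy: assumes "x \<in> generic_points" "e + d \<le> N" shows "mixed_minor e d (yy x) = mixed_minor e d x"
  using mixed_minor_conj[OF vv_G[OF assms(1)] U1_utri[OF vy(1)[OF assms(1)]] vy(2)[OF assms(1)] assms(2)]
  unfolding vy(4)[OF assms(1), symmetric] by simp

lemma yy_mid:
  assumes ab: "mid a" "mid b" shows "(\<lambda>x. entry (yy x) a b) \<in> gen_funs"
proof -
  have "Pf (a, b) \<in> gen_field" using ab by (intro F0B_gen_field) (auto simp: F0B_def intro: generate_field.incl)
  moreover have "\<forall>x\<in>generic_points. irr.ev x (Pf (a, b)) (bordered_minor a b x / mixed_minor m 0 x)"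
    using ev_Pf[OF ab] generic_points_C corner_minor_m_Gen[OF generic_points_Gen] by blast
  ultimately have "(\<lambda>x. bordered_minor a b x / mixed_minor m 0 x) \<in> gen_funs" unfolding gen_funs_def by blast
  from gen_funs.mult[OF gen_funs.const[of "(-1) ^ m"] this] show ?thesis
  proof (rule gen_funs.cong)
    fix x assume x: "x \<in> generic_points"
    note v = vy[OF x]
    have aN: "a \<in> {1..N}" using ab by (auto simp: mid_def)
    have z: "entry (yy x) a q = 0" if "q \<in> {1..m}" for q
      using zpatD[OF v(3) aN, of q] that ab m_le by (auto simp: mid_def)
    have "bordered_minor a b x = bordered_minor a b (yy x)"
      using bordered_minor_conj[OF v(1) G_carrier[OF v(2)] ab] unfolding v(4)[symmetric] .
    also have "\<dots> = (-1) ^ m * entry (yy x) a b * mixed_minor m 0 x"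
      using bordered_minor_value[OF ab z] mixed_minor_yy[OF x, of m 0] m_le by simp
    finally show "(-1) ^ m * (bordered_minor a b x / mixed_minor m 0 x) = entry (yy x) a b"
      using corner_minor_m_Gen[OF generic_points_Gen[OF x]] by (simp add: mult.assoc[symmetric] power_mult_distrib[symmetric])
  qed
qed

lemma det_yy: "\<exists>\<delta>. \<forall>x\<in>generic_points. det (yy x) = \<delta>"
proof -
  obtain x0 where x0: "x0 \<in> generic_points" using generic_points_nonempty by blast
  have "det (yy x) = det x0" if x: "x \<in> generic_points" for x
    using det_conj[OF vv_G[OF x] G_carrier[OF vy(2)[OF x]]] vy(4)[OF x] det_C[OF generic_points_C[OF x] generic_points_C[OF x0]] by simp
  then show ?thesis by blast
qed

text \<open>Solve \<open>J\<^sub>r\<^sub>c\<close> for \<open>y\<^sub>r\<^sub>c\<close>: it is affine in this entry with the nonzero slope \<open>Kl r c\<close>, and all other entries that occur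
  are known by assumption.\<close>

lemma yy_lower:
  assumes rc: "(r, c) \<in> lower_pairs"
    and cols: "\<And>p q. p \<in> {1..N} \<Longrightarrow> q \<in> {1..N} \<Longrightarrow> q < c \<Longrightarrow> (\<lambda>x. entry (yy x) p q) \<in> gen_funs"
    and rows: "\<And>p. p \<in> {1..N} \<Longrightarrow> r < p \<Longrightarrow> (\<lambda>x. entry (yy x) p c) \<in> gen_funs"
  shows "(\<lambda>x. entry (yy x) r c) \<in> gen_funs"
proof -
  define e where "e = N - r"
  define d where "d = c - (Suc N - r)"
  have rcN: "r \<in> {1..N}" "c \<in> {1..N}" "r + c \<ge> Suc N" using lower_pairsD[OF rc] by auto
  have ed: "Suc N - r = Suc e" "e + d = c - 1" "Suc (e + d) = c" "Suc e \<le> N" "e + d < N" "N - e = r" "d < c" "d \<le> N"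
    using rcN by (auto simp: e_def d_def)
  obtain \<delta> where \<delta>: "\<And>x. x \<in> generic_points \<Longrightarrow> det (yy x) = \<delta>" using det_yy by blast
  let ?A = "\<lambda>x. stack (Suc e) d (yy x) (adj_mat (yy x))"
  \<comment> \<open>\<open>Z x\<close> is the stack with its unknown entry \<open>y\<^sub>r\<^sub>c\<close> replaced by zero.\<close>
  define Z where "Z x = mat c c (\<lambda>(p, q). if (p, q) = (0, c - 1) then 0 else ?A x $$ (p, q))" for x
  have adj: "(\<lambda>x. entry (adj_mat (yy x)) a b) \<in> gen_funs" if ab: "a \<in> {1..N}" "b \<in> {1..N}" "Suc N - a < c" for a b
  proof -
    have "(\<lambda>x. \<delta> * (s (Suc N - a) * s (Suc N - b) * entry (yy x) (Suc N - b) (Suc N - a))) \<in> gen_funs"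
      by (intro gen_funs.mult gen_funs.const cols opp_mem ab)
    then show ?thesis by (rule gen_funs.cong) (simp add: entry_adj[OF vy(2) ab(1,2)] \<delta>)
  qed
  have ent: "(\<lambda>x. ?A x $$ (p, q)) \<in> gen_funs" if pq: "p < c" "q < c" "(p, q) \<noteq> (0, c - 1)" for p q
  proof (cases "p < Suc e")
    case True
    have i: "r + p \<in> {1..N}" "q + 1 \<in> {1..N}" using True pq rcN by (auto simp: e_def)
    have "(\<lambda>x. entry (yy x) (r + p) (q + 1)) \<in> gen_funs"
    proof (cases "q + 1 = c")
      case True
      then have "0 < p" using pq by auto
      then show ?thesis using rows[OF i(1)] True by simp
    next
      case False then show ?thesis using cols[OF i] pq by simp
    qed
    moreover have "Suc (N + p - Suc e) = r + p" using rcN by (auto simp: e_def)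
    ultimately show ?thesis using True pq ed by (simp add: stack_def)
  next
    case False
    have "N - d + 1 + (p - Suc e) \<in> {1..N}" "q + 1 \<in> {1..N}" "Suc N - (N - d + 1 + (p - Suc e)) < c"
      using False pq ed rcN by auto
    from adj[OF this] show ?thesis using False pq ed by (simp add: stack_def)
  qed
  have Zc: "Z x \<in> carrier_mat c c" for x by (simp add: Z_def)
  have "(\<lambda>x. Z x $$ (p, q)) \<in> gen_funs" if "p < c" "q < c" for p q
    using ent[of p q] that by (cases "(p, q) = (0, c - 1)") (auto simp: Z_def intro: gen_funs.const)
  then have dZ: "(\<lambda>x. det (Z x)) \<in> gen_funs" using Zc by (intro gen_funs.det)
  have "(\<lambda>x. stack e d (yy x) (adj_mat (yy x)) $$ (p, q)) \<in> gen_funs" if pq: "p < e + d" "q < e + d" for p q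
  proof -
    have "(\<lambda>x. ?A x $$ (Suc p, q)) \<in> gen_funs" by (rule ent) (use pq ed in auto)
    moreover have "?A x $$ (Suc p, q) = stack e d (yy x) (adj_mat (yy x)) $$ (p, q)" for x
      using pq ed by (auto simp: stack_def Suc_diff_Suc)
    ultimately show ?thesis by simp
  qed
  then have dK: "(\<lambda>x. mixed_minor e d (yy x)) \<in> gen_funs" unfolding mixed_minor_def by (intro gen_funs.det[where n = "e + d"] stack_carrier)
  have K0: "mixed_minor e d (yy x) \<noteq> 0" if "x \<in> generic_points" for x
    using GenD(2)[OF generic_points_Gen[OF that] rc] mixed_minor_yy[OF that, of e d] ed by (simp add: Kl_def e_def d_def)
  have "J_poly N (r, c) \<in> gen_funs" using rc gen_pairs_split by (intro J_gen_funs) blast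
  then have "(\<lambda>x. (-1) ^ (c - 1) * ((J_poly N (r, c) x - det (Z x)) / mixed_minor e d (yy x))) \<in> gen_funs"
    by (intro gen_funs.mult gen_funs.const gen_funs_divide gen_funs.diff dZ dK K0)
  then show ?thesis
  proof (rule gen_funs.cong)
    fix x assume x: "x \<in> generic_points"
    have "det (?A x) = det (Z x) + (-1) ^ (e + d) * (?A x $$ (0, e + d) - Z x $$ (0, e + d)) * det (mat_delete (?A x) 0 (e + d))"
      by (rule det_corner) (use stack_carrier[of "Suc e" d] Zc ed in \<open>auto simp: Z_def\<close>)
    also have "mat_delete (?A x) 0 (e + d) = stack e d (yy x) (adj_mat (yy x))" by (rule stack_delete[OF ed(4)])
    also have "?A x $$ (0, e + d) - Z x $$ (0, e + d) = entry (yy x) r c"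
    proof -
      have "Suc (N - Suc e) = r" using rcN by (auto simp: e_def)
      then show ?thesis using ed by (simp add: stack_def Z_def)
    qed
    finally have 1: "det (?A x) = det (Z x) + (-1) ^ (c - 1) * (entry (yy x) r c * mixed_minor e d (yy x))"
      unfolding ed(2) by (simp add: mixed_minor_def mult.assoc)
    have "J_poly N (r, c) x = mixed_minor (Suc e) d x"
      using J_poly_lower_pairs[OF rc C_carrier[OF generic_points_C[OF x]]] by (simp add: Jl_def ed(1) d_def)
    also have "\<dots> = det (?A x)" using mixed_minor_yy[OF x, of "Suc e" d] ed by (simp add: mixed_minor_def)
    finally have 2: "J_poly N (r, c) x - det (Z x) = (-1) ^ (c - 1) * (entry (yy x) r c * mixed_minor e d (yy x))" using 1 by simp
    show "(-1) ^ (c - 1) * ((J_poly N (r, c) x - det (Z x)) / mixed_minor e d (yy x)) = entry (yy x) r c"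
      unfolding 2 using K0[OF x] by (simp add: mult.assoc[symmetric] power_mult_distrib[symmetric])
  qed
qed

text \<open>In these positions the product of the rows \<open>r\<close> and \<open>c\<close> of \<open>y\<close> is an equation for \<open>y\<^sub>r\<^sub>c\<close>, whose coefficient is the
  nonzero antidiagonal entry in row \<open>c\<close>. All other terms vanish or lie in earlier columns. On the diagonal \<open>y\<^sub>c\<^sub>c\<close> appears
  twice for a symmetric form and cancels for an alternating one, which is why \<open>(c, c)\<close> indexes a generator in the
  latter case.\<close>

lemma yy_dependent:
  assumes rc: "r \<in> {1..N}" "c \<in> {1..N}" "N - m < c" "r < c \<or> (r = c \<and> sg = 1)"
    and cols: "\<And>p q. p \<in> {1..N} \<Longrightarrow> q \<in> {1..N} \<Longrightarrow> q < c \<Longrightarrow> (\<lambda>x. entry (yy x) p q) \<in> gen_funs"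
  shows "(\<lambda>x. entry (yy x) r c) \<in> gen_funs"
proof -
  note c' = opp_mem[OF rc(2)]
  have cc: "Suc N - c < c" "\<not> mid c" using rc m_le by (auto simp: mid_def)
  define R where "R x = (\<Sum>p\<in>{1..N} - {c, Suc N - r}. s p * entry (yy x) r p * entry (yy x) c (Suc N - p))" for x
  have tm: "(\<lambda>x. s p * entry (yy x) r p * entry (yy x) c (Suc N - p)) \<in> gen_funs"
    if p: "p \<in> {1..N}" "p \<noteq> c" "p \<noteq> Suc N - r \<or> r < c" for p
  proof (cases "c < p")
    case True
    have "entry (yy x) c (Suc N - p) = 0" if "x \<in> generic_points" for x
      by (rule zpatD[OF vy(3)[OF that] rc(2) opp_mem[OF p(1)]]) (use True cc p in auto)
    then show ?thesis by (intro gen_funs.cong[OF gen_funs.const[of 0]]) simp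
  next
    case False
    then have pc: "p < c" using p by simp
    show ?thesis
    proof (cases "Suc N - p < c")
      case True
      then show ?thesis by (intro gen_funs.mult gen_funs.const cols rc opp_mem p pc)
    next
      case False
      have "entry (yy x) r p = 0" if "x \<in> generic_points" for x
        by (rule zpatD[OF vy(3)[OF that] rc(1) p(1)]) (use False p rc m_le in \<open>auto simp: mid_def\<close>)
      then show ?thesis by (intro gen_funs.cong[OF gen_funs.const[of 0]]) simp
    qed
  qed
  have corner: "(\<lambda>x. entry (yy x) c (Suc N - c)) \<in> gen_funs" using cc by (intro cols rc c')
  have corner0: "entry (yy x) c (Suc N - c) \<noteq> 0" if "x \<in> generic_points" for x
    by (rule zpat_antidiagonal[OF vy(2,3)[OF that] rc(2) cc(2)])
  have e: "(\<Sum>p = 1..N. s p * entry (yy x) r p * entry (yy x) c (Suc N - p)) = (if c = Suc N - r then s r else 0)" if "x \<in> generic_points" for x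
    using G_rows[OF vy(2)[OF that] rc(1,2)] by (simp add: bf_def)
  show ?thesis
  proof (cases "r < c")
    case True
    define T where "T x = (\<Sum>p\<in>{1..N} - {c}. s p * entry (yy x) r p * entry (yy x) c (Suc N - p))" for x
    have T: "T \<in> gen_funs" unfolding T_def[abs_def] by (intro gen_funs.sum tm) (use True in auto)
    have "(\<lambda>x. s c * (((if c = Suc N - r then s r else 0) - T x) / entry (yy x) c (Suc N - c))) \<in> gen_funs"
      by (intro gen_funs.mult gen_funs.const gen_funs_divide gen_funs.diff T corner corner0)
    then show ?thesis
    proof (rule gen_funs.cong)
      fix x assume x: "x \<in> generic_points"
      have "(\<Sum>p = 1..N. s p * entry (yy x) r p * entry (yy x) c (Suc N - p)) = s c * entry (yy x) r c * entry (yy x) c (Suc N - c) + T x"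
        unfolding T_def using rc(2) by (intro sum.remove) auto
      then have "(if c = Suc N - r then s r else 0) - T x = s c * entry (yy x) r c * entry (yy x) c (Suc N - c)"
        unfolding e[OF x] by simp
      then show "s c * (((if c = Suc N - r then s r else 0) - T x) / entry (yy x) c (Suc N - c)) = entry (yy x) r c"
        using corner0[OF x] s_sq[OF rc(2)] by (simp add: mult.assoc[symmetric])
    qed
  next
    case False
    then have r: "r = c" "sg = 1" using rc by auto
    have R: "R \<in> gen_funs" unfolding R_def[abs_def] by (intro gen_funs.sum tm) auto
    have "(\<lambda>x. s c * ((- R x) / (2 * entry (yy x) c (Suc N - c)))) \<in> gen_funs"
      by (intro gen_funs.mult gen_funs.const gen_funs_divide gen_funs.uminus R corner) (use corner0 in auto)
    then show ?thesis
    proof (rule gen_funs.cong)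
      fix x assume x: "x \<in> generic_points"
      let ?f = "\<lambda>p. s p * entry (yy x) r p * entry (yy x) c (Suc N - p)"
      have "(\<Sum>p = 1..N. ?f p) = ?f c + (\<Sum>p\<in>{1..N} - {c}. ?f p)" using rc(2) by (intro sum.remove) auto
      also have "(\<Sum>p\<in>{1..N} - {c}. ?f p) = ?f (Suc N - c) + (\<Sum>p\<in>{1..N} - {c} - {Suc N - c}. ?f p)"
        using c' cc by (intro sum.remove) auto
      also have "{1..N} - {c} - {Suc N - c} = {1..N} - {c, Suc N - r}" using r by auto
      finally have 1: "0 = ?f c + (?f (Suc N - c) + R x)" unfolding e[OF x] R_def using r cc by auto
      have "s (Suc N - c) = s c" "Suc N - (Suc N - c) = c" using r s_opp[OF rc(2)] rc(2) by auto
      then have "?f (Suc N - c) = s c * entry (yy x) c (Suc N - c) * entry (yy x) c c" unfolding r(1) by (simp only:)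
      moreover have "s c * entry (yy x) c (Suc N - c) * entry (yy x) c c = ?f c" unfolding r(1) by simp
      ultimately have "0 = ?f c + (?f c + R x)" using 1 by (simp only:)
      then have "?f c + ?f c = - R x" by (metis add.assoc eq_neg_iff_add_eq_0)
      then have "- R x = s c * entry (yy x) r c * (2 * entry (yy x) c (Suc N - c))"
        by (simp only: mult_2 distrib_left)
      then show "s c * ((- R x) / (2 * entry (yy x) c (Suc N - c))) = entry (yy x) r c"
        using corner0[OF x] s_sq[OF rc(2)] by (simp add: mult.assoc[symmetric])
    qed
  qed
qed

text \<open>Columns from left to right and, within a column, rows from below.\<close>

lemma yy_gen_funs: "r \<in> {1..N} \<Longrightarrow> c \<in> {1..N} \<Longrightarrow> (\<lambda>x. entry (yy x) r c) \<in> gen_funs"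
proof (induction c arbitrary: r rule: less_induct)
  case (less c)
  have cols: "(\<lambda>x. entry (yy x) p q) \<in> gen_funs" if "p \<in> {1..N}" "q \<in> {1..N}" "q < c" for p q
    using less.IH that by blast
  show ?case
    using less.prems(1)
  proof (induction "N - r" arbitrary: r rule: less_induct)
    case (less r')
    note r = less.prems
    have rows: "(\<lambda>x. entry (yy x) p c) \<in> gen_funs" if "p \<in> {1..N}" "r' < p" for p
      using less.hyps[of p] that by auto
    note c = \<open>c \<in> {1..N}\<close>
    consider "mid r'" "mid c" | "r' + c < Suc N" "\<not> (mid r' \<and> mid c)" | "(r', c) \<in> lower_pairs"
      | "N - m < c" "r' < c \<or> (r' = c \<and> sg = 1)"
    proof -
      assume t: "mid r' \<Longrightarrow> mid c \<Longrightarrow> thesis" "r' + c < Suc N \<Longrightarrow> \<not> (mid r' \<and> mid c) \<Longrightarrow> thesis"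
        "(r', c) \<in> lower_pairs \<Longrightarrow> thesis" "N - m < c \<Longrightarrow> r' < c \<or> (r' = c \<and> sg = 1) \<Longrightarrow> thesis"
      show thesis
      proof (cases "mid r' \<and> mid c \<or> r' + c < Suc N")
        case True then show ?thesis using t(1,2) by blast
      next
        case F: False
        show ?thesis
        proof (cases "N - m < r' \<and> (c < r' \<or> (c = r' \<and> sg = -1))")
          case True
          then have "(r', c) \<in> lower_pairs" using r c F by (auto simp: lower_pairs_def)
          then show ?thesis by (rule t(3))
        next
          case False
          have "N - m < c" using F False r c m_le by (auto simp: mid_def)
          moreover have "r' < c \<or> (r' = c \<and> sg = 1)" using F False r c sg_cases m_le calculation by auto
          ultimately show ?thesis by (rule t(4))
        qed
      qed
    qed
    then show ?case
    proof cases
      case 1 then show ?thesis by (rule yy_mid)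
    next
      case 2
      then have "entry (yy x) r' c = 0" if "x \<in> generic_points" for x using zpatD[OF vy(3)[OF that] r c] by simp
      then show ?thesis by (intro gen_funs.cong[OF gen_funs.const[of 0]]) simp
    next
      case 3 then show ?thesis using cols rows by (rule yy_lower)
    next
      case 4 then show ?thesis using cols by (rule yy_dependent[OF r c])
    qed
  qed
qed

text \<open>The last blocks are read off from the generators above the antidiagonal, the inverse follows by back
  substitution, and the first blocks are determined by the last ones through \<open>entry_ginv\<close>.\<close>

lemma vv_gen_funs:
  assumes ab: "a \<in> {1..N}" "b \<in> {1..N}" "B a = B b"
  shows "(\<lambda>x. entry (vv x) a b) \<in> gen_funs" "(\<lambda>x. entry (ginv (vv x)) a b) \<in> gen_funs"
proof -
  have up: "upat (vv x)" "upat (ginv (vv x))" if "x \<in> generic_points" for x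
    using vy(1)[OF that] U1_ginv[OF vy(1)[OF that]] by (auto simp: U1_def)
  have low: "(\<lambda>x. entry (vv x) a b) \<in> gen_funs \<and> (\<lambda>x. entry (ginv (vv x)) a b) \<in> gen_funs"
    if "a \<in> {1..N}" "b \<in> {1..N}" "b \<le> a \<or> (mid a \<and> mid b)" for a b
    using upatD[OF up(1) that] upatD[OF up(2) that] by (auto intro!: gen_funs.cong[OF gen_funs.const[of "if a = b then 1 else 0"]])
  have bot: "(\<lambda>x. entry (vv x) a b) \<in> gen_funs" if ab: "a \<in> {1..N}" "b \<in> {1..N}" "N - m < a" "a < b" "B a = B b" for a b
  proof -
    define j where "j = Suc N - b"
    have j: "j \<in> {1..m}" "j \<in> {1..N}" "a + j < Suc N" "Suc N - j = b" using ab by (auto simp: j_def)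
    have s: "(a, j) \<in> gen_pairs" using ab j by (auto simp: gen_pairs_split upper_pairs_def)
    have "(\<lambda>x. J_poly N (a, j) x / mixed_minor j 0 x) \<in> gen_funs"
      by (rule gen_funs_divide[OF J_gen_funs[OF s] mixed_minor_gen_funs[OF j(1)]])
    then show ?thesis
    proof (rule gen_funs.cong)
      fix x assume x: "x \<in> generic_points"
      have "J_poly N (a, j) x = entry (vv x) a b * mixed_minor j 0 x"
        using J_upper_value[OF vy(1-3)[OF x] ab(3,1) j(2,3)] mixed_minor_yy[OF x, of j 0] j
        unfolding vy(4)[OF x, symmetric] by simp
      then show "J_poly N (a, j) x / mixed_minor j 0 x = entry (vv x) a b" using mixed_minor_gen_funs(2)[OF j(1) x] by simp
    qed
  qed
  have bot': "(\<lambda>x. entry (ginv (vv x)) a b) \<in> gen_funs" if "a \<in> {1..N}" "b \<in> {1..N}" "N - m < a" "B a = B b" for a b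
    using that
  proof (induction "b - a" arbitrary: a rule: less_induct)
    case (less a)
    show ?case
    proof (cases "b \<le> a")
      case True then show ?thesis using low less.prems by blast
    next
      case False
      define T where "T x = (\<Sum>p\<in>{Suc a..b}. entry (vv x) a p * entry (ginv (vv x)) p b)" for x
      have "T \<in> gen_funs" unfolding T_def[abs_def]
      proof (intro gen_funs.sum gen_funs.mult)
        fix p assume p: "p \<in> {Suc a..b}"
        have pN: "p \<in> {1..N}" using p less.prems by auto
        have "B a \<le> B p" "B p \<le> B b" using B_mono[of a p] B_mono[of p b] p pN less.prems by auto
        then have Bp: "B a = B p" "B p = B b" using less.prems by auto
        show "(\<lambda>x. entry (vv x) a p) \<in> gen_funs" using p pN less.prems Bp by (intro bot) auto
        show "(\<lambda>x. entry (ginv (vv x)) p b) \<in> gen_funs" using p pN less.prems Bp by (intro less.hyps) auto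
      qed
      then have "(\<lambda>x. - T x) \<in> gen_funs" by (rule gen_funs.uminus)
      then show ?thesis
      proof (rule gen_funs.cong)
        fix x assume x: "x \<in> generic_points"
        let ?f = "\<lambda>p. entry (vv x) a p * entry (ginv (vv x)) p b"
        have "0 = entry (vv x * ginv (vv x)) a b"
          using ginv_right[OF vv_G[OF x]] entry_one[of a N b] less.prems False by simp
        also have "\<dots> = (\<Sum>p = 1..N. ?f p)"
          by (rule entry_mult[OF G_carrier[OF vv_G[OF x]] ginv_carrier less.prems(1,2)])
        also have "\<dots> = (\<Sum>p\<in>{a..b}. ?f p)"
        proof (rule sum.mono_neutral_right)
          show "\<forall>p\<in>{1..N} - {a..b}. ?f p = 0"
          proof
            fix p assume p: "p \<in> {1..N} - {a..b}"
            then consider "p < a" | "b < p" by force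
            then show "?f p = 0"
              using upatD[OF up(1)[OF x] less.prems(1), of p] upatD[OF up(2)[OF x] _ less.prems(2), of p] p by cases auto
          qed
        qed (use less.prems in auto)
        also have "\<dots> = ?f a + T x" unfolding T_def using False by (intro sum.atLeast_Suc_atMost) simp
        also have "?f a = entry (ginv (vv x)) a b" using upatD[OF up(1)[OF x] less.prems(1,1)] by simp
        finally show "- T x = entry (ginv (vv x)) a b" by (simp add: neg_eq_iff_add_eq_0 add.commute)
      qed
    qed
  qed
  have gg: "ginv (ginv (vv x)) = vv x" if "x \<in> generic_points" for x by (rule ginv_ginv[OF vv_G[OF that]])
  from B_region[OF ab] consider "b \<le> a \<or> (mid a \<and> mid b)" | "N - m < a" "a < b" | "a \<le> m" "b \<le> m" "a < b" by linarith
  then have "(\<lambda>x. entry (vv x) a b) \<in> gen_funs \<and> (\<lambda>x. entry (ginv (vv x)) a b) \<in> gen_funs"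
  proof cases
    case 1 then show ?thesis using low[OF ab(1,2)] by blast
  next
    case 2 then show ?thesis using bot[OF ab(1,2)] bot'[OF ab(1,2)] ab(3) by blast
  next
    case 3
    \<comment> \<open>The entry \<open>(a, b)\<close> of \<open>v\<close> is, up to sign, the entry \<open>(b', a')\<close> of the inverse, and vice versa.\<close>
    let ?a = "Suc N - a" and ?b = "Suc N - b"
    have o: "?a \<in> {1..N}" "?b \<in> {1..N}" "N - m < ?b" "?b < ?a" "B ?b = B ?a"
      using 3 ab B_opp[OF ab(1)] B_opp[OF ab(2)] m_le by auto
    have "(\<lambda>x. s ?a * s ?b * entry (ginv (vv x)) ?b ?a) \<in> gen_funs"
      by (intro gen_funs.mult gen_funs.const bot' o)
    then have 1: "(\<lambda>x. entry (vv x) a b) \<in> gen_funs"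
      by (rule gen_funs.cong) (simp add: entry_ginv[OF ab(1,2), symmetric] gg)
    have "(\<lambda>x. s ?a * s ?b * entry (vv x) ?b ?a) \<in> gen_funs"
      by (intro gen_funs.mult gen_funs.const bot o)
    then have "(\<lambda>x. entry (ginv (vv x)) a b) \<in> gen_funs"
      by (rule gen_funs.cong) (simp add: entry_ginv[OF ab(1,2)])
    then show ?thesis using 1 by blast
  qed
  then show "(\<lambda>x. entry (vv x) a b) \<in> gen_funs" "(\<lambda>x. entry (ginv (vv x)) a b) \<in> gen_funs" by auto
qed

definition block_diag :: "'a mat \<Rightarrow> 'a mat" where
  "block_diag v = mat1 N (\<lambda>a b. if B a = B b then entry v a b else 0)"

lemma block_diag_carrier[simp]: "block_diag v \<in> carrier_mat N N" by (simp add: block_diag_def)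

lemma entry_block_diag: "a \<in> {1..N} \<Longrightarrow> b \<in> {1..N} \<Longrightarrow> entry (block_diag v) a b = (if B a = B b then entry v a b else 0)"
  by (simp add: block_diag_def)

lemma B_opp_eq: "a \<in> {1..N} \<Longrightarrow> b \<in> {1..N} \<Longrightarrow> B (Suc N - b) = B (Suc N - a) \<longleftrightarrow> B a = B b"
  using B_opp[of a] B_opp[of b] by auto

text \<open>Block triangular matrices: on and below the diagonal blocks products are computed blockwise.\<close>

lemma block_diag_mult:
  assumes v: "upat v" "v \<in> carrier_mat N N" and w: "upat w" "w \<in> carrier_mat N N"
    and ab: "a \<in> {1..N}" "b \<in> {1..N}" "B b \<le> B a"
  shows "entry (v * block_diag w) a b = (if B a = B b then entry (v * w) a b else 0)"
    "entry (block_diag v * block_diag w) a b = (if B a = B b then entry (v * w) a b else 0)"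
proof -
  have v0: "entry v a p = 0" if "p \<in> {1..N}" "B p < B a" for p
    using upatD[OF v(1) ab(1) that(1)] B_mono[OF ab(1) that(1)] that(2) by (cases "p \<le> a") auto
  have w0: "entry w p b = 0" if "p \<in> {1..N}" "B b < B p" for p
    using upatD[OF w(1) that(1) ab(2)] B_mono[OF that(1) ab(2)] that(2) by (cases "b \<le> p") auto
  have "entry v a p * entry (block_diag w) p b = (if B a = B b then entry v a p * entry w p b else 0)" if "p \<in> {1..N}" for p
    using v0[OF that] w0[OF that] ab that by (auto simp: entry_block_diag not_le[symmetric]) (metis le_antisym linorder_not_le)+
  then show "entry (v * block_diag w) a b = (if B a = B b then entry (v * w) a b else 0)"
    unfolding entry_mult[OF v(2) block_diag_carrier ab(1,2)] entry_mult[OF v(2) w(2) ab(1,2)] by (auto intro!: sum.cong)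
  have "entry (block_diag v) a p * entry (block_diag w) p b = (if B a = B b then entry v a p * entry w p b else 0)" if "p \<in> {1..N}" for p
    using v0[OF that] w0[OF that] ab that by (auto simp: entry_block_diag not_le[symmetric]) (metis le_antisym linorder_not_le)+
  then show "entry (block_diag v * block_diag w) a b = (if B a = B b then entry (v * w) a b else 0)"
    unfolding entry_mult[OF block_diag_carrier block_diag_carrier ab(1,2)] entry_mult[OF v(2) w(2) ab(1,2)] by (auto intro!: sum.cong)
qed

lemma block_diag_ginv: "ginv (block_diag v) = block_diag (ginv v)"
proof (rule mat_eqI[where N = N])
  fix a b assume ab: "a \<in> {1..N}" "b \<in> {1..N}"
  show "entry (ginv (block_diag v)) a b = entry (block_diag (ginv v)) a b"
    unfolding entry_ginv[OF ab] entry_block_diag[OF opp_mem[OF ab(2)] opp_mem[OF ab(1)]] entry_block_diag[OF ab]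
    using B_opp_eq[OF ab] entry_ginv[OF ab] by simp
qed auto

lemma block_diag_G: assumes v: "v \<in> U1" shows "block_diag v \<in> G"
proof -
  have vG: "v \<in> G" "upat v" "upat (ginv v)" using v U1_ginv[OF v] by (auto simp: U1_def)
  have "bf (entry (block_diag v) i) (entry (block_diag v) k) = (if k = Suc N - i then s i else 0)" if ik: "i \<in> {1..N}" "k \<in> {1..N}" for i k
  proof (cases "B i + B k = Suc L")
    case True
    have "bf (entry (block_diag v) i) (entry (block_diag v) k) = bf (entry v i) (entry v k)"
      unfolding bf_def
    proof (intro sum.cong refl)
      fix p assume p: "p \<in> {1..N}"
      have o: "B (Suc N - p) + B p = Suc L" by (rule B_opp[OF p])
      show "s p * entry (block_diag v) i p * entry (block_diag v) k (Suc N - p) = s p * entry v i p * entry v k (Suc N - p)"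
      proof (cases "B i = B p")
        case eq: True
        then have "B k = B (Suc N - p)" using True o by simp
        then show ?thesis using eq by (simp add: entry_block_diag[OF ik(1) p] entry_block_diag[OF ik(2) opp_mem[OF p]])
      next
        case False
        have "entry v i p = 0 \<or> entry v k (Suc N - p) = 0"
        proof (rule ccontr)
          assume a: "\<not> (entry v i p = 0 \<or> entry v k (Suc N - p) = 0)"
          have "i \<le> p" using a upatD[OF vG(2) ik(1) p] by (metis linorder_le_cases order_refl)
          moreover have "k \<le> Suc N - p" using a upatD[OF vG(2) ik(2) opp_mem[OF p]] by (metis linorder_le_cases order_refl)
          ultimately have "B i \<le> B p" "B k \<le> B (Suc N - p)" using B_mono ik p opp_mem[OF p] by blast+
          then show False using False True o by simp
        qed
        then show ?thesis using False by (auto simp: entry_block_diag[OF ik(1) p])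
      qed
    qed
    then show ?thesis using G_rows[OF vG(1) ik] by simp
  next
    case False
    have "bf (entry (block_diag v) i) (entry (block_diag v) k) = 0" unfolding bf_def
    proof (intro sum.neutral ballI)
      fix p assume p: "p \<in> {1..N}"
      have "B (Suc N - p) + B p = Suc L" by (rule B_opp[OF p])
      then have "B i \<noteq> B p \<or> B k \<noteq> B (Suc N - p)" using False by auto
      then show "s p * entry (block_diag v) i p * entry (block_diag v) k (Suc N - p) = 0"
        by (auto simp: entry_block_diag[OF ik(1) p] entry_block_diag[OF ik(2) opp_mem[OF p]])
    qed
    moreover have "k \<noteq> Suc N - i" using False B_opp[OF ik(1)] by auto
    ultimately show ?thesis by simp
  qed
  then show ?thesis by (simp add: G_def)
qed

lemma unipotent_factor:
  assumes v: "v \<in> U1" shows "v * ginv (block_diag v) \<in> radical"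
proof -
  have vG: "v \<in> G" "upat v" "upat (ginv v)" using v U1_ginv[OF v] by (auto simp: U1_def)
  have "entry (v * ginv (block_diag v)) a b = (if a = b then 1 else 0)" if ab: "a \<in> {1..N}" "b \<in> {1..N}" "B b \<le> B a" for a b
    unfolding block_diag_ginv block_diag_mult(1)[OF vG(2) G_carrier[OF vG(1)] vG(3) ginv_carrier ab] ginv_right[OF vG(1)]
    using entry_one[OF ab(1,2)] by auto
  then show ?thesis using G_mult[OF vG(1) G_ginv[OF block_diag_G[OF v]]] by (simp add: radical_def)
qed

text \<open>A point of the orbit of \<open>x\<close> under the radical whose entries are known.\<close>

definition zz :: "'a mat \<Rightarrow> 'a mat" where
  "zz x = block_diag (vv x) * yy x * block_diag (ginv (vv x))"

definition uu :: "'a mat \<Rightarrow> 'a mat" where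
  "uu x = vv x * ginv (block_diag (vv x))"

lemma uu_radical: "x \<in> generic_points \<Longrightarrow> uu x \<in> radical" unfolding uu_def by (rule unipotent_factor[OF vy(1)])

lemma zz_conj: assumes x: "x \<in> generic_points" shows "zz x = irr.cj (uu x) x"
proof -
  define D where "D = block_diag (vv x)"
  have DG: "D \<in> G" unfolding D_def by (rule block_diag_G[OF vy(1)[OF x]])
  have vG: "vv x \<in> G" by (rule vv_G[OF x])
  have uG: "uu x \<in> G" using radical_G[OF uu_radical[OF x]] .
  note c = G_carrier[OF vG] G_carrier[OF DG] G_carrier[OF vy(2)[OF x]] ginv_carrier[of "vv x"] ginv_carrier[of D] G_carrier[OF uG]
  note as = assoc_mult_mat[of _ N N _ N _ N]
  have gu: "ginv (uu x) = D * ginv (vv x)"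
  proof (rule ginv_unique[OF uG, symmetric])
    show "D * ginv (vv x) \<in> carrier_mat N N" using c by simp
    have "D * ginv (vv x) * uu x = D * (ginv (vv x) * vv x) * ginv D"
      unfolding uu_def D_def[symmetric] using c mult_carrier_mat[OF c(4,1)] mult_carrier_mat[OF c(1,5)] by (simp add: as)
    also have "\<dots> = 1\<^sub>m N" using c ginv_right[OF DG] by (simp add: ginv_left[OF vG])
    finally show "D * ginv (vv x) * uu x = 1\<^sub>m N" .
  qed
  have "irr.cj (uu x) x = ginv (uu x) * x * uu x"
    using cj_ginv[OF uu_radical[OF x]] ginv_ginv[OF uG] by simp
  also have "\<dots> = D * ginv (vv x) * (vv x * yy x * ginv (vv x)) * (vv x * ginv D)"
    unfolding gu vy(4)[OF x, symmetric] by (simp add: uu_def D_def)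
  also have "\<dots> = D * ((ginv (vv x) * vv x) * (yy x * ((ginv (vv x) * vv x) * ginv D)))"
    using c(1,3-5) c(2) by (simp add: as mult_carrier_mat[of _ N N _ N])
  also have "\<dots> = D * (yy x * ginv D)" unfolding ginv_left[OF vG]
    using c by (simp add: left_mult_one_mat[of _ N N] mult_carrier_mat[of _ N N _ N])
  also have "\<dots> = zz x" unfolding zz_def D_def block_diag_ginv using c by (simp add: as D_def)
  finally show ?thesis by simp
qed

lemma zz_C: "x \<in> generic_points \<Longrightarrow> zz x \<in> C"
  using zz_conj irr.cj_stable uu_radical generic_points_C by simp

lemma zz_gen_funs: assumes ij: "i \<in> {1..N}" "j \<in> {1..N}" shows "(\<lambda>x. entry (zz x) i j) \<in> gen_funs"
proof -
  have 1: "(\<lambda>x. entry (block_diag (vv x)) a b) \<in> gen_funs" "(\<lambda>x. entry (block_diag (ginv (vv x))) a b) \<in> gen_funs" if "a \<in> {1..N}" "b \<in> {1..N}" for a b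
    using vv_gen_funs[OF that] gen_funs.const[of 0] by (cases "B a = B b"; simp add: entry_block_diag[OF that])+
  have "(\<lambda>x. \<Sum>k=1..N. (\<Sum>l=1..N. entry (block_diag (vv x)) i l * entry (yy x) l k) * entry (block_diag (ginv (vv x))) k j) \<in> gen_funs"
    by (intro gen_funs.sum gen_funs.mult 1 yy_gen_funs ij)
  then show ?thesis
  proof (rule gen_funs.cong)
    fix x assume x: "x \<in> generic_points"
    note c = G_carrier[OF vy(2)[OF x]]
    show "(\<Sum>k=1..N. (\<Sum>l=1..N. entry (block_diag (vv x)) i l * entry (yy x) l k) * entry (block_diag (ginv (vv x))) k j) = entry (zz x) i j"
      unfolding zz_def entry_mult[OF mult_carrier_mat[OF block_diag_carrier c] block_diag_carrier ij]
      by (intro sum.cong refl arg_cong2[of _ _ _ _ "(*)"]) (use ij in \<open>simp add: entry_mult[OF block_diag_carrier c]\<close>)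
  qed
qed

text \<open>An invariant \<open>q\<close> has the same value at \<open>x\<close> and at \<open>zz x\<close>, and the entries of \<open>zz x\<close> are values of elements of
  \<open>gen_field\<close>. So a representation of \<open>q\<close> as a fraction, evaluated at \<open>zz x\<close>, gives \<open>q\<close> as a quotient of elements of \<open>gen_field\<close>.\<close>

lemma invariants_subset_gen_field:
  assumes q: "q \<in> invariants N C radical" shows "q \<in> gen_field"
proof -
  obtain p r where pr: "p \<in> regular_funs N" "r \<in> regular_funs N" "\<exists>x\<in>C. r x \<noteq> 0"
    "q = frac_of irr.CR (restrict p C) (restrict r C)" "\<And>x. x \<in> C \<Longrightarrow> r x \<noteq> 0 \<Longrightarrow> irr.ev x q (p x / r x)"
    using irr.frac_regular[OF irr.invariants_carrier[OF q]] by metis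
  obtain x0 where x0: "x0 \<in> C" "Gen x0 \<noteq> 0" "r x0 \<noteq> 0"
    using irr.irreducible[OF Gen_regular pr(2) Gen_nonzero pr(3)] by blast
  have x0O: "x0 \<in> generic_points" using x0 by (simp add: generic_points_def)
  \<comment> \<open>The denominator may vanish at all points \<open>zz x\<close>; conjugating by \<open>uu x0\<close> repairs this.\<close>
  obtain h where h: "h \<in> radical" "\<And>x. x \<in> C \<Longrightarrow> irr.cj h (irr.cj (uu x0) x) = x"
    using irr.cj_inverse[OF uu_radical[OF x0O]] by metis
  define p' where "p' x = p (irr.cj h x)" for x
  define r' where "r' x = r (irr.cj h x)" for x
  have reg: "p' \<in> regular_funs N" "r' \<in> regular_funs N"
    using irr.conj_regular[OF h(1)] pr(1,2) unfolding p'_def[abs_def] r'_def[abs_def] irr.cj_def by auto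
  have nonzero_CR: "restrict f C \<in> carrier irr.CR - {\<zero>\<^bsub>irr.CR\<^esub>}"
    if f: "f \<in> regular_funs N" "x \<in> C" "f x \<noteq> 0" for f :: "'a mat \<Rightarrow> 'a" and x
    by (rule irr.CR_nonzero[OF irr.restrict_CR[OF f(1)] f(2)]) (use f in simp)
  have CRp: "restrict p C \<in> carrier irr.CR" "restrict p' C \<in> carrier irr.CR"
    using irr.restrict_CR pr(1) reg(1) by auto
  have CRr: "restrict r C \<in> carrier irr.CR - {\<zero>\<^bsub>irr.CR\<^esub>}" by (rule nonzero_CR[OF pr(2) x0(1,3)])
  have inv: "irr.inv_frac (restrict p C) (restrict r C)"
    using q unfolding pr(4) by (simp add: irr.invariants_iff[OF CRp(1) CRr])
  have r'z: "r' (zz x0) \<noteq> 0" using x0(3) h(2)[OF x0(1)] by (simp add: r'_def zz_conj[OF x0O])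
  have CRr': "restrict r' C \<in> carrier irr.CR - {\<zero>\<^bsub>irr.CR\<^esub>}" by (rule nonzero_CR[OF reg(2) zz_C[OF x0O] r'z])
  have q': "q = frac_of irr.CR (restrict p' C) (restrict r' C)"
  proof -
    have e: "conj_fun N C h (restrict f C) = restrict (\<lambda>x. f (irr.cj h x)) C" for f
      unfolding irr.conj_fun_cj using irr.cj_stable[OF h(1)] by (auto simp: restrict_def fun_eq_iff)
    have "(restrict p C, restrict r C) \<in> q" unfolding pr(4) irr.CR.mem_frac_of_iff using CRp CRr by auto
    then have "map_prod (conj_fun N C h) (conj_fun N C h) (restrict p C, restrict r C) \<in> q"
      using irr.conj_frac_subset[OF CRp(1) CRr inv h(1)] unfolding pr(4) by blast
    then have "(restrict p' C, restrict r' C) \<in> q" by (simp add: e p'_def[abs_def] r'_def[abs_def])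
    then show ?thesis
      unfolding pr(4) irr.CR.mem_frac_of_iff using irr.CR.frac_eq_iff[OF CRp CRr CRr'] by blast
  qed
  have inv': "irr.inv_frac (restrict p' C) (restrict r' C)"
    using q unfolding q' by (simp add: irr.invariants_iff[OF CRp(2) CRr'])
  have key: "p' x * r' (zz x) = p' (zz x) * r' x" if x: "x \<in> generic_points" for x
  proof -
    have "restrict p' C x * restrict r' C (irr.cj (uu x) x) = restrict p' C (irr.cj (uu x) x) * restrict r' C x"
      using inv' uu_radical[OF x] generic_points_C[OF x] unfolding irr.inv_frac_def by blast
    then show ?thesis using generic_points_C[OF x] zz_C[OF x] unfolding zz_conj[OF x] by simp
  qed
  have "(\<lambda>x. p' (zz x)) \<in> gen_funs" by (rule gen_funs.regular_comp[OF reg(1) C_carrier[OF zz_C] zz_gen_funs])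
  moreover have "(\<lambda>x. r' (zz x)) \<in> gen_funs" by (rule gen_funs.regular_comp[OF reg(2) C_carrier[OF zz_C] zz_gen_funs])
  ultimately obtain q1 q2 where q1: "q1 \<in> gen_field" "\<And>x. x \<in> generic_points \<Longrightarrow> irr.ev x q1 (p' (zz x))"
    and q2: "q2 \<in> gen_field" "\<And>x. x \<in> generic_points \<Longrightarrow> irr.ev x q2 (r' (zz x))"
    unfolding gen_funs_def by blast
  have q20: "q2 \<noteq> \<zero>\<^bsub>irr.F\<^esub>" by (rule irr.ev_nonzero[OF q2(2)[OF x0O] r'z])
  have F: "q \<in> carrier irr.F" "q1 \<in> carrier irr.F" "q2 \<in> carrier irr.F"
    using irr.invariants_carrier[OF q] irr.ev_carrier[OF q1(2)[OF x0O]] irr.ev_carrier[OF q2(2)[OF x0O]] by auto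
  have qq: "q \<otimes>\<^bsub>irr.F\<^esub> q2 = q1"
  proof (rule irr.ev_eqI)
    have r'0: "\<exists>x\<in>C. r' x \<noteq> 0" using r'z zz_C[OF x0O] by blast
    note m = irr.regular_mult_nonzero[OF Gen_regular reg(2) Gen_nonzero r'0]
    show "(\<lambda>x. Gen x * r' x) \<in> regular_funs N" "\<exists>x\<in>C. Gen x * r' x \<noteq> 0" by (rule m)+
    fix x assume x: "x \<in> C" "Gen x * r' x \<noteq> 0"
    then have xO: "x \<in> generic_points" "r' x \<noteq> 0" by (auto simp: generic_points_def)
    have "irr.ev x q (p' x / r' x)"
      using irr.ev_frac[OF x(1) CRp(2), of "restrict r' C"] CRr' xO x unfolding q' by simp
    from irr.ev_mult[OF this q2(2)[OF xO(1)]] have "irr.ev x (q \<otimes>\<^bsub>irr.F\<^esub> q2) (p' (zz x))"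
      using key[OF xO(1)] xO(2) by simp
    then show "\<exists>v. irr.ev x (q \<otimes>\<^bsub>irr.F\<^esub> q2) v \<and> irr.ev x q1 v" using q1(2)[OF xO(1)] by blast
  qed (use F in auto)
  have "q1 \<otimes>\<^bsub>irr.F\<^esub> inv\<^bsub>irr.F\<^esub> q2 = q \<otimes>\<^bsub>irr.F\<^esub> (q2 \<otimes>\<^bsub>irr.F\<^esub> inv\<^bsub>irr.F\<^esub> q2)"
    unfolding qq[symmetric] using F q20 irr.F.field_Units by (intro irr.F.m_assoc) auto
  also have "\<dots> = q" using F q20 irr.F.field_Units by simp
  finally have "q = q1 \<otimes>\<^bsub>irr.F\<^esub> inv\<^bsub>irr.F\<^esub> q2" by simp
  then show ?thesis using q1(1) q2(1) q20 unfolding gen_field_def by (auto intro: generate_field.m_inv generate_field.eng_mult)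
qed

theorem gen_field_eq_invariants: "gen_field = invariants N C radical"
proof
  show "gen_field \<subseteq> invariants N C radical"
    unfolding gen_field_def using F0B_invariant J_circ_invariant by (intro irr.generate_field_invariants) auto
qed (use invariants_subset_gen_field in blast)

end

section \<open>Symmetric partitions\<close>

locale partitioned_segment =
  fixes N l :: nat and I :: "nat \<Rightarrow> nat set"
  assumes partition: "symmetric_partition N l I"
begin

lemmas partition_parts = partition[unfolded symmetric_partition_def]
lemmas block_interval = partition_parts[THEN conjunct1]
lemmas block_union = partition_parts[THEN conjunct2, THEN conjunct1]
lemmas blocks_ordered = partition_parts[THEN conjunct2, THEN conjunct2, THEN conjunct1]
lemmas blocks_symmetric = partition_parts[THEN conjunct2, THEN conjunct2, THEN conjunct2]

lemma block_less: "k \<in> {1..l} \<Longrightarrow> p \<in> {1..l} \<Longrightarrow> k < p \<Longrightarrow> i \<in> I k \<Longrightarrow> j \<in> I p \<Longrightarrow> i < j"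
  using blocks_ordered by blast

lemma block_opp: "k \<in> {1..l} \<Longrightarrow> opp N ` I k = I (l - k + 1)"
  using blocks_symmetric by blast

definition blk :: "nat \<Rightarrow> nat" where "blk i = (THE k. k \<in> {1..l} \<and> i \<in> I k)"

lemma blk_eq: assumes "k \<in> {1..l}" "i \<in> I k" shows "blk i = k"
  unfolding blk_def
proof (rule the_equality)
  fix p assume "p \<in> {1..l} \<and> i \<in> I p"
  then show "p = k" using block_less[of k p i i] block_less[of p k i i] assms by (cases p k rule: linorder_cases) auto
qed (use assms in simp)

lemma blk_mem: assumes "i \<in> {1..N}" shows "blk i \<in> {1..l}" "i \<in> I (blk i)"
proof -
  obtain k where "k \<in> {1..l}" "i \<in> I k" using assms block_union by blast
  then show "blk i \<in> {1..l}" "i \<in> I (blk i)" using blk_eq by simp_all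
qed

lemma block_subset: "k \<in> {1..l} \<Longrightarrow> i \<in> I k \<Longrightarrow> i \<in> {1..N}"
  using block_union by blast

lemma blk_iff: "k \<in> {1..l} \<Longrightarrow> i \<in> I k \<longleftrightarrow> i \<in> {1..N} \<and> blk i = k"
  using blk_eq blk_mem block_subset by blast

lemma blk_mono: assumes "a \<in> {1..N}" "b \<in> {1..N}" "a \<le> b" shows "blk a \<le> blk b"
  using block_less[OF blk_mem(1)[OF assms(2)] blk_mem(1)[OF assms(1)] _ blk_mem(2)[OF assms(2)] blk_mem(2)[OF assms(1)]] assms(3)
  by (meson leD leI)

lemma blk_opp: assumes a: "a \<in> {1..N}" shows "blk (Suc N - a) + blk a = Suc l"
proof -
  note k = blk_mem[OF a]
  have "opp N a \<in> I (l - blk a + 1)" using block_opp[OF k(1)] k(2) by blast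
  then have "blk (Suc N - a) = l - blk a + 1" using k(1) by (intro blk_eq) (auto simp: opp_def)
  then show ?thesis using k(1) by simp
qed

text \<open>The first \<open>l div 2\<close> segments form an initial segment of \<open>[1, N]\<close>, which is determined by its size.\<close>

lemma size0_block: "{i \<in> {1..N}. blk i \<le> l div 2} = {1..size0 l I}"
proof -
  let ?D = "{i \<in> {1..N}. blk i \<le> l div 2}"
  have h: "{1..l div 2} \<subseteq> {1..l}" by auto
  have "?D = (\<Union>k\<in>{1..l div 2}. I k)"
  proof (intro subset_antisym subsetI)
    fix i assume "i \<in> ?D" then show "i \<in> (\<Union>k\<in>{1..l div 2}. I k)" using blk_mem[of i] by auto
  next
    fix i assume "i \<in> (\<Union>k\<in>{1..l div 2}. I k)"
    then obtain k where k: "k \<in> {1..l div 2}" "i \<in> I k" by blast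
    then have "k \<in> {1..l}" by auto
    then show "i \<in> ?D" using k blk_eq[of k i] block_subset[of k i] by auto
  qed
  also have "card \<dots> = size0 l I" unfolding size0_def
  proof (rule card_UN_disjoint)
    show "\<forall>k\<in>{1..l div 2}. finite (I k)" using block_interval h by (metis finite_atLeastAtMost subsetD)
    show "\<forall>k\<in>{1..l div 2}. \<forall>p\<in>{1..l div 2}. k \<noteq> p \<longrightarrow> I k \<inter> I p = {}"
      using blk_eq h by blast
  qed simp
  finally have card: "card ?D = size0 l I" .
  show ?thesis
  proof (cases "?D = {}")
    case True
    then have "size0 l I = 0" using card by (metis card.empty)
    then show ?thesis using True by simp
  next
    case False
    have fin: "finite ?D" by simp
    have mx: "Max ?D \<in> {1..N}" "blk (Max ?D) \<le> l div 2" using Max_in[OF fin False] by auto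
    have "?D = {1..Max ?D}"
    proof (intro subset_antisym subsetI)
      fix i assume "i \<in> ?D" then show "i \<in> {1..Max ?D}" using Max_ge[OF fin] by auto
    next
      fix i assume i: "i \<in> {1..Max ?D}"
      then have "i \<in> {1..N}" using mx(1) by auto
      then show "i \<in> ?D" using blk_mono[of i "Max ?D"] mx i by auto
    qed
    moreover from this have "Max ?D = size0 l I" using card by (metis card_atLeastAtMost diff_Suc_1)
    ultimately show ?thesis by simp
  qed
qed

lemma low: assumes "i \<in> {1..N}" shows "i \<le> size0 l I \<longleftrightarrow> blk i \<le> l div 2"
  using size0_block assms by (auto simp: set_eq_iff)

lemma high: assumes i: "i \<in> {1..N}" shows "N - size0 l I < i \<longleftrightarrow> l - l div 2 < blk i"
proof -
  have o: "Suc N - i \<in> {1..N}" using i by auto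
  have "N - size0 l I < i \<longleftrightarrow> Suc N - i \<le> size0 l I" using i by auto
  also have "\<dots> \<longleftrightarrow> blk (Suc N - i) \<le> l div 2" by (rule low[OF o])
  also have "\<dots> \<longleftrightarrow> l - l div 2 < blk i" using blk_opp[OF i] blk_mem(1)[OF i] blk_mem(1)[OF o] by auto
  finally show ?thesis .
qed

lemma size0_le: "2 * size0 l I \<le> N"
proof (rule ccontr)
  assume a: "\<not> 2 * size0 l I \<le> N"
  have "size0 l I \<in> {1..size0 l I}" using a by auto
  then have i: "size0 l I \<in> {1..N}" "blk (size0 l I) \<le> l div 2" unfolding size0_block[symmetric] by auto
  have "l - l div 2 < blk (size0 l I)" using a unfolding high[OF i(1), symmetric] by auto
  then show False using i(2) by auto
qed

lemma middle:
  assumes "i \<in> {1..N}"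
  shows "size0 l I < i \<and> i \<le> N - size0 l I \<longleftrightarrow> odd l \<and> blk i = l div 2 + 1"
proof -
  have "size0 l I < i \<and> i \<le> N - size0 l I \<longleftrightarrow> l div 2 < blk i \<and> blk i \<le> l - l div 2"
    using low[OF assms] high[OF assms] by auto
  also have "\<dots> \<longleftrightarrow> odd l \<and> blk i = l div 2 + 1"
  proof (cases "even l")
    case True then show ?thesis by (auto elim!: evenE)
  next
    case False then show ?thesis by (auto elim!: oddE)
  qed
  finally show ?thesis .
qed

lemma middle_block: assumes "odd l" shows "I (l div 2 + 1) = {size0 l I + 1..N - size0 l I}"
proof -
  have k: "l div 2 + 1 \<in> {1..l}" using assms by (auto elim!: oddE)
  show ?thesis
  proof (intro subset_antisym subsetI)
    fix i assume "i \<in> I (l div 2 + 1)"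
    then have "i \<in> {1..N}" "blk i = l div 2 + 1" using blk_iff[OF k] by auto
    then show "i \<in> {size0 l I + 1..N - size0 l I}" using middle[of i] assms by auto
  next
    fix i assume i: "i \<in> {size0 l I + 1..N - size0 l I}"
    then have "i \<in> {1..N}" by auto
    then show "i \<in> I (l div 2 + 1)" using middle[of i] assms i blk_iff[OF k] by auto
  qed
qed

lemma size0_pos: assumes "size0 l I \<ge> 1" shows "l \<ge> 2"
proof -
  have "1 \<in> {1..size0 l I}" using assms by auto
  then have "1 \<in> {1..N}" "blk 1 \<le> l div 2" unfolding size0_block[symmetric] by auto
  then show ?thesis using blk_mem(1)[of 1] by auto
qed

lemma M_cols_eq: "M_cols l I = {1..size0 l I}"
proof -
  have "M_cols l I = {i \<in> {1..N}. blk i \<le> l div 2}" unfolding M_cols_def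
  proof (intro subset_antisym subsetI)
    fix i assume "i \<in> (\<Union>k\<in>{1..l div 2}. I k)"
    then obtain k where k: "k \<in> {1..l div 2}" "i \<in> I k" by blast
    then have "k \<in> {1..l}" by auto
    then show "i \<in> {i \<in> {1..N}. blk i \<le> l div 2}" using k blk_iff by auto
  next
    fix i assume "i \<in> {i \<in> {1..N}. blk i \<le> l div 2}"
    then show "i \<in> (\<Union>k\<in>{1..l div 2}. I k)" using blk_mem[of i] by auto
  qed
  then show ?thesis unfolding size0_block .
qed

lemma M_rows_eq: assumes "odd l" shows "M_rows l I = {N - size0 l I + 1..N}"
proof -
  have h: "l - l div 2 < k \<longleftrightarrow> l div 2 + 2 \<le> k" for k using assms by (auto elim!: oddE)
  show ?thesis unfolding M_rows_def
  proof (intro subset_antisym subsetI)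
    fix i assume "i \<in> (\<Union>k\<in>{l div 2 + 2..l}. I k)"
    then obtain k where k: "k \<in> {l div 2 + 2..l}" "i \<in> I k" by blast
    then have "k \<in> {1..l}" by auto
    then have "i \<in> {1..N}" "blk i = k" using k blk_iff by auto
    then show "i \<in> {N - size0 l I + 1..N}" using high[of i] h[of k] k by auto
  next
    fix i assume i: "i \<in> {N - size0 l I + 1..N}"
    then have iN: "i \<in> {1..N}" by auto
    then have "l div 2 + 2 \<le> blk i" using high[OF iN] h[of "blk i"] i by auto
    then show "i \<in> (\<Union>k\<in>{l div 2 + 2..l}. I k)" using blk_mem[OF iN] by auto
  qed
qed

end

section \<open>Orthogonal and symplectic groups\<close>

definition form_sign :: "group_type \<Rightarrow> nat \<Rightarrow> nat \<Rightarrow> 'a::field_char_0" where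
  "form_sign t N i = (if t = Symplectic \<and> i \<le> N div 2 then -1 else 1)"

definition type_sign :: "group_type \<Rightarrow> 'a::field_char_0" where
  "type_sign t = (if t = Symplectic then -1 else 1)"

lemma type_sign_iff: "(type_sign t :: 'a::field_char_0) = 1 \<longleftrightarrow> t = Orthogonal"
  "(type_sign t :: 'a::field_char_0) = -1 \<longleftrightarrow> t = Symplectic"
  by (cases t; simp add: type_sign_def)+

lemma antidiagonal_form_sign:
  assumes "N \<ge> 1" "t = Symplectic \<Longrightarrow> even N"
  shows "antidiagonal_form N (form_sign t N) (type_sign t :: 'a::field_char_0)"
proof
  fix i assume i: "i \<in> {1..N}"
  show "form_sign t N i * form_sign t N i = (1::'a)" by (simp add: form_sign_def)
  have "t = Symplectic \<Longrightarrow> Suc N - i \<le> N div 2 \<longleftrightarrow> \<not> i \<le> N div 2" using assms(2) i by (auto elim!: evenE)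
  then show "form_sign t N (Suc N - i) = type_sign t * (form_sign t N i :: 'a)"
    by (auto simp: form_sign_def type_sign_def)
next
  show "type_sign t = (1::'a) \<or> type_sign t = (-1::'a)" by (simp add: type_sign_def)
qed (rule assms(1))

lemma form_mat_entries:
  assumes "t = Symplectic \<Longrightarrow> even N"
  shows "form_mat t N = mat1 N (\<lambda>a b. if b = Suc N - a then form_sign t N a else (0::'a::field_char_0))"
proof (cases t)
  case Orthogonal
  then show ?thesis by (auto simp: antidiag_def mat1_def form_sign_def intro!: eq_matI)
next
  case Symplectic
  then obtain n where n: "N = 2 * n" using assms by (auto elim: evenE)
  show ?thesis unfolding Symplectic n
    by (rule eq_matI) (auto simp: Let_def antidiag_def mat1_def form_sign_def)
qed

text \<open>Expansion along the first row gives the sign \<open>(-1)^k\<close> for size \<open>k + 1\<close>; two consecutive steps give \<open>-1\<close>.\<close>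

lemma det_antidiag_even: "det (antidiag (2 * n) :: 'a::field_char_0 mat) = (-1) ^ n"
proof -
  have step: "det (antidiag (Suc k) :: 'a mat) = (-1) ^ k * det (antidiag k :: 'a mat)" for k
  proof -
    let ?A = "antidiag (Suc k) :: 'a mat"
    have A: "?A \<in> carrier_mat (Suc k) (Suc k)" by (simp add: antidiag_def)
    have "det ?A = (\<Sum>j<Suc k. ?A $$ (0, j) * cofactor ?A 0 j)"
      by (rule laplace_expansion_row[OF A]) simp
    also have "\<dots> = (\<Sum>j<Suc k. if j = k then cofactor ?A 0 j else 0)"
      by (intro sum.cong refl) (auto simp: antidiag_def)
    also have "\<dots> = cofactor ?A 0 k" by simp
    also have "mat_delete ?A 0 k = antidiag k" by (rule eq_matI) (auto simp: mat_delete_def antidiag_def)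
    then have "cofactor ?A 0 k = (-1) ^ k * det (antidiag k :: 'a mat)" by (simp add: cofactor_def)
    finally show ?thesis .
  qed
  show ?thesis
  proof (induction n)
    case 0 show ?case by (simp add: antidiag_def)
  next
    case (Suc n)
    have "det (antidiag (2 * Suc n) :: 'a mat) = (-1) ^ Suc (2 * n) * ((-1) ^ (2 * n) * det (antidiag (2 * n) :: 'a mat))"
      using step[of "Suc (2 * n)"] step[of "2 * n"] by simp
    then show ?case unfolding Suc.IH by simp
  qed
qed

locale partitioned_group = partitioned_segment +
  fixes t :: group_type and \<epsilon> :: "'a::field_char_0"
  assumes N_ge: "N \<ge> 1"
    and N_even: "t = Symplectic \<Longrightarrow> even N"
    and \<epsilon>_orthogonal: "t = Orthogonal \<Longrightarrow> \<epsilon> = 1 \<or> \<epsilon> = -1"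
    and \<epsilon>_even: "t = Orthogonal \<Longrightarrow> even N \<Longrightarrow> l \<ge> 2 \<Longrightarrow> \<epsilon> = (-1) ^ (N div 2)"
begin

sublocale split_form N "form_sign t N" "type_sign t :: 'a" "size0 l I" \<epsilon>
proof -
  interpret antidiagonal_form N "form_sign t N" "type_sign t :: 'a"
    by (rule antidiagonal_form_sign[OF N_ge N_even])
  show "split_form N (form_sign t N) (type_sign t :: 'a) (size0 l I) \<epsilon>"
    by unfold_locales (use size0_le \<epsilon>_orthogonal type_sign_iff in auto)
qed

lemma G_classical: "G = classical_group t N"
proof -
  have f: "form_mat t N = form" unfolding form_def by (rule form_mat_entries[OF N_even])
  have inv: "invertible_mat g" if "g \<in> G" for g
    unfolding invertible_mat_def inverts_mat_def
    using G_carrier[OF that] ginv_left[OF that] ginv_right[OF that] carrier_matD[OF ginv_carrier[of g]]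
    by (auto intro!: exI[of _ "ginv g"])
  show ?thesis
  proof (intro subset_antisym subsetI)
    fix g assume "g \<in> G"
    then show "g \<in> classical_group t N" using inv G_iff[of g] unfolding classical_group_def f by blast
  next
    fix g :: "'a mat" assume "g \<in> classical_group t N"
    then show "g \<in> G" using G_iff[of g] unfolding classical_group_def f by blast
  qed
qed

lemma C_irr_component: "C = irr_component t N \<epsilon>"
  unfolding component_def irr_component_def G_classical
  by (cases t) (auto simp: type_sign_def)

lemma component_not_empty: "C \<noteq> {}"
proof (cases "t = Orthogonal \<and> \<epsilon> = -1")
  case True
  then have sg: "(type_sign t :: 'a) = 1" using type_sign_iff by blast
  obtain \<tau> w where w: "\<tau> * bf w w = 2" "det (lmat (refl \<tau> w)) = -1"
    using reflection_with_det_minus_one[OF sg] .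
  have "lmat (refl \<tau> w) \<in> G" by (rule lmat_refl_G) (use w(1) in \<open>simp add: type_sign_def True\<close>)
  then have "lmat (refl \<tau> w) \<in> C" using w(2) True unfolding component_def by blast
  then show ?thesis by blast
next
  case False
  then have "(type_sign t :: 'a) = 1 \<Longrightarrow> \<epsilon> = 1" using \<epsilon>_orthogonal type_sign_iff by blast
  then have "1\<^sub>m N \<in> C" using G_one by (simp add: component_def)
  then show ?thesis by blast
qed

lemma scaled_form:
  assumes c: "c * c = 1" shows "c \<cdot>\<^sub>m form \<in> G" "det (c \<cdot>\<^sub>m form) = c ^ N * det form"
    "i \<in> {1..N} \<Longrightarrow> k \<in> {1..N} \<Longrightarrow> entry (c \<cdot>\<^sub>m form) i k = (if k = Suc N - i then c * form_sign t N i else 0)"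
proof -
  have e: "entry (c \<cdot>\<^sub>m form) i k = c * entry form i k" if "i \<in> {1..N}" "k \<in> {1..N}" for i k
  proof -
    have "i - 1 < N" "k - 1 < N" using that by auto
    then show ?thesis unfolding entry_def using index_smult_mat(1)[of "i - 1" form "k - 1" c] carrier_matD[OF form_carrier] by simp
  qed
  then show "i \<in> {1..N} \<Longrightarrow> k \<in> {1..N} \<Longrightarrow> entry (c \<cdot>\<^sub>m form) i k = (if k = Suc N - i then c * form_sign t N i else 0)"
    by (simp add: form_def)
  have "bf (entry (c \<cdot>\<^sub>m form) i) (entry (c \<cdot>\<^sub>m form) k) = (if k = Suc N - i then form_sign t N i else 0)"
    if ik: "i \<in> {1..N}" "k \<in> {1..N}" for i k
  proof -
    have "bf (entry (c \<cdot>\<^sub>m form) i) (entry (c \<cdot>\<^sub>m form) k) = bf (\<lambda>p. c * entry form i p) (\<lambda>p. c * entry form k p)"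
      by (rule bf_cong) (use e ik in auto)
    also have "\<dots> = c * c * bf (entry form i) (entry form k)" unfolding bf_scale_left bf_scale_right by simp
    finally show ?thesis using G_rows[OF form_G ik] c by simp
  qed
  then show "c \<cdot>\<^sub>m form \<in> G" unfolding G_def by simp
  show "det (c \<cdot>\<^sub>m form) = c ^ N * det form" using carrier_matD(2)[OF form_carrier] by (simp only: det_smult)
qed

text \<open>For odd \<open>N\<close> the sign of the determinant is adjusted by the factor \<open>c = \<plusminus>1\<close>; for even \<open>N\<close> the hypothesis on \<open>\<epsilon>\<close> is just
  that \<open>form\<close> lies in the component.\<close>

lemma antidiagonal_in_component:
  assumes m: "size0 l I \<ge> 1"
  shows "\<exists>w\<in>C. \<exists>c. c \<noteq> 0 \<and>
    (\<forall>i\<in>{1..N}. \<forall>k\<in>{1..N}. entry w i k = (if k = Suc N - i then c * form_sign t N i else 0))"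
proof -
  have "\<exists>c. c * c = 1 \<and> (t = Orthogonal \<longrightarrow> c ^ N * det form = \<epsilon>)"
  proof (cases "t = Orthogonal \<and> odd N")
    case True
    have d: "det form * det form = 1" by (rule det_sq[OF form_G])
    have e: "\<epsilon> * \<epsilon> = 1" using \<epsilon>_orthogonal True by auto
    define c where "c = \<epsilon> * det form"
    have c: "c * c = 1" using d e unfolding c_def by (metis mult.assoc mult.left_commute mult_1_right)
    obtain n where n: "N = 2 * n + 1" using True by (auto elim: oddE)
    have "c ^ N = c" using c unfolding n by (simp add: power_mult power2_eq_square)
    then have "c ^ N * det form = \<epsilon> * (det form * det form)" by (simp add: c_def mult.assoc)
    then show ?thesis using c d by auto
  next
    case False
    have "det form = \<epsilon>" if o: "t = Orthogonal"
    proof -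
      obtain n where n: "N = 2 * n" using False o by (auto elim: evenE)
      have "form = form_mat t N" unfolding form_def by (rule form_mat_entries[OF N_even, symmetric])
      then have "form = antidiag N" using o by simp
      then show ?thesis using det_antidiag_even[of n] \<epsilon>_even[OF o _ size0_pos[OF m]] n by simp
    qed
    then show ?thesis by (intro exI[of _ 1]) simp
  qed
  then obtain c where c: "c * c = 1" "t = Orthogonal \<Longrightarrow> c ^ N * det form = \<epsilon>" by blast
  have "det (c \<cdot>\<^sub>m form) = \<epsilon>" if "(type_sign t :: 'a) = 1"
    using c(2) that type_sign_iff(1) unfolding scaled_form(2)[OF c(1)] by blast
  then have "c \<cdot>\<^sub>m form \<in> C" unfolding component_def using scaled_form(1)[OF c(1)] by blast
  then show ?thesis using c(1) scaled_form(3)[OF c(1)] by (intro bexI[of _ "c \<cdot>\<^sub>m form"] exI[of _ c]) auto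
qed

sublocale block_form N "form_sign t N" "type_sign t :: 'a" "size0 l I" \<epsilon> blk l
proof
  show "C \<noteq> {}" by (rule component_not_empty)
  show "size0 l I \<ge> 1 \<Longrightarrow> \<exists>w\<in>C. \<exists>c. c \<noteq> 0 \<and>
    (\<forall>i\<in>{1..N}. \<forall>k\<in>{1..N}. entry w i k = (if k = Suc N - i then c * form_sign t N i else 0))"
    by (rule antidiagonal_in_component)
next
  fix a b assume "mid a" "mid b"
  then have "a \<in> {1..N}" "b \<in> {1..N}" by (auto simp: mid_def)
  then show "blk a = blk b" using middle[of a] middle[of b] \<open>mid a\<close> \<open>mid b\<close> by (simp add: mid_def)
next
  fix a b assume ab: "a \<in> {1..N}" "b \<in> {1..N}" "blk a = blk b"
  then show "(a \<le> size0 l I \<and> b \<le> size0 l I) \<or> (mid a \<and> mid b) \<or> (N - size0 l I < a \<and> N - size0 l I < b)"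
    using low[of a] low[of b] high[of a] high[of b] by (auto simp: mid_def)
qed (rule blk_mono blk_opp; assumption)+

lemma S_circ_gen_pairs: "S_circ t N l I = gen_pairs"
proof -
  have 1: "(if even l then i > size0 l I else i > size0 l I + card (I (l div 2 + 1))) \<longleftrightarrow> N - size0 l I < i"
    if i: "i \<in> {1..N}" for i
  proof (cases "even l")
    case True
    then have "\<not> (size0 l I < i \<and> i \<le> N - size0 l I)" using middle[OF i] by simp
    then show ?thesis using True size0_le by auto
  next
    case False
    have "size0 l I + card (I (l div 2 + 1)) = N - size0 l I"
      unfolding middle_block[OF False] using size0_le by simp
    then show ?thesis using False by simp
  qed
  have 2: "(\<forall>k\<in>{1..l}. \<forall>p\<in>{1..l}. i \<in> I k \<and> j \<in> opp N ` I p \<longrightarrow> p \<le> k) \<longleftrightarrow> blk (Suc N - j) \<le> blk i"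
    if ij: "i \<in> {1..N}" "j \<in> {1..N}" for i j
  proof -
    have j': "Suc N - j \<in> {1..N}" using ij by auto
    have "j \<in> opp N ` I p \<longleftrightarrow> blk (Suc N - j) = p" if p: "p \<in> {1..l}" for p
    proof
      assume "j \<in> opp N ` I p"
      then obtain q where q: "q \<in> I p" "j = opp N q" by blast
      then have "Suc N - j = q" using block_subset[OF p q(1)] by (auto simp: opp_def)
      then show "blk (Suc N - j) = p" using blk_eq[OF p] q by simp
    next
      assume "blk (Suc N - j) = p"
      then have "Suc N - j \<in> I p" using blk_mem[OF j'] by simp
      moreover have "opp N (Suc N - j) = j" using ij by (auto simp: opp_def)
      ultimately show "j \<in> opp N ` I p" by (metis imageI)
    qed
    moreover have "i \<in> I k \<longleftrightarrow> blk i = k" if "k \<in> {1..l}" for k using blk_iff[OF that] ij by simp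
    ultimately show ?thesis using blk_mem(1)[OF ij(1)] blk_mem(1)[OF j'] by auto
  qed
  have 3: "(case t of Orthogonal \<Rightarrow> i > j | Symplectic \<Rightarrow> i \<ge> j) \<longleftrightarrow> j < i \<or> (j = i \<and> (type_sign t :: 'a) = -1)" for i j :: nat
    by (cases t) (auto simp: type_sign_def)
  have "(i, j) \<in> S_circ t N l I \<longleftrightarrow> (i, j) \<in> gen_pairs" for i j
  proof (cases "i \<in> {1..N} \<and> j \<in> {1..N}")
    case True
    then show ?thesis using 1[of i] 2[of i j] 3[of j i] unfolding S_circ_def gen_pairs_def by (simp only: mem_Collect_eq prod.case) blast
  next
    case False then show ?thesis unfolding S_circ_def gen_pairs_def by (simp only: mem_Collect_eq prod.case) blast
  qed
  then show ?thesis by auto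
qed

lemma unipotent_radical_radical: "unipotent_radical t N l I = radical"
proof (intro subset_antisym subsetI)
  fix g :: "'a mat" assume g: "g \<in> unipotent_radical t N l I"
  have "entry g a b = (if a = b then 1 else 0)" if ab: "a \<in> {1..N}" "b \<in> {1..N}" "blk b \<le> blk a" for a b
  proof (cases "blk b = blk a")
    case True
    have "\<forall>k\<in>{1..l}. \<forall>i\<in>I k. \<forall>j\<in>I k. entry g i j = (if i = j then 1 else 0)"
      using g unfolding unipotent_radical_def by blast
    then show ?thesis using blk_mem[OF ab(1)] blk_mem[OF ab(2)] True by metis
  next
    case False
    have "\<forall>k\<in>{1..l}. \<forall>p\<in>{1..l}. p < k \<longrightarrow> (\<forall>i\<in>I k. \<forall>j\<in>I p. entry g i j = 0)"
      using g unfolding unipotent_radical_def parabolic_def by blast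
    then have "entry g a b = 0" using blk_mem[OF ab(1)] blk_mem[OF ab(2)] ab(3) False by (metis le_neq_implies_less)
    then show ?thesis using False by auto
  qed
  then show "g \<in> radical" using g by (simp add: radical_def G_classical unipotent_radical_def parabolic_def)
next
  fix g assume g: "g \<in> radical"
  have e: "entry g a b = (if a = b then 1 else 0)" if "k \<in> {1..l}" "p \<in> {1..l}" "p \<le> k" "a \<in> I k" "b \<in> I p" for a b k p
    using radicalD[OF g, of a b] blk_iff that by simp
  show "g \<in> unipotent_radical t N l I"
    unfolding unipotent_radical_def parabolic_def G_classical[symmetric] mem_Collect_eq
  proof (intro conjI ballI impI)
    fix k p a b assume *: "k \<in> {1..l}" "p \<in> {1..l}" "p < k" "a \<in> I k" "b \<in> I p"
    then have "b < a" using block_less by blast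
    then show "entry g a b = 0" using e[of k p a b] * by simp
  next
    fix k a b assume "k \<in> {1..l}" "a \<in> I k" "b \<in> I k"
    then show "entry g a b = (if a = b then 1 else 0)" using e[of k k a b] by simp
  qed (rule radical_G[OF g])
qed

lemma ratfun_of_eqI: "(\<And>x. x \<in> C \<Longrightarrow> f x = g x) \<Longrightarrow> ratfun_of N C f = ratfun_of N C g"
  unfolding ratfun_of_def using restrict_ext[of C f g] by (simp only:)

lemma P_fun_Pf:
  assumes l: "odd l" and ab: "mid a" "mid b" shows "P_fun N C l I (a, b) = Pf (a, b)"
proof -
  let ?m = "size0 l I"
  have 1: "minor x (insert a (M_rows l I)) (insert b (M_cols l I)) = bordered_minor a b x" if x: "x \<in> C" for x
    unfolding bordered_minor_def M_rows_eq[OF l] M_cols_eq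
  proof (rule minor_sel[OF C_carrier[OF x]])
    show "(\<lambda>p. if p = 0 then a else N - ?m + p) ` {..<Suc ?m} = insert a {N - ?m + 1..N}"
    proof (intro subset_antisym subsetI)
      fix r assume r: "r \<in> insert a {N - ?m + 1..N}"
      show "r \<in> (\<lambda>p. if p = 0 then a else N - ?m + p) ` {..<Suc ?m}"
      proof (cases "r = a")
        case True then show ?thesis by (intro image_eqI[of _ _ 0]) auto
      next
        case False then show ?thesis using r m_le by (intro image_eqI[of _ _ "r - (N - ?m)"]) auto
      qed
    qed (use m_le in auto)
    show "(\<lambda>q. if q < ?m then Suc q else b) ` {..<Suc ?m} = insert b {1..?m}"
    proof (intro subset_antisym subsetI)
      fix r assume r: "r \<in> insert b {1..?m}"
      show "r \<in> (\<lambda>q. if q < ?m then Suc q else b) ` {..<Suc ?m}"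
      proof (cases "r = b")
        case True then show ?thesis by (intro image_eqI[of _ _ ?m]) auto
      next
        case False then show ?thesis using r by (intro image_eqI[of _ _ "r - 1"]) auto
      qed
    qed auto
  qed (use ab m_le in \<open>auto simp: strict_mono_on_def mid_def\<close>)
  have 2: "minor x (M_rows l I) (M_cols l I) = mixed_minor ?m 0 x" if x: "x \<in> C" for x
    unfolding M_rows_eq[OF l] M_cols_eq
  proof -
    have "minor x {N - ?m + 1..N} {1..?m} = det (sel x (\<lambda>p. N - ?m + Suc p) Suc ?m)"
    proof (rule minor_sel[OF C_carrier[OF x]])
      show "(\<lambda>p. N - ?m + Suc p) ` {..<?m} = {N - ?m + 1..N}"
      proof (intro subset_antisym subsetI)
        fix r assume "r \<in> {N - ?m + 1..N}"
        then show "r \<in> (\<lambda>p. N - ?m + Suc p) ` {..<?m}"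
          using m_le by (intro image_eqI[of _ _ "r - (N - ?m) - 1"]) auto
      qed (use m_le in auto)
      show "Suc ` {..<?m} = {1..?m}" by (simp add: image_Suc_lessThan)
    qed (use m_le in \<open>auto simp: strict_mono_on_def\<close>)
    also have "sel x (\<lambda>p. N - ?m + Suc p) Suc ?m = stack ?m 0 x (adj_mat x)"
      by (rule eq_matI) (auto simp: sel_def stack_def)
    finally show "minor x {N - ?m + 1..N} {1..?m} = mixed_minor ?m 0 x" by (simp add: mixed_minor_def)
  qed
  show ?thesis unfolding P_fun_def Pf_def Let_def prod.case
    using ratfun_of_eqI[OF 1] ratfun_of_eqI[OF 2] by simp
qed

lemma mid_N: "mid a \<Longrightarrow> a \<in> {1..N}" by (auto simp: mid_def)

lemma F0_F0B: "F0 N C l I = F0B"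
proof -
  have "G0 l I = {(a, b). mid a \<and> mid b}"
  proof (cases "odd l")
    case True
    then have "G0 l I = {size0 l I + 1..N - size0 l I} \<times> {size0 l I + 1..N - size0 l I}"
      unfolding G0_def middle_block[OF True] by (rule if_P)
    then show ?thesis by (simp only:) (force simp: mid_def)
  next
    case False
    have "\<not> mid a" for a using middle[of a] mid_N[of a] False by (simp only: mid_def) blast
    then show ?thesis using False by (auto simp: G0_def)
  qed
  moreover have "P_fun N C l I ` {(a, b). mid a \<and> mid b} = Pf ` {(a, b). mid a \<and> mid b}"
  proof (rule image_cong[OF refl])
    fix z assume "z \<in> {(a, b). mid a \<and> mid b}"
    then obtain a b where z: "z = (a, b)" "mid a" "mid b" by blast
    have "odd l" using middle[of a] mid_N[of a] z(2) by (simp only: mid_def) blast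
    then show "P_fun N C l I z = Pf z" unfolding z(1) using P_fun_Pf z(2,3) by blast
  qed
  ultimately show ?thesis unfolding F0_def F0B_def by simp
qed

end

theorem theorem3p5:
  fixes t :: group_type and N l :: nat and I :: "nat \<Rightarrow> nat set"
    and \<epsilon> :: "'a::field_char_0"
  assumes "N \<ge> 1"
    and "t = Symplectic \<Longrightarrow> even N"
    and "symmetric_partition N l I"
    and "t = Orthogonal \<Longrightarrow> \<epsilon> = 1 \<or> \<epsilon> = -1"
    and "t = Orthogonal \<Longrightarrow> even N \<Longrightarrow> l \<ge> 2 \<Longrightarrow> \<epsilon> = (-1) ^ (N div 2)"
  shows "let C = irr_component t N \<epsilon>;
             F = rational_functions N C;
             FU = invariants N C (unipotent_radical t N l I);
             S = S_circ t N l I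
         in (\<forall>s\<in>S. J_circ N C s \<in> FU) \<and>
            algebraically_independent F (F0 N C l I) S (J_circ N C) \<and>
            generate_field F (F0 N C l I \<union> J_circ N C ` S) = FU"
proof -
  interpret partitioned_group N l I t \<epsilon>
    using assms by unfold_locales auto
  show ?thesis
    unfolding Let_def C_irr_component[symmetric] unipotent_radical_radical S_circ_gen_pairs F0_F0B
  proof (intro conjI ballI)
    show "algebraically_independent (rational_functions N C) F0B gen_pairs (J_circ N C)" by (rule J_circ_independent)
    show "generate_field (rational_functions N C) (F0B \<union> J_circ N C ` gen_pairs) = invariants N C radical"
      by (rule gen_field_eq_invariants[unfolded gen_field_def])
  qed (rule J_circ_invariant)
qed

end
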